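(* Let $X$ and $Y$ be i.i.d.\ $\mathbb{Z}$-processes taking values in Polish spaces $\mathcal{A}$ and $\mathcal{B}$ respectively, with equal entropy. Then they are topo-finitarily isomorphic: there is a shift-equivariant measurable map $\phi:\mathcal{A}^\mathbb{Z}\to\mathcal{B}^\mathbb{Z}$ which restricts to a homeomorphism between sets of full measure and such that $\phi(X)$ has the distribution of $Y$.
   Context: The entropy of an i.i.d.\ process is its Kolmogorov–Sinai entropy (which equals the Shannon entropy of one coordinate when this is finite and is infinite otherwise, in particular infinite for non-atomic marginals). Sets of full measure refer to the laws of $X$ and $Y$ respectively. *)

theory Defs
  imports "HOL-Probability.Probability"
begin

text \<open>Shannon entropy (natural logarithm) of a Borel probability measure on a Polish
space, as in the paper's convention: if the measure is purely atomic (the point masses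
add up to total mass 1), it is the (possibly infinite) sum of the terms -p ln p over the
atoms; otherwise (some non-atomic part) it is infinite.  By the standing convention this
is the Kolmogorov--Sinai entropy of the i.i.d. process with this marginal.\<close>

definition shannon_entropy :: "'a measure \<Rightarrow> ennreal" where
  "shannon_entropy \<mu> =
     (if (\<integral>\<^sup>+ x. emeasure \<mu> {x} \<partial>count_space UNIV) = 1
      then (\<integral>\<^sup>+ x. ennreal (- measure \<mu> {x} * ln (measure \<mu> {x})) \<partial>count_space UNIV)
      else \<infinity>)"

definition shift :: "(int \<Rightarrow> 'a) \<Rightarrow> (int \<Rightarrow> 'a)" where
  "shift x = (\<lambda>n. x (n + 1))"

end

theory Submission
  imports Defs "HOL-Probability.Probability" "HOL-Library.Sublist"
begin

text \<open>
  This is the marker-filler argument of Keane and Smorodinsky, carried out for Polish alphabets.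
  A Polish alphabet is coded by the digits "x lies in the i-th set", for a countable family of
  small sets with null boundary; this is a homeomorphism between sets of full measure, and the
  entropy of the alphabet is the supremum of the entropies of the first n digits. Two processes
  that share a marker (a word with the same probability and no self-overlap) are aligned along
  their markers. Conditionally on the marker positions the fillers are independent, and since the
  entropies agree, at infinitely many scales the fillers of long blocks can be matched by
  couplings whose relation is sparse, alternately in both directions, so that in the limit each
  side determines the other from a finite window.

  Processes without a common marker are connected through auxiliary ones: a measure with three
  cells of positive mass shares a one-letter marker with a discrete measure of the same entropy
  having an additional atom of an arbitrarily small prescribed mass, and that atom is a marker
  common to two such discrete measures. For infinite entropy, Lebesgue measure on the unit
  interval has markers of every probability. A two-point measure is treated with a marker aab.
\<close>

text \<open>The law of the marker positions is determined by the length and the probability of the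
  marker alone, through a renewal equation. Two processes with a common marker thus have the same
  skeleton, and the entropy rate of their fillers is the entropy of the alphabet minus one and the
  same entropy of gap lengths. This rate may be infinite and is not attained at any finite level. So
  level \<open>n\<close> reads only the gaps of length at most \<open>n\<close>, with
  \<open>n\<close> digits per letter: the information per site becomes bounded, which gives
  concentration, and the truncated rates can always be increased strictly, which leaves room at each
  stage. A stage refines one side only. On a block of length \<open>l\<close> the other side has at
  most \<open>exp (d * l)\<close> labels, while typical refined labels have mass at most
  \<open>exp (- e * l)\<close> with \<open>e > d\<close>. A sparse coupling has at most as many
  ambiguous refined labels as there are labels opposite, so ambiguity becomes unlikely. The two maps
  are mutually inverse because a label predicted at one stage contains, one stage below, a label at
  which the opposite map is already decided.\<close>

section \<open>Sparse couplings of finite distributions\<close>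

lemma sum_Times: "(\<Sum>v\<in>I \<times> J. f v) = (\<Sum>i\<in>I. \<Sum>j\<in>J. f (i, j))"
  unfolding sum.cartesian_product by (intro sum.cong) auto

text \<open>Gaussian elimination: an equation with a nonzero coefficient is used up to remove one
  unknown, an equation without one is dropped.\<close>

lemma underdetermined_system:
  fixes c :: "'e \<Rightarrow> 'v \<Rightarrow> real"
  assumes "finite E" "finite V" "card E < card V"
  shows "\<exists>d. (\<exists>v\<in>V. d v \<noteq> 0) \<and> (\<forall>e\<in>E. (\<Sum>v\<in>V. c e v * d v) = 0)"
  using assms
proof (induction E arbitrary: V c rule: finite_induct)
  case empty
  then have "V \<noteq> {}" by auto
  then show ?case by (intro exI[of _ "\<lambda>_. 1"]) auto
next
  case (insert e E)
  show ?case
  proof (cases "\<forall>v\<in>V. c e v = 0")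
    case True
    have "card E < card V" using insert by simp
    from insert.IH[OF insert.prems(1) this, of c] obtain d
      where d: "\<exists>v\<in>V. d v \<noteq> 0" "\<forall>e\<in>E. (\<Sum>v\<in>V. c e v * d v) = 0" by blast
    have "(\<Sum>v\<in>V. c e v * d v) = 0" using True by simp
    with d show ?thesis by blast
  next
    case False
    then obtain w where w: "w \<in> V" "c e w \<noteq> 0" by auto
    define c' where "c' f v = c f v - c f w * c e v / c e w" for f v
    have "card E < card (V - {w})" using insert w by simp
    from insert.IH[OF _ this, of c'] insert.prems(1) obtain d
      where d: "\<exists>v\<in>V - {w}. d v \<noteq> 0" "\<forall>f\<in>E. (\<Sum>v\<in>V - {w}. c' f v * d v) = 0" by auto
    define s where "s = - (\<Sum>v\<in>V - {w}. c e v * d v) / c e w"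
    define d' where "d' = d(w := s)"
    have sum: "(\<Sum>v\<in>V. c f v * d' v) = c f w * s + (\<Sum>v\<in>V - {w}. c f v * d v)" for f
      using sum.remove[OF insert.prems(1) w(1), of "\<lambda>v. c f v * d' v"]
      by (simp add: d'_def)
    have "(\<Sum>v\<in>V. c e v * d' v) = 0"
      unfolding sum s_def using w(2) by simp
    moreover have "(\<Sum>v\<in>V. c f v * d' v) = 0" if "f \<in> E" for f
    proof -
      have "0 = (\<Sum>v\<in>V - {w}. c f v * d v - (c f w / c e w) * (c e v * d v))"
        using bspec[OF d(2) that] by (simp add: c'_def left_diff_distrib mult.assoc)
      also have "\<dots> = (\<Sum>v\<in>V - {w}. c f v * d v) - (c f w / c e w) * (\<Sum>v\<in>V - {w}. c e v * d v)"
        by (simp add: sum_subtractf sum_distrib_left)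
      finally show ?thesis
        unfolding sum s_def using w(2) by (simp add: field_simps)
    qed
    moreover have "\<exists>v\<in>V. d' v \<noteq> 0" using d(1) by (auto simp: d'_def)
    ultimately show ?thesis by blast
  qed
qed

text \<open>A descent in the transport polytope, as in the search for an extreme point: more than
  \<open>card I + card J\<close> cells of support leave a nonzero perturbation inside the support
  that changes no row or column sum, and a move along it stops when a cell becomes empty.\<close>

lemma sparse_transport:
  fixes q :: "'a \<Rightarrow> 'b \<Rightarrow> real"
  assumes fin: "finite I" "finite J" and nn: "\<And>i j. 0 \<le> q i j"
  shows "\<exists>q'. (\<forall>i j. 0 \<le> q' i j) \<and> (\<forall>i j. q' i j \<noteq> 0 \<longrightarrow> q i j \<noteq> 0)
     \<and> (\<forall>i\<in>I. (\<Sum>j\<in>J. q' i j) = (\<Sum>j\<in>J. q i j)) \<and> (\<forall>j\<in>J. (\<Sum>i\<in>I. q' i j) = (\<Sum>i\<in>I. q i j))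
     \<and> card {ij\<in>I \<times> J. q' (fst ij) (snd ij) \<noteq> 0} \<le> card I + card J"
  using nn
proof (induction "card {ij\<in>I \<times> J. q (fst ij) (snd ij) \<noteq> 0}" arbitrary: q rule: less_induct)
  case (less q)
  define V where "V = {ij\<in>I \<times> J. q (fst ij) (snd ij) \<noteq> 0}"
  have finV: "finite V" using fin by (simp add: V_def)
  show ?case
  proof (cases "card V \<le> card I + card J")
    case True
    then show ?thesis using less.prems unfolding V_def by (intro exI[of _ q]) auto
  next
    case False
    define c :: "'a + 'b \<Rightarrow> 'a \<times> 'b \<Rightarrow> real" where
      "c e v = (case e of Inl i \<Rightarrow> of_bool (fst v = i) | Inr j \<Rightarrow> of_bool (snd v = j))" for e v
    have "card (I <+> J) < card V" using False fin by (simp add: card_Plus)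
    from underdetermined_system[OF _ finV this, of c] fin obtain d
      where d: "\<exists>v\<in>V. d v \<noteq> 0" "\<forall>e\<in>I <+> J. (\<Sum>v\<in>V. c e v * d v) = 0" by auto
    define D where "D i j = (if (i, j) \<in> V then d (i, j) else 0)" for i j
    have row: "(\<Sum>j\<in>J. D i j) = 0" if "i \<in> I" for i
    proof -
      have "(\<Sum>j\<in>J. D i j) = (\<Sum>v\<in>I \<times> J. c (Inl i) v * (if v \<in> V then d v else 0))"
        proof -
        have "(\<Sum>v\<in>I \<times> J. c (Inl i) v * (if v \<in> V then d v else 0))
          = (\<Sum>i'\<in>I. if i' = i then (\<Sum>j\<in>J. D i' j) else 0)"
          unfolding sum_Times by (intro sum.cong) (auto simp: c_def D_def)
        then show ?thesis using that fin by simp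
      qed
      also have "\<dots> = (\<Sum>v\<in>V. c (Inl i) v * d v)"
        using fin by (intro sum.mono_neutral_cong_right) (auto simp: V_def)
      also have "\<dots> = 0" using d(2) that by blast
      finally show ?thesis .
    qed
    have col: "(\<Sum>i\<in>I. D i j) = 0" if "j \<in> J" for j
    proof -
      have "(\<Sum>i\<in>I. D i j) = (\<Sum>v\<in>I \<times> J. c (Inr j) v * (if v \<in> V then d v else 0))"
        proof -
        have "(\<Sum>v\<in>I \<times> J. c (Inr j) v * (if v \<in> V then d v else 0))
          = (\<Sum>i\<in>I. \<Sum>j'\<in>J. if j' = j then D i j' else 0)"
          unfolding sum_Times by (intro sum.cong) (auto simp: c_def D_def)
        then show ?thesis using that fin by simp
      qed
      also have "\<dots> = (\<Sum>v\<in>V. c (Inr j) v * d v)"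
        using fin by (intro sum.mono_neutral_cong_right) (auto simp: V_def)
      also have "\<dots> = 0" using d(2) that by blast
      finally show ?thesis .
    qed
    define Ng where "Ng = {v\<in>V. d v < 0}"
    \<comment> \<open>A nonzero perturbation with vanishing row sums cannot be nonnegative.\<close>
    have "Ng \<noteq> {}"
    proof
      assume "Ng = {}"
      then have ge: "d v \<ge> 0" if "v \<in> V" for v using that by (metis (mono_tags, lifting) Ng_def empty_iff linorder_not_le mem_Collect_eq)
      obtain v where v: "v \<in> V" "d v \<noteq> 0" using d(1) by blast
      then have "0 < D (fst v) (snd v)" using ge[of v] by (simp add: D_def)
      moreover have "fst v \<in> I" "snd v \<in> J" using v by (auto simp: V_def)
      moreover have "\<And>j. 0 \<le> D (fst v) j" using ge by (simp add: D_def)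
      ultimately have "0 < (\<Sum>j\<in>J. D (fst v) j)"
        using fin by (intro sum_pos2[of J "snd v"]) auto
      with row[OF \<open>fst v \<in> I\<close>] show False by simp
    qed
    have finN: "finite Ng" using finV by (simp add: Ng_def)
    \<comment> \<open>The ratio test of the simplex method: the largest step that keeps all entries
      nonnegative. It empties the cell \<open>w\<close> at which the minimum is attained.\<close>
    define t where "t = Min ((\<lambda>v. q (fst v) (snd v) / (- d v)) ` Ng)"
    have "t \<in> (\<lambda>v. q (fst v) (snd v) / (- d v)) ` Ng"
      unfolding t_def using \<open>Ng \<noteq> {}\<close> finN by (intro Min_in) auto
    then obtain w where w: "w \<in> Ng" "t = q (fst w) (snd w) / (- d w)" by auto
    have tle: "t \<le> q (fst v) (snd v) / (- d v)" if "v \<in> Ng" for v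
      unfolding t_def using that finN by (intro Min_le) auto
    have t0: "0 \<le> t" using w less.prems by (simp add: Ng_def divide_nonneg_neg)
    define q1 where "q1 i j = q i j + t * D i j" for i j
    have nn1: "0 \<le> q1 i j" for i j
    proof (cases "(i, j) \<in> Ng")
      case True
      then have "t * (- d (i, j)) \<le> q i j" using tle[OF True] by (simp add: Ng_def field_simps)
      then show ?thesis using True by (simp add: q1_def D_def Ng_def)
    next
      case False
      then have "0 \<le> D i j" by (auto simp: D_def Ng_def)
      then show ?thesis using t0 less.prems by (simp add: q1_def)
    qed
    have sub1: "q1 i j \<noteq> 0 \<Longrightarrow> q i j \<noteq> 0" for i j
      by (auto simp: q1_def D_def V_def split: if_splits)
    have zero: "q1 (fst w) (snd w) = 0"
      using w by (simp add: q1_def D_def Ng_def)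
    have "{ij\<in>I \<times> J. q1 (fst ij) (snd ij) \<noteq> 0} \<subset> V"
    proof
      show "{ij\<in>I \<times> J. q1 (fst ij) (snd ij) \<noteq> 0} \<subseteq> V" using sub1 by (auto simp: V_def)
      show "{ij\<in>I \<times> J. q1 (fst ij) (snd ij) \<noteq> 0} \<noteq> V" using zero w by (auto simp: Ng_def)
    qed
    then have "card {ij\<in>I \<times> J. q1 (fst ij) (snd ij) \<noteq> 0} < card V"
      by (rule psubset_card_mono[OF finV])
    from less.hyps[OF this[unfolded V_def] nn1] obtain q' where q':
      "\<forall>i j. 0 \<le> q' i j" "\<forall>i j. q' i j \<noteq> 0 \<longrightarrow> q1 i j \<noteq> 0"
      "\<forall>i\<in>I. (\<Sum>j\<in>J. q' i j) = (\<Sum>j\<in>J. q1 i j)" "\<forall>j\<in>J. (\<Sum>i\<in>I. q' i j) = (\<Sum>i\<in>I. q1 i j)"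
      "card {ij\<in>I \<times> J. q' (fst ij) (snd ij) \<noteq> 0} \<le> card I + card J" by blast
    have "(\<Sum>j\<in>J. q1 i j) = (\<Sum>j\<in>J. q i j)" if "i \<in> I" for i
      using row[OF that] by (simp add: q1_def sum.distrib flip: sum_distrib_left)
    moreover have "(\<Sum>i\<in>I. q1 i j) = (\<Sum>i\<in>I. q i j)" if "j \<in> J" for j
      using col[OF that] by (simp add: q1_def sum.distrib flip: sum_distrib_left)
    ultimately show ?thesis using q' sub1 by (intro exI[of _ q']) auto
  qed
qed

text \<open>A coupling with as few atoms as possible has at most \<open>card I + card J\<close> of them, while every
  point of \<open>J\<close> needs one; so at most \<open>card I\<close> points of \<open>J\<close> have two partners.\<close>

lemma rel_pmf_sparse:
  fixes p :: "'a pmf" and q :: "'b pmf"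
  assumes rel: "rel_pmf R p q" and fin: "finite (set_pmf p)" "finite (set_pmf q)"
  shows "\<exists>R'. (\<forall>a b. R' a b \<longrightarrow> R a b) \<and> rel_pmf R' p q \<and>
     card {b\<in>set_pmf q. \<exists>a\<in>set_pmf p. \<exists>a'\<in>set_pmf p. a \<noteq> a' \<and> R' a b \<and> R' a' b} \<le> card (set_pmf p)"
proof -
  obtain pq where pq: "\<And>x y. (x, y) \<in> set_pmf pq \<Longrightarrow> R x y" "map_pmf fst pq = p" "map_pmf snd pq = q"
    using rel by (auto elim!: rel_pmf.cases)
  define I where "I = set_pmf p"
  define J where "J = set_pmf q"
  have supp: "set_pmf pq \<subseteq> I \<times> J"
    unfolding I_def J_def pq(2,3)[symmetric] by force
  have finIJ: "finite I" "finite J" using fin by (simp_all add: I_def J_def)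
  define w where "w i j = pmf pq (i, j)" for i j
  have rowp: "(\<Sum>j\<in>J. w i j) = pmf p i" for i
  proof -
    have "pmf p i = measure pq (fst -` {i})" unfolding pq(2)[symmetric] by (simp add: pmf_map)
    also have "\<dots> = measure pq ({i} \<times> J)"
      using supp by (intro measure_eq_AE) (auto simp: AE_measure_pmf_iff)
    also have "\<dots> = (\<Sum>v\<in>{i} \<times> J. pmf pq v)" using finIJ by (intro measure_measure_pmf_finite) auto
    also have "\<dots> = (\<Sum>j\<in>J. w i j)" by (simp add: w_def sum_Times)
    finally show ?thesis by simp
  qed
  have colp: "(\<Sum>i\<in>I. w i j) = pmf q j" for j
  proof -
    have "pmf q j = measure pq (snd -` {j})" unfolding pq(3)[symmetric] by (simp add: pmf_map)
    also have "\<dots> = measure pq (I \<times> {j})"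
      using supp by (intro measure_eq_AE) (auto simp: AE_measure_pmf_iff)
    also have "\<dots> = (\<Sum>v\<in>I \<times> {j}. pmf pq v)" using finIJ by (intro measure_measure_pmf_finite) auto
    also have "\<dots> = (\<Sum>i\<in>I. w i j)" by (simp add: w_def sum_Times)
    finally show ?thesis by simp
  qed
  have w0: "\<And>i j. 0 \<le> w i j" by (simp add: w_def)
  obtain w' where w': "\<And>i j. 0 \<le> w' i j" "\<And>i j. w' i j \<noteq> 0 \<Longrightarrow> w i j \<noteq> 0"
    "\<And>i. i \<in> I \<Longrightarrow> (\<Sum>j\<in>J. w' i j) = pmf p i" "\<And>j. j \<in> J \<Longrightarrow> (\<Sum>i\<in>I. w' i j) = pmf q j"
    "card {ij\<in>I \<times> J. w' (fst ij) (snd ij) \<noteq> 0} \<le> card I + card J"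
    using sparse_transport[OF finIJ, of w, OF w0] unfolding rowp colp by blast
  define V where "V = {ij\<in>I \<times> J. w' (fst ij) (snd ij) \<noteq> 0}"
  have finV: "finite V" using finIJ by (simp add: V_def)
  have w'supp: "w' i j \<noteq> 0 \<Longrightarrow> i \<in> I \<and> j \<in> J" for i j
    using w'(2)[of i j] supp by (auto simp: w_def set_pmf_iff[symmetric])
  have tot: "(\<Sum>v\<in>I \<times> J. w' (fst v) (snd v)) = 1"
  proof -
    have "(\<Sum>v\<in>I \<times> J. w' (fst v) (snd v)) = (\<Sum>i\<in>I. pmf p i)"
      using w'(3) by (simp add: sum_Times)
    also have "\<dots> = 1" using fin by (intro sum_pmf_eq_1) (auto simp: I_def)
    finally show ?thesis .
  qed
  have nnint: "(\<integral>\<^sup>+v. ennreal (w' (fst v) (snd v)) \<partial>count_space UNIV) = 1"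
  proof -
    have "(\<integral>\<^sup>+v. ennreal (w' (fst v) (snd v)) \<partial>count_space UNIV)
      = (\<Sum>v\<in>I \<times> J. ennreal (w' (fst v) (snd v)))"
    proof (rule nn_integral_count_space'[where A="I \<times> J"])
      show "ennreal (w' (fst v) (snd v)) = 0" if "v \<notin> I \<times> J" for v
        using w'supp[of "fst v" "snd v"] that by (metis SigmaI ennreal_0 prod.collapse)
    qed (use finIJ in auto)
    also have "\<dots> = 1" using w'(1) tot by (simp add: sum_ennreal)
    finally show ?thesis .
  qed
  define pq' where "pq' = embed_pmf (\<lambda>v. w' (fst v) (snd v))"
  have pmf': "pmf pq' v = w' (fst v) (snd v)" for v
    unfolding pq'_def by (rule pmf_embed_pmf) (use w'(1) nnint in auto)
  have supp': "set_pmf pq' = V"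
    using w'supp by (fastforce simp: set_pmf_eq pmf' V_def)
  have supp'': "set_pmf pq' \<subseteq> I \<times> J" using supp' by (auto simp: V_def)
  have m1: "map_pmf fst pq' = p"
  proof (rule pmf_eqI)
    fix i
    have "pmf (map_pmf fst pq') i = measure pq' (fst -` {i})" by (simp add: pmf_map)
    also have "\<dots> = measure pq' ({i} \<times> J)"
      using supp'' by (intro measure_eq_AE) (auto simp: AE_measure_pmf_iff)
    also have "\<dots> = (\<Sum>v\<in>{i} \<times> J. pmf pq' v)" using finIJ by (intro measure_measure_pmf_finite) auto
    also have "\<dots> = (\<Sum>j\<in>J. w' i j)" by (simp add: pmf' sum_Times)
    also have "\<dots> = pmf p i"
    proof (cases "i \<in> I")
      case False
      then have "w' i j = 0" for j using w'supp by blast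
      then show ?thesis using False by (simp add: I_def set_pmf_iff)
    qed (use w' in auto)
    finally show "pmf (map_pmf fst pq') i = pmf p i" .
  qed
  have m2: "map_pmf snd pq' = q"
  proof (rule pmf_eqI)
    fix j
    have "pmf (map_pmf snd pq') j = measure pq' (snd -` {j})" by (simp add: pmf_map)
    also have "\<dots> = measure pq' (I \<times> {j})"
      using supp'' by (intro measure_eq_AE) (auto simp: AE_measure_pmf_iff)
    also have "\<dots> = (\<Sum>v\<in>I \<times> {j}. pmf pq' v)" using finIJ by (intro measure_measure_pmf_finite) auto
    also have "\<dots> = (\<Sum>i\<in>I. w' i j)" by (simp add: pmf' sum_Times)
    also have "\<dots> = pmf q j"
    proof (cases "j \<in> J")
      case False
      then have "w' i j = 0" for i using w'supp by blast
      then show ?thesis using False by (simp add: J_def set_pmf_iff)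
    qed (use w' in auto)
    finally show "pmf (map_pmf snd pq') j = pmf q j" .
  qed
  define R' where "R' i j \<longleftrightarrow> w' i j \<noteq> 0" for i j
  have "R' a b \<longrightarrow> R a b" for a b
    using w'(2)[of a b] pq(1)[of a b] by (auto simp: R'_def w_def set_pmf_iff)
  moreover have "rel_pmf R' p q"
    using m1 m2 by (intro rel_pmf.intros[where pq=pq']) (auto simp: supp' V_def R'_def)
  moreover have "card {b\<in>J. \<exists>a\<in>I. \<exists>a'\<in>I. a \<noteq> a' \<and> R' a b \<and> R' a' b} \<le> card I"
  proof -
    define B where "B = {b\<in>J. \<exists>a\<in>I. \<exists>a'\<in>I. a \<noteq> a' \<and> R' a b \<and> R' a' b}"
    define N where "N b = {a\<in>I. R' a b}" for b
    have "V = (\<lambda>(b, a). (a, b)) ` (SIGMA b:J. N b)" by (force simp: V_def N_def R'_def)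
    then have "card V = card (SIGMA b:J. N b)" by (simp add: card_image inj_on_def)
    also have "\<dots> = (\<Sum>b\<in>J. card (N b))" using finIJ by (subst card_SigmaI) (auto simp: N_def)
    finally have cardV: "card V = (\<Sum>b\<in>J. card (N b))" .
    have ge1: "1 \<le> card (N b)" if "b \<in> J" for b
    proof -
      have "(\<Sum>i\<in>I. w' i b) \<noteq> 0" using w'(4)[OF that] that by (simp add: J_def set_pmf_iff)
      then obtain i where "i \<in> I" "w' i b \<noteq> 0" by (meson sum.neutral)
      then have "N b \<noteq> {}" by (auto simp: N_def R'_def)
      then show ?thesis using finIJ by (simp add: N_def Suc_le_eq card_gt_0_iff)
    qed
    have ge2: "2 \<le> card (N b)" if "b \<in> B" for b
    proof -
      obtain a a' where "a \<in> I" "a' \<in> I" "a \<noteq> a'" "R' a b" "R' a' b" using \<open>b \<in> B\<close> by (auto simp: B_def)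
      then have "{a, a'} \<subseteq> N b" "card {a, a'} = 2" by (auto simp: N_def)
      moreover have "finite (N b)" using finIJ by (simp add: N_def)
      ultimately show ?thesis by (metis card_mono)
    qed
    have "card J + card B = (\<Sum>b\<in>J. 1 + (if b \<in> B then 1 else 0))"
    proof -
      have "(\<Sum>b\<in>J. (if b \<in> B then 1 else 0)) = card B"
      proof -
        have "J \<inter> B = B" by (auto simp: B_def)
        then show ?thesis using finIJ by (simp add: sum.If_cases)
      qed
      then show ?thesis by (simp only: sum.distrib) simp
    qed
    also have "\<dots> \<le> (\<Sum>b\<in>J. card (N b))" using ge1 ge2 by (intro sum_mono) (auto simp: numeral_2_eq_2)
    also have "\<dots> \<le> card I + card J" using w'(5) cardV by (simp add: V_def)
    finally show ?thesis by (simp add: B_def)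
  qed
  ultimately show ?thesis unfolding I_def J_def by blast
qed

lemma rel_pmf_sparse':
  fixes p :: "'a pmf" and q :: "'b pmf"
  assumes rel: "rel_pmf R p q" and fin: "finite (set_pmf p)" "finite (set_pmf q)"
  shows "\<exists>R'. (\<forall>a b. R' a b \<longrightarrow> R a b) \<and> rel_pmf R' p q \<and>
     card {a\<in>set_pmf p. \<exists>b\<in>set_pmf q. \<exists>b'\<in>set_pmf q. b \<noteq> b' \<and> R' a b \<and> R' a b'} \<le> card (set_pmf q)"
proof -
  have "rel_pmf R\<inverse>\<inverse> q p" using rel by (simp add: pmf.rel_flip)
  from rel_pmf_sparse[OF this fin(2,1)] obtain R' where
    "\<forall>a b. R' a b \<longrightarrow> R\<inverse>\<inverse> a b" "rel_pmf R' q p"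
    "card {b\<in>set_pmf p. \<exists>a\<in>set_pmf q. \<exists>a'\<in>set_pmf q. a \<noteq> a' \<and> R' a b \<and> R' a' b} \<le> card (set_pmf q)"
    by blast
  then show ?thesis
    by (intro exI[of _ "R'\<inverse>\<inverse>"]) (auto simp: pmf.rel_flip)
qed

subsection \<open>Products of probability mass functions along lists\<close>

fun lprod :: "'a pmf list \<Rightarrow> 'a list pmf" where
  "lprod [] = return_pmf []"
| "lprod (p # ps) = bind_pmf p (\<lambda>x. map_pmf ((#) x) (lprod ps))"

lemma pmf_lprod_Cons: "pmf (lprod (p # ps)) (x # xs) = pmf p x * pmf (lprod ps) xs"
proof -
  have "lprod (p # ps) = map_pmf (\<lambda>(x, xs). x # xs) (pair_pmf p (lprod ps))"
    unfolding lprod.simps pair_pmf_def map_pmf_def by (simp add: bind_assoc_pmf bind_return_pmf)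
  moreover have "inj (\<lambda>(x::'a, xs). x # xs)" by (auto simp: inj_def)
  from pmf_map_inj'[OF this, of "pair_pmf p (lprod ps)" "(x, xs)"]
  have "pmf (map_pmf (\<lambda>(x, xs). x # xs) (pair_pmf p (lprod ps))) (x # xs) = pmf p x * pmf (lprod ps) xs"
    by (simp add: pmf_pair)
  ultimately show ?thesis by simp
qed

lemma set_lprod: "set_pmf (lprod ps) = {xs. list_all2 (\<lambda>x p. x \<in> set_pmf p) xs ps}"
  by (induction ps) (auto simp: list_all2_Cons2)

lemma length_lprod: "xs \<in> set_pmf (lprod ps) \<Longrightarrow> length xs = length ps"
  by (auto simp: set_lprod dest: list_all2_lengthD)

lemma pmf_lprod_0: "length xs \<noteq> length ps \<Longrightarrow> pmf (lprod ps) xs = 0"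
  using length_lprod[of xs ps] by (auto simp: set_pmf_iff)

lemma map_lprod: "map_pmf (map f) (lprod ps) = lprod (map (map_pmf f) ps)"
proof (induction ps)
  case (Cons p ps)
  have *: "lprod (map (map_pmf f) ps) = map_pmf (map f) (lprod ps)" using Cons by simp
  show ?case by (simp add: * map_bind_pmf bind_map_pmf pmf.map_comp o_def)
qed simp

lemma lprod_append: "lprod (ps @ qs) = bind_pmf (lprod ps) (\<lambda>xs. map_pmf ((@) xs) (lprod qs))"
proof (induction ps)
  case Nil
  have "((@) []) = (\<lambda>x::'a list. x)" by auto
  then show ?case by (simp add: bind_return_pmf)
next
  case (Cons p ps)
  have "((@) (x # xs)) = (\<lambda>ys::'a list. x # xs @ ys)" for x xs by auto
  with Cons show ?case by (simp add: bind_assoc_pmf bind_map_pmf map_bind_pmf pmf.map_comp o_def)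
qed

lemma lprod_concat: "lprod (concat pss) = map_pmf concat (lprod (map lprod pss))"
  by (induction pss) (simp_all add: lprod_append map_bind_pmf pmf.map_comp o_def)

lemma rel_lprod_nth:
  assumes "length ps = length qs" "length ps = n" "\<And>i. i < n \<Longrightarrow> rel_pmf (R i) (ps ! i) (qs ! i)"
  shows "rel_pmf (\<lambda>xs ys. length xs = n \<and> length ys = n \<and> (\<forall>i<n. R i (xs ! i) (ys ! i))) (lprod ps) (lprod qs)"
  using assms
proof (induction ps arbitrary: qs n R)
  case (Cons p ps)
  then obtain q qs' where qs: "qs = q # qs'" by (cases qs) auto
  obtain m where m: "n = Suc m" using Cons by (cases n) auto
  have h: "rel_pmf (R 0) p q" using Cons.prems(3)[of 0] qs m by simp
  have "rel_pmf (\<lambda>xs ys. length xs = m \<and> length ys = m \<and> (\<forall>i<m. R (Suc i) (xs ! i) (ys ! i))) (lprod ps) (lprod qs')"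
  proof (rule Cons.IH)
    show "rel_pmf (R (Suc i)) (ps ! i) (qs' ! i)" if "i < m" for i
      using Cons.prems(3)[of "Suc i"] that qs m by simp
  qed (use Cons.prems qs m in auto)
  then show ?case unfolding qs m lprod.simps
    by (intro rel_pmf_bindI[OF h]) (auto simp: pmf.rel_map nth_Cons split: nat.split elim!: pmf.rel_mono_strong)
qed auto

lemma finite_set_lprod: "(\<And>p. p \<in> set ps \<Longrightarrow> finite (set_pmf p)) \<Longrightarrow> finite (set_pmf (lprod ps))"
  by (induction ps) auto

lemma card_set_lprod:
  "card (set_pmf (lprod ps)) = prod_list (map (\<lambda>p. card (set_pmf p)) ps)"
proof (induction ps)
  case (Cons p ps)
  have "set_pmf (lprod (p # ps)) = (\<lambda>(x, xs). x # xs) ` (set_pmf p \<times> set_pmf (lprod ps))" by auto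
  moreover have "inj_on (\<lambda>(x, xs). x # xs) (set_pmf p \<times> set_pmf (lprod ps))" by (auto simp: inj_on_def)
  ultimately show ?case using Cons by (simp only: card_image card_cartesian_product) simp
qed simp

subsection \<open>The law of a discrete random variable\<close>

definition rvpmf :: "'a measure \<Rightarrow> ('a \<Rightarrow> 'b::countable) \<Rightarrow> 'b pmf" where
  "rvpmf M f = Abs_pmf (distr M (count_space UNIV) f)"

lemma measure_pmf_rvpmf:
  assumes "prob_space M" "f \<in> measurable M (count_space UNIV)"
  shows "measure_pmf (rvpmf M f) = distr M (count_space UNIV) f"
  unfolding rvpmf_def
proof (rule Abs_pmf_inverse)
  interpret D: prob_space "distr M (count_space UNIV) f"
    using assms by (intro prob_space.prob_space_distr)
  have "AE x in distr M (count_space UNIV) f. measure (distr M (count_space UNIV) f) {x} \<noteq> 0"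
    by (subst D.AE_support_countable) (auto intro!: exI[of _ UNIV])
  then show "distr M (count_space UNIV) f \<in> {M. prob_space M \<and> sets M = UNIV \<and> (AE x in M. measure M {x} \<noteq> 0)}"
    using D.prob_space_axioms by simp
qed

lemma prob_rvpmf:
  assumes "prob_space M" "f \<in> measurable M (count_space UNIV)"
  shows "measure_pmf.prob (rvpmf M f) A = measure M {x\<in>space M. f x \<in> A}"
  unfolding measure_pmf_rvpmf[OF assms]
  using assms(2) by (subst measure_distr) (auto intro!: arg_cong[where f="measure M"])

lemma pmf_rvpmf:
  assumes "prob_space M" "f \<in> measurable M (count_space UNIV)"
  shows "pmf (rvpmf M f) v = measure M {x\<in>space M. f x = v}"
  using prob_rvpmf[OF assms, of "{v}"] by (simp add: measure_pmf_single)

lemma map_rvpmf: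
  assumes "prob_space M" "f \<in> measurable M (count_space UNIV)"
  shows "map_pmf g (rvpmf M f) = rvpmf M (\<lambda>x. g (f x))"
proof (rule pmf_eqI)
  fix i
  have gf: "(\<lambda>x. g (f x)) \<in> measurable M (count_space UNIV)"
    using assms(2) by (rule measurable_compose) simp
  show "pmf (map_pmf g (rvpmf M f)) i = pmf (rvpmf M (\<lambda>x. g (f x))) i"
    by (simp add: pmf_map prob_rvpmf[OF assms] pmf_rvpmf[OF assms(1) gf])
qed

text \<open>The easy half of Strassen's theorem. This is how couplings are used below: events of two
  different processes are compared without placing both processes on one space.\<close>

lemma rel_pmf_prob_le:
  assumes rel: "rel_pmf R p q"
    and imp: "\<And>x y. x \<in> set_pmf p \<Longrightarrow> y \<in> set_pmf q \<Longrightarrow> R x y \<Longrightarrow> x \<in> A \<Longrightarrow> y \<in> B"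
  shows "measure_pmf.prob p A \<le> measure_pmf.prob q B"
proof -
  obtain pq where pq: "\<And>x y. (x, y) \<in> set_pmf pq \<Longrightarrow> R x y" "map_pmf fst pq = p" "map_pmf snd pq = q"
    using rel by (auto elim!: rel_pmf.cases)
  have "measure_pmf.prob p A = measure_pmf.prob pq (fst -` A)" unfolding pq(2)[symmetric] by simp
  also have "\<dots> \<le> measure_pmf.prob pq (snd -` B)"
  proof (rule measure_pmf.finite_measure_mono_AE)
    show "AE x in pq. x \<in> fst -` A \<longrightarrow> x \<in> snd -` B"
    proof (simp add: AE_measure_pmf_iff, intro ballI impI)
      fix z assume z: "z \<in> set_pmf pq" "fst z \<in> A"
      have "fst z \<in> set_pmf p" "snd z \<in> set_pmf q" using z unfolding pq(2,3)[symmetric] by auto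
      then show "snd z \<in> B" using imp[of "fst z" "snd z"] pq(1)[of "fst z" "snd z"] z by simp
    qed
  qed simp
  also have "\<dots> = measure_pmf.prob q B" unfolding pq(3)[symmetric] by simp
  finally show ?thesis .
qed

subsection \<open>Grouping lists and locating positions\<close>

text \<open>Each group ends with its only element satisfying \<open>P\<close>; a remainder without
  such an element forms a last group. In this way a long block falls into blocks of the previous
  stage, with \<open>P\<close> singling out the gaps that close such a block.\<close>

fun grp :: "('a \<Rightarrow> bool) \<Rightarrow> 'a list \<Rightarrow> 'a list list" where
  "grp P [] = []"
| "grp P (x # xs) = (if P x then [x] # grp P xs
     else (case grp P xs of [] \<Rightarrow> [[x]] | g # gs \<Rightarrow> (x # g) # gs))"

lemma concat_grp: "concat (grp P xs) = xs"
  by (induction xs) (auto split: list.split)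

lemma grp_map: "grp P (map f xs) = map (map f) (grp (\<lambda>x. P (f x)) xs)"
  by (induction xs) (auto split: list.split)

lemma grp_ne: "g \<in> set (grp P xs) \<Longrightarrow> g \<noteq> []"
  by (induction xs arbitrary: g) (auto split: list.splits if_splits)

lemma grp_eq_Nil: "grp P xs = [] \<longleftrightarrow> xs = []"
  by (metis concat.simps(1) concat_grp grp.simps(1))

lemma grp_blocks:
  assumes "xs \<noteq> []" "P (last xs)" "g \<in> set (grp P xs)"
  shows "P (last g) \<and> (\<forall>x\<in>set (butlast g). \<not> P x)"
  using assms
proof (induction xs arbitrary: g)
  case (Cons x xs)
  show ?case
  proof (cases "xs = []")
    case False
    then obtain h hs where hs: "grp P xs = h # hs" by (metis grp_eq_Nil neq_Nil_conv)
    have ne: "h \<noteq> []" using grp_ne[of h P xs] hs by simp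
    have lst: "P (last xs)" using Cons.prems(2) False by (metis last_ConsR)
    have IH: "P (last g) \<and> (\<forall>x\<in>set (butlast g). \<not> P x)" if "g \<in> set (grp P xs)" for g
      by (rule Cons.IH[OF False lst that])
    have "g = [x] \<and> P x \<or> g = x # h \<and> \<not> P x \<or> g \<in> set (grp P xs)"
      using Cons.prems(3) hs by (auto split: if_splits)
    then consider "g = [x]" "P x" | "g = x # h" "\<not> P x" | "g \<in> set (grp P xs)" by blast
    then show ?thesis
    proof cases
      case 2
      then show ?thesis using IH[of h] hs ne by simp
    qed (use IH in auto)
  next
    case True
    then show ?thesis using Cons.prems by (auto split: if_splits)
  qed
qed simp

lemma length_concat_map: "length (concat xss) = sum_list (map length xss)"
  by (simp add: length_concat)

text \<open>The inverse of concatenation on positions: from a position in the whole to the index of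
  a group and the offset inside it.\<close>

fun loc :: "nat list \<Rightarrow> nat \<Rightarrow> nat \<times> nat" where
  "loc [] j = (0, j)"
| "loc (a # as) j = (if j < a then (0, j) else (let (i, j') = loc as (j - a) in (Suc i, j')))"

lemma loc_spec:
  assumes "j < sum_list as" "loc as j = (i, j')"
  shows "i < length as \<and> j' < as ! i \<and> j = sum_list (take i as) + j'"
  using assms
proof (induction as arbitrary: i j j')
  case (Cons a as)
  show ?case
  proof (cases "j < a")
    case False
    obtain i1 j1 where l: "loc as (j - a) = (i1, j1)" by fastforce
    have "j - a < sum_list as" using Cons.prems False by auto
    from Cons.IH[OF this l] show ?thesis using Cons.prems(2) False l by auto
  qed (use Cons in auto)
qed simp

lemma nth_concat_loc:
  assumes "j < length (concat xss)" "loc (map length xss) j = (i, j')"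
  shows "concat xss ! j = xss ! i ! j'"
  using assms
proof (induction xss arbitrary: i j j')
  case (Cons x xss)
  show ?case
  proof (cases "j < length x")
    case False
    obtain i1 j1 where l: "loc (map length xss) (j - length x) = (i1, j1)" by fastforce
    have "j - length x < length (concat xss)" using Cons.prems False by auto
    from Cons.IH[OF this l] show ?thesis using Cons.prems(2) False l by (auto simp: nth_append)
  qed (use Cons in \<open>auto simp: nth_append\<close>)
qed simp

subsection \<open>Bi-infinite i.i.d. sequences\<close>

definition iproc :: "'a measure \<Rightarrow> (int \<Rightarrow> 'a) measure" where
  "iproc M = PiM UNIV (\<lambda>_. M)"

definition sh :: "int \<Rightarrow> (int \<Rightarrow> 'a) \<Rightarrow> int \<Rightarrow> 'a" where
  "sh a x = (\<lambda>i. x (i + a))"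

lemma sh_apply [simp]: "sh a x i = x (i + a)" by (simp add: sh_def)
lemma sh_sh [simp]: "sh a (sh b x) = sh (a + b) x" by (simp add: sh_def algebra_simps)
lemma sh_0 [simp]: "sh 0 x = x" by (simp add: sh_def)

definition dep_on :: "int set \<Rightarrow> ((int \<Rightarrow> 'a) \<Rightarrow> 'b) \<Rightarrow> bool" where
  "dep_on A f \<longleftrightarrow> (\<forall>x y. (\<forall>i\<in>A. x i = y i) \<longrightarrow> f x = f y)"

lemma dep_onI: "(\<And>x y. (\<And>i. i \<in> A \<Longrightarrow> x i = y i) \<Longrightarrow> f x = f y) \<Longrightarrow> dep_on A f"
  unfolding dep_on_def by blast

lemma dep_onD: "dep_on A f \<Longrightarrow> (\<And>i. i \<in> A \<Longrightarrow> x i = y i) \<Longrightarrow> f x = f y"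
  unfolding dep_on_def by blast

locale iid = prob_space M for M :: "'a measure" +
  assumes space_UNIV: "space M = UNIV"
begin

abbreviation P where "P \<equiv> iproc M"

sublocale P: prob_space P
  unfolding iproc_def by (intro prob_space_PiM) (rule prob_space_axioms)

sublocale PP: product_prob_space "\<lambda>_. M" "UNIV :: int set"
  by unfold_locales

lemma space_P [simp]: "space P = UNIV"
  by (simp add: iproc_def space_PiM space_UNIV)

lemma coord [measurable]: "(\<lambda>x. x i) \<in> measurable P M"
  unfolding iproc_def by measurable

lemma measurable_P: "(\<And>i. (\<lambda>x. f x i) \<in> measurable N M) \<Longrightarrow> f \<in> measurable N P"
  unfolding iproc_def by (rule measurable_PiM_single') (auto simp: space_UNIV)

lemma sh_measurable [measurable]: "sh a \<in> measurable P P"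
  by (rule measurable_P) simp

lemma distr_sh: "distr P P (sh a) = P"
proof -
  have "distr P P (\<lambda>x. \<lambda>i\<in>UNIV. x (i + a)) = P"
    unfolding iproc_def
    by (rule distr_PiM_reindex[where M="\<lambda>_. M" and f="\<lambda>i. i + a"])
       (auto simp: inj_on_def prob_space_axioms)
  moreover have "(\<lambda>x. \<lambda>i\<in>UNIV. x (i + a)) = (sh a :: (int \<Rightarrow> 'a) \<Rightarrow> _)"
    by (simp add: sh_def[abs_def] restrict_def)
  ultimately show ?thesis by simp
qed

lemma prob_sh:
  assumes "{x. Q x} \<in> sets P"
  shows "P.prob {x. Q (sh a x)} = P.prob {x. Q x}"
proof -
  have "P.prob {x. Q x} = measure (distr P P (sh a)) {x. Q x}" by (simp add: distr_sh)
  also have "\<dots> = P.prob (sh a -` {x. Q x} \<inter> space P)" using assms by (intro measure_distr) auto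
  finally show ?thesis by (simp add: vimage_def)
qed

lemma indep_coord: "P.indep_vars (\<lambda>_. M) (\<lambda>i x. x i) UNIV"
proof (subst P.indep_vars_iff_distr_eq_PiM')
  have "distr P (PiM UNIV (\<lambda>_. M)) (\<lambda>x. \<lambda>i\<in>UNIV. x i) = distr P P (\<lambda>x. x)"
    by (simp add: iproc_def restrict_def)
  also have "\<dots> = P" by simp
  also have "\<dots> = PiM UNIV (\<lambda>i. distr P M (\<lambda>x. x i))"
    unfolding iproc_def by (simp add: PP.PiM_component)
  finally show "distr P (PiM UNIV (\<lambda>_. M)) (\<lambda>x. \<lambda>i\<in>UNIV. x i) = PiM UNIV (\<lambda>i. distr P M (\<lambda>x. x i))" .
qed auto

lemma extend_measurable: "(\<lambda>r i. if i \<in> A then r i else x0 i) \<in> measurable (PiM A (\<lambda>_. M)) P"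
proof (rule measurable_P)
  fix i show "(\<lambda>r. if i \<in> A then r i else x0 i) \<in> measurable (PiM A (\<lambda>_. M)) M"
    by (cases "i \<in> A") (auto simp: space_UNIV)
qed

lemma dep_on_extend: "dep_on A f \<Longrightarrow> f x = f (\<lambda>i. if i \<in> A then restrict x A i else x0 i)"
  by (rule dep_onD[of A f]) auto

text \<open>Restrictions of \<open>x\<close> to disjoint sets of coordinates are independent. An
  event on \<open>x\<close> that depends on \<open>A\<close> only becomes an event on the
  restriction by filling in a fixed point outside \<open>A\<close>.\<close>

lemma prob_indep:
  assumes Q1: "{x. Q1 x} \<in> sets P" "dep_on A Q1" and Q2: "{x. Q2 x} \<in> sets P" "dep_on B Q2"
    and AB: "A \<inter> B = {}"
  shows "P.prob {x. Q1 x \<and> Q2 x} = P.prob {x. Q1 x} * P.prob {x. Q2 x}"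
proof -
  have ind: "P.indep_var (PiM A (\<lambda>_. M)) (\<lambda>x. restrict x A) (PiM B (\<lambda>_. M)) (\<lambda>x. restrict x B)"
    using P.indep_var_restrict[OF indep_coord AB] by simp
  define x0 :: "int \<Rightarrow> 'a" where "x0 = undefined"
  define E where "E A r = (\<lambda>i. if i \<in> A then r i else x0 i)" for A and r :: "int \<Rightarrow> 'a"
  have E: "E A \<in> measurable (PiM A (\<lambda>_. M)) P" for A
    unfolding E_def by (rule extend_measurable)
  have m: "E A -` {x. Q x} \<inter> space (PiM A (\<lambda>_. M)) \<in> sets (PiM A (\<lambda>_. M))"
    if "{x. Q x} \<in> sets P" for A Q using E that by (rule measurable_sets)
  have e: "Q (E A (restrict x A)) = Q x" if "dep_on A Q" for A and Q :: "(int \<Rightarrow> 'a) \<Rightarrow> bool" and x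
    using dep_on_extend[OF that, of x x0] by (simp add: E_def)
  have sp: "restrict x A \<in> space (PiM A (\<lambda>_. M))" for x A by (auto simp: space_PiM space_UNIV)
  define E1 where "E1 = E A -` {x. Q1 x} \<inter> space (PiM A (\<lambda>_. M))"
  define E2 where "E2 = E B -` {x. Q2 x} \<inter> space (PiM B (\<lambda>_. M))"
  have s1: "(\<lambda>x. restrict x A) -` E1 \<inter> space P = {x. Q1 x}"
    by (auto simp: E1_def sp e[OF Q1(2)])
  have s2: "(\<lambda>x. restrict x B) -` E2 \<inter> space P = {x. Q2 x}"
    by (auto simp: E2_def sp e[OF Q2(2)])
  have s12: "(\<lambda>x. (restrict x A, restrict x B)) -` (E1 \<times> E2) \<inter> space P = {x. Q1 x \<and> Q2 x}"
    using s1 s2 by auto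
  from P.indep_varD[OF ind m[OF Q1(1)] m[OF Q2(1)]]
  show ?thesis unfolding E1_def[symmetric] E2_def[symmetric] s1 s2 s12 .
qed

lemma prob_coord: "E \<in> sets M \<Longrightarrow> P.prob {x. x i \<in> E} = prob E"
proof -
  assume "E \<in> sets M"
  have "prob E = measure (distr P M (\<lambda>x. x i)) E" by (simp add: iproc_def PP.PiM_component)
  also have "\<dots> = P.prob ((\<lambda>x. x i) -` E \<inter> space P)" using \<open>E \<in> sets M\<close> by (intro measure_distr) auto
  finally show ?thesis by (simp add: vimage_def)
qed

end

lemma measurable_map_list:
  fixes f :: "'j \<Rightarrow> 'a \<Rightarrow> 'b::countable"
  assumes "\<And>j. j \<in> set js \<Longrightarrow> f j \<in> measurable M (count_space UNIV)"
  shows "(\<lambda>x. map (\<lambda>j. f j x) js) \<in> measurable M (count_space UNIV)"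
  using assms
proof (induction js)
  case (Cons j js)
  have 1: "f j \<in> measurable M (count_space UNIV)" using Cons by simp
  have 2: "(\<lambda>x. map (\<lambda>j. f j x) js) \<in> measurable M (count_space UNIV)" using Cons by simp
  have "(\<lambda>x. map (\<lambda>j. f j x) (j # js)) -` {v} \<inter> space M \<in> sets M" for v
  proof (cases v)
    case (Cons d ds)
    have "(\<lambda>x. map (\<lambda>j. f j x) (j # js)) -` {v} \<inter> space M
      = (f j -` {d} \<inter> space M) \<inter> ((\<lambda>x. map (\<lambda>j. f j x) js) -` {ds} \<inter> space M)"
      using Cons by auto
    also have "\<dots> \<in> sets M" 
      using measurable_sets[OF 1, of "{d}"] measurable_sets[OF 2, of "{ds}"] by auto
    finally show ?thesis .
  next
    case Nil
    then have "(\<lambda>x. map (\<lambda>j. f j x) (j # js)) -` {v} \<inter> space M = {}" by auto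
    then show ?thesis by (metis sets.empty_sets)
  qed
  then show ?case by (subst measurable_count_space_eq2_countable) auto
qed simp

subsection \<open>Digit sequences and marker patterns\<close>

type_synonym sym = "nat \<Rightarrow> bool"

definition symM :: "sym measure" where "symM = PiM UNIV (\<lambda>_. count_space UNIV)"

lemma space_symM [simp]: "space symM = UNIV" by (simp add: symM_def space_PiM)

definition lev :: "nat \<Rightarrow> sym \<Rightarrow> bool list" where "lev n c = map c [0..<n]"

lemma length_lev [simp]: "length (lev n c) = n" by (simp add: lev_def)
lemma nth_lev [simp]: "j < n \<Longrightarrow> lev n c ! j = c j" by (simp add: lev_def)
lemma take_lev: "m \<le> n \<Longrightarrow> take m (lev n c) = lev m c" by (simp add: lev_def take_map)
definition wrd :: "nat \<Rightarrow> (int \<Rightarrow> sym) \<Rightarrow> int \<Rightarrow> nat \<Rightarrow> bool list list" where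
  "wrd n x i L = map (\<lambda>j. lev n (x (i + int j))) [0..<L]"

lemma length_wrd [simp]: "length (wrd n x i L) = L" by (simp add: wrd_def)
lemma nth_wrd [simp]: "j < L \<Longrightarrow> wrd n x i L ! j = lev n (x (i + int j))" by (simp add: wrd_def)
lemma wrd_0 [simp]: "wrd n x i 0 = []" by (simp add: wrd_def)
lemma take_wrd: "l \<le> L \<Longrightarrow> take l (wrd n x i L) = wrd n x i l" by (simp add: wrd_def take_map)
lemma wrd_Suc: "wrd n x i (Suc L) = lev n (x i) # wrd n x (i + 1) L"
  unfolding wrd_def map_upt_Suc by (simp add: add.assoc)
lemma wrd_add: "wrd n x i (L + L') = wrd n x i L @ wrd n x (i + int L) L'"
  by (rule nth_equalityI) (simp_all add: nth_append of_nat_diff)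
lemma wrd_sh: "wrd n (sh a x) i L = wrd n x (i + a) L"
  by (rule nth_equalityI) (simp_all add: add_ac)
lemma wrd_coarse: "m \<le> n \<Longrightarrow> map (take m) (wrd n x i L) = wrd m x i L"
  by (rule nth_equalityI) (auto simp: take_lev)

text \<open>Together with \<open>patend\<close> this fixes the marker. Digit 0 distinguishes the
  letter b, the letter a has digit 0 off and digit 1 on, and the marker is \<open>k - 1\<close>
  letters a followed by b. As b stands at the end only, the word cannot overlap itself.\<close>

definition isa :: "bool list \<Rightarrow> bool" where "isa d \<longleftrightarrow> \<not> d ! 0 \<and> d ! 1"

definition patend :: "nat \<Rightarrow> bool list list \<Rightarrow> bool" where
  "patend k v \<longleftrightarrow> k \<le> length v \<and> v ! (length v - 1) ! 0 \<and> (\<forall>j\<in>{2..k}. isa (v ! (length v - j)))"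

text \<open>The stretch from one marker end to the next, its closing marker included. Since no
  proper prefix ends with a marker, these words form a prefix code, and a concatenation of them can
  be parsed in one way only.\<close>

definition gapw :: "nat \<Rightarrow> bool list list \<Rightarrow> bool" where
  "gapw k v \<longleftrightarrow> patend k v \<and> (\<forall>l<length v. \<not> patend k (take l v))"

text \<open>The marker occupies the \<open>k\<close> sites before \<open>i\<close>. So a cut at
  \<open>i\<close> is decided by the past and is independent of the letters from \<open>i\<close>
  on.\<close>

definition cut :: "nat \<Rightarrow> (int \<Rightarrow> sym) \<Rightarrow> int \<Rightarrow> bool" where
  "cut k x i \<longleftrightarrow> x (i - 1) 0 \<and> (\<forall>j\<in>{2..k}. \<not> x (i - int j) 0 \<and> x (i - int j) 1)"

text \<open>The gap that ends at \<open>i\<close> is longer than \<open>N\<close>. Such cuts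
  separate the blocks of threshold \<open>N\<close>; raising \<open>N\<close> merges blocks, which
  produces a nested hierarchy.\<close>

definition CC :: "nat \<Rightarrow> nat \<Rightarrow> (int \<Rightarrow> sym) \<Rightarrow> int \<Rightarrow> bool" where
  "CC k N x i \<longleftrightarrow> cut k x i \<and> (\<forall>l\<in>{1..N}. \<not> cut k x (i - int l))"

lemma cut_sh: "cut k (sh a x) i = cut k x (i + a)"
  by (simp add: cut_def diff_add_eq)

lemma CC_sh: "CC k N (sh a x) i = CC k N x (i + a)"
  by (simp add: CC_def cut_sh diff_add_eq)

lemma CC_cut: "CC k N x i \<Longrightarrow> cut k x i" by (simp add: CC_def)

lemma CC_mono: "N \<le> N' \<Longrightarrow> CC k N' x i \<Longrightarrow> CC k N x i"
  by (auto simp: CC_def)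

lemma patend_coarse:
  assumes "1 \<le> k" "2 \<le> n" shows "patend k (map (take n) v) = patend k v"
proof (cases "k \<le> length v")
  case True
  have "map (take n) v ! (length v - j) ! 0 = v ! (length v - j) ! 0"
    "map (take n) v ! (length v - j) ! 1 = v ! (length v - j) ! 1" if "1 \<le> j" for j
    using assms True that by auto
  then show ?thesis by (simp add: patend_def isa_def)
qed (simp add: patend_def)

lemma gapw_coarse: "1 \<le> k \<Longrightarrow> 2 \<le> n \<Longrightarrow> gapw k (map (take n) v) = gapw k v"
  by (simp add: gapw_def patend_coarse take_map)

lemma cut_patend:
  assumes "2 \<le> n" "1 \<le> k" "k \<le> L"
  shows "cut k x (i + int L) \<longleftrightarrow> patend k (wrd n x i L)"
proof -
  have "isa (wrd n x i L ! (L - j)) \<longleftrightarrow> \<not> x (i + int L - int j) 0 \<and> x (i + int L - int j) 1"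
    if "j \<in> {2..k}" for j using that assms by (simp add: isa_def of_nat_diff add_diff_eq)
  moreover have "wrd n x i L ! (L - 1) ! 0 = x (i + int L - 1) 0"
    using assms by (simp add: of_nat_diff add_diff_eq)
  ultimately show ?thesis using assms unfolding cut_def patend_def by simp
qed

text \<open>Two overlapping markers would put the final b of the first in the place of an a of the
  second.\<close>

lemma cut_gap: 
  assumes "cut k x i" "cut k x j" "i < j" "1 \<le> k" shows "i + int k \<le> j"
proof (rule ccontr)
  assume "\<not> ?thesis"
  then have lt: "j < i + int k" by simp
  have "nat (j - i + 1) \<in> {2..k}" using lt assms by auto
  then have "\<not> x (j - int (nat (j - i + 1))) 0" using assms(2) unfolding cut_def by blast
  moreover have "j - int (nat (j - i + 1)) = i - 1" using assms by simp
  ultimately show False using assms(1) by (simp add: cut_def)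
qed

text \<open>A cut fewer than \<open>k\<close> sites after the cut at \<open>i\<close> is excluded by
  \<open>cut_gap\<close>, so nothing is lost by reading only from \<open>i\<close> on.\<close>

lemma cut_patend':
  assumes "2 \<le> n" "1 \<le> k" "cut k x i" "1 \<le> L"
  shows "cut k x (i + int L) \<longleftrightarrow> patend k (wrd n x i L)"
proof (cases "k \<le> L")
  case False
  then show ?thesis using cut_gap[OF assms(3), of "i + int L"] assms by (auto simp: patend_def)
qed (use cut_patend assms in auto)

lemma cut_gapw:
  assumes "2 \<le> n" "1 \<le> k" "cut k x i" "1 \<le> L"
  shows "gapw k (wrd n x i L) \<longleftrightarrow> cut k x (i + int L) \<and> (\<forall>l\<in>{1..<L}. \<not> cut k x (i + int l))"
proof -
  have "(\<forall>l<L. \<not> patend k (take l (wrd n x i L))) \<longleftrightarrow> (\<forall>l\<in>{1..<L}. \<not> cut k x (i + int l))"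
  proof -
    have "\<not> patend k (take 0 (wrd n x i L))" using assms by (simp add: patend_def)
    moreover have "patend k (take l (wrd n x i L)) \<longleftrightarrow> cut k x (i + int l)" if "1 \<le> l" "l < L" for l
      using cut_patend'[OF assms(1-3) that(1)] that by (simp add: take_wrd)
    ultimately show ?thesis by (metis One_nat_def Suc_leI atLeastLessThan_iff neq0_conv)
  qed
  then show ?thesis using cut_patend'[OF assms] by (simp add: gapw_def)
qed

lemma gapw_length: "gapw k v \<Longrightarrow> k \<le> length v" by (simp add: gapw_def patend_def)

lemma next_cut:
  assumes "cut k x i" "cut k x j" "i < j"
  obtains L where "1 \<le> L" "i + int L \<le> j" "cut k x (i + int L)" "\<forall>l\<in>{1..<L}. \<not> cut k x (i + int l)"
proof -
  define L where "L = (LEAST l. 1 \<le> l \<and> cut k x (i + int l))"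
  have ex: "1 \<le> nat (j - i) \<and> cut k x (i + int (nat (j - i)))" using assms by auto
  have "1 \<le> L \<and> cut k x (i + int L)" 
    using LeastI[of "\<lambda>l. 1 \<le> l \<and> cut k x (i + int l)", OF ex] by (simp add: L_def)
  moreover have "L \<le> nat (j - i)" 
    using Least_le[of "\<lambda>l. 1 \<le> l \<and> cut k x (i + int l)", OF ex] by (simp add: L_def)
  moreover have "\<not> cut k x (i + int l)" if "l \<in> {1..<L}" for l
    using not_less_Least[of l "\<lambda>l. 1 \<le> l \<and> cut k x (i + int l)"] that by (auto simp: L_def)
  ultimately show ?thesis using that assms by auto
qed

subsection \<open>Words, gaps and renewal probabilities\<close>

locale bern = iid \<mu> for \<mu> :: "sym measure" +
  fixes k :: nat
  assumes sets_mu: "sets \<mu> = sets symM" and k1: "1 \<le> k"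
begin

lemma digit_mu [measurable]: "(\<lambda>c. c n) \<in> measurable \<mu> (count_space UNIV)"
  unfolding measurable_cong_sets[OF sets_mu refl] symM_def by measurable

lemma digit [measurable]: "(\<lambda>x. x i n) \<in> measurable P (count_space UNIV)"
  by (rule measurable_compose[OF coord digit_mu])

lemma lev_mu [measurable]: "lev n \<in> measurable \<mu> (count_space UNIV)"
  unfolding lev_def by (rule measurable_map_list) (rule digit_mu)

lemma lev_meas [measurable]: "(\<lambda>x. lev n (x i)) \<in> measurable P (count_space UNIV)"
  by (rule measurable_compose[OF coord lev_mu])

lemma wrd_meas [measurable]: "(\<lambda>x. wrd n x i L) \<in> measurable P (count_space UNIV)"
  unfolding wrd_def by (rule measurable_map_list) (rule lev_meas)

lemma sets_wrd: "{x. Q (wrd n x i L)} \<in> sets P"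
  using measurable_sets[OF wrd_meas, of "{v. Q v}" n i L] by (simp add: vimage_def)

lemma pred_cut [measurable]: "Measurable.pred P (\<lambda>x. cut k x i)"
  unfolding cut_def by measurable

lemma pred_CC [measurable]: "Measurable.pred P (\<lambda>x. CC k N x i)"
  unfolding CC_def by measurable

lemma sets_pred: "Measurable.pred P Q \<Longrightarrow> {x. Q x} \<in> sets P"
  unfolding pred_def by simp

lemmas sets_cut = sets_pred[OF pred_cut] and sets_CC = sets_pred[OF pred_CC]

lemma dep_wrd: "{i..<i + int L} \<subseteq> A \<Longrightarrow> dep_on A (\<lambda>x. f (wrd n x i L))"
proof (rule dep_onI)
  fix x y :: "int \<Rightarrow> sym" assume A: "{i..<i + int L} \<subseteq> A" and e: "\<And>i. i \<in> A \<Longrightarrow> x i = y i"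
  have "x (i + int j) = y (i + int j)" if "j < L" for j
    by (rule e) (use A that in auto)
  then have "wrd n x i L = wrd n y i L" by (intro nth_equalityI) auto
  then show "f (wrd n x i L) = f (wrd n y i L)" by simp
qed

lemma dep_lev: "i \<in> A \<Longrightarrow> dep_on A (\<lambda>x. f (x i))"
  by (rule dep_onI) simp

lemma dep_cut: "{i - int k..<i} \<subseteq> A \<Longrightarrow> dep_on A (\<lambda>x. cut k x i)"
proof (rule dep_onI)
  fix x y :: "int \<Rightarrow> sym" assume A: "{i - int k..<i} \<subseteq> A" and e: "\<And>i. i \<in> A \<Longrightarrow> x i = y i"
  have "x (i - int j) = y (i - int j)" if "1 \<le> j" "j \<le> k" for j
    by (rule e) (use A that in auto)
  from this[of 1] this k1 show "cut k x i = cut k y i" unfolding cut_def by auto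
qed

lemma dep_CC: "{i - int k - int N..<i} \<subseteq> A \<Longrightarrow> dep_on A (\<lambda>x. CC k N x i)"
proof (rule dep_onI)
  fix x y :: "int \<Rightarrow> sym" assume A: "{i - int k - int N..<i} \<subseteq> A" and e: "\<And>i. i \<in> A \<Longrightarrow> x i = y i"
  have "cut k x (i - int j) = cut k y (i - int j)" if "j \<le> N" for j
    by (rule dep_onD[OF dep_cut[of "i - int j" A]]) (use A e that in auto)
  from this[of 0] this show "CC k N x i = CC k N y i" unfolding CC_def by auto
qed

definition sp :: "nat \<Rightarrow> bool list pmf" where "sp n = rvpmf \<mu> (lev n)"
definition wp :: "nat \<Rightarrow> nat \<Rightarrow> bool list list pmf" where "wp n L = lprod (replicate L (sp n))"

lemma prob_sp: "measure_pmf.prob (sp n) V = prob {c. lev n c \<in> V}"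
  unfolding sp_def by (subst prob_rvpmf) (auto simp: prob_space_axioms space_UNIV)

lemma pmf_sp: "pmf (sp n) d = prob {c. lev n c = d}"
  using prob_sp[of n "{d}"] by (simp add: measure_pmf_single)

lemma prob_lev: "P.prob {x. lev n (x i) = d} = pmf (sp n) d"
proof -
  have "lev n -` {d} \<inter> space \<mu> \<in> sets \<mu>" using lev_mu by (rule measurable_sets) simp
  then have "{c. lev n c = d} \<in> sets \<mu>" by (simp add: vimage_def space_UNIV)
  from prob_coord[OF this, of i] show ?thesis by (simp add: pmf_sp)
qed

lemma wrd_law: "rvpmf P (\<lambda>x. wrd n x i L) = wp n L"
proof (rule pmf_eqI)
  fix v
  have "P.prob {x. wrd n x i L = v} = pmf (wp n L) v"
  proof (induction L arbitrary: i v)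
    case 0
    then show ?case by (cases "v = []") (auto simp: wp_def P.prob_space[simplified])
  next
    case (Suc L)
    show ?case
    proof (cases v)
      case Nil
      then have "pmf (wp n (Suc L)) v = 0" unfolding wp_def by (intro pmf_lprod_0) simp
      moreover have "{x. wrd n x i (Suc L) = v} = {}" using Nil by (auto simp: wrd_Suc)
      ultimately show ?thesis by simp
    next
      case (Cons d ds)
      have "P.prob {x. wrd n x i (Suc L) = v} = P.prob {x. lev n (x i) = d \<and> wrd n x (i + 1) L = ds}"
        by (simp add: Cons wrd_Suc)
      also have "\<dots> = P.prob {x. lev n (x i) = d} * P.prob {x. wrd n x (i + 1) L = ds}"
        by (rule prob_indep[where A="{i}" and B="{i + 1..<i + 1 + int L}"])
           (auto intro!: dep_lev[where f="\<lambda>c. lev n c = d"] sets_wrd[where Q="\<lambda>v. v = ds"]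
             dep_wrd[where f="\<lambda>v. v = ds"] sets_pred)
      also have "\<dots> = pmf (wp n (Suc L)) v"
        unfolding Suc prob_lev wp_def Cons by (simp add: pmf_lprod_Cons del: lprod.simps)
      finally show ?thesis .
    qed
  qed
  then show "pmf (rvpmf P (\<lambda>x. wrd n x i L)) v = pmf (wp n L) v"
    by (subst pmf_rvpmf) (auto simp: P.prob_space_axioms)
qed

lemma prob_wrd: "P.prob {x. Q (wrd n x i L)} = measure_pmf.prob (wp n L) {v. Q v}"
  unfolding wrd_law[of n i L, symmetric] by (subst prob_rvpmf) (auto simp: P.prob_space_axioms)

lemma prob_past_wrd:
  assumes "Measurable.pred P Q1" "dep_on {..<i} Q1"
  shows "P.prob {x. Q1 x \<and> Q (wrd n x i L)} = P.prob {x. Q1 x} * measure_pmf.prob (wp n L) {v. Q v}"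
  unfolding prob_wrd[of Q n i L, symmetric]
  by (rule prob_indep[where A="{..<i}" and B="{i..<i + int L}"])
     (use assms in \<open>auto intro!: sets_pred sets_wrd dep_wrd\<close>)

lemma set_sp: "set_pmf (sp n) \<subseteq> {d. length d = n}"
proof
  fix d assume "d \<in> set_pmf (sp n)"
  then have "{c. lev n c = d} \<noteq> {}" unfolding set_pmf_iff pmf_sp by (metis measure_empty)
  then show "d \<in> {d. length d = n}" by auto
qed

lemma finite_sp: "finite (set_pmf (sp n))"
  using set_sp by (rule finite_subset) (use finite_lists_length_eq[of "UNIV :: bool set" n] in auto)

lemma set_wp: "v \<in> set_pmf (wp n L) \<longleftrightarrow> length v = L \<and> set v \<subseteq> set_pmf (sp n)"
  unfolding wp_def by (auto simp: set_lprod list_all2_conv_all_nth in_set_conv_nth subset_iff)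

lemma finite_wp: "finite (set_pmf (wp n L))"
  unfolding wp_def by (rule finite_set_lprod) (auto simp: finite_sp split: if_splits)

lemma wp_coarse: "m \<le> n \<Longrightarrow> map_pmf (map (take m)) (wp n L) = wp m L"
  unfolding wrd_law[symmetric, where i=0]
  by (subst map_rvpmf) (auto simp: wrd_coarse P.prob_space_axioms)

lemma sp_coarse: "m \<le> n \<Longrightarrow> map_pmf (take m) (sp n) = sp m"
  unfolding sp_def by (subst map_rvpmf) (auto simp: take_lev prob_space_axioms)

text \<open>The law of the gap lengths: after a cut the letters are still i.i.d., so the next gap
  has length \<open>L\<close> with this probability. Two digits show the marker, hence level
  2.\<close>

definition u :: "nat \<Rightarrow> real" where "u L = measure_pmf.prob (wp 2 L) {v. gapw k v}"

lemma u_eq: "2 \<le> n \<Longrightarrow> measure_pmf.prob (wp n L) {v. gapw k v} = u L"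
  unfolding u_def wp_coarse[of 2 n L, symmetric] by (simp add: vimage_def gapw_coarse[OF k1, of 2])

lemma u_nonneg: "0 \<le> u L" by (simp add: u_def)

definition G :: "nat \<Rightarrow> nat \<Rightarrow> bool list list pmf" where
  "G n L = cond_pmf (wp n L) {v. gapw k v}"

lemma u_pos_ne: "2 \<le> n \<Longrightarrow> 0 < u L \<Longrightarrow> set_pmf (wp n L) \<inter> {v. gapw k v} \<noteq> {}"
  using u_eq[of n L] measure_pmf_zero_iff[of "wp n L" "{v. gapw k v}"] by auto

lemma pmf_G: "2 \<le> n \<Longrightarrow> 0 < u L \<Longrightarrow> pmf (G n L) v = (if gapw k v then pmf (wp n L) v / u L else 0)"
  unfolding G_def by (subst pmf_cond) (auto simp: u_pos_ne u_eq)

lemma set_G: "2 \<le> n \<Longrightarrow> 0 < u L \<Longrightarrow> set_pmf (G n L) = set_pmf (wp n L) \<inter> {v. gapw k v}"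
  unfolding G_def by (rule set_cond_pmf) (rule u_pos_ne)

lemma finite_G: "2 \<le> n \<Longrightarrow> 0 < u L \<Longrightarrow> finite (set_pmf (G n L))"
  by (simp add: set_G finite_wp)

lemma G_coarse:
  assumes "2 \<le> m" "m \<le> n" "0 < u L" shows "map_pmf (map (take m)) (G n L) = G m L"
proof -
  have v: "map (take m) -` {v. gapw k v} = {v. gapw k v}" using gapw_coarse k1 assms by auto
  have "cond_pmf (map_pmf (map (take m)) (wp n L)) {v. gapw k v}
    = map_pmf (map (take m)) (cond_pmf (wp n L) (map (take m) -` {v. gapw k v}))"
    by (rule cond_map_pmf) (use u_pos_ne[of n L] assms v in auto)
  then show ?thesis unfolding G_def v wp_coarse[OF assms(2)] by simp
qed

definition p :: real where "p = P.prob {x. cut k x 0}"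

lemma prob_cut: "P.prob {x. cut k x i} = p"
  using prob_sh[of "\<lambda>x. cut k x 0" i] sets_cut by (simp add: cut_sh p_def)

lemma p_formula: "p = prob {c. c 0} * prob {c. \<not> c 0 \<and> c 1} ^ (k - 1)"
proof -
  have "P.prob {x. x (-1) 0 \<and> (\<forall>j\<in>{2..m}. \<not> x (- int j) 0 \<and> x (- int j) 1)}
      = prob {c. c 0} * prob {c. \<not> c 0 \<and> c 1} ^ (m - 1)" if "1 \<le> m" for m
    using that
  proof (induction m rule: dec_induct)
    case base
    have "{c. c 0} \<in> sets \<mu>" using measurable_sets[OF digit_mu, of "{True}" 0] by (simp add: vimage_def space_UNIV)
    from prob_coord[OF this, of "-1"] show ?case by simp
  next
    case (step m)
    have s: "{c. \<not> c 0 \<and> c 1} \<in> sets \<mu>"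
    proof -
      have "Measurable.pred \<mu> (\<lambda>c. \<not> c 0 \<and> c 1)" by measurable
      then show ?thesis by (simp add: pred_def space_UNIV)
    qed
    have "{2..Suc m} = insert (Suc m) {2..m}" using step by auto
    then have "P.prob {x. x (-1) 0 \<and> (\<forall>j\<in>{2..Suc m}. \<not> x (- int j) 0 \<and> x (- int j) 1)}
      = P.prob {x. (x (-1) 0 \<and> (\<forall>j\<in>{2..m}. \<not> x (- int j) 0 \<and> x (- int j) 1)) \<and> (\<not> x (- int (Suc m)) 0 \<and> x (- int (Suc m)) 1)}"
      by (intro arg_cong[where f=P.prob]) auto
    also have "\<dots> = P.prob {x. x (-1) 0 \<and> (\<forall>j\<in>{2..m}. \<not> x (- int j) 0 \<and> x (- int j) 1)}
       * P.prob {x. \<not> x (- int (Suc m)) 0 \<and> x (- int (Suc m)) 1}"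
    proof (rule prob_indep[where A="{- int m..-1}" and B="{- int (Suc m)}"])
      show "{x. x (- 1) 0 \<and> (\<forall>j\<in>{2..m}. \<not> x (- int j) 0 \<and> x (- int j) 1)} \<in> sets P"
        by (rule sets_pred) measurable
      show "dep_on {- int m..- 1} (\<lambda>x. x (- 1) 0 \<and> (\<forall>j\<in>{2..m}. \<not> x (- int j) 0 \<and> x (- int j) 1))"
        using step by (intro dep_onI) auto
      show "{x. \<not> x (- int (Suc m)) 0 \<and> x (- int (Suc m)) 1} \<in> sets P"
        by (rule sets_pred) measurable
      show "dep_on {- int (Suc m)} (\<lambda>x. \<not> x (- int (Suc m)) 0 \<and> x (- int (Suc m)) 1)"
        by (rule dep_lev) simp
    qed auto
    also have "P.prob {x. \<not> x (- int (Suc m)) 0 \<and> x (- int (Suc m)) 1} = prob {c. \<not> c 0 \<and> c 1}"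
      using prob_coord[OF s, of "- int (Suc m)"] by simp
    finally show ?case using step.IH step.hyps by (cases m) simp_all
  qed
  from this[OF k1] show ?thesis by (simp add: p_def cut_def)
qed

lemma u_less_k: "L < k \<Longrightarrow> u L = 0"
proof -
  assume "L < k"
  then have "set_pmf (wp 2 L) \<inter> {v. gapw k v} = {}" by (auto simp: set_wp dest: gapw_length)
  then show ?thesis by (simp add: u_def measure_pmf_zero_iff)
qed

lemma patend_first:
  assumes "patend k v" obtains j where "j \<le> length v" "gapw k (take j v)"
proof -
  define j where "j = (LEAST j. patend k (take j v))"
  have ex: "patend k (take (length v) v)" using assms by simp
  have "patend k (take j v)"
    using LeastI[of "\<lambda>j. patend k (take j v)", OF ex] by (simp add: j_def)
  moreover have "j \<le> length v"
    using Least_le[of "\<lambda>j. patend k (take j v)", OF ex] by (simp add: j_def)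
  moreover have "\<not> patend k (take l v)" if "l < j" for l
    using not_less_Least[of l "\<lambda>j. patend k (take j v)"] that by (simp add: j_def)
  ultimately show ?thesis using that by (auto simp: gapw_def min_def)
qed

lemma gapw_take_inj: "gapw k (take i v) \<Longrightarrow> gapw k (take j v) \<Longrightarrow> i \<le> length v \<Longrightarrow> j \<le> length v \<Longrightarrow> i = j"
proof (induction i j rule: linorder_wlog)
  case (le i j)
  show ?case
  proof (rule ccontr)
    assume "i \<noteq> j"
    with le have "i < length (take j v)" by auto
    with le(3) have "\<not> patend k (take i (take j v))" by (auto simp: gapw_def)
    with le(1,2) show False by (simp add: gapw_def min_def split: if_splits)
  qed
qed auto

text \<open>Split the event that a marker ends at \<open>L\<close> by the place \<open>j\<close>
  where a marker first ends. Either \<open>j = L\<close>, or the two markers are disjoint,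
  \<open>j \<le> L - k\<close>, and independence gives \<open>u j * p\<close>. The right side
  involves only earlier values, so \<open>k\<close> and \<open>p\<close> determine
  \<open>u\<close>.\<close>

lemma renewal:
  assumes "k \<le> L" shows "u L = p * (1 - (\<Sum>j\<le>L - k. u j))"
proof -
  let ?E = "\<lambda>j. {x. gapw k (wrd 2 x 0 j) \<and> cut k x (int L)}"
  have pat: "cut k x (int L) \<longleftrightarrow> patend k (wrd 2 x 0 L)" for x
    using cut_patend[of 2 k L x 0] k1 assms by simp
  have meas: "?E j \<in> sets P" for j
    using sets.Int[OF sets_wrd[of "gapw k" 2 0 j] sets_cut[of "int L"]] by (simp add: Collect_conj_eq)
  have un: "{x. cut k x (int L)} = (\<Union>j\<in>{..L}. ?E j)"
  proof (intro equalityI subsetI)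
    fix x assume "x \<in> {x. cut k x (int L)}"
    then have c: "cut k x (int L)" by simp
    then obtain j where "j \<le> L" "gapw k (take j (wrd 2 x 0 L))"
      using pat patend_first[of "wrd 2 x 0 L"] by auto
    then show "x \<in> (\<Union>j\<in>{..L}. ?E j)" using c by (auto simp: take_wrd)
  qed auto
  have disj: "disjoint_family_on ?E {..L}"
    unfolding disjoint_family_on_def
  proof (intro ballI impI)
    fix i j assume "i \<in> {..L}" "j \<in> {..L}" "i \<noteq> j"
    then show "?E i \<inter> ?E j = {}" using gapw_take_inj[of i "wrd 2 _ 0 L" j] by (auto simp: take_wrd)
  qed
  have "p = P.prob {x. cut k x (int L)}" by (simp add: prob_cut)
  also have "\<dots> = (\<Sum>j\<le>L. P.prob (?E j))"
    unfolding un by (rule P.finite_measure_finite_Union) (use disj meas in auto)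
  also have "\<dots> = (\<Sum>j\<in>insert L {..L - k}. P.prob (?E j))"
  proof (rule sum.mono_neutral_right)
    show "\<forall>j\<in>{..L} - insert L {..L - k}. P.prob (?E j) = 0"
    proof
      fix j assume j: "j \<in> {..L} - insert L {..L - k}"
      \<comment> \<open>A first marker end strictly between \<open>L - k\<close> and
        \<open>L\<close> would overlap the marker that ends at \<open>L\<close>.\<close>
      have emp: "?E j = {}"
      proof (rule ccontr)
        assume "?E j \<noteq> {}"
        then obtain x where x: "gapw k (wrd 2 x 0 j)" "cut k x (int L)" by auto
        have "k \<le> j" using gapw_length[OF x(1)] by simp
        then have "cut k x (int j)" using cut_patend[of 2 k j x 0] x(1) k1 by (simp add: gapw_def)
        from cut_gap[OF this x(2)] j k1 show False by auto
      qed
      show "P.prob (?E j) = 0" unfolding emp by simp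
    qed
  qed auto
  also have "\<dots> = P.prob (?E L) + (\<Sum>j\<le>L - k. P.prob (?E j))"
    using assms k1 by (subst sum.insert) auto
  also have "P.prob (?E L) = u L"
  proof -
    have "?E L = {x. gapw k (wrd 2 x 0 L)}" using pat by (auto simp: gapw_def)
    then show ?thesis using prob_wrd[of "gapw k" 2 0 L] by (simp add: u_def)
  qed
  also have "(\<Sum>j\<le>L - k. P.prob (?E j)) = (\<Sum>j\<le>L - k. u j * p)"
  proof (rule sum.cong[OF refl])
    fix j assume j: "j \<in> {..L - k}"
    have "P.prob (?E j) = P.prob {x. gapw k (wrd 2 x 0 j)} * P.prob {x. cut k x (int L)}"
      by (rule prob_indep[where A="{0..<int j}" and B="{int L - int k..<int L}"])
         (use j assms in \<open>auto intro!: sets_wrd sets_cut dep_wrd dep_cut\<close>)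
    then show "P.prob (?E j) = u j * p" using prob_wrd[of "gapw k" 2 0 j] by (simp add: u_def prob_cut)
  qed
  finally show ?thesis by (simp add: sum_distrib_left sum_distrib_right algebra_simps)
qed

definition kappa :: "nat \<Rightarrow> real" where "kappa N = P.prob {x. CC k N x 0}"

lemma prob_CC: "P.prob {x. CC k N x i} = kappa N"
  using prob_sh[of "\<lambda>x. CC k N x 0" i] sets_CC by (simp add: CC_sh kappa_def)

lemma prob_cut_wrd: "P.prob {x. cut k x i \<and> Q (wrd n x i L)} = p * measure_pmf.prob (wp n L) {v. Q v}"
  by (subst prob_past_wrd) (auto intro!: dep_cut simp: prob_cut)

lemma prob_CC_wrd: "P.prob {x. CC k N x i \<and> Q (wrd n x i L)} = kappa N * measure_pmf.prob (wp n L) {v. Q v}"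
  by (subst prob_past_wrd) (auto intro!: dep_CC simp: prob_CC)

text \<open>Look back from a cut at 0 to the cut before it: it lies at distance \<open>L\<close>
  with probability \<open>p * u L\<close>. Hence \<open>kappa\<close> too depends on
  \<open>k\<close> and \<open>p\<close> only.\<close>

lemma kappa_formula: "kappa N = p * (1 - (\<Sum>L\<in>{1..N}. u L))"
proof -
  let ?E = "\<lambda>L. {x. cut k x (- int L) \<and> gapw k (wrd 2 x (- int L) L)}"
  have E: "?E L = {x. cut k x (- int L) \<and> cut k x 0 \<and> (\<forall>l\<in>{1..<L}. \<not> cut k x (- int L + int l))}" if "1 \<le> L" for L
    using cut_gapw[of 2 k _ "- int L" L] that k1 by auto
  have meas: "?E L \<in> sets P" for L
    using sets.Int[OF sets_cut[of "- int L"] sets_wrd[of "gapw k" 2 "- int L" L]] by (simp add: Collect_conj_eq)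
  have un: "{x. cut k x 0} = {x. CC k N x 0} \<union> (\<Union>L\<in>{1..N}. ?E L)"
  proof (intro equalityI subsetI)
    fix x assume "x \<in> {x. cut k x 0}"
    then have c: "cut k x 0" by simp
    show "x \<in> {x. CC k N x 0} \<union> (\<Union>L\<in>{1..N}. ?E L)"
    proof (cases "CC k N x 0")
      case False
      then obtain l where l: "l \<in> {1..N}" "cut k x (- int l)" using c by (auto simp: CC_def)
      define L where "L = (LEAST l. 1 \<le> l \<and> cut k x (- int l))"
      have ex: "1 \<le> l \<and> cut k x (- int l)" using l by auto
      have L: "1 \<le> L" "cut k x (- int L)"
        using LeastI[of "\<lambda>l. 1 \<le> l \<and> cut k x (- int l)", OF ex] by (auto simp: L_def)
      have "L \<le> l" using Least_le[of "\<lambda>l. 1 \<le> l \<and> cut k x (- int l)", OF ex] by (simp add: L_def)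
      moreover have "\<not> cut k x (- int L + int l)" if "l \<in> {1..<L}" for l
      proof -
        have "L - l < L" "1 \<le> L - l" "- int L + int l = - int (L - l)" using that by auto
        then show ?thesis
          using not_less_Least[of "L - l" "\<lambda>l. 1 \<le> l \<and> cut k x (- int l)"] unfolding L_def by metis
      qed
      ultimately have "L \<in> {1..N}" "x \<in> ?E L" unfolding E[OF L(1)] using L c l by auto
      then show ?thesis by blast
    qed simp
  next
    fix x assume "x \<in> {x. CC k N x 0} \<union> (\<Union>L\<in>{1..N}. ?E L)"
    then show "x \<in> {x. cut k x 0}" using E by (auto simp: CC_def)
  qed
  have disj: "disjoint_family_on ?E {1..N}"
    unfolding disjoint_family_on_def
  proof (intro ballI impI)
    have *: "?E i \<inter> ?E j = {}" if "1 \<le> i" "i < j" for i j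
    proof -
      have "cut k x (- int j + int (j - i)) = cut k x (- int i)" for x using that by (simp add: of_nat_diff)
      moreover have "j - i \<in> {1..<j}" using that by auto
      ultimately show ?thesis using that E[of i] E[of j] by fastforce
    qed
    fix i j assume ij: "i \<in> {1..N}" "j \<in> {1..N}" "i \<noteq> j"
    then consider "i < j" | "j < i" by linarith
    then show "?E i \<inter> ?E j = {}"
      using *[of i j] *[of j i] ij by cases (auto simp: Int_commute)
  qed
  have "p = P.prob {x. cut k x 0}" by (simp add: prob_cut)
  also have "\<dots> = P.prob {x. CC k N x 0} + P.prob (\<Union>L\<in>{1..N}. ?E L)"
    unfolding un
  proof (rule P.finite_measure_Union)
    show "{x. CC k N x 0} \<inter> (\<Union>L\<in>{1..N}. ?E L) = {}" by (auto simp: CC_def)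
  qed (use meas sets_CC in auto)
  also have "P.prob (\<Union>L\<in>{1..N}. ?E L) = (\<Sum>L\<in>{1..N}. P.prob (?E L))"
    by (rule P.finite_measure_finite_Union) (use disj meas in auto)
  also have "\<dots> = (\<Sum>L\<in>{1..N}. p * u L)"
    by (intro sum.cong refl) (simp add: prob_cut_wrd u_def)
  finally show ?thesis by (simp add: kappa_def sum_distrib_left algebra_simps)
qed

end

text \<open>Strong induction along \<open>renewal\<close>. This is the reason for asking that the
  two markers have equal length and equal probability: the gaps then have the same law.\<close>

lemma (in bern) u_unique:
  assumes "bern \<nu> k" "bern.p \<nu> k = p" shows "bern.u \<nu> k L = u L"
proof (induction L rule: less_induct)
  case (less L)
  interpret N: bern \<nu> k by fact
  show ?case
  proof (cases "k \<le> L")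
    case True
    then have "(\<Sum>j\<le>L - k. N.u j) = (\<Sum>j\<le>L - k. u j)" using k1 less by (intro sum.cong) auto
    then show ?thesis using True assms by (simp add: renewal N.renewal)
  qed (simp add: u_less_k N.u_less_k)
qed

subsection \<open>Blocks\<close>

definition bvs :: "nat \<Rightarrow> nat list \<Rightarrow> bool" where
  "bvs N S \<longleftrightarrow> S \<noteq> [] \<and> N < last S \<and> (\<forall>L\<in>set (butlast S). L \<le> N)"

abbreviation bsize :: "bool list list list \<Rightarrow> nat" where "bsize F \<equiv> length (concat F)"

text \<open>Site 0 has offset \<open>j\<close> in a block of threshold \<open>N\<close> with gap
  words \<open>F\<close>. For fixed \<open>j\<close> and \<open>F\<close> the condition concerns a
  finite window, which makes it measurable, clopen and easy to shift within the block.\<close>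

definition isblk :: "nat \<Rightarrow> nat \<Rightarrow> nat \<Rightarrow> (int \<Rightarrow> sym) \<Rightarrow> nat \<Rightarrow> bool list list list \<Rightarrow> bool" where
  "isblk k N n x j F \<longleftrightarrow> CC k N x (- int j) \<and> wrd n x (- int j) (bsize F) = concat F
     \<and> (\<forall>W\<in>set F. gapw k W) \<and> bvs N (map length F) \<and> j < bsize F"

text \<open>The value \<open>(0, [])\<close> stands for the absence of a block. It cannot be
  confused with a block, because \<open>bvs\<close> excludes the empty list.\<close>

definition bd :: "nat \<Rightarrow> nat \<Rightarrow> nat \<Rightarrow> (int \<Rightarrow> sym) \<Rightarrow> nat \<times> bool list list list" where
  "bd k N n x = (if \<exists>j F. isblk k N n x j F then (THE jF. isblk k N n x (fst jF) (snd jF)) else (0, []))"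

lemma wrd_Cons_fill:
  "wrd n x s (bsize (W # F)) = concat (W # F) \<longleftrightarrow>
   wrd n x s (length W) = W \<and> wrd n x (s + int (length W)) (bsize F) = concat F"
  by (simp add: wrd_add)

text \<open>Inner cuts follow a gap of length at most \<open>N\<close> and fail \<open>CC\<close>,
  while the last gap is longer than \<open>N\<close>. So both ends of a block are determined by the
  sequence.\<close>

lemma fill_ends:
  assumes "2 \<le> n" "1 \<le> k" "cut k x s" "wrd n x s (bsize F) = concat F" "\<forall>W\<in>set F. gapw k W"
    "bvs N (map length F)"
  shows "CC k N x (s + int (bsize F)) \<and> (\<forall>t\<in>{1..<bsize F}. \<not> CC k N x (s + int t))"
  using assms(3-)
proof (induction F arbitrary: s)
  case (Cons W F)
  have w: "wrd n x s (length W) = W" and wF: "wrd n x (s + int (length W)) (bsize F) = concat F"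
    using Cons.prems(2) unfolding wrd_Cons_fill by auto
  have gW: "gapw k W" using Cons.prems by simp
  have W1: "1 \<le> length W" using gapw_length[OF gW] assms by simp
  have c: "cut k x (s + int (length W))" and nc: "\<forall>l\<in>{1..<length W}. \<not> cut k x (s + int l)"
    using cut_gapw[OF assms(1,2) Cons.prems(1) W1] gW w by auto
  show ?case
  proof (cases "F = []")
    case True
    have N: "N < length W" using Cons.prems(4) True by (simp add: bvs_def)
    have "\<not> cut k x (s + int (length W) - int l)" if "l \<in> {1..N}" for l
    proof -
      have "length W - l \<in> {1..<length W}" "s + int (length W) - int l = s + int (length W - l)"
        using that N by auto
      then show ?thesis using nc by metis
    qed
    then have "CC k N x (s + int (length W))" using c by (simp add: CC_def)
    then show ?thesis using True nc by (auto dest: CC_cut)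
  next
    case False
    have N: "length W \<le> N" "bvs N (map length F)" using Cons.prems(4) False by (auto simp: bvs_def)
    from Cons.IH[OF c wF _ N(2)] Cons.prems(3)
    have IH: "CC k N x (s + int (length W) + int (bsize F))"
      "\<forall>t\<in>{1..<bsize F}. \<not> CC k N x (s + int (length W) + int t)" by auto
    have "\<not> CC k N x (s + int t)" if t: "t \<in> {1..<bsize (W # F)}" for t
    proof -
      consider "t < length W" | "t = length W" | "length W < t" by linarith
      then show ?thesis
      proof cases
        case 1 then show ?thesis using nc t by (auto dest: CC_cut)
      next
        case 2
        have "length W \<in> {1..N}" using N W1 by simp
        moreover have "cut k x (s + int (length W) - int (length W))" using Cons.prems(1) by simp
        ultimately show ?thesis unfolding CC_def 2 by blast
      next
        case 3
        then have "t - length W \<in> {1..<bsize F}" "s + int t = s + int (length W) + int (t - length W)"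
          using t by auto
        then show ?thesis using IH(2) by metis
      qed
    qed
    then show ?thesis using IH(1) by (simp add: add.assoc)
  qed
qed (simp add: bvs_def)

lemma parse_unique:
  assumes "1 \<le> k" "\<forall>W\<in>set F. gapw k W" "\<forall>W\<in>set F'. gapw k W" "concat F = concat F'"
  shows "F = F'"
  using assms(2-)
proof (induction F arbitrary: F')
  case Nil
  then have "\<forall>W\<in>set F'. W = []" by simp
  moreover have "\<forall>W\<in>set F'. W \<noteq> []" using Nil assms(1) gapw_length by force
  ultimately show ?case by (metis list.set_intros(1) neq_Nil_conv)
next
  case (Cons W F)
  have ne: "W \<noteq> []" using Cons.prems(1) gapw_length[of k W] assms(1) by auto
  obtain W' F1 where F': "F' = W' # F1" using Cons.prems(3) ne by (cases F') auto
  have eq: "W @ concat F = W' @ concat F1" using Cons.prems(3) F' by simp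
  have g: "gapw k W" "gapw k W'" using Cons.prems F' by auto
  have no: "\<not> length W < length W'" 
  proof
    assume "length W < length W'"
    moreover have "take (length W) (W @ concat F) = take (length W) (W' @ concat F1)" using eq by simp
    ultimately have "W = take (length W) W'" by simp
    then show False using g \<open>length W < length W'\<close> by (metis gapw_def)
  qed
  have no': "\<not> length W' < length W" 
  proof
    assume "length W' < length W"
    moreover have "take (length W') (W @ concat F) = take (length W') (W' @ concat F1)" using eq by simp
    ultimately have "W' = take (length W') W" by simp
    then show False using g \<open>length W' < length W\<close> by (metis gapw_def)
  qed
  have "length W = length W'" using no no' by simp
  then have "W = W'" "concat F = concat F1" using eq by auto
  then show ?case using Cons.IH[of F1] Cons.prems F' by simp
qed

lemma isblk_unique:
  assumes "2 \<le> n" "1 \<le> k" "isblk k N n x j F" "isblk k N n x j' F'"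
  shows "j = j' \<and> F = F'"
proof -
  have e: "CC k N x (- int j)" "CC k N x (- int j + int (bsize F))"
    "\<forall>t\<in>{1..<bsize F}. \<not> CC k N x (- int j + int t)" "j < bsize F" if "isblk k N n x j F" for j F
    using fill_ends[OF assms(1,2), of x "- int j" F N] that by (auto simp: isblk_def dest: CC_cut)
  have le: "j \<le> j'" if "isblk k N n x j F" "isblk k N n x j' F'" for j j' F F'
  proof (rule ccontr)
    assume "\<not> j \<le> j'"
    then have "j - j' \<in> {1..<bsize F}" "- int j + int (j - j') = - int j'" using e(4)[OF that(1)] by auto
    then show False using e(3)[OF that(1)] e(1)[OF that(2)] by metis
  qed
  have j: "j = j'" using le assms by (meson le_antisym)
  have le2: "bsize F \<le> bsize F'" if "isblk k N n x j F" "isblk k N n x j F'" for F F'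
  proof (rule ccontr)
    assume "\<not> bsize F \<le> bsize F'"
    then have "bsize F' \<in> {1..<bsize F}" using e(4)[OF that(2)] by auto
    then show False using e(3)[OF that(1)] e(2)[OF that(2)] by blast
  qed
  have "bsize F = bsize F'" using le2 assms j by (meson le_antisym)
  then have "concat F = concat F'" using assms(3,4) j by (metis isblk_def)
  then have "F = F'" using assms parse_unique[of k F F'] by (simp add: isblk_def)
  then show ?thesis using j by simp
qed

lemma bd_iff:
  assumes "2 \<le> n" "1 \<le> k" "F \<noteq> []"
  shows "bd k N n x = (j, F) \<longleftrightarrow> isblk k N n x j F"
proof
  assume "isblk k N n x j F"
  moreover from this have "(THE jF. isblk k N n x (fst jF) (snd jF)) = (j, F)"
    using isblk_unique[OF assms(1,2)] by (intro the_equality) (auto simp: prod_eq_iff)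
  ultimately show "bd k N n x = (j, F)" by (auto simp: bd_def)
next
  assume bd: "bd k N n x = (j, F)"
  then obtain j' F' where b: "isblk k N n x j' F'" using assms(3) by (auto simp: bd_def split: if_splits)
  then have "(THE jF. isblk k N n x (fst jF) (snd jF)) = (j', F')"
    using isblk_unique[OF assms(1,2)] by (intro the_equality) (auto simp: prod_eq_iff)
  then have "bd k N n x = (j', F')" using b by (auto simp: bd_def)
  then show "isblk k N n x j F" using b bd by simp
qed

lemma parse_exists:
  assumes "2 \<le> n" "1 \<le> k" "cut k x s" "cut k x t" "s < t"
  shows "\<exists>F. F \<noteq> [] \<and> (\<forall>W\<in>set F. gapw k W) \<and> concat F = wrd n x s (nat (t - s))"
  using assms(3-)
proof (induction "nat (t - s)" arbitrary: s rule: less_induct)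
  case less
  obtain L where L: "1 \<le> L" "s + int L \<le> t" "cut k x (s + int L)" "\<forall>l\<in>{1..<L}. \<not> cut k x (s + int l)"
    using next_cut[OF less.prems] by blast
  have g: "gapw k (wrd n x s L)" using cut_gapw[OF assms(1,2) less.prems(1) L(1)] L by simp
  show ?case
  proof (cases "s + int L = t")
    case True
    then have "nat (t - s) = L" by auto
    then show ?thesis using g by (intro exI[of _ "[wrd n x s L]"]) simp
  next
    case False
    then have "nat (t - (s + int L)) < nat (t - s)" "s + int L < t" using L by auto
    from less.hyps[OF this(1) L(3) less.prems(2) this(2)] obtain F where
      F: "\<forall>W\<in>set F. gapw k W" "concat F = wrd n x (s + int L) (nat (t - (s + int L)))" by auto
    have "nat (t - s) = L + nat (t - (s + int L))" using L by auto
    then have "wrd n x s (nat (t - s)) = concat (wrd n x s L # F)" using F by (simp add: wrd_add)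
    then show ?thesis using F g by (intro exI[of _ "wrd n x s L # F"]) simp
  qed
qed

lemma parse_bvs:
  assumes "2 \<le> n" "1 \<le> k" "cut k x s" "F \<noteq> []" "\<forall>W\<in>set F. gapw k W" "wrd n x s (bsize F) = concat F"
    "CC k N x (s + int (bsize F))" "\<forall>t\<in>{1..<bsize F}. \<not> CC k N x (s + int t)"
  shows "bvs N (map length F)"
  using assms(3-)
proof (induction F arbitrary: s)
  case (Cons W F)
  have w: "wrd n x s (length W) = W" and wF: "wrd n x (s + int (length W)) (bsize F) = concat F"
    using Cons.prems(4) unfolding wrd_Cons_fill by auto
  have gW: "gapw k W" using Cons.prems by simp
  have W1: "1 \<le> length W" using gapw_length[OF gW] assms by simp
  have c: "cut k x (s + int (length W))" and nc: "\<forall>l\<in>{1..<length W}. \<not> cut k x (s + int l)"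
    using cut_gapw[OF assms(1,2) Cons.prems(1) W1] gW w by auto
  show ?case
  proof (cases "F = []")
    case True
    have "\<not> length W \<le> N"
    proof
      assume "length W \<le> N"
      moreover have "cut k x (s + int (length W) - int (length W))" using Cons.prems(1) by simp
      moreover have "CC k N x (s + int (length W))" using Cons.prems(5) True by simp
      ultimately show False using W1 unfolding CC_def by (meson atLeastAtMost_iff)
    qed
    then show ?thesis using True by (simp add: bvs_def)
  next
    case False
    have "1 \<le> bsize F" using False Cons.prems(3) gapw_length[of k "hd F"] assms(2) by (cases F) auto
    moreover have "bsize (W # F) = length W + bsize F" by simp
    ultimately have "length W \<in> {1..<bsize (W # F)}" using W1 by (metis atLeastLessThan_iff less_add_same_cancel1 less_eq_Suc_le One_nat_def)
    then have "\<not> CC k N x (s + int (length W))" using Cons.prems(6) by blast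
    then obtain l where l: "l \<in> {1..N}" "cut k x (s + int (length W) - int l)" using c by (auto simp: CC_def)
    have "\<not> l < length W"
    proof
      assume "l < length W"
      then have "length W - l \<in> {1..<length W}" "s + int (length W) - int l = s + int (length W - l)"
        using l by auto
      then show False using nc l(2) by metis
    qed
    then have WN: "length W \<le> N" using l by simp
    have "\<forall>t\<in>{1..<bsize F}. \<not> CC k N x (s + int (length W) + int t)"
    proof
      fix t assume "t \<in> {1..<bsize F}"
      then have "length W + t \<in> {1..<bsize (W # F)}" by auto
      then show "\<not> CC k N x (s + int (length W) + int t)" using Cons.prems(6) by (metis add.assoc of_nat_add)
    qed
    from Cons.IH[OF c False _ wF _ this] Cons.prems(3,5)
    have "bvs N (map length F)" by (simp add: add.assoc)
    then show ?thesis using WN False by (simp add: bvs_def)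
  qed
qed simp

lemma isblk_exists:
  assumes "2 \<le> n" "1 \<le> k" "\<exists>i\<le>0. CC k N x i" "\<exists>i>0. CC k N x i"
  shows "\<exists>j F. isblk k N n x j F"
proof -
  obtain i1 i2 where i1: "i1 \<le> 0" "CC k N x i1" and i2: "0 < i2" "CC k N x i2" using assms by auto
  define j where "j = (LEAST j. CC k N x (- int j))"
  have ex: "CC k N x (- int (nat (- i1)))" using i1 by simp
  have j: "CC k N x (- int j)"
    using LeastI[of "\<lambda>j. CC k N x (- int j)", OF ex] by (simp add: j_def)
  have jmin: "\<not> CC k N x (- int l)" if "l < j" for l
    using not_less_Least[of l "\<lambda>j. CC k N x (- int j)"] that by (simp add: j_def)
  define t where "t = (LEAST t. 0 < t \<and> CC k N x (int t))"
  have ex2: "0 < nat i2 \<and> CC k N x (int (nat i2))" using i2 by simp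
  have t: "0 < t" "CC k N x (int t)"
    using LeastI[of "\<lambda>t. 0 < t \<and> CC k N x (int t)", OF ex2] by (auto simp: t_def)
  have tmin: "\<not> CC k N x (int l)" if "0 < l" "l < t" for l
    using not_less_Least[of l "\<lambda>t. 0 < t \<and> CC k N x (int t)"] that by (auto simp: t_def)
  obtain F where F: "F \<noteq> []" "\<forall>W\<in>set F. gapw k W" "concat F = wrd n x (- int j) (nat (int t - (- int j)))"
    using parse_exists[OF assms(1,2) CC_cut[OF j] CC_cut[OF t(2)]] t by auto
  have sz: "bsize F = j + t" unfolding F(3) by simp
  have "bvs N (map length F)"
  proof (rule parse_bvs[OF assms(1,2) CC_cut[OF j] F(1,2)])
    show "wrd n x (- int j) (bsize F) = concat F" using F(3) sz by (simp add: nat_add_distrib add.commute)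
    show "CC k N x (- int j + int (bsize F))" using t sz by simp
    show "\<forall>l\<in>{1..<bsize F}. \<not> CC k N x (- int j + int l)"
    proof
      fix l assume l: "l \<in> {1..<bsize F}"
      show "\<not> CC k N x (- int j + int l)"
      proof (cases "l \<le> j")
        case True
        then have "- int j + int l = - int (j - l)" "j - l < j" using l by auto
        then show ?thesis using jmin by metis
      next
        case False
        then have "- int j + int l = int (l - j)" "0 < l - j" "l - j < t" using l sz by auto
        then show ?thesis using tmin by metis
      qed
    qed
  qed
  then have "isblk k N n x j F" unfolding isblk_def using j F sz t by (simp add: nat_add_distrib add.commute)
  then show ?thesis by blast
qed

lemma isblk_sh:
  assumes "isblk k N n x j F" "0 \<le> int j + i" "int j + i < int (bsize F)"
  shows "isblk k N n (sh i x) (nat (int j + i)) F"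
  using assms by (simp add: isblk_def CC_sh wrd_sh)

lemma isblk_coarse:
  assumes "isblk k N n x j F" "m \<le> n" "2 \<le> m" "1 \<le> k"
  shows "isblk k N m x j (map (map (take m)) F)"
proof -
  have c: "concat (map (map (take m)) F) = map (take m) (concat F)" by (simp add: map_concat)
  have l: "map length (map (map (take m)) F) = map length F" by simp
  show ?thesis using assms wrd_coarse[OF assms(2), of x "- int j" "bsize F"]
    unfolding isblk_def c l by (auto simp: gapw_coarse)
qed

section \<open>Recurrence of markers and the law of the block at site 0\<close>

text \<open>Long gaps must occur, or beyond some threshold no block would ever end. There must also
  be a choice of fillers in arbitrarily long gaps, or the truncated rates would stop growing. The
  condition secures both.\<close>

locale bernd = bern +
  assumes nd: "\<exists>L>N. \<exists>n\<ge>2. \<exists>v v'. v \<noteq> v' \<and> v \<in> set_pmf (wp n L) \<and> v' \<in> set_pmf (wp n L) \<and> gapw k v \<and> gapw k v'"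
begin

lemma AE_not: "Measurable.pred P Q \<Longrightarrow> P.prob {x. Q x} = 0 \<longleftrightarrow> (AE x in P. \<not> Q x)"
  using P.prob_eq_0[of "{x. Q x}"] by (simp add: sets_pred)

lemma u_pos_ex: "\<exists>L>N. 0 < u L"
proof -
  obtain L n v where "N < L" "2 \<le> n" "v \<in> set_pmf (wp n L)" "gapw k v" using nd[of N] by blast
  moreover from this have "0 < measure_pmf.prob (wp n L) {v. gapw k v}" by (intro measure_pmf_posI[of v]) auto
  ultimately show ?thesis using u_eq by auto
qed

lemma p_nonneg: "0 \<le> p" by (simp add: p_def)

lemma p_pos: "0 < p"
proof -
  obtain L where L: "0 < u L" using u_pos_ex by blast
  then have "k \<le> L" using u_less_k[of L] by force
  from renewal[OF this] L have "p \<noteq> 0" by auto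
  then show ?thesis using p_nonneg by simp
qed

lemma kappa_le1: "kappa N \<le> 1" by (simp add: kappa_def)

text \<open>A gap of some length \<open>L > N\<close> that ends at 0 realises the event, and such
  gaps have positive probability.\<close>

lemma kappa_pos: "0 < kappa N"
proof -
  obtain L where L: "N < L" "0 < u L" using u_pos_ex by blast
  have "0 < p * u L" using p_pos L by simp
  also have "\<dots> = P.prob {x. cut k x (- int L) \<and> gapw k (wrd 2 x (- int L) L)}"
    by (simp add: prob_cut_wrd u_def)
  also have "\<dots> \<le> P.prob {x. CC k N x 0}"
  proof (rule P.finite_measure_mono)
    show "{x. cut k x (- int L) \<and> gapw k (wrd 2 x (- int L) L)} \<subseteq> {x. CC k N x 0}"
    proof safe
      fix x assume x: "cut k x (- int L)" "gapw k (wrd 2 x (- int L) L)"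
      then have c: "cut k x 0" "\<forall>l\<in>{1..<L}. \<not> cut k x (- int L + int l)"
        using cut_gapw[of 2 k x "- int L" L] k1 L by auto
      have "\<not> cut k x (0 - int l)" if "l \<in> {1..N}" for l
      proof -
        have "L - l \<in> {1..<L}" "0 - int l = - int L + int (L - l)" using that L by auto
        then show ?thesis using c by metis
      qed
      then show "CC k N x 0" using c by (simp add: CC_def)
    qed
  qed (rule sets_CC)
  finally show ?thesis by (simp add: kappa_def)
qed

text \<open>\<open>CC\<close> at a site looks at the \<open>N + k\<close> sites before it, so at
  this spacing the events are independent.\<close>

lemma prob_avoid: "P.prob {x. \<forall>m<M. \<not> CC k N x (i + int (m * (N + k)))} = (1 - kappa N) ^ M"
proof (induction M)
  case 0
  then show ?case using P.prob_space by simp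
next
  case (Suc M)
  have pr: "Measurable.pred P (\<lambda>x. \<forall>m<M. \<not> CC k N x (i + int (m * (N + k))))" by measurable
  have "P.prob {x. \<forall>m<Suc M. \<not> CC k N x (i + int (m * (N + k)))}
     = P.prob {x. (\<forall>m<M. \<not> CC k N x (i + int (m * (N + k)))) \<and> \<not> CC k N x (i + int (M * (N + k)))}"
    by (intro arg_cong[where f=P.prob]) (auto simp: less_Suc_eq)
  also have "\<dots> = P.prob {x. \<forall>m<M. \<not> CC k N x (i + int (m * (N + k)))} * P.prob {x. \<not> CC k N x (i + int (M * (N + k)))}"
  proof (rule prob_indep[where A="{..<i + int (M * (N + k)) - int k - int N}" and B="{i + int (M * (N + k)) - int k - int N..<i + int (M * (N + k))}"])
    show "dep_on {..<i + int (M * (N + k)) - int k - int N} (\<lambda>x. \<forall>m<M. \<not> CC k N x (i + int (m * (N + k))))"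
    proof (rule dep_onI)
      fix x y :: "int \<Rightarrow> sym"
      assume e: "\<And>j. j \<in> {..<i + int (M * (N + k)) - int k - int N} \<Longrightarrow> x j = y j"
      have "CC k N x (i + int (m * (N + k))) = CC k N y (i + int (m * (N + k)))" if "m < M" for m
      proof (rule dep_onD[OF dep_CC[of "i + int (m * (N + k))" N "{..<i + int (M * (N + k)) - int k - int N}"]])
        have "Suc m * (N + k) \<le> M * (N + k)" using that by (intro mult_right_mono) auto
        then have "int (Suc m * (N + k)) \<le> int (M * (N + k))" by (simp only: of_nat_le_iff)
        then show "{i + int (m * (N + k)) - int k - int N..<i + int (m * (N + k))} \<subseteq> {..<i + int (M * (N + k)) - int k - int N}"
          by auto
      qed (rule e)
      then show "(\<forall>m<M. \<not> CC k N x (i + int (m * (N + k)))) = (\<forall>m<M. \<not> CC k N y (i + int (m * (N + k))))" by blast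
    qed
    show "{x. \<forall>m<M. \<not> CC k N x (i + int (m * (N + k)))} \<in> sets P" by (rule sets_pred[OF pr])
    show "{x. \<not> CC k N x (i + int (M * (N + k)))} \<in> sets P" by (rule sets_pred) measurable
    show "dep_on {i + int (M * (N + k)) - int k - int N..<i + int (M * (N + k))} (\<lambda>x. \<not> CC k N x (i + int (M * (N + k))))"
      using dep_CC[of "i + int (M * (N + k))" N, OF subset_refl] by (auto simp: dep_on_def)
  qed auto
  also have "P.prob {x. \<not> CC k N x (i + int (M * (N + k)))} = 1 - kappa N"
    using P.prob_compl[OF sets_CC[of N "i + int (M * (N + k))"]] by (simp add: prob_CC set_diff_eq)
  finally show ?case using Suc by simp
qed

lemma AE_hits: "AE x in P. (\<exists>j\<le>i. CC k N x j) \<and> (\<exists>j>i. CC k N x j)"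
proof -
  have lim: "(\<lambda>M. (1 - kappa N) ^ M) \<longlonglongrightarrow> 0"
    using kappa_pos[of N] kappa_le1[of N] by (intro LIMSEQ_realpow_zero) auto
  have zero: "r = 0" if "0 \<le> r" "\<And>M. r \<le> (1 - kappa N) ^ M" for r
    using LIMSEQ_le_const[OF lim] that by (metis antisym)
  have "P.prob {x. \<forall>j>i. \<not> CC k N x j} = 0"
  proof (rule zero)
    fix M
    have "P.prob {x. \<forall>j>i. \<not> CC k N x j} \<le> P.prob {x. \<forall>m<M. \<not> CC k N x (i + 1 + int (m * (N + k)))}"
    proof (rule P.finite_measure_mono)
      have "i < i + 1 + int m" for m by simp
      then show "{x. \<forall>j>i. \<not> CC k N x j} \<subseteq> {x. \<forall>m<M. \<not> CC k N x (i + 1 + int (m * (N + k)))}" by blast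
    qed (rule sets_pred, measurable)
    then show "P.prob {x. \<forall>j>i. \<not> CC k N x j} \<le> (1 - kappa N) ^ M" by (simp only: prob_avoid)
  qed simp
  then have 1: "AE x in P. \<exists>j>i. CC k N x j"
    by (subst (asm) AE_not) auto
  have "P.prob {x. \<forall>j\<le>i. \<not> CC k N x j} = 0"
  proof (rule zero)
    fix M
    have "P.prob {x. \<forall>j\<le>i. \<not> CC k N x j} \<le> P.prob {x. \<forall>m<M. \<not> CC k N x (i - int (M * (N + k)) + int (m * (N + k)))}"
    proof (rule P.finite_measure_mono)
      have "i - int (M * (N + k)) + int (m * (N + k)) \<le> i" if "m < M" for m
      proof -
        have "m * (N + k) \<le> M * (N + k)" using that by (intro mult_right_mono) auto
        then have "int (m * (N + k)) \<le> int (M * (N + k))" by (simp only: of_nat_le_iff)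
        then show ?thesis by simp
      qed
      then show "{x. \<forall>j\<le>i. \<not> CC k N x j} \<subseteq> {x. \<forall>m<M. \<not> CC k N x (i - int (M * (N + k)) + int (m * (N + k)))}"
        by blast
    qed (rule sets_pred, measurable)
    then show "P.prob {x. \<forall>j\<le>i. \<not> CC k N x j} \<le> (1 - kappa N) ^ M" by (simp only: prob_avoid)
  qed simp
  then have 2: "AE x in P. \<exists>j\<le>i. CC k N x j"
    by (subst (asm) AE_not) auto
  from 1 2 show ?thesis by eventually_elim auto
qed

definition nice :: "(int \<Rightarrow> sym) \<Rightarrow> bool" where
  "nice x \<longleftrightarrow> (\<forall>N i. (\<exists>j\<le>i. CC k N x j) \<and> (\<exists>j>i. CC k N x j)) \<and> (\<forall>n i. lev n (x i) \<in> set_pmf (sp n))"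

lemma pred_nice [measurable]: "Measurable.pred P nice"
  unfolding nice_def[abs_def] by measurable

lemma AE_nice: "AE x in P. nice x"
proof -
  have "AE x in P. lev n (x i) \<in> set_pmf (sp n)" for n i
  proof -
    have "P.prob {x. lev n (x i) \<in> - set_pmf (sp n)} = measure_pmf.prob (sp n) (- set_pmf (sp n))"
    proof -
      have "lev n -` (- set_pmf (sp n)) \<inter> space \<mu> \<in> sets \<mu>" using lev_mu by (rule measurable_sets) simp
      then have "{c. lev n c \<in> - set_pmf (sp n)} \<in> sets \<mu>" by (simp add: vimage_def space_UNIV)
      from prob_coord[OF this, of i] show ?thesis by (simp add: prob_sp)
    qed
    also have "\<dots> = 0" by (simp add: measure_pmf_zero_iff)
    finally show ?thesis by (subst (asm) AE_not) auto
  qed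
  then show ?thesis unfolding nice_def using AE_hits by (simp add: AE_all_countable)
qed

lemma nice_sh [simp]: "nice (sh a x) \<longleftrightarrow> nice x"
proof -
  have "nice (sh a x)" if x: "nice x" for a x
    unfolding nice_def
  proof (intro conjI allI)
    fix N i
    obtain j where "j \<le> i + a" "CC k N x j" using x unfolding nice_def by blast
    then show "\<exists>j\<le>i. CC k N (sh a x) j" by (intro exI[of _ "j - a"]) (simp add: CC_sh)
    obtain j where "j > i + a" "CC k N x j" using x unfolding nice_def by blast
    then show "\<exists>j>i. CC k N (sh a x) j" by (intro exI[of _ "j - a"]) (simp add: CC_sh)
  next
    fix n i show "lev n (sh a x i) \<in> set_pmf (sp n)" using x by (simp add: nice_def)
  qed
  from this[of x a] this[of "sh a x" "- a"] show ?thesis by auto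
qed

lemma nice_isblk: "nice x \<Longrightarrow> 2 \<le> n \<Longrightarrow> isblk k N n x (fst (bd k N n x)) (snd (bd k N n x))"
proof -
  assume "nice x" "2 \<le> n"
  then obtain j F where b: "isblk k N n x j F"
    using isblk_exists[of n k N x] k1 by (auto simp: nice_def)
  moreover from this have "F \<noteq> []" by (auto simp: isblk_def)
  ultimately show ?thesis using bd_iff[of n k F N x j] k1 \<open>2 \<le> n\<close> by simp
qed

lemma pred_isblk [measurable]: "Measurable.pred P (\<lambda>x. isblk k N n x j F)"
  unfolding isblk_def by measurable

lemma bd_meas: assumes "2 \<le> n" shows "bd k N n \<in> measurable P (count_space UNIV)"
proof (subst measurable_count_space_eq2_countable)
  have "bd k N n -` {(j, F)} \<inter> space P \<in> sets P" for j F
  proof (cases "F = []")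
    case False
    then have "bd k N n -` {(j, F)} \<inter> space P = {x. isblk k N n x j F}"
      using bd_iff[OF assms k1 False] by auto
    then show ?thesis using sets_pred[OF pred_isblk] by simp
  next
    case True
    have "bd k N n x = (j, F) \<longleftrightarrow> j = 0 \<and> \<not> (\<exists>j F. isblk k N n x j F)" for x
    proof
      assume b: "bd k N n x = (j, F)"
      show "j = 0 \<and> \<not> (\<exists>j F. isblk k N n x j F)"
      proof (cases "\<exists>j F. isblk k N n x j F")
        case True
        then obtain j' F' where "isblk k N n x j' F'" by blast
        moreover from this have "F' \<noteq> []" by (auto simp: isblk_def)
        ultimately have "bd k N n x = (j', F')" "F' \<noteq> []" using bd_iff[OF assms k1] by auto
        then show ?thesis using b \<open>F = []\<close> by simp
      qed (use b in \<open>auto simp: bd_def split: if_splits\<close>)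
    qed (use True in \<open>auto simp: bd_def\<close>)
    then have "bd k N n -` {(j, F)} \<inter> space P = {x. j = 0 \<and> \<not> (\<exists>j F. isblk k N n x j F)}" by auto
    also have "\<dots> \<in> sets P" by (rule sets_pred) measurable
    finally show ?thesis .
  qed
  then show "bd k N n \<in> space P \<rightarrow> UNIV \<and> (\<forall>a\<in>UNIV. bd k N n -` {a} \<inter> space P \<in> sets P)" by auto
qed

definition BD :: "nat \<Rightarrow> nat \<Rightarrow> (nat \<times> bool list list list) pmf" where
  "BD N n = rvpmf P (bd k N n)"

lemma prob_BD: "2 \<le> n \<Longrightarrow> measure_pmf.prob (BD N n) A = P.prob {x. bd k N n x \<in> A}"
  unfolding BD_def by (subst prob_rvpmf) (auto simp: P.prob_space_axioms bd_meas)

lemma set_BD: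
  assumes "2 \<le> n" "(j, F) \<in> set_pmf (BD N n)"
  shows "\<exists>x. nice x \<and> isblk k N n x j F"
proof (rule ccontr)
  assume no: "\<not> ?thesis"
  have "AE x in P. bd k N n x \<noteq> (j, F)"
    using AE_nice
  proof eventually_elim
    case (elim x)
    with nice_isblk[OF elim assms(1), of N] no show ?case by auto
  qed
  then have "P.prob {x. bd k N n x \<in> {(j, F)}} = 0"
  proof (subst AE_not)
    show "Measurable.pred P (\<lambda>x. bd k N n x \<in> {(j, F)})"
      using bd_meas[OF assms(1)] by measurable
  qed simp
  then have "measure_pmf.prob (BD N n) {(j, F)} = 0" using prob_BD[OF assms(1)] by metis
  then show False using assms(2) by (simp add: measure_pmf_single set_pmf_iff)
qed

text \<open>The value does not depend on the offset \<open>j\<close>: a block starts at a given site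
  with probability \<open>kappa N\<close>, and its letters come afterwards. Summed over
  \<open>j\<close> this is the size bias of the block that contains a given site.\<close>

lemma pmf_BD:
  assumes "2 \<le> n" "bvs N (map length F)" "\<forall>W\<in>set F. gapw k W" "j < bsize F"
  shows "pmf (BD N n) (j, F) = kappa N * pmf (wp n (bsize F)) (concat F)"
proof -
  have "F \<noteq> []" using assms by (auto simp: bvs_def)
  have "pmf (BD N n) (j, F) = P.prob {x. bd k N n x \<in> {(j, F)}}"
    unfolding prob_BD[OF assms(1), symmetric] by (simp add: measure_pmf_single)
  also have "\<dots> = P.prob {x. CC k N x (- int j) \<and> wrd n x (- int j) (bsize F) = concat F}"
    using bd_iff[OF assms(1) k1 \<open>F \<noteq> []\<close>] assms by (simp add: isblk_def)
  also have "\<dots> = kappa N * pmf (wp n (bsize F)) (concat F)"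
    using prob_CC_wrd[of N "- int j" "\<lambda>v. v = concat F" n "bsize F"] by (simp add: measure_pmf_single)
  finally show ?thesis .
qed

end

section \<open>Skeleton and conditionally independent fillers\<close>

context bernd
begin

definition FW :: "nat \<Rightarrow> nat list \<Rightarrow> bool list list list pmf" where
  "FW n S = lprod (map (G n) S)"

definition okS :: "nat list \<Rightarrow> bool" where "okS S \<longleftrightarrow> (\<forall>L\<in>set S. 0 < u L)"

lemma set_FW:
  assumes "2 \<le> n" "okS S"
  shows "F \<in> set_pmf (FW n S) \<longleftrightarrow> map length F = S \<and> (\<forall>W\<in>set F. gapw k W \<and> set W \<subseteq> set_pmf (sp n))"
proof -
  have "F \<in> set_pmf (FW n S) \<longleftrightarrow> length F = length S \<and> (\<forall>i<length S. F ! i \<in> set_pmf (G n (S ! i)))"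
    unfolding FW_def by (auto simp: set_lprod list_all2_conv_all_nth)
  also have "\<dots> \<longleftrightarrow> length F = length S \<and> (\<forall>i<length S. length (F ! i) = S ! i \<and> gapw k (F ! i) \<and> set (F ! i) \<subseteq> set_pmf (sp n))"
    using assms by (auto simp: okS_def set_G set_wp)
  also have "\<dots> \<longleftrightarrow> map length F = S \<and> (\<forall>W\<in>set F. gapw k W \<and> set W \<subseteq> set_pmf (sp n))"
    by (auto simp: list_eq_iff_nth_eq all_set_conv_all_nth)
  finally show ?thesis .
qed

lemma finite_FW: "2 \<le> n \<Longrightarrow> okS S \<Longrightarrow> finite (set_pmf (FW n S))"
  unfolding FW_def by (rule finite_set_lprod) (auto simp: okS_def finite_G)

lemma FW_coarse: "2 \<le> m \<Longrightarrow> m \<le> n \<Longrightarrow> okS S \<Longrightarrow> map_pmf (map (map (take m))) (FW n S) = FW m S"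
  unfolding FW_def map_lprod by (auto simp: okS_def G_coarse intro!: arg_cong[where f=lprod])

lemma FW_concat: "FW n (concat Ss) = map_pmf concat (lprod (map (FW n) Ss))"
  unfolding FW_def map_concat lprod_concat by (simp add: o_def FW_def[abs_def])

lemma pmf_wp_append: "pmf (wp n (length v + M)) (v @ v') = pmf (wp n (length v)) v * pmf (wp n M) v'"
  unfolding wp_def by (induction v) (simp_all add: pmf_lprod_Cons del: lprod.simps(2))

lemma pmf_wp_concat:
  assumes "2 \<le> n" "okS (map length F)" "\<forall>W\<in>set F. gapw k W"
  shows "pmf (wp n (bsize F)) (concat F) = prod_list (map u (map length F)) * pmf (FW n (map length F)) F"
  using assms(2-)
proof (induction F)
  case Nil
  then show ?case by (simp add: wp_def FW_def)
next
  case (Cons W F)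
  have uW: "0 < u (length W)" using Cons.prems by (simp add: okS_def)
  have "pmf (wp n (bsize (W # F))) (concat (W # F)) = pmf (wp n (length W)) W * pmf (wp n (bsize F)) (concat F)"
    by (simp add: pmf_wp_append)
  also have "pmf (wp n (length W)) W = u (length W) * pmf (G n (length W)) W"
    using Cons.prems uW assms(1) by (simp add: pmf_G)
  also have "pmf (FW n (map length (W # F))) (W # F) = pmf (G n (length W)) W * pmf (FW n (map length F)) F"
    unfolding FW_def by (simp add: pmf_lprod_Cons del: lprod.simps)
  ultimately show ?case using Cons by (simp add: okS_def)
qed

lemma wp_gap_pos: "2 \<le> n \<Longrightarrow> gapw k W \<Longrightarrow> set W \<subseteq> set_pmf (sp n) \<Longrightarrow> 0 < u (length W)"
  unfolding u_eq[symmetric, of n] by (rule measure_pmf_posI[of W]) (auto simp: set_wp)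

lemma nice_blk_letters:
  assumes "nice x" "isblk k N n x j F" "W \<in> set F" shows "set W \<subseteq> set_pmf (sp n)"
proof
  fix d assume "d \<in> set W"
  then have "d \<in> set (concat F)" using assms(3) by auto
  then have "d \<in> set (wrd n x (- int j) (bsize F))" using assms(2) by (simp add: isblk_def)
  then show "d \<in> set_pmf (sp n)" using assms(1) by (auto simp: wrd_def nice_def)
qed

lemma nice_blk_FW:
  assumes "nice x" "isblk k N n x j F" "2 \<le> n"
  shows "okS (map length F)" "F \<in> set_pmf (FW n (map length F))"
proof -
  have g: "\<forall>W\<in>set F. gapw k W" using assms(2) by (simp add: isblk_def)
  then show ok: "okS (map length F)"
    using nice_blk_letters[OF assms(1,2)] wp_gap_pos[OF assms(3)] by (auto simp: okS_def)
  show "F \<in> set_pmf (FW n (map length F))"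
    unfolding set_FW[OF assms(3) ok] using g nice_blk_letters[OF assms(1,2)] by auto
qed

text \<open>The skeleton: offset and gap lengths of the block at site 0. Level 2 already shows it,
  and by \<open>pmf_shape_BD\<close> every higher level gives the same law, expressed through
  \<open>kappa\<close> and \<open>u\<close>.\<close>

definition KP :: "nat \<Rightarrow> (nat \<times> nat list) pmf" where
  "KP N = map_pmf (\<lambda>(j, F). (j, map length F)) (BD N 2)"

lemma pmf_shape_BD:
  assumes "2 \<le> n"
  shows "pmf (map_pmf (\<lambda>(j, F). (j, map length F)) (BD N n)) (j, S)
    = (if bvs N S \<and> j < sum_list S then kappa N * prod_list (map u S) else 0)"
proof -
  let ?A = "(\<lambda>(j, F). (j, map length F)) -` {(j, S)}"
  have supp: "bvs N S \<and> j < sum_list S \<and> okS S \<and> F \<in> set_pmf (FW n S)"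
    if "(j', F) \<in> set_pmf (BD N n)" "(j', F) \<in> ?A" for j' F
  proof -
    note h = that
    obtain x where x: "nice x" "isblk k N n x j' F" using set_BD[OF assms h(1)] by blast
    then show ?thesis using h(2) nice_blk_FW[OF x assms] by (auto simp: isblk_def length_concat_map)
  qed
  show ?thesis
  proof (cases "bvs N S \<and> j < sum_list S \<and> okS S")
    case True
    have "measure_pmf.prob (BD N n) ?A = measure_pmf.prob (BD N n) ({j} \<times> set_pmf (FW n S))"
    proof (rule measure_pmf.finite_measure_eq_AE)
      show "AE x in BD N n. (x \<in> ?A) = (x \<in> {j} \<times> set_pmf (FW n S))"
        unfolding AE_measure_pmf_iff using supp set_FW[OF assms, of S] True by fastforce
    qed auto
    also have "\<dots> = (\<Sum>z\<in>{j} \<times> set_pmf (FW n S). pmf (BD N n) z)"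
      using finite_FW[OF assms] True by (intro measure_measure_pmf_finite) auto
    also have "\<dots> = (\<Sum>F\<in>set_pmf (FW n S). pmf (BD N n) (j, F))" by (simp add: sum_Times)
    also have "\<dots> = (\<Sum>F\<in>set_pmf (FW n S). kappa N * prod_list (map u S) * pmf (FW n S) F)"
    proof (rule sum.cong[OF refl])
      fix F assume "F \<in> set_pmf (FW n S)"
      then have F: "map length F = S" "\<forall>W\<in>set F. gapw k W" using set_FW[OF assms, of S] True by auto
      then have "j < bsize F" using True by (simp add: length_concat_map)
      then show "pmf (BD N n) (j, F) = kappa N * prod_list (map u S) * pmf (FW n S) F"
        using pmf_BD[OF assms, of N F j] pmf_wp_concat[OF assms, of F] True F by simp
    qed
    also have "\<dots> = kappa N * prod_list (map u S) * (\<Sum>F\<in>set_pmf (FW n S). pmf (FW n S) F)"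
      by (simp add: sum_distrib_left)
    also have "(\<Sum>F\<in>set_pmf (FW n S). pmf (FW n S) F) = 1"
      using finite_FW[OF assms] True by (intro sum_pmf_eq_1) auto
    finally show ?thesis using True by (simp add: pmf_map)
  next
    case False
    have "set_pmf (BD N n) \<inter> ?A = {}" using supp False by fast
    then have "measure_pmf.prob (BD N n) ?A = 0" by (simp add: measure_pmf_zero_iff)
    \<comment> \<open>A shape with a gap length of probability zero makes both sides vanish.\<close>
    moreover have "prod_list (map u S) = 0" if "\<not> okS S"
    proof -
      have "0 \<in> set (map u S)" using that u_nonneg by (force simp: okS_def not_less intro: antisym)
      then show ?thesis by (simp add: prod_list_zero_iff)
    qed
    ultimately show ?thesis using False by (auto simp: pmf_map)
  qed
qed

lemma KP_eq: "2 \<le> n \<Longrightarrow> map_pmf (\<lambda>(j, F). (j, map length F)) (BD N n) = KP N"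
  unfolding KP_def by (rule pmf_eqI) (auto simp: pmf_shape_BD)

lemma pmf_KP: "pmf (KP N) (j, S) = (if bvs N S \<and> j < sum_list S then kappa N * prod_list (map u S) else 0)"
  unfolding KP_def by (simp add: pmf_shape_BD)

lemma set_KP: assumes "(j, S) \<in> set_pmf (KP N)" shows "bvs N S" "j < sum_list S" "okS S"
proof -
  have ne: "pmf (KP N) (j, S) \<noteq> 0" using assms by (simp add: set_pmf_iff)
  then show "bvs N S" "j < sum_list S" by (auto simp: pmf_KP split: if_splits)
  have "0 \<notin> set (map u S)" using ne by (auto simp: pmf_KP prod_list_zero_iff split: if_splits)
  then show "okS S" using u_nonneg by (force simp: okS_def less_le)
qed

text \<open>The probability of a block factors into that of its gap lengths and the conditional
  probabilities of the gap words. So the skeleton can be drawn first, and then each filler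
  independently of the others.\<close>

lemma BD_bind:
  assumes "2 \<le> n" shows "BD N n = bind_pmf (KP N) (\<lambda>(j, S). map_pmf (Pair j) (FW n S))"
proof (rule pmf_eqI)
  fix z :: "nat \<times> bool list list list"
  obtain j F where z: "z = (j, F)" by fastforce
  let ?S = "map length F"
  have val: "pmf (map_pmf (Pair j') (FW n S')) (j, F) = (if (j', S') = (j, ?S) then pmf (FW n S') F else 0)"
    if "(j', S') \<in> set_pmf (KP N)" for j' S'
  proof -
    have ok: "okS S'" using set_KP[OF that] by simp
    have "pmf (map_pmf (Pair j') (FW n S')) (j', F) = pmf (FW n S') F"
      by (rule pmf_map_inj') (simp add: inj_def)
    moreover have "pmf (map_pmf (Pair j') (FW n S')) (j, F) = 0" if "j' \<noteq> j"
      using that by (auto simp: pmf_eq_0_set_pmf)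
    moreover have "pmf (FW n S') F = 0" if "S' \<noteq> ?S"
      using that set_FW[OF assms ok, of F] by (auto simp: pmf_eq_0_set_pmf)
    ultimately show ?thesis by (cases "j' = j"; cases "S' = ?S") auto
  qed
  have "pmf (bind_pmf (KP N) (\<lambda>(j, S). map_pmf (Pair j) (FW n S))) z
     = (LINT a|measure_pmf (KP N). (if a = (j, ?S) then pmf (FW n ?S) F else 0))"
    unfolding pmf_bind z using val
    by (intro integral_cong_AE) (auto simp: AE_measure_pmf_iff split: if_splits)
  also have "\<dots> = pmf (KP N) (j, ?S) * pmf (FW n ?S) F"
    by (subst integral_measure_pmf[of "{(j, ?S)}"]) (auto split: if_splits)
  also have "\<dots> = pmf (BD N n) z"
  proof (cases "(j, ?S) \<in> set_pmf (KP N) \<and> (\<forall>W\<in>set F. gapw k W)")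
    case True
    then show ?thesis using set_KP[of j ?S N] pmf_BD[OF assms, of N F j] pmf_wp_concat[OF assms, of F]
      by (simp add: z pmf_KP length_concat_map)
  next
    case False
    have "(j, F) \<notin> set_pmf (BD N n)"
    proof
      assume a: "(j, F) \<in> set_pmf (BD N n)"
      then have "(j, ?S) \<in> set_pmf (KP N)" unfolding KP_eq[OF assms, symmetric] by force
      moreover have "\<forall>W\<in>set F. gapw k W" using set_BD[OF assms a] by (auto simp: isblk_def)
      ultimately show False using False by simp
    qed
    moreover have "pmf (FW n ?S) F = 0" if "(j, ?S) \<in> set_pmf (KP N)"
      using False that set_FW[OF assms, of ?S F] set_KP[OF that] by (auto simp: pmf_eq_0_set_pmf)
    ultimately show ?thesis unfolding z by (metis pmf_eq_0_set_pmf mult_zero_left mult_zero_right)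
  qed
  finally show "pmf (BD N n) z = pmf (bind_pmf (KP N) (\<lambda>(j, S). map_pmf (Pair j) (FW n S))) z" by simp
qed

end

text \<open>\<open>kappa\<close> and \<open>u\<close> are functions of \<open>k\<close> and
  \<open>p\<close>; two processes with a common marker can therefore be coupled with identical
  skeletons.\<close>

lemma (in bernd) KP_unique:
  assumes "bernd \<nu> k" "bern.p \<nu> k = p" shows "bernd.KP \<nu> k N = KP N"
proof (rule pmf_eqI)
  interpret N: bernd \<nu> k by fact
  have uu: "N.u = u" using u_unique[OF N.bern_axioms assms(2)] by auto
  have "N.kappa N = kappa N" by (simp add: kappa_formula N.kappa_formula uu assms(2))
  then show "pmf (N.KP N) i = pmf (KP N) i" for i by (cases i) (simp add: pmf_KP N.pmf_KP uu)
qed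

subsection \<open>Labels\<close>

text \<open>What level \<open>n\<close> discloses of a gap: \<open>n\<close> digits of each letter
  if the gap has length at most \<open>n\<close>, otherwise its length alone. The double truncation
  bounds the information of a gap in terms of \<open>n\<close>, whatever the entropy of the
  alphabet.\<close>

definition rev1 :: "nat \<Rightarrow> bool list list \<Rightarrow> bool list list" where
  "rev1 n W = map (take (if length W \<le> n then n else 0)) W"

definition rv :: "nat \<Rightarrow> bool list list list \<Rightarrow> bool list list list" where
  "rv n F = map (rev1 n) F"

lemma length_rev1 [simp]: "length (rev1 n W) = length W" by (simp add: rev1_def)

lemma map_length_rv [simp]: "map length (rv n F) = map length F" by (simp add: rv_def)

lemma rv_rv: "m \<le> n \<Longrightarrow> rv m (rv n F) = rv m F"
  by (auto simp: rv_def rev1_def min_def)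

lemma rv_coarse: "m \<le> n \<Longrightarrow> rv m (map (map (take n)) F) = rv m F"
  by (auto simp: rv_def rev1_def min_def)

lemma rv_shape: "rv n F = rv n F' \<Longrightarrow> map length F = map length F'"
  by (metis map_length_rv)

lemma bsize_shape: "map length F = map length F' \<Longrightarrow> bsize F = bsize F'"
  by (simp add: length_concat_map)

text \<open>A node stands for a block, its children for the blocks of the previous stage inside it.
  The option holds the disclosed filler of a typical block; otherwise only the labels of the
  children are known. The type is countable, so that laws of labels are discrete.\<close>

datatype lab = Lf nat | Nd "bool list list list option" "lab list"

instance lab :: countable by countable_datatype

fun pts :: "lab \<Rightarrow> lab list" where "pts (Nd _ ps) = ps" | "pts (Lf _) = []"

text \<open>The digits that a label discloses at each site of its block; a leaf discloses none, and
  a filler overrides what the children show.\<close>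

fun flat :: "lab \<Rightarrow> bool list list" where
  "flat (Lf n) = replicate n []"
| "flat (Nd (Some F) ps) = concat F"
| "flat (Nd None ps) = concat (map flat ps)"

definition lgrp :: "nat \<Rightarrow> bool list list list \<Rightarrow> bool list list list list" where
  "lgrp N F = grp (\<lambda>W. N < length W) F"

definition sgrp :: "nat \<Rightarrow> nat list \<Rightarrow> nat list list" where
  "sgrp N S = grp (\<lambda>L. N < L) S"

lemma concat_lgrp [simp]: "concat (lgrp N F) = F" by (simp add: lgrp_def concat_grp)
lemma concat_sgrp [simp]: "concat (sgrp N S) = S" by (simp add: sgrp_def concat_grp)

lemma sgrp_map: "sgrp N (map length F) = map (map length) (lgrp N F)"
  by (simp add: sgrp_def lgrp_def grp_map)

lemma lgrp_rv: "lgrp N (rv n F) = map (rv n) (lgrp N F)"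
  unfolding lgrp_def rv_def by (subst grp_map) simp

lemma lgrp_concat:
  assumes "map (map length) Fs = sgrp N (map length (concat Fs))"
  shows "lgrp N (concat Fs) = Fs"
proof -
  have eq: "map (map length) (lgrp N (concat Fs)) = map (map length) Fs"
    using assms by (simp add: sgrp_map)
  have "length (lgrp N (concat Fs)) = length Fs" using eq by (metis length_map)
  moreover have "length x = length y" if "(x, y) \<in> set (zip (lgrp N (concat Fs)) Fs)" for x y
  proof -
    note h = that
    obtain i where i: "i < length Fs" "i < length (lgrp N (concat Fs))" "x = lgrp N (concat Fs) ! i" "y = Fs ! i"
      using h by (auto simp: in_set_zip)
    then have "map length x = map length y" using eq by (metis nth_map)
    then show ?thesis by (metis length_map)
  qed
  ultimately show ?thesis
    using concat_eq_concat_iff[of "lgrp N (concat Fs)" Fs] by auto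
qed

text \<open>Stage \<open>r\<close> has digit level \<open>lv r\<close> and block threshold
  \<open>N r\<close>. In the step to \<open>Suc r\<close>, \<open>fl r\<close> says whether this
  side is refined, \<open>T r\<close> is the least length of a typical block and \<open>c r\<close>
  bounds its information per site from above.\<close>

locale side = bernd +
  fixes lv N T :: "nat \<Rightarrow> nat" and c :: "nat \<Rightarrow> real" and fl :: "nat \<Rightarrow> bool"
  assumes lv2: "2 \<le> lv r" and lvS: "lv r < lv (Suc r)" and N0: "N 0 = 0" and NS: "N r < N (Suc r)"
begin

definition inf1 :: "nat \<Rightarrow> bool list list \<Rightarrow> real" where
  "inf1 n W = (if length W \<le> n then - ln (pmf (G n (length W)) (map (take n) W)) else 0)"

definition infS :: "nat \<Rightarrow> bool list list list \<Rightarrow> real" where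
  "infS n F = sum_list (map (inf1 n) F)"

lemma inf1_rev1: "inf1 n (rev1 n W) = inf1 n W"
  by (simp add: inf1_def rev1_def o_def)

lemma infS_rv: "infS n (rv n F) = infS n F"
  by (simp add: infS_def rv_def o_def inf1_rev1)

text \<open>The bound is one-sided: given the shape, the disclosed filler has probability at least
  \<open>exp (- (c r * bsize F))\<close>. This limits the number of typical fillers.\<close>

definition typl :: "nat \<Rightarrow> bool list list list \<Rightarrow> bool" where
  "typl r F \<longleftrightarrow> fl r \<and> T r \<le> bsize F \<and> infS (lv (Suc r)) F \<le> c r * real (bsize F)"

lemma typl_rv: "rv (lv (Suc r)) F = rv (lv (Suc r)) F' \<Longrightarrow> typl r F = typl r F'"
proof -
  assume e: "rv (lv (Suc r)) F = rv (lv (Suc r)) F'"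
  have "infS (lv (Suc r)) F = infS (lv (Suc r)) F'" using infS_rv[of "lv (Suc r)"] e by metis
  moreover have "bsize F = bsize F'" using rv_shape[OF e] by (rule bsize_shape)
  ultimately show ?thesis by (simp add: typl_def)
qed

primrec lb :: "nat \<Rightarrow> bool list list list \<Rightarrow> lab" where
  "lb 0 F = Lf (bsize F)"
| "lb (Suc r) F = Nd (if typl r F then Some (rv (lv (Suc r)) F) else None) (map (lb r) (lgrp (N r) F))"

lemma lb_rv: "rv (lv r) F = rv (lv r) F' \<Longrightarrow> lb r F = lb r F'"
proof (induction r arbitrary: F F')
  case 0
  from bsize_shape[OF rv_shape[OF 0]] show ?case by simp
next
  case (Suc r)
  have "rv (lv r) (rv (lv (Suc r)) F) = rv (lv r) (rv (lv (Suc r)) F')" using Suc.prems by simp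
  then have "rv (lv r) F = rv (lv r) F'" using lvS[of r] by (simp add: rv_rv)
  then have "map (rv (lv r)) (lgrp (N r) F) = map (rv (lv r)) (lgrp (N r) F')"
    by (simp flip: lgrp_rv)
  then have "list_all2 (\<lambda>F F'. rv (lv r) F = rv (lv r) F') (lgrp (N r) F) (lgrp (N r) F')"
    by (simp add: list_all2_conv_all_nth list_eq_iff_nth_eq)
  then have "list_all2 (\<lambda>F F'. lb r F = lb r F') (lgrp (N r) F) (lgrp (N r) F')"
    by (rule list_all2_mono) (rule Suc.IH)
  then have "map (lb r) (lgrp (N r) F) = map (lb r) (lgrp (N r) F')"
    by (simp add: list_all2_conv_all_nth list_eq_iff_nth_eq)
  then show ?case unfolding lb.simps typl_rv[OF Suc.prems] Suc.prems by simp
qed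

lemma lb_coarse: "lv r \<le> n \<Longrightarrow> lb r (map (map (take n)) F) = lb r F"
  by (rule lb_rv) (simp add: rv_coarse)

lemma length_flat_lb: "length (flat (lb r F)) = bsize F"
proof (induction r arbitrary: F)
  case (Suc r)
  have "length (concat (map (\<lambda>F. flat (lb r F)) Fs)) = bsize (concat Fs)" for Fs
    by (induction Fs) (auto simp: Suc)
  from this[of "lgrp (N r) F"] have "length (concat (map (\<lambda>F. flat (lb r F)) (lgrp (N r) F))) = bsize F" by simp
  moreover have "bsize (rv (lv (Suc r)) F) = bsize F" by (rule bsize_shape) simp
  ultimately show ?case by (simp add: o_def)
qed simp

lemma prefix_take: "m \<le> n \<Longrightarrow> prefix (take m d) (take n d)"
  by (metis min.absorb1 take_is_prefix take_take)

lemma prefix_rv: "m \<le> n \<Longrightarrow> list_all2 prefix (concat (rv m F)) (concat (rv n F))"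
proof (induction F)
  case (Cons W F)
  have "list_all2 prefix (rev1 m W) (rev1 n W)"
    using Cons.prems by (auto simp: rev1_def list_all2_conv_all_nth intro: prefix_take)
  then show ?case using Cons by (auto simp: rv_def intro: list_all2_appendI)
qed (simp add: rv_def)

text \<open>An atypical node falls back on its children, whose level is lower. A site may thus show
  fewer than \<open>lv r\<close> digits, but never a wrong one.\<close>

lemma prefix_flat: "list_all2 prefix (flat (lb r F)) (concat (rv (lv r) F))"
proof (induction r arbitrary: F)
  case 0
  have "list_all2 prefix (replicate (length v) []) v" for v :: "bool list list"
    by (simp add: list_all2_conv_all_nth)
  from this[of "concat (rv (lv 0) F)"] show ?case
    using length_concat_map[of "rv (lv 0) F"] length_concat_map[of F] by simp
next
  case (Suc r)
  show ?case
  proof (cases "typl r F")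
    case True
    then show ?thesis by (simp add: list.rel_refl)
  next
    case False
    have "list_all2 prefix (concat (map (\<lambda>F. flat (lb r F)) Fs)) (concat (rv (lv r) (concat Fs)))" for Fs
      using Suc by (induction Fs) (auto simp: rv_def intro: list_all2_appendI)
    from this[of "lgrp (N r) F"] have "list_all2 prefix (flat (lb (Suc r) F)) (concat (rv (lv r) F))"
      using False by (simp add: o_def)
    from list_all2_trans[OF _ this prefix_rv[of "lv r" "lv (Suc r)" F]] show ?thesis
      using lvS[of r] by (auto intro: prefix_order.trans)
  qed
qed

definition LL :: "nat \<Rightarrow> nat list \<Rightarrow> lab pmf" where
  "LL r S = map_pmf (lb r) (FW (lv r) S)"

lemma LL_level: "lv r \<le> n \<Longrightarrow> okS S \<Longrightarrow> map_pmf (lb r) (FW n S) = LL r S"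
  unfolding LL_def FW_coarse[OF lv2, of r n S, symmetric] by (simp add: pmf.map_comp o_def lb_coarse)

lemma set_LL: "\<alpha> \<in> set_pmf (LL r S) \<longleftrightarrow> (\<exists>F\<in>set_pmf (FW (lv r) S). \<alpha> = lb r F)"
  by (auto simp: LL_def)

lemma finite_LL: "okS S \<Longrightarrow> finite (set_pmf (LL r S))"
  by (simp add: LL_def finite_FW lv2)

lemma okS_sgrp: "okS S \<Longrightarrow> S' \<in> set (sgrp M S) \<Longrightarrow> okS S'"
  using concat_sgrp[of M S] unfolding okS_def by (metis (no_types, lifting) UN_I set_concat)

text \<open>Grouping the gaps into blocks of the previous stage turns one product law into a product
  of product laws. For this reason couplings of the smaller blocks can be multiplied to couple the
  larger one.\<close>

lemma pts_LL:
  assumes "okS S"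
  shows "map_pmf pts (LL (Suc r) S) = lprod (map (LL r) (sgrp (N r) S))"
proof -
  let ?n = "lv (Suc r)"
  have n2: "2 \<le> ?n" by (rule lv2)
  have "map_pmf pts (LL (Suc r) S) = map_pmf (\<lambda>F. map (lb r) (lgrp (N r) F)) (FW ?n S)"
    unfolding LL_def pmf.map_comp by (simp add: o_def)
  also have "FW ?n S = map_pmf concat (lprod (map (FW ?n) (sgrp (N r) S)))"
    using FW_concat[of ?n "sgrp (N r) S"] by simp
  also have "map_pmf (\<lambda>F. map (lb r) (lgrp (N r) F)) (map_pmf concat (lprod (map (FW ?n) (sgrp (N r) S))))
    = map_pmf (map (lb r)) (lprod (map (FW ?n) (sgrp (N r) S)))"
    unfolding pmf.map_comp
  proof (rule map_pmf_cong[OF refl])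
    fix Fs assume "Fs \<in> set_pmf (lprod (map (FW ?n) (sgrp (N r) S)))"
    then have "list_all2 (\<lambda>F S. F \<in> set_pmf (FW ?n S)) Fs (sgrp (N r) S)"
      by (simp add: set_lprod list_all2_map2)
    then have "list_all2 (\<lambda>F S. map length F = S) Fs (sgrp (N r) S)"
      using set_FW[OF n2] okS_sgrp[OF assms] by (auto elim!: list.rel_mono_strong)
    then have sh: "map (map length) Fs = sgrp (N r) S" by (auto simp: list_all2_conv_all_nth intro: nth_equalityI)
    moreover from this have "map length (concat Fs) = S" by (simp add: map_concat)
    ultimately have "lgrp (N r) (concat Fs) = Fs" by (intro lgrp_concat) simp
    then show "((\<lambda>F. map (lb r) (lgrp (N r) F)) \<circ> concat) Fs = map (lb r) Fs" by simp
  qed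
  also have "\<dots> = lprod (map (LL r) (sgrp (N r) S))"
    unfolding map_lprod map_map using lvS[of r] okS_sgrp[OF assms]
    by (intro arg_cong[where f=lprod]) (auto intro!: LL_level)
  finally show ?thesis .
qed

text \<open>Gaps longer than \<open>n\<close> disclose only their length, which \<open>S\<close>
  already contains, and contribute the factor 1.\<close>

lemma infS_pmf:
  assumes "2 \<le> n" "okS S" "F \<in> set_pmf (FW n S)"
  shows "pmf (map_pmf (rv n) (FW n S)) (rv n F) = exp (- infS n F)"
proof -
  have F: "list_all2 (\<lambda>W L. W \<in> set_pmf (G n L)) F S" using assms(3) by (simp add: FW_def set_lprod list_all2_map2)
  have "map_pmf (rv n) (FW n S) = lprod (map (\<lambda>L. map_pmf (rev1 n) (G n L)) S)"
    unfolding FW_def rv_def[abs_def] map_lprod by (simp add: o_def)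
  moreover have "pmf (lprod (map (\<lambda>L. map_pmf (rev1 n) (G n L)) S)) (map (rev1 n) F) = exp (- infS n F)"
    using F assms(2)
  proof (induction rule: list_all2_induct)
    case Nil
    then show ?case by (simp add: infS_def)
  next
    case (Cons W F L S)
    have uL: "0 < u L" using Cons.prems by (simp add: okS_def)
    have lenW: "length W = L" "set W \<subseteq> set_pmf (sp n)" using Cons(1) set_G[OF assms(1) uL] by (auto simp: set_wp)
    have "pmf (map_pmf (rev1 n) (G n L)) (rev1 n W) = exp (- inf1 n W)"
    proof (cases "L \<le> n")
      case True
      have id: "rev1 n V = V" if "V \<in> set_pmf (G n L)" for V
      proof -
        have "length V = L" "set V \<subseteq> {d. length d = n}"
          using that set_G[OF assms(1) uL] set_sp[of n] by (auto simp: set_wp)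
        then show ?thesis using True by (auto simp: rev1_def intro!: map_idI)
      qed
      have "map_pmf (rev1 n) (G n L) = map_pmf (\<lambda>V. V) (G n L)"
        using id by (intro map_pmf_cong) auto
      then have e: "map_pmf (rev1 n) (G n L) = G n L" by simp
      have "map (take n) W = W" using id[OF Cons(1)] True lenW by (simp add: rev1_def)
      moreover have "0 < pmf (G n L) W" using Cons(1) by (simp add: pmf_positive)
      ultimately show ?thesis using True lenW e id[OF Cons(1)] by (simp add: inf1_def)
    next
      case False
      have "map_pmf (rev1 n) (G n L) = map_pmf (\<lambda>_. rev1 n W) (G n L)"
      proof (rule map_pmf_cong[OF refl])
        fix V assume "V \<in> set_pmf (G n L)"
        then have "length V = L" using set_G[OF assms(1) uL] by (auto simp: set_wp)
        then show "rev1 n V = rev1 n W" using False lenW by (simp add: rev1_def map_replicate_const)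
      qed
      then show ?thesis using False lenW by (simp add: inf1_def map_pmf_const)
    qed
    then show ?case using Cons by (simp add: pmf_lprod_Cons okS_def infS_def exp_diff exp_minus field_simps del: lprod.simps)
  qed
  ultimately show ?thesis by (simp add: rv_def)
qed

end

section \<open>Counting labels\<close>

context side
begin

lemma card_parts:
  assumes IH: "\<And>S. okS S \<Longrightarrow> real (card (set_pmf (LL r S))) \<le> exp (d * real (sum_list S))" and ok: "okS S"
  shows "finite (set_pmf (lprod (map (LL r) (sgrp (N r) S))))"
    "real (card (set_pmf (lprod (map (LL r) (sgrp (N r) S))))) \<le> exp (d * real (sum_list S))"
proof -
  define A where "A = set_pmf (lprod (map (LL r) (sgrp (N r) S)))"
  have finA: "finite A" unfolding A_def
    using okS_sgrp[OF ok] by (intro finite_set_lprod) (auto simp: finite_LL)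
  have "real (card A) = (\<Prod>S'\<leftarrow>sgrp (N r) S. real (card (set_pmf (LL r S'))))"
  proof -
    have "real (prod_list (map f xs)) = (\<Prod>x\<leftarrow>xs. real (f x))" for f and xs :: "nat list list"
      by (induction xs) auto
    then show ?thesis unfolding A_def card_set_lprod by (simp add: o_def)
  qed
  also have "\<dots> \<le> (\<Prod>S'\<leftarrow>sgrp (N r) S. exp (d * real (sum_list S')))"
  proof -
    have "(\<Prod>S'\<leftarrow>Ss. real (card (set_pmf (LL r S')))) \<le> (\<Prod>S'\<leftarrow>Ss. exp (d * real (sum_list S')))"
      if "\<forall>S'\<in>set Ss. okS S'" for Ss
      using that IH by (induction Ss) (auto intro!: mult_mono prod_list_nonneg)
    then show ?thesis using okS_sgrp[OF ok] by blast
  qed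
  also have "\<dots> = exp (d * real (sum_list (concat (sgrp (N r) S))))"
  proof -
    have "(\<Prod>S'\<leftarrow>Ss. exp (d * real (sum_list S'))) = exp (d * real (sum_list (concat Ss)))" for Ss
      by (induction Ss) (auto simp: exp_add[symmetric] algebra_simps)
    then show ?thesis .
  qed
  finally have cardA: "real (card A) \<le> exp (d * real (sum_list S))" by simp
  show "finite (set_pmf (lprod (map (LL r) (sgrp (N r) S))))"
    "real (card (set_pmf (lprod (map (LL r) (sgrp (N r) S))))) \<le> exp (d * real (sum_list S))"
    using finA cardA by (simp_all add: A_def)
qed

text \<open>Without refinement a node carries nothing beyond its children, so the exponent stays
  that of the stage before. This is the count used on the side opposite to a refinement.\<close>

lemma card_LL_unrefined:
  assumes IH: "\<And>S. okS S \<Longrightarrow> real (card (set_pmf (LL r S))) \<le> exp (d * real (sum_list S))"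
    and ok: "okS S" and "\<not> fl r"
  shows "real (card (set_pmf (LL (Suc r) S))) \<le> exp (d * real (sum_list S))"
proof -
  have "inj_on pts (set_pmf (LL (Suc r) S))"
    using assms(3) by (auto simp: inj_on_def set_LL typl_def)
  then have "card (set_pmf (LL (Suc r) S)) = card (set_pmf (map_pmf pts (LL (Suc r) S)))"
    by (simp add: card_image)
  then show ?thesis unfolding pts_LL[OF ok] using card_parts(2)[OF IH ok] by simp
qed

text \<open>Labels without a filler are determined by their children: at most
  \<open>exp (d r * l)\<close> by multiplicativity. Labels with a filler are determined by it, and
  its probability is at least \<open>exp (- (c r * l))\<close>, so there are at most
  \<open>exp (c r * l)\<close>. The factor 2 from adding is absorbed by
  \<open>d (Suc r) > c r\<close>, since typical blocks have length at least
  \<open>T r\<close>.\<close>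

lemma card_LL:
  fixes d :: "nat \<Rightarrow> real"
  assumes d: "0 \<le> d 0" "\<And>r. d r < c r" "\<And>r. c r < d (Suc r)"
    and T: "\<And>r. 2 \<le> exp ((d (Suc r) - c r) * real (T r))"
    and ok: "okS S"
  shows "real (card (set_pmf (LL r S))) \<le> exp (d r * real (sum_list S))"
  using ok
proof (induction r arbitrary: S)
  case 0
  have "set_pmf (LL 0 S) \<subseteq> {Lf (sum_list S)}"
    using set_FW[OF lv2 0] by (auto simp: set_LL length_concat_map)
  then have "card (set_pmf (LL 0 S)) \<le> card {Lf (sum_list S)}" by (intro card_mono) auto
  then have "real (card (set_pmf (LL 0 S))) \<le> 1" by simp
  also have "\<dots> \<le> exp (d 0 * real (sum_list S))" using d(1) by simp
  finally show ?case .
next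
  case (Suc r)
  let ?l = "real (sum_list S)"
  let ?n = "lv (Suc r)"
  define A where "A = set_pmf (lprod (map (LL r) (sgrp (N r) S)))"
  have finA: "finite A" and cardA: "real (card A) \<le> exp (d r * ?l)"
    unfolding A_def using card_parts[OF Suc.IH Suc.prems] by auto
  define L0 where "L0 = {\<alpha>\<in>set_pmf (LL (Suc r) S). \<exists>ps. \<alpha> = Nd None ps}"
  define L1 where "L1 = {\<alpha>\<in>set_pmf (LL (Suc r) S). \<exists>F ps. \<alpha> = Nd (Some F) ps}"
  have form: "\<exists>q ps. \<alpha> = Nd q ps" if "\<alpha> \<in> set_pmf (LL (Suc r) S)" for \<alpha>
    using that unfolding set_LL lb.simps by blast
  have un: "set_pmf (LL (Suc r) S) = L0 \<union> L1"
  proof (intro equalityI subsetI)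
    fix \<alpha> assume a: "\<alpha> \<in> set_pmf (LL (Suc r) S)"
    obtain q ps where "\<alpha> = Nd q ps" using form[OF a] by blast
    then show "\<alpha> \<in> L0 \<union> L1" using a by (cases q) (auto simp: L0_def L1_def)
  qed (auto simp: L0_def L1_def)
  have "pts ` set_pmf (LL (Suc r) S) = A" unfolding A_def pts_LL[OF Suc.prems, symmetric] by simp
  then have "pts ` L0 \<subseteq> A" by (auto simp: L0_def)
  moreover have "inj_on pts L0" by (auto simp: inj_on_def L0_def)
  ultimately have "card L0 \<le> card A" using finA by (metis card_inj_on_le)
  then have c0: "real (card L0) \<le> exp (d r * ?l)" using cardA by linarith
  have typL: "\<exists>F\<in>set_pmf (FW ?n S). typl r F \<and> \<alpha> = lb (Suc r) F" if "\<alpha> \<in> L1" for \<alpha>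
  proof -
    note h = that
    obtain F where F: "F \<in> set_pmf (FW ?n S)" "\<alpha> = lb (Suc r) F" using h unfolding L1_def set_LL by blast
    moreover have "typl r F" using h F(2) unfolding L1_def lb.simps by (cases "typl r F") simp_all
    ultimately show ?thesis by blast
  qed
  show ?case
  proof (cases "L1 = {}")
    case True
    have "d r * ?l \<le> d (Suc r) * ?l" using d(2,3)[of r] by (intro mult_right_mono) auto
    then show ?thesis using c0 True un by (smt (verit) exp_le_cancel_iff sup_bot_right)
  next
    case False
    then obtain F0 where F0: "F0 \<in> set_pmf (FW ?n S)" "typl r F0" using typL by blast
    have bs: "bsize F = sum_list S" if "F \<in> set_pmf (FW ?n S)" for F
      using that set_FW[OF lv2 Suc.prems] by (simp add: length_concat_map)
    have Tl: "T r \<le> sum_list S" using F0 bs by (simp add: typl_def)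
    define q where "q = map_pmf (rv ?n) (FW ?n S)"
    define h where "h \<alpha> = (case \<alpha> of Nd (Some F) ps \<Rightarrow> F | _ \<Rightarrow> [])" for \<alpha>
    have h: "h (lb (Suc r) F) = rv ?n F" if "typl r F" for F using that by (simp add: h_def)
    have inj: "inj_on h L1"
    proof (rule inj_onI)
      fix \<alpha> \<beta> assume a: "\<alpha> \<in> L1" "\<beta> \<in> L1" "h \<alpha> = h \<beta>"
      obtain F where F: "typl r F" "\<alpha> = lb (Suc r) F" using typL[OF a(1)] by blast
      obtain F' where F': "typl r F'" "\<beta> = lb (Suc r) F'" using typL[OF a(2)] by blast
      have "rv ?n F = rv ?n F'" using a(3) F F' h by simp
      then have "lb (Suc r) F = lb (Suc r) F'" by (rule lb_rv)
      then show "\<alpha> = \<beta>" using F F' by (simp only:)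
    qed
    have finL1: "finite L1" using finite_LL[OF Suc.prems] un by (metis finite_Un)
    have ge: "exp (- (c r * ?l)) \<le> pmf q w" if "w \<in> h ` L1" for w
    proof -
      note that' = that
      obtain \<alpha> where \<alpha>: "\<alpha> \<in> L1" "w = h \<alpha>" using that' by blast
      obtain F where F0: "F \<in> set_pmf (FW ?n S)" "typl r F" "\<alpha> = lb (Suc r) F" using typL[OF \<alpha>(1)] by blast
      have F: "F \<in> set_pmf (FW ?n S)" "typl r F" "w = rv ?n F" using F0 \<alpha>(2) h[OF F0(2)] by (simp_all only:)
      then have "infS ?n F \<le> c r * ?l" using bs by (simp add: typl_def)
      then show ?thesis using infS_pmf[OF lv2 Suc.prems F(1)] F(3) by (simp add: q_def)
    qed
    have "real (card L1) * exp (- (c r * ?l)) = (\<Sum>w\<in>h ` L1. exp (- (c r * ?l)))"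
      by (simp add: card_image[OF inj])
    also have "\<dots> \<le> (\<Sum>w\<in>h ` L1. pmf q w)" using ge by (rule sum_mono)
    also have "\<dots> = measure_pmf.prob q (h ` L1)" using finL1 by (simp add: measure_measure_pmf_finite)
    also have "\<dots> \<le> 1" by simp
    finally have c1: "real (card L1) \<le> exp (c r * ?l)" by (simp add: exp_minus field_simps)
    have "real (card (set_pmf (LL (Suc r) S))) \<le> real (card L0) + real (card L1)"
      unfolding un using card_Un_le[of L0 L1] by linarith
    also have "\<dots> \<le> exp (d r * ?l) + exp (c r * ?l)" using c0 c1 by simp
    also have "\<dots> \<le> 2 * exp (c r * ?l)" using d(2)[of r] by (simp add: mult_right_mono)
    also have "\<dots> \<le> exp ((d (Suc r) - c r) * real (T r)) * exp (c r * ?l)" using T[of r] by simp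
    also have "\<dots> \<le> exp ((d (Suc r) - c r) * ?l) * exp (c r * ?l)"
      using Tl d(3)[of r] by (simp add: mult_left_mono)
    also have "\<dots> = exp (d (Suc r) * ?l)" by (simp add: exp_add[symmetric] algebra_simps)
    finally show ?thesis .
  qed
qed

end

subsection \<open>Entropy rates\<close>

context bernd
begin

text \<open>The information of a gap is booked at its first site, and gaps longer than
  \<open>n\<close> count as zero. Summed over the sites of a block this is \<open>infS\<close> (see
  \<open>infS_fI\<close>), so typicality is a matter of averages of one bounded local
  function.\<close>

definition fI :: "nat \<Rightarrow> (int \<Rightarrow> sym) \<Rightarrow> real" where
  "fI n x = (\<Sum>L\<in>{1..n}. of_bool (cut k x 0 \<and> gapw k (wrd n x 0 L)) * - ln (pmf (G n L) (wrd n x 0 L)))"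

definition Words :: "nat \<Rightarrow> nat \<Rightarrow> bool list list set" where
  "Words n L = {v. length v = L \<and> set v \<subseteq> {d. length d = n}}"

lemma finite_Words: "finite (Words n L)"
proof -
  have "finite {d :: bool list. length d = n}" using finite_lists_length_eq[of "UNIV :: bool set" n] by simp
  then show ?thesis unfolding Words_def using finite_lists_length_eq[of "{d :: bool list. length d = n}" L]
    by (simp add: conj_commute)
qed

lemma wrd_Words: "wrd n x i L \<in> Words n L" by (auto simp: Words_def wrd_def)

text \<open>At probability zero the value is 0 because \<open>ln 0 = 0\<close>.\<close>

lemma neg_ln_pmf: "0 \<le> - ln (pmf q v)"
  using pmf_le_1[of q v] pmf_nonneg[of q v] by (cases "pmf q v = 0") (auto simp: ln_le_zero_iff less_le)

text \<open>A crude bound by a sum over all words. The summand 1 keeps it positive where it becomes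
  a divisor.\<close>

definition BB :: "nat \<Rightarrow> real" where
  "BB n = 1 + (\<Sum>L\<in>{1..n}. \<Sum>v\<in>Words n L. - ln (pmf (G n L) v))"

lemma fI_bounds: "0 \<le> fI n x" "fI n x \<le> BB n"
proof -
  show "0 \<le> fI n x" unfolding fI_def by (intro sum_nonneg mult_nonneg_nonneg neg_ln_pmf) simp
  have "fI n x \<le> (\<Sum>L\<in>{1..n}. \<Sum>v\<in>Words n L. - ln (pmf (G n L) v))"
    unfolding fI_def
  proof (rule sum_mono)
    fix L
    have "of_bool (cut k x 0 \<and> gapw k (wrd n x 0 L)) * - ln (pmf (G n L) (wrd n x 0 L)) \<le> - ln (pmf (G n L) (wrd n x 0 L))"
      using neg_ln_pmf[of "G n L" "wrd n x 0 L"] by auto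
    also have "\<dots> \<le> (\<Sum>v\<in>Words n L. - ln (pmf (G n L) v))"
      by (rule member_le_sum) (auto simp: wrd_Words finite_Words neg_ln_pmf simp del: neg_0_le_iff_le)
    finally show "of_bool (cut k x 0 \<and> gapw k (wrd n x 0 L)) * - ln (pmf (G n L) (wrd n x 0 L)) \<le> (\<Sum>v\<in>Words n L. - ln (pmf (G n L) v))" .
  qed
  then show "fI n x \<le> BB n" by (simp add: BB_def)
qed

lemma BB_pos: "0 < BB n"
  unfolding BB_def by (intro add_pos_nonneg sum_nonneg neg_ln_pmf) simp

lemma wrd_fun_borel: "(\<lambda>x. (h (wrd n x i L) :: real)) \<in> borel_measurable P"
  by (rule measurable_compose[OF wrd_meas]) simp

lemma lev_fun_borel: "(\<lambda>x. (h (lev n (x i)) :: real)) \<in> borel_measurable P"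
  by (rule measurable_compose[OF lev_meas]) simp

lemma of_bool_borel [measurable]:
  "Measurable.pred P Q \<Longrightarrow> (\<lambda>x. of_bool (Q x) :: real) \<in> borel_measurable P"
  by (simp add: of_bool_def)

lemma fI_meas [measurable]: "fI n \<in> borel_measurable P"
  unfolding fI_def[abs_def]
  by (intro borel_measurable_sum borel_measurable_times of_bool_borel
      wrd_fun_borel[where h="\<lambda>v. - ln (pmf (G n _) v)"]) measurable

lemma integrable_bdd:
  fixes f :: "_ \<Rightarrow> real"
  shows "f \<in> borel_measurable P \<Longrightarrow> (\<And>x. \<bar>f x\<bar> \<le> B) \<Longrightarrow> integrable P f"
  by (rule P.integrable_const_bound[of _ B]) auto

lemma fI_integrable: "integrable P (fI n)"
  by (rule integrable_bdd[of _ "BB n"]) (use fI_bounds in \<open>auto simp: abs_le_iff intro: order_trans\<close>)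

definition g :: "nat \<Rightarrow> real" where "g n = P.expectation (fI n)"

lemma expectation_sh:
  fixes f :: "_ \<Rightarrow> real" assumes "f \<in> borel_measurable P"
  shows "P.expectation (\<lambda>x. f (sh a x)) = P.expectation f"
  using integral_distr[OF sh_measurable[of a] assms] by (simp add: distr_sh)

lemma pmf_G_mono:
  assumes "2 \<le> n" "n \<le> m" "0 < u L"
  shows "pmf (G m L) v \<le> pmf (G n L) (map (take n) v)"
  unfolding G_coarse[OF assms, symmetric] pmf_map
  by (subst measure_pmf_single[symmetric]) (auto intro!: measure_pmf.finite_measure_mono)

lemma nice_gap:
  assumes "nice x" "gapw k (wrd n x i L)" "2 \<le> n"
  shows "0 < u L" "wrd n x i L \<in> set_pmf (G n L)" "0 < pmf (G n L) (wrd n x i L)"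
proof -
  have s: "set (wrd n x i L) \<subseteq> set_pmf (sp n)" using assms(1) by (auto simp: wrd_def nice_def)
  show uL: "0 < u L" using wp_gap_pos[OF assms(3,2) s] by simp
  show "wrd n x i L \<in> set_pmf (G n L)" using set_G[OF assms(3) uL] s assms(2) by (simp add: set_wp)
  then show "0 < pmf (G n L) (wrd n x i L)" by (simp add: pmf_positive)
qed

lemma info_mono:
  assumes "nice x" "2 \<le> n" "n \<le> m" "gapw k (wrd m x 0 L)"
  shows "- ln (pmf (G n L) (wrd n x 0 L)) \<le> - ln (pmf (G m L) (wrd m x 0 L))"
  using pmf_G_mono[OF assms(2,3) nice_gap(1)[OF assms(1,4)], of "wrd m x 0 L"]
    nice_gap(3)[OF assms(1,4)] assms by (simp add: wrd_coarse)

lemma gapw_wrd_level: "2 \<le> n \<Longrightarrow> n \<le> m \<Longrightarrow> gapw k (wrd n x i L) = gapw k (wrd m x i L)"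
  using gapw_coarse[OF k1, of n "wrd m x i L"] by (simp add: wrd_coarse)

text \<open>Raising the level from \<open>n\<close> to \<open>m\<close> never loses information, and
  a gap of length \<open>M\<close> with \<open>n < M \<le> m\<close> counts at level
  \<open>m\<close> only; \<open>e\<close> is a lower bound for what it adds. With
  \<open>e = 0\<close> this gives monotonicity, otherwise strict growth.\<close>

lemma fI_gain:
  assumes x: "nice x" and n: "2 \<le> n" "n \<le> m" and M: "M \<in> {1..m} - {1..n} \<or> e = 0"
    and e: "cut k x 0 \<and> gapw k (wrd m x 0 M) \<Longrightarrow> e \<le> - ln (pmf (G m M) (wrd m x 0 M))"
    and e': "\<not> (cut k x 0 \<and> gapw k (wrd m x 0 M)) \<Longrightarrow> e \<le> 0"
  shows "fI n x + e \<le> fI m x"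
proof -
  let ?t = "\<lambda>n L. of_bool (cut k x 0 \<and> gapw k (wrd n x 0 L)) * - ln (pmf (G n L) (wrd n x 0 L))"
  have nn: "0 \<le> ?t n L" for n L by (intro mult_nonneg_nonneg neg_ln_pmf) simp
  have 1: "fI n x \<le> (\<Sum>L\<in>{1..n}. ?t m L)"
    unfolding fI_def
  proof (rule sum_mono)
    fix L show "?t n L \<le> ?t m L"
      using info_mono[OF x n, of L] gapw_wrd_level[OF n, of x 0 L] by auto
  qed
  have 2: "e \<le> (\<Sum>L\<in>{1..m} - {1..n}. ?t m L)"
  proof (cases "e = 0")
    case True
    then show ?thesis using nn by (simp only:) (intro sum_nonneg)
  next
    case False
    then have "M \<in> {1..m} - {1..n}" using M by simp
    then have "?t m M \<le> (\<Sum>L\<in>{1..m} - {1..n}. ?t m L)" using nn by (intro member_le_sum) auto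
    moreover have "e \<le> ?t m M" using e e' by (cases "cut k x 0 \<and> gapw k (wrd m x 0 M)") auto
    ultimately show ?thesis by linarith
  qed
  have "fI m x = (\<Sum>L\<in>{1..m} - {1..n}. ?t m L) + (\<Sum>L\<in>{1..n}. ?t m L)"
    unfolding fI_def using n by (intro sum.subset_diff) auto
  then show ?thesis using 1 2 by linarith
qed

lemma g_mono: assumes "2 \<le> n" "n \<le> m" shows "g n \<le> g m"
  unfolding g_def
proof (rule integral_mono_AE[OF fI_integrable fI_integrable])
  show "AE x in P. fI n x \<le> fI m x"
    using AE_nice
  proof eventually_elim
    case (elim x)
    show ?case using fI_gain[OF elim assms, of 0 0] neg_ln_pmf[of "G m 0" "wrd m x 0 0"] by simp
  qed
qed

text \<open>Some gap length \<open>L > n\<close> admits two words of positive probability. Each has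
  conditional probability below 1, so disclosing gaps of that length adds a positive amount with
  positive probability.\<close>

lemma g_strict: assumes "2 \<le> n" shows "\<exists>m\<ge>n. g n < g m"
proof -
  obtain L n' v v' where L: "n < L" "2 \<le> n'" "v \<noteq> v'" "v \<in> set_pmf (wp n' L)" "v' \<in> set_pmf (wp n' L)"
    "gapw k v" "gapw k v'" using nd[of n] by blast
  define m where "m = max L n'"
  have m: "n \<le> m" "n' \<le> m" "L \<le> m" using L by (auto simp: m_def)
  have uL: "0 < u L" using wp_gap_pos[of n' v] L by (auto simp: set_wp)
  have vG: "v \<in> set_pmf (G n' L)" "v' \<in> set_pmf (G n' L)" using L uL by (auto simp: set_G)
  have "pmf (G n' L) v + pmf (G n' L) v' \<le> 1"
  proof -
    have "pmf (G n' L) v + pmf (G n' L) v' = measure_pmf.prob (G n' L) {v, v'}"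
      using L(3) by (simp add: measure_measure_pmf_finite)
    then show ?thesis by simp
  qed
  moreover have "0 < pmf (G n' L) v'" "0 < pmf (G n' L) v" using vG by (auto simp: pmf_positive)
  ultimately have lt: "pmf (G n' L) v < 1" "0 < pmf (G n' L) v" by linarith+
  define \<delta> where "\<delta> = - ln (pmf (G n' L) v)"
  have \<delta>: "0 < \<delta>" using lt by (simp add: \<delta>_def)
  define E where "E x \<longleftrightarrow> cut k x 0 \<and> wrd n' x 0 L = v" for x
  have Em [measurable]: "Measurable.pred P E" unfolding E_def[abs_def] by measurable
  have "P.prob {x. E x} = p * pmf (wp n' L) v"
    unfolding E_def using prob_cut_wrd[of 0 "\<lambda>w. w = v" n' L] by (simp add: measure_pmf_single)
  then have Epos: "0 < P.prob {x. E x}" using p_pos L(4) by (simp add: pmf_positive)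
  have int: "integrable P (\<lambda>x. fI n x + \<delta> * of_bool (E x))"
    by (intro Bochner_Integration.integrable_add fI_integrable integrable_bdd[of _ \<delta>]) (use \<delta> in auto)
  have "g n + \<delta> * P.prob {x. E x} = P.expectation (\<lambda>x. fI n x + \<delta> * of_bool (E x))"
  proof -
    have "P.expectation (\<lambda>x. of_bool (E x) :: real) = P.prob {x. E x}"
    proof -
      have "(\<lambda>x. of_bool (E x) :: real) = indicator {x. E x}" by (auto simp: indicator_def)
      then show ?thesis by (simp add: sets_pred)
    qed
    moreover have "integrable P (\<lambda>x. of_bool (E x) :: real)" by (rule integrable_bdd[of _ 1]) auto
    ultimately show ?thesis by (simp add: g_def fI_integrable)
  qed
  also have "\<dots> \<le> g m" unfolding g_def
  proof (rule integral_mono_AE[OF int fI_integrable])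
    show "AE x in P. fI n x + \<delta> * of_bool (E x) \<le> fI m x"
      using AE_nice
    proof eventually_elim
      case (elim x)
      show ?case
      proof (rule fI_gain[OF elim assms m(1), of L])
        show "L \<in> {1..m} - {1..n} \<or> \<delta> * of_bool (E x) = 0" using L m by auto
        assume c: "cut k x 0 \<and> gapw k (wrd m x 0 L)"
        show "\<delta> * of_bool (E x) \<le> - ln (pmf (G m L) (wrd m x 0 L))"
        proof (cases "E x")
          case True
          then show ?thesis using info_mono[OF elim L(2) m(2), of L] c by (simp add: E_def \<delta>_def)
        qed (use neg_ln_pmf in simp)
      next
        assume "\<not> (cut k x 0 \<and> gapw k (wrd m x 0 L))"
        then have "\<not> E x" using gapw_wrd_level[OF L(2) m(2), of x 0 L] L(6) by (auto simp: E_def)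
        then show "\<delta> * of_bool (E x) \<le> 0" by simp
      qed
    qed
  qed
  finally have "g n < g m" using Epos \<delta> by (smt (verit) mult_pos_pos)
  then show ?thesis using m by blast
qed

definition gc :: "nat \<Rightarrow> nat \<Rightarrow> nat \<Rightarrow> (int \<Rightarrow> sym) \<Rightarrow> bool" where
  "gc n L j x \<longleftrightarrow> cut k x (- int j) \<and> gapw k (wrd n x (- int j) L)"

definition GC :: "nat \<Rightarrow> (int \<Rightarrow> sym) \<Rightarrow> bool" where
  "GC n x \<longleftrightarrow> (\<exists>L\<in>{1..n}. \<exists>j<L. gc n L j x)"

lemma gc_meas [measurable]: "Measurable.pred P (gc n L j)"
  unfolding gc_def[abs_def] by measurable

lemma GC_meas [measurable]: "Measurable.pred P (GC n)"
  unfolding GC_def[abs_def] by measurable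

lemma gc_unique:
  assumes "2 \<le> n" "1 \<le> L" "1 \<le> L'" "j < L" "j' < L'" "gc n L j x" "gc n L' j' x"
  shows "L = L' \<and> j = j'"
proof -
  have e: "cut k x (- int j)" "cut k x (- int j + int L)" "\<forall>l\<in>{1..<L}. \<not> cut k x (- int j + int l)"
    if "gc n L j x" "1 \<le> L" for L j
    using that cut_gapw[OF assms(1) k1, of x "- int j" L] by (auto simp: gc_def)
  have le: "j \<le> j'" if "gc n L j x" "1 \<le> L" "j < L" "gc n L' j' x" "1 \<le> L'" for L j L' j'
  proof (rule ccontr)
    assume "\<not> j \<le> j'"
    then have "j - j' \<in> {1..<L}" "- int j + int (j - j') = - int j'" using that by auto
    then show False using e(3)[OF that(1,2)] e(1)[OF that(4,5)] by metis
  qed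
  have j: "j = j'" using le assms by (meson le_antisym)
  have "\<not> L < L'" "\<not> L' < L"
    using e(2,3)[OF assms(6,2)] e(2,3)[OF assms(7,3)] assms(2,3) j by auto
  then show ?thesis using j by simp
qed

lemma of_bool_GC:
  assumes "2 \<le> n"
  shows "(\<Sum>L\<in>{1..n}. \<Sum>j<L. of_bool (gc n L j x)) = (of_bool (GC n x) :: real)"
proof (cases "GC n x")
  case True
  then obtain L0 j0 where g0: "L0 \<in> {1..n}" "j0 < L0" "gc n L0 j0 x" by (auto simp: GC_def)
  have "(\<Sum>L\<in>{1..n}. \<Sum>j<L. of_bool (gc n L j x)) = (\<Sum>L\<in>{1..n}. if L = L0 then 1 else (0::real))"
  proof (rule sum.cong[OF refl])
    fix L assume L: "L \<in> {1..n}"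
    have "gc n L j x \<longleftrightarrow> L = L0 \<and> j = j0" if "j < L" for j
      using gc_unique[OF assms, of L L0 j j0 x] L that g0 by auto
    then have "(\<Sum>j<L. of_bool (gc n L j x)) = (\<Sum>j<L. of_bool (L = L0 \<and> j = j0) :: real)"
      by (intro sum.cong) auto
    also have "\<dots> = (if L = L0 then 1 else 0)" using g0 by (auto simp: of_bool_def)
    finally show "(\<Sum>j<L. of_bool (gc n L j x)) = (if L = L0 then 1 else (0::real))" .
  qed
  also have "\<dots> = 1" using g0 by simp
  finally show ?thesis using True by simp
next
  case False
  then have "(\<Sum>L\<in>{1..n}. \<Sum>j<L. of_bool (gc n L j x) :: real) = 0"
    by (intro sum.neutral ballI) (auto simp: GC_def)
  then show ?thesis using False by simp
qed

lemma GC_mono: assumes "2 \<le> n" "n \<le> m" "GC n x" shows "GC m x"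
proof -
  obtain L j where "L \<in> {1..n}" "j < L" "gc n L j x" using assms by (auto simp: GC_def)
  moreover from this have "gc m L j x" using gapw_wrd_level[OF assms(1,2)] by (simp add: gc_def)
  ultimately show ?thesis using assms unfolding GC_def by (intro bexI[of _ L] exI[of _ j]) auto
qed

lemma nice_GC: assumes "nice x" shows "\<exists>n\<ge>2. GC n x"
proof -
  obtain j F where b: "isblk k 0 2 x j F" using nice_isblk[OF assms, of 2 0] by auto
  have "length F = 1"
  proof -
    have "length W \<noteq> 0" if "W \<in> set F" for W using b that gapw_length[of k W] k1 by (auto simp: isblk_def)
    then have "set (butlast F) = {}" using b in_set_butlastD[of _ F]
      unfolding isblk_def bvs_def map_butlast[symmetric] by force
    moreover have "F \<noteq> []" using b by (auto simp: isblk_def)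
    ultimately show ?thesis by (cases F rule: rev_cases) auto
  qed
  then obtain W where F: "F = [W]" by (auto simp: length_Suc_conv)
  have W: "cut k x (- int j)" "wrd 2 x (- int j) (length W) = W" "gapw k W" "j < length W"
    using b F by (auto simp: isblk_def dest: CC_cut)
  define n where "n = max 2 (length W)"
  have "gc n (length W) j x" using W gapw_wrd_level[of 2 n x "- int j" "length W"] by (simp add: gc_def n_def)
  then have "GC n x" unfolding GC_def using W by (intro bexI[of _ "length W"] exI[of _ j]) (auto simp: n_def)
  then show ?thesis by (auto simp: n_def intro!: exI[of _ n])
qed

lemma prob_GC_lim: "(\<lambda>n. P.prob {x. GC n x}) \<longlonglongrightarrow> 1"
proof -
  have "(\<lambda>n. P.prob {x. GC (n + 2) x}) \<longlonglongrightarrow> P.prob (\<Union>n. {x. GC (n + 2) x})"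
  proof (rule P.finite_Lim_measure_incseq)
    show "range (\<lambda>n. {x. GC (n + 2) x}) \<subseteq> sets P" by (auto intro!: sets_pred)
    show "incseq (\<lambda>n. {x. GC (n + 2) x})" 
    proof (rule incseq_SucI)
      fix n show "{x. GC (n + 2) x} \<subseteq> {x. GC (Suc n + 2) x}" using GC_mono[of "n + 2" "Suc n + 2"] by auto
    qed
  qed
  moreover have "P.prob (\<Union>n. {x. GC (n + 2) x}) = 1"
  proof -
    have "AE x in P. x \<in> (\<Union>n. {x. GC (n + 2) x})"
      using AE_nice
    proof eventually_elim
      case (elim x)
      then obtain n where "2 \<le> n" "GC n x" using nice_GC by blast
      then have "GC (n - 2 + 2) x" by (simp only: le_add_diff_inverse2)
      then show ?case by blast
    qed
    then show ?thesis by (subst P.prob_eq_1) (auto intro!: sets_pred)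
  qed
  ultimately have "(\<lambda>n. P.prob {x. GC (n + 2) x}) \<longlonglongrightarrow> 1" by simp
  then show ?thesis by (rule LIMSEQ_offset)
qed

end

section \<open>Comparison of the rate with the entropy of the alphabet\<close>

context bernd
begin

definition sl :: "nat \<Rightarrow> bool list \<Rightarrow> real" where "sl n d = - ln (pmf (sp n) d)"

definition BS :: "nat \<Rightarrow> real" where "BS n = (\<Sum>d\<in>{d. length d = n}. sl n d)"

lemma sl_nonneg: "0 \<le> sl n d" unfolding sl_def by (rule neg_ln_pmf)

lemma sl_bound: "sl n (lev n c) \<le> BS n"
  unfolding BS_def using finite_lists_length_eq[of "UNIV :: bool set" n]
  by (intro member_le_sum) (auto simp: sl_nonneg)

lemma BS_nonneg: "0 \<le> BS n" unfolding BS_def by (intro sum_nonneg) (rule sl_nonneg)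

definition Hf :: "nat \<Rightarrow> real" where "Hf n = expectation (\<lambda>c. sl n (lev n c))"

lemma sl_borel [measurable]: "(\<lambda>x. sl n (lev n (x i))) \<in> borel_measurable P"
  by (rule lev_fun_borel)

lemma Hf_P: "Hf n = P.expectation (\<lambda>x. sl n (lev n (x 0)))"
proof -
  have b: "(\<lambda>c. sl n (lev n c)) \<in> borel_measurable \<mu>" by (rule measurable_compose[OF lev_mu]) simp
  have "Hf n = (LINT c|distr P \<mu> (\<lambda>x. x 0). sl n (lev n c))"
    unfolding Hf_def by (simp add: iproc_def PP.PiM_component)
  also have "\<dots> = P.expectation (\<lambda>x. sl n (lev n (x 0)))" using b by (intro integral_distr) auto
  finally show ?thesis .
qed

lemma pmf_wp_wrd:
  assumes "nice x"
  shows "0 < pmf (wp n L) (wrd n x i L) \<and> - ln (pmf (wp n L) (wrd n x i L)) = (\<Sum>j<L. sl n (lev n (x (i + int j))))"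
proof (induction L arbitrary: i)
  case 0
  then show ?case by (simp add: wp_def)
next
  case (Suc L)
  have pos: "0 < pmf (sp n) (lev n (x i))" using assms by (simp add: nice_def pmf_positive)
  have e: "pmf (wp n (Suc L)) (wrd n x i (Suc L)) = pmf (sp n) (lev n (x i)) * pmf (wp n L) (wrd n x (i + 1) L)"
    unfolding wp_def wrd_Suc by (simp add: pmf_lprod_Cons del: lprod.simps)
  have "- ln (pmf (wp n (Suc L)) (wrd n x i (Suc L))) = sl n (lev n (x i)) + (\<Sum>j<L. sl n (lev n (x (i + 1 + int j))))"
    using Suc[of "i + 1"] pos unfolding e by (simp add: ln_mult sl_def)
  also have "\<dots> = (\<Sum>j<Suc L. sl n (lev n (x (i + int j))))"
    by (subst sum.lessThan_Suc_shift) (simp add: add.assoc)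
  finally show ?case using Suc[of "i + 1"] pos unfolding e by simp
qed

lemma info_split:
  assumes "nice x" "2 \<le> n" "gapw k (wrd n x i L)"
  shows "- ln (pmf (G n L) (wrd n x i L)) = (\<Sum>j<L. sl n (lev n (x (i + int j)))) + ln (u L)"
proof -
  have uL: "0 < u L" using nice_gap(1)[OF assms(1,3,2)] .
  have "pmf (G n L) (wrd n x i L) = pmf (wp n L) (wrd n x i L) / u L" using pmf_G[OF assms(2) uL] assms(3) by simp
  then show ?thesis using pmf_wp_wrd[OF assms(1), of n L i] uL by (simp add: ln_div)
qed

definition Hp :: "nat \<Rightarrow> real" where "Hp n = P.expectation (\<lambda>x. of_bool (GC n x) * sl n (lev n (x 0)))"

text \<open>The entropy per site of the gap lengths up to \<open>n\<close>: gaps start with density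
  \<open>p\<close> and have law \<open>u\<close>. It is a function of \<open>k\<close> and
  \<open>p\<close>, hence common to both processes.\<close>

definition ss :: "nat \<Rightarrow> real" where "ss n = - (p * (\<Sum>L\<in>{1..n}. u L * ln (u L)))"

lemma gc_sh: "gc n L j x = gc n L 0 (sh (- int j) x)"
  by (simp add: gc_def cut_sh wrd_sh)

lemma gc_sl_integrable: "integrable P (\<lambda>x. of_bool (gc n L j x) * sl n (lev n (x i)))"
  by (rule integrable_bdd[of _ "BS n"]) (auto simp: abs_mult sl_nonneg BS_nonneg sl_bound intro!: borel_measurable_times)

lemma expectation_of_bool:
  assumes "Measurable.pred P Q" shows "P.expectation (\<lambda>x. of_bool (Q x)) = P.prob {x. Q x}"
proof -
  have "(\<lambda>x. of_bool (Q x) :: real) = indicator {x. Q x}" by (auto simp: indicator_def)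
  then show ?thesis using assms by (simp add: sets_pred)
qed

lemma of_bool_integrable: "Measurable.pred P Q \<Longrightarrow> integrable P (\<lambda>x. of_bool (Q x) :: real)"
  by (rule integrable_bdd[of _ 1]) auto

lemma prob_gc: "2 \<le> n \<Longrightarrow> P.prob {x. gc n L j x} = p * u L"
  unfolding gc_def by (simp add: prob_cut_wrd u_eq)

text \<open>The information of a gap word is that of its letters, plus \<open>ln (u L)\<close> for
  conditioning on being a gap of length \<open>L\<close>. By shift invariance the letters are
  charged to the sites they occupy instead of the first site of the gap; a site inside a gap of
  length at most \<open>n\<close> is then charged exactly once, any other site not at all.\<close>

lemma g_split: assumes "2 \<le> n" shows "g n = Hp n - ss n"
proof -
  have "g n = P.expectation (\<lambda>x. \<Sum>L\<in>{1..n}. (\<Sum>j<L. of_bool (gc n L 0 x) * sl n (lev n (x (int j)))) + of_bool (gc n L 0 x) * ln (u L))"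
    unfolding g_def
  proof (rule integral_cong_AE)
    show "AE x in P. fI n x = (\<Sum>L\<in>{1..n}. (\<Sum>j<L. of_bool (gc n L 0 x) * sl n (lev n (x (int j)))) + of_bool (gc n L 0 x) * ln (u L))"
      using AE_nice
    proof eventually_elim
      case (elim x)
      show ?case unfolding fI_def
      proof (rule sum.cong[OF refl])
        fix L
        show "of_bool (cut k x 0 \<and> gapw k (wrd n x 0 L)) * - ln (pmf (G n L) (wrd n x 0 L))
          = (\<Sum>j<L. of_bool (gc n L 0 x) * sl n (lev n (x (int j)))) + of_bool (gc n L 0 x) * ln (u L)"
          using info_split[OF elim assms, of 0 L] by (auto simp: gc_def)
      qed
    qed
  qed (auto intro!: borel_measurable_sum borel_measurable_add borel_measurable_times)
  also have "\<dots> = (\<Sum>L\<in>{1..n}. (\<Sum>j<L. P.expectation (\<lambda>x. of_bool (gc n L 0 x) * sl n (lev n (x (int j))))) + p * u L * ln (u L))"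
    by (simp add: gc_sl_integrable of_bool_integrable expectation_of_bool prob_gc[OF assms] del: sum_of_bool_eq sum_mult_of_bool_eq sum_of_bool_mult_eq)
  also have "\<dots> = (\<Sum>L\<in>{1..n}. \<Sum>j<L. P.expectation (\<lambda>x. of_bool (gc n L j x) * sl n (lev n (x 0)))) - ss n"
  proof -
    have "P.expectation (\<lambda>x. of_bool (gc n L 0 x) * sl n (lev n (x (int j)))) = P.expectation (\<lambda>x. of_bool (gc n L j x) * sl n (lev n (x 0)))" for L j
      using expectation_sh[of "\<lambda>x. of_bool (gc n L 0 x) * sl n (lev n (x (int j)))" "- int j"]
      by (simp add: gc_sh[of n L j] borel_measurable_times)
    then show ?thesis by (simp add: ss_def sum.distrib sum_distrib_left mult.assoc)
  qed
  also have "(\<Sum>L\<in>{1..n}. \<Sum>j<L. P.expectation (\<lambda>x. of_bool (gc n L j x) * sl n (lev n (x 0))))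
    = P.expectation (\<lambda>x. \<Sum>L\<in>{1..n}. \<Sum>j<L. of_bool (gc n L j x) * sl n (lev n (x 0)))"
    by (simp add: gc_sl_integrable del: sum_of_bool_eq sum_mult_of_bool_eq sum_of_bool_mult_eq)
  also have "\<dots> = Hp n"
    unfolding Hp_def of_bool_GC[OF assms, symmetric] by (simp add: sum_distrib_right del: sum_of_bool_eq sum_mult_of_bool_eq sum_of_bool_mult_eq)
  finally show ?thesis .
qed

lemma GC_sl_integrable: "integrable P (\<lambda>x. of_bool (GC m x) * sl n (lev n (x 0)))"
  by (rule integrable_bdd[of _ "BS n"]) (auto simp: abs_mult sl_nonneg BS_nonneg sl_bound intro!: borel_measurable_times)

lemma sl_integrable: "integrable P (\<lambda>x. sl n (lev n (x 0)))"
  by (rule integrable_bdd[of _ "BS n"]) (auto simp: sl_nonneg sl_bound)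

lemma Hp_le: "Hp n \<le> Hf n"
  unfolding Hp_def Hf_P by (rule integral_mono[OF GC_sl_integrable sl_integrable]) (auto simp: sl_nonneg)

lemma sl_mono: assumes "nice x" "n \<le> m" shows "sl n (lev n (x 0)) \<le> sl m (lev m (x 0))"
proof -
  have "pmf (sp m) (lev m (x 0)) \<le> pmf (sp n) (take n (lev m (x 0)))"
    unfolding sp_coarse[OF assms(2), symmetric] pmf_map
    by (subst measure_pmf_single[symmetric]) (auto intro!: measure_pmf.finite_measure_mono)
  moreover have "0 < pmf (sp m) (lev m (x 0))" using assms(1) by (simp add: nice_def pmf_positive)
  ultimately show ?thesis by (simp add: sl_def take_lev[OF assms(2)])
qed

lemma Hp_ge: assumes "n \<le> m" shows "Hf n - BS n * (1 - P.prob {x. GC m x}) \<le> Hp m"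
proof -
  have "Hf n - BS n * (1 - P.prob {x. GC m x}) = P.expectation (\<lambda>x. sl n (lev n (x 0)) - BS n * (1 - of_bool (GC m x)))"
  proof -
    have a1: "P.expectation (\<lambda>x. BS n * (1 - of_bool (GC m x))) = BS n * (1 - P.prob {x. GC m x})"
      using P.prob_space by (simp add: of_bool_integrable expectation_of_bool)
    have a2: "integrable P (\<lambda>x. BS n * (1 - of_bool (GC m x)))"
      by (intro integrable_mult_right Bochner_Integration.integrable_diff) (auto intro!: of_bool_integrable)
    show ?thesis
      unfolding Hf_P Bochner_Integration.integral_diff[OF sl_integrable a2] a1 by (rule refl)
  qed
  also have "\<dots> \<le> Hp m"
    unfolding Hp_def
  proof (rule integral_mono_AE)
    show "AE x in P. sl n (lev n (x 0)) - BS n * (1 - of_bool (GC m x)) \<le> of_bool (GC m x) * sl m (lev m (x 0))"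
      using AE_nice by eventually_elim (use sl_mono[OF _ assms] sl_bound in auto)
    show "integrable P (\<lambda>x. sl n (lev n (x 0)) - BS n * (1 - of_bool (GC m x)))"
      by (intro integrable_mult_right Bochner_Integration.integrable_diff sl_integrable) (auto intro!: of_bool_integrable)
  qed (rule GC_sl_integrable)
  finally show ?thesis .
qed

lemma Hp_ge_ev: assumes "0 < \<epsilon>" shows "\<exists>m0. \<forall>m\<ge>m0. Hf n - \<epsilon> \<le> Hp m"
proof -
  have "(\<lambda>m. BS n * (1 - P.prob {x. GC m x})) \<longlonglongrightarrow> BS n * (1 - 1)"
    by (intro tendsto_intros prob_GC_lim)
  then have "eventually (\<lambda>m. BS n * (1 - P.prob {x. GC m x}) < \<epsilon>) sequentially"
    using assms by (intro order_tendstoD(2)) auto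
  then obtain m0 where "\<And>m. m \<ge> m0 \<Longrightarrow> BS n * (1 - P.prob {x. GC m x}) < \<epsilon>"
    by (auto simp: eventually_sequentially)
  then show ?thesis using Hp_ge[of n] by (intro exI[of _ "max m0 n"]) (smt (verit) max.bounded_iff)
qed

text \<open>Gaps are disjoint, and the sum is the density of the sites covered by those of length at
  most \<open>n\<close>.\<close>

lemma mean_gap: assumes "2 \<le> n" shows "(\<Sum>L\<in>{1..n}. p * u L * real L) \<le> 1"
proof -
  have "P.prob {x. GC n x} = P.expectation (\<lambda>x. \<Sum>L\<in>{1..n}. \<Sum>j<L. of_bool (gc n L j x))"
    unfolding of_bool_GC[OF assms] by (simp add: expectation_of_bool)
  also have "\<dots> = (\<Sum>L\<in>{1..n}. \<Sum>j<L. p * u L)"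
    by (simp add: of_bool_integrable expectation_of_bool prob_gc[OF assms] del: sum_of_bool_eq sum_mult_of_bool_eq sum_of_bool_mult_eq)
  finally have "(\<Sum>L\<in>{1..n}. p * u L * real L) = P.prob {x. GC n x}" by (simp add: mult_ac)
  then show ?thesis by simp
qed

lemma u_le1: "u L \<le> 1" by (simp add: u_def)

text \<open>The tangent bound \<open>ln y \<le> y - 1\<close> at \<open>y = 1 / (t * exp a)\<close>.
  With \<open>a = L\<close> it bounds the entropy of a law on the integers by its mean plus a
  convergent series.\<close>

lemma entropy_term: assumes "0 \<le> (t::real)" "t \<le> 1" shows "- (t * ln t) \<le> t * a + exp (- a)"
proof (cases "t = 0")
  case False
  then have t: "0 < t" using assms by simp
  have "ln (1 / (t * exp a)) \<le> 1 / (t * exp a) - 1" using t by (intro ln_le_minus_one) auto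
  then have "- ln t - a \<le> exp (- a) / t - 1" using t by (simp add: ln_div ln_mult exp_minus field_simps)
  then have "t * (- ln t - a) \<le> t * (exp (- a) / t - 1)" using t by (intro mult_left_mono) auto
  also have "\<dots> \<le> exp (- a)" using t by (simp add: field_simps)
  finally show ?thesis by (simp add: algebra_simps)
qed simp

text \<open>A gap has finite mean, so its length has finite entropy and the increasing sequence
  \<open>ss\<close> is bounded. Even for infinite alphabet entropy the term common to both rates can
  thus be cancelled at high levels.\<close>

lemma ss_Cauchy: "0 < \<epsilon> \<Longrightarrow> \<exists>M. \<forall>a\<ge>M. \<forall>b\<ge>M. \<bar>ss a - ss b\<bar> < \<epsilon>"
proof -
  assume "0 < \<epsilon>"
  have p1: "p \<le> 1" by (simp add: p_def)
  have tm: "0 \<le> - (u L * ln (u L))" for L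
    using u_nonneg[of L] u_le1[of L] by (cases "u L = 0") (auto simp: mult_nonneg_nonpos ln_le_zero_iff)
  have inc: "incseq ss"
  proof (rule incseq_SucI)
    fix n show "ss n \<le> ss (Suc n)"
      using tm[of "Suc n"] p_nonneg by (simp add: ss_def algebra_simps) (metis mult_nonneg_nonpos neg_0_le_iff_le)
  qed
  have "ss n \<le> 1 + (\<Sum>L. exp (- real L))" if n: "2 \<le> n" for n
  proof -
    have sm: "summable (\<lambda>L. exp (- real L))"
    proof -
      have "summable (\<lambda>L. exp (- 1 :: real) ^ L)" by (rule summable_geometric) simp
      then show ?thesis by (simp add: exp_of_nat_mult[symmetric])
    qed
    have "ss n = (\<Sum>L\<in>{1..n}. p * - (u L * ln (u L)))" by (simp add: ss_def sum_distrib_left sum_negf)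
    also have "\<dots> \<le> (\<Sum>L\<in>{1..n}. p * (u L * real L + exp (- real L)))"
      using entropy_term[OF u_nonneg u_le1] p_nonneg by (intro sum_mono mult_left_mono) auto
    also have "\<dots> = (\<Sum>L\<in>{1..n}. p * u L * real L) + (\<Sum>L\<in>{1..n}. p * exp (- real L))"
      by (simp add: sum.distrib algebra_simps)
    also have "(\<Sum>L\<in>{1..n}. p * exp (- real L)) \<le> (\<Sum>L\<in>{1..n}. exp (- real L))"
      using p1 p_nonneg by (intro sum_mono) (simp add: mult_left_le_one_le)
    also have "(\<Sum>L\<in>{1..n}. exp (- real L)) \<le> (\<Sum>L. exp (- real L))"
      by (rule sum_le_suminf[OF sm]) auto
    finally show ?thesis using mean_gap[OF n] by linarith
  qed
  note bnd = this
  have "ss n \<le> 1 + (\<Sum>L. exp (- real L))" for n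
    using bnd[of n] bnd[of 2] incseqD[OF inc, of n 2] by (cases "2 \<le> n") auto
  with inc have "convergent ss" by (metis incseq_convergent convergent_def)
  then have "Cauchy ss" by (rule convergent_Cauchy)
  then show ?thesis using \<open>0 < \<epsilon>\<close> unfolding Cauchy_def dist_real_def by blast
qed

text \<open>Both rates have the form \<open>Hp - ss\<close> with the same \<open>ss\<close>, and
  \<open>Hp\<close> comes close to \<open>Hf\<close>. Strict growth on the first side yields slack
  \<open>\<delta>\<close>; three errors of \<open>\<delta> / 4\<close> are charged to it, one from
  \<open>H\<close>, one from \<open>Hp\<close> against \<open>Hf\<close>, one from two values of
  \<open>ss\<close>. Since only finite levels are compared, infinite entropy is included.\<close>

lemma rate_compare:
  assumes "bernd \<nu> k" "bern.p \<nu> k = p"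
    and H: "\<And>n \<epsilon>. 0 < \<epsilon> \<Longrightarrow> \<exists>m. Hf n \<le> bernd.Hf \<nu> m + \<epsilon>"
    and n: "2 \<le> n"
  shows "\<exists>m\<ge>M. g n < bernd.g \<nu> k m"
proof -
  interpret N: bernd \<nu> k by fact
  have "N.u = u" using u_unique[OF N.bern_axioms assms(2)] by auto
  then have ss: "N.ss = ss" by (simp add: fun_eq_iff ss_def N.ss_def assms(2))
  obtain m1 where m1: "n \<le> m1" "g n < g m1" using g_strict[OF n] by blast
  define \<delta> where "\<delta> = g m1 - g n"
  have \<delta>: "0 < \<delta> / 4" using m1 by (simp add: \<delta>_def)
  obtain M0 where M0: "\<And>a b. a \<ge> M0 \<Longrightarrow> b \<ge> M0 \<Longrightarrow> \<bar>ss a - ss b\<bar> < \<delta> / 4" using ss_Cauchy[OF \<delta>] by blast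
  define m2 where "m2 = max m1 M0"
  have g2: "g m1 \<le> g m2" using m1 n by (intro g_mono) (auto simp: m2_def)
  obtain m3 where m3: "Hf m2 \<le> N.Hf m3 + \<delta> / 4" using H[OF \<delta>] by blast
  obtain m0 where m0: "\<And>m. m \<ge> m0 \<Longrightarrow> N.Hf m3 - \<delta> / 4 \<le> N.Hp m" using N.Hp_ge_ev[OF \<delta>] by blast
  define m where "m = Max {m0, M0, 2, M}"
  have m: "m0 \<le> m" "M0 \<le> m" "2 \<le> m" "M \<le> m" by (auto simp: m_def)
  have "N.g m = N.Hp m - ss m" using N.g_split[OF m(3)] ss by simp
  moreover have "g m2 = Hp m2 - ss m2" using n m1 by (intro g_split) (simp add: m2_def)
  moreover have "\<bar>ss m - ss m2\<bar> < \<delta> / 4" using M0[OF m(2)] by (simp add: m2_def)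
  ultimately have "N.g m \<ge> g m2 - 3 * (\<delta> / 4)" using Hp_le[of m2] m3 m0[OF m(1)] by linarith
  moreover have "g m2 \<ge> g n + \<delta>" using g2 by (simp add: \<delta>_def)
  ultimately have "g n < N.g m" using \<delta> by linarith
  then show ?thesis using m(4) by blast
qed

subsection \<open>Concentration\<close>

lemma dep_fI: "dep_on {a - int k..<a + int n} (\<lambda>x. fI n (sh a x))"
proof (rule dep_onI)
  fix x y :: "int \<Rightarrow> sym"
  assume e: "\<And>i. i \<in> {a - int k..<a + int n} \<Longrightarrow> x i = y i"
  have "cut k x a = cut k y a"
    by (rule dep_onD[OF dep_cut[of a "{a - int k..<a + int n}"]]) (use e in auto)
  moreover have "wrd n x a L = wrd n y a L" if "L \<le> n" for L
    by (rule dep_onD[OF dep_wrd[of a L "{a - int k..<a + int n}" "\<lambda>v. v"]]) (use e that in auto)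
  ultimately show "fI n (sh a x) = fI n (sh a y)"
    unfolding fI_def by (intro sum.cong) (auto simp: cut_sh wrd_sh)
qed

lemma indep_fI:
  assumes "\<And>i j. i \<in> I \<Longrightarrow> j \<in> I \<Longrightarrow> i \<noteq> j \<Longrightarrow> int n + int k \<le> \<bar>i - j\<bar>"
  shows "P.indep_vars (\<lambda>_. borel) (\<lambda>i x. fI n (sh i x)) I"
proof -
  define K where "K j = {j - int k..<j + int n}" for j :: int
  have disj: "disjoint_family_on K I"
    unfolding disjoint_family_on_def K_def using assms by fastforce
  have 1: "P.indep_vars (\<lambda>j. PiM (K j) (\<lambda>_. \<mu>)) (\<lambda>j x. restrict x (K j)) I"
    using P.indep_vars_restrict[OF indep_coord _ disj] by simp
  define x0 :: "int \<Rightarrow> sym" where "x0 = undefined"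
  define Y where "Y j r = fI n (sh j (\<lambda>i. if i \<in> K j then r i else x0 i))" for j r
  have "P.indep_vars (\<lambda>_. borel) (\<lambda>j x. Y j (restrict x (K j))) I"
  proof (rule P.indep_vars_compose2[OF 1])
    fix j assume "j \<in> I"
    have "(\<lambda>x. fI n (sh j x)) \<in> borel_measurable P" by measurable
    from measurable_compose[OF extend_measurable[of "K j" x0] this]
    show "Y j \<in> borel_measurable (PiM (K j) (\<lambda>_. \<mu>))" by (simp add: Y_def[abs_def])
  qed
  moreover have "Y j (restrict x (K j)) = fI n (sh j x)" for j x
    using dep_on_extend[OF dep_fI[of j n, folded K_def], of x x0] by (simp add: Y_def)
  ultimately show ?thesis by simp
qed

text \<open>\<open>fI n\<close> at a site looks at \<open>n + k\<close> sites, so the sites of one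
  residue class modulo \<open>w\<close> give independent bounded variables. Hoeffding's inequality
  is applied to each class, and the \<open>w\<close> bounds are added.\<close>

lemma concentration:
  assumes "0 < \<epsilon>" "1 \<le> L" "2 \<le> n"
  defines "w \<equiv> n + k"
  shows "P.prob {x. \<epsilon> * real L \<le> \<bar>(\<Sum>i<L. fI n (sh (a + int i) x)) - real L * g n\<bar>}
     \<le> 2 * real w * exp (- (2 * \<epsilon>\<^sup>2 / (real w * BB n)\<^sup>2) * real L)"
proof -
  define I where "I c = {i\<in>{..<L}. i mod w = c}" for c
  have w: "0 < w" using assms by (simp add: w_def)
  \<comment> \<open>A deviation of \<open>\<epsilon> * real L\<close> in total forces some class to
    deviate by at least this share.\<close>
  define t where "t = \<epsilon> * real L / real w"
  have t: "0 < t" using assms w by (simp add: t_def)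
  define E where "E c = {x. t \<le> \<bar>(\<Sum>i\<in>I c. fI n (sh (a + int i) x)) - real (card (I c)) * g n\<bar>}" for c
  have Em: "E c \<in> sets P" for c unfolding E_def by (rule sets_pred) measurable
  have un: "{..<L} = (\<Union>c<w. I c)" using w by (auto simp: I_def)
  have sumI: "(\<Sum>i<L. f i) = (\<Sum>c<w. \<Sum>i\<in>I c. f i)" for f :: "nat \<Rightarrow> real"
    unfolding un by (rule sum.UNION_disjoint) (auto simp: I_def)
  have sub: "{x. \<epsilon> * real L \<le> \<bar>(\<Sum>i<L. fI n (sh (a + int i) x)) - real L * g n\<bar>} \<subseteq> (\<Union>c<w. E c)"
  proof
    fix x assume x: "x \<in> {x. \<epsilon> * real L \<le> \<bar>(\<Sum>i<L. fI n (sh (a + int i) x)) - real L * g n\<bar>}"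
    show "x \<in> (\<Union>c<w. E c)"
    proof (rule ccontr)
      assume "x \<notin> (\<Union>c<w. E c)"
      then have lt: "\<bar>(\<Sum>i\<in>I c. fI n (sh (a + int i) x)) - real (card (I c)) * g n\<bar> < t" if "c < w" for c
        using that by (auto simp: E_def not_le)
      have "(\<Sum>i<L. fI n (sh (a + int i) x)) - real L * g n = (\<Sum>i<L. fI n (sh (a + int i) x) - g n)"
        by (simp add: sum_subtractf)
      also have "\<dots> = (\<Sum>c<w. (\<Sum>i\<in>I c. fI n (sh (a + int i) x)) - real (card (I c)) * g n)"
        unfolding sumI by (simp add: sum_subtractf)
      finally have "\<bar>(\<Sum>i<L. fI n (sh (a + int i) x)) - real L * g n\<bar>
        \<le> (\<Sum>c<w. \<bar>(\<Sum>i\<in>I c. fI n (sh (a + int i) x)) - real (card (I c)) * g n\<bar>)" by simp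
      also have "\<dots> < (\<Sum>c<w. t)" using lt w by (intro sum_strict_mono) auto
      also have "\<dots> = \<epsilon> * real L" using w by (simp add: t_def)
      finally show False using x by simp
    qed
  qed
  have hoef: "P.prob (E c) \<le> 2 * exp (- (2 * \<epsilon>\<^sup>2 / (real w * BB n)\<^sup>2) * real L)" if "c < w" for c
  proof (cases "I c = {}")
    case True
    then have "E c = {}" using t by (simp add: E_def)
    then show ?thesis by simp
  next
    case False
    have fin: "finite (I c)" by (simp add: I_def)
    define J where "J = (\<lambda>i. a + int i) ` I c"
    have injJ: "inj_on (\<lambda>i. a + int i) (I c)" by (auto simp: inj_on_def)
    have ind: "P.indep_vars (\<lambda>_. borel) (\<lambda>i x. fI n (sh i x)) J"
    proof (rule indep_fI)
      fix i j assume "i \<in> J" "j \<in> J" "i \<noteq> j"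
      then obtain i' j' where ij: "i = a + int i'" "j = a + int j'" "i' mod w = j' mod w" "i' \<noteq> j'"
        by (auto simp: J_def I_def)
      have "int w dvd int i' - int j'" using ij(3) by (metis mod_eq_dvd_iff zmod_int)
      then have "int w \<le> \<bar>int i' - int j'\<bar>" using ij(4) by (intro zdvd_imp_le) auto
      then show "int n + int k \<le> \<bar>i - j\<bar>" using ij by (simp add: w_def)
    qed
    have ex: "P.expectation (\<lambda>x. fI n (sh j x)) = g n" for j unfolding g_def by (rule expectation_sh) simp
    interpret H: Hoeffding_ineq P J "\<lambda>i x. fI n (sh i x)" "\<lambda>_. 0" "\<lambda>_. BB n" "real (card J) * g n"
    proof unfold_locales
      show "finite J" using fin by (simp add: J_def)
      show "P.indep_vars (\<lambda>_. borel) (\<lambda>i x. fI n (sh i x)) J" by (rule ind)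
      show "AE x in P. fI n (sh i x) \<in> {0..BB n}" if "i \<in> J" for i using fI_bounds by auto
      show "real (card J) * g n \<equiv> \<Sum>i\<in>J. P.expectation (\<lambda>x. fI n (sh i x))" by (simp add: ex)
    qed
    have cJ: "card J = card (I c)" unfolding J_def by (rule card_image[OF injJ])
    have sumJ: "(\<Sum>j\<in>J. fI n (sh j x)) = (\<Sum>i\<in>I c. fI n (sh (a + int i) x))" for x
      unfolding J_def by (simp add: sum.reindex[OF injJ])
    have cpos: "0 < card J" using False fin cJ by (simp add: card_gt_0_iff)
    have cle: "card J \<le> L" unfolding cJ using card_mono[of "{..<L}" "I c"] by (auto simp: I_def)
    have "P.prob (E c) \<le> 2 * exp (- 2 * t\<^sup>2 / (\<Sum>i\<in>J. (BB n - 0)\<^sup>2))"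
    proof -
      have pos: "0 < (\<Sum>i\<in>J. (BB n - 0)\<^sup>2)" using cpos BB_pos[of n] by simp
      show ?thesis
        using H.Hoeffding_ineq_abs_ge[OF less_imp_le[OF t] pos] unfolding E_def sumJ cJ[symmetric] by simp
    qed
    also have "\<dots> \<le> 2 * exp (- (2 * \<epsilon>\<^sup>2 / (real w * BB n)\<^sup>2) * real L)"
    proof -
      have "2 * \<epsilon>\<^sup>2 / (real w * BB n)\<^sup>2 * real L = 2 * t\<^sup>2 / (real L * (BB n)\<^sup>2)"
        using assms(2) w by (simp add: t_def power_mult_distrib power_divide power2_eq_square[of "real L"])
      also have "\<dots> \<le> 2 * t\<^sup>2 / (real (card J) * (BB n)\<^sup>2)"
        using cpos cle BB_pos[of n] by (intro divide_left_mono mult_right_mono) auto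
      finally show ?thesis by simp
    qed
    finally show ?thesis .
  qed
  have "P.prob {x. \<epsilon> * real L \<le> \<bar>(\<Sum>i<L. fI n (sh (a + int i) x)) - real L * g n\<bar>} \<le> P.prob (\<Union>c<w. E c)"
    by (rule P.finite_measure_mono[OF sub]) (use Em in auto)
  also have "\<dots> \<le> (\<Sum>c<w. P.prob (E c))" by (rule P.finite_measure_subadditive_finite) (use Em in auto)
  also have "\<dots> \<le> (\<Sum>c<w. 2 * exp (- (2 * \<epsilon>\<^sup>2 / (real w * BB n)\<^sup>2) * real L))" using hoef by (intro sum_mono) auto
  finally show ?thesis by simp
qed

definition atyp :: "nat \<Rightarrow> real \<Rightarrow> nat \<Rightarrow> (int \<Rightarrow> sym) \<Rightarrow> bool" where
  "atyp n \<epsilon> T x \<longleftrightarrow> (\<exists>L\<ge>T. \<exists>m\<le>L. \<epsilon> * real L \<le> \<bar>(\<Sum>i<L. fI n (sh (- int m + int i) x)) - real L * g n\<bar>)"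

lemma atyp_meas [measurable]: "Measurable.pred P (atyp n \<epsilon> T)"
  unfolding atyp_def[abs_def] by measurable

text \<open>There are \<open>L + 1\<close> windows of length \<open>L\<close>, each deviating with
  probability exponentially small in \<open>L\<close>; the union over \<open>L \<ge> T\<close> is
  bounded by the tail of a convergent series.\<close>

lemma prob_atyp:
  assumes "0 < \<epsilon>" "2 \<le> n" "0 < \<eta>" shows "\<exists>T0. \<forall>T\<ge>T0. P.prob {x. atyp n \<epsilon> T x} < \<eta>"
proof -
  define C where "C = 2 * real (n + k)"
  define cc where "cc = 2 * \<epsilon>\<^sup>2 / (real (n + k) * BB n)\<^sup>2"
  have cc: "0 < cc" using assms BB_pos[of n] by (simp add: cc_def)
  define f where "f L = real (Suc L) * (C * exp (- cc * real L))" for L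
  have "summable (\<lambda>L. of_nat (Suc L) * exp (- cc) ^ L :: real)"
  proof -
    have "summable (\<lambda>n. diffs (\<lambda>_. 1) n * exp (- cc) ^ n)"
      using cc by (intro termdiff_converges[of _ 1]) (auto intro!: summable_geometric)
    then show ?thesis by (simp add: diffs_def)
  qed
  then have sf: "summable f"
    unfolding f_def by (auto simp: exp_of_nat_mult[symmetric] mult_ac intro!: summable_mult[of _ C])
  obtain T1 where T1: "\<And>T. T \<ge> T1 \<Longrightarrow> norm (\<Sum>i. f (i + T)) < \<eta>"
    using suminf_exist_split[OF assms(3) sf] by blast
  have "P.prob {x. atyp n \<epsilon> T x} < \<eta>" if T: "T \<ge> max T1 1" for T
  proof -
    define E where "E L m = {x. \<epsilon> * real L \<le> \<bar>(\<Sum>i<L. fI n (sh (- int m + int i) x)) - real L * g n\<bar>}" for L m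
    have Em: "E L m \<in> sets P" for L m unfolding E_def by (rule sets_pred) measurable
    define A where "A i = (\<Union>m\<le>i + T. E (i + T) m)" for i
    have Am: "A i \<in> sets P" for i using Em by (auto simp: A_def)
    have Ale: "P.prob (A i) \<le> f (i + T)" for i
    proof -
      have "P.prob (A i) \<le> (\<Sum>m\<le>i + T. P.prob (E (i + T) m))"
        unfolding A_def by (rule P.finite_measure_subadditive_finite) (use Em in auto)
      also have "\<dots> \<le> (\<Sum>m\<le>i + T. C * exp (- cc * real (i + T)))"
      proof (rule sum_mono)
        fix m
        show "P.prob (E (i + T) m) \<le> C * exp (- cc * real (i + T))"
          unfolding E_def C_def cc_def
          by (rule concentration[OF assms(1) _ assms(2), of "i + T" "- int m"]) (use T in auto)
      qed
      finally show ?thesis by (simp add: f_def)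
    qed
    have sfT: "summable (\<lambda>i. f (i + T))" using sf by (simp add: summable_iff_shift)
    have sA: "summable (\<lambda>i. P.prob (A i))"
      by (rule summable_comparison_test'[OF sfT, of 0]) (use Ale in auto)
    have "{x. atyp n \<epsilon> T x} = (\<Union>i. A i)"
    proof (intro equalityI subsetI)
      fix x assume "x \<in> {x. atyp n \<epsilon> T x}"
      then obtain L m where Lm: "T \<le> L" "m \<le> L" "x \<in> E L m" by (auto simp: atyp_def E_def)
      then have "x \<in> A (L - T)" by (auto simp: A_def)
      then show "x \<in> (\<Union>i. A i)" by blast
    next
      fix x assume "x \<in> (\<Union>i. A i)"
      then obtain i m where "m \<le> i + T" "x \<in> E (i + T) m" by (auto simp: A_def)
      then show "x \<in> {x. atyp n \<epsilon> T x}" unfolding atyp_def E_def mem_Collect_eq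
        by (intro exI[of _ "i + T"] conjI exI[of _ m]) simp_all
    qed
    then have "P.prob {x. atyp n \<epsilon> T x} = P.prob (\<Union>i. A i)" by simp
    also have "\<dots> \<le> (\<Sum>i. P.prob (A i))"
      by (rule P.finite_measure_subadditive_countably[OF _ sA]) (use Am in auto)
    also have "\<dots> \<le> (\<Sum>i. f (i + T))" by (rule suminf_le[OF Ale sA sfT])
    also have "\<dots> < \<eta>" using T1[of T] T by simp
    finally show ?thesis .
  qed
  then show ?thesis by blast
qed

text \<open>A cut somewhere to the left of 0 contradicts \<open>CC\<close> for all large thresholds,
  so the events decrease to a null set.\<close>

lemma kappa_lim: "kappa \<longlonglongrightarrow> 0"
proof -
  have "(\<lambda>N. P.prob {x. CC k N x 0}) \<longlonglongrightarrow> P.prob (\<Inter>N. {x. CC k N x 0})"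
  proof (rule P.finite_Lim_measure_decseq)
    show "range (\<lambda>N. {x. CC k N x 0}) \<subseteq> sets P" using sets_CC by auto
    show "decseq (\<lambda>N. {x. CC k N x 0})" by (rule decseq_SucI) (auto intro: CC_mono[OF le_SucI[OF order_refl]])
  qed
  moreover have "P.prob (\<Inter>N. {x. CC k N x 0}) = 0"
  proof -
    have "AE x in P. x \<notin> (\<Inter>N. {x. CC k N x 0})"
      using AE_nice
    proof eventually_elim
      case (elim x)
      then obtain j where j: "j \<le> -1" "CC k 0 x j" unfolding nice_def by blast
      have "\<not> CC k (nat (- j)) x 0"
      proof
        assume "CC k (nat (- j)) x 0"
        moreover have "nat (- j) \<in> {1..nat (- j)}" "0 - int (nat (- j)) = j" using j by auto
        ultimately have "\<not> cut k x j" unfolding CC_def by metis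
        then show False using j by (auto dest: CC_cut)
      qed
      then show ?case by blast
    qed
    then show ?thesis by (subst P.prob_eq_0) (auto intro!: sets_CC)
  qed
  ultimately show ?thesis by (simp add: kappa_def[abs_def])
qed

end

subsection \<open>Label laws along blocks\<close>

lemma prob_bind_le:
  assumes "\<And>x. x \<in> set_pmf q \<Longrightarrow> measure_pmf.prob (f x) A \<le> B" "0 \<le> B"
  shows "measure_pmf.prob (bind_pmf q f) A \<le> B"
proof -
  have "emeasure (measure_pmf (bind_pmf q f)) A = (\<integral>\<^sup>+x. emeasure (measure_pmf (f x)) A \<partial>measure_pmf q)"
    by (rule emeasure_bind_pmf)
  also have "\<dots> \<le> (\<integral>\<^sup>+x. ennreal B \<partial>measure_pmf q)"
    by (rule nn_integral_mono_AE) (use assms in \<open>auto simp: AE_measure_pmf_iff measure_pmf.emeasure_eq_measure ennreal_leI\<close>)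
  also have "\<dots> = ennreal B" by simp
  finally show ?thesis using assms(2) by (simp add: measure_pmf.emeasure_eq_measure)
qed

lemma sum_lessThan_add: "(\<Sum>i<m + l. f i) = (\<Sum>i<m. f i) + (\<Sum>i<l. f (m + i) :: real)" for m l :: nat
  by (induction l) (simp_all add: add.assoc)

context side
begin

text \<open>Inside a block, cuts occur only at the first sites of its gaps, and at such a site just
  one length \<open>L\<close> can contribute.\<close>

lemma infS_fI:
  assumes "2 \<le> n" "cut k x s" "wrd n x s (bsize F) = concat F" "\<forall>W\<in>set F. gapw k W"
  shows "infS n F = (\<Sum>i<bsize F. fI n (sh (s + int i) x))"
  using assms(2-)
proof (induction F arbitrary: s)
  case Nil
  then show ?case by (simp add: infS_def)
next
  case (Cons W F)
  have w: "wrd n x s (length W) = W" and wF: "wrd n x (s + int (length W)) (bsize F) = concat F"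
    using Cons.prems(2) unfolding wrd_Cons_fill by auto
  have gW: "gapw k W" using Cons.prems by simp
  have W1: "1 \<le> length W" using gapw_length[OF gW] k1 by simp
  have c: "cut k x (s + int (length W))" and nc: "\<forall>l\<in>{1..<length W}. \<not> cut k x (s + int l)"
    using cut_gapw[OF assms(1) k1 Cons.prems(1) W1] gW w by auto
  have only: "gapw k (wrd n x s L) \<longleftrightarrow> L = length W" if "1 \<le> L" for L
  proof
    assume "gapw k (wrd n x s L)"
    then have L: "cut k x (s + int L)" "\<forall>l\<in>{1..<L}. \<not> cut k x (s + int l)"
      using cut_gapw[OF assms(1) k1 Cons.prems(1) that] by auto
    have "\<not> L < length W" using nc L(1) that by auto
    moreover have "\<not> length W < L" using L(2) c W1 by auto
    ultimately show "L = length W" by simp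
  qed (use gW w in simp)
  have id: "map (take n) W = W" using wrd_coarse[of n n x s "length W"] w by simp
  have 0: "fI n (sh s x) = inf1 n W"
  proof -
    have "fI n (sh s x) = (\<Sum>L\<in>{1..n}. if L = length W then - ln (pmf (G n (length W)) W) else 0)"
      unfolding fI_def by (rule sum.cong[OF refl]) (use only w Cons.prems(1) in \<open>auto simp: cut_sh wrd_sh\<close>)
    also have "\<dots> = inf1 n W" using W1 by (simp add: inf1_def id)
    finally show ?thesis .
  qed
  have z: "fI n (sh (s + int i) x) = 0" if "i \<in> {1..<length W}" for i
  proof -
    have "\<not> cut k (sh (s + int i) x) 0" using nc that by (simp add: cut_sh)
    then show ?thesis by (simp add: fI_def)
  qed
  obtain l where l: "length W = Suc l" using W1 by (cases "length W") auto
  have e1: "(\<Sum>i<length W. fI n (sh (s + int i) x)) = fI n (sh s x) + (\<Sum>i<l. fI n (sh (s + int (Suc i)) x))"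
    unfolding l by (subst sum.lessThan_Suc_shift) simp
  have e2: "(\<Sum>i<l. fI n (sh (s + int (Suc i)) x)) = 0"
  proof (intro sum.neutral ballI)
    fix i assume "i \<in> {..<l}"
    then show "fI n (sh (s + int (Suc i)) x) = 0" by (intro z) (simp add: l)
  qed
  have W: "(\<Sum>i<length W. fI n (sh (s + int i) x)) = inf1 n W"
    by (simp only: e1 e2 0 add_0_right)
  have "(\<Sum>i<bsize (W # F). fI n (sh (s + int i) x))
    = (\<Sum>i<length W. fI n (sh (s + int i) x)) + (\<Sum>i<bsize F. fI n (sh (s + int (length W) + int i) x))"
    using sum_lessThan_add[of "\<lambda>i. fI n (sh (s + int i) x)" "length W" "bsize F"]
    by (simp add: add.assoc)
  also have "\<dots> = inf1 n W + infS n F"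
  proof -
    have IH: "infS n F = (\<Sum>i<bsize F. fI n (sh (s + int (length W) + int i) x))"
      by (rule Cons.IH[OF c wF]) (use Cons.prems(3) in auto)
    show ?thesis by (simp only: W IH)
  qed
  finally show ?case by (simp add: infS_def del: sh_apply)
qed

definition dat :: "nat \<Rightarrow> (int \<Rightarrow> sym) \<Rightarrow> nat \<times> nat list \<times> lab" where
  "dat r x = (\<lambda>(j, F). (j, map length F, lb r F)) (bd k (N r) (lv r) x)"

definition DD :: "nat \<Rightarrow> (nat \<times> nat list \<times> lab) pmf" where "DD r = rvpmf P (dat r)"

lemma bd_meas' [measurable]: "bd k (N r) (lv r) \<in> measurable P (count_space UNIV)"
  by (rule bd_meas[OF lv2])

lemma dat_meas [measurable]: "dat r \<in> measurable P (count_space UNIV)"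
  unfolding dat_def[abs_def] by (rule measurable_compose[OF bd_meas']) simp

lemma prob_DD: "measure_pmf.prob (DD r) A = P.prob {x. dat r x \<in> A}"
  unfolding DD_def by (subst prob_rvpmf) (auto simp: P.prob_space_axioms)

lemma DD_bind: "DD r = bind_pmf (KP (N r)) (\<lambda>(j, S). map_pmf (\<lambda>\<alpha>. (j, S, \<alpha>)) (LL r S))"
proof -
  have "DD r = map_pmf (\<lambda>(j, F). (j, map length F, lb r F)) (BD (N r) (lv r))"
    unfolding BD_def DD_def by (subst map_rvpmf) (auto simp: P.prob_space_axioms dat_def[abs_def])
  also have "\<dots> = bind_pmf (KP (N r)) (\<lambda>z. map_pmf (\<lambda>(j, F). (j, map length F, lb r F)) (case z of (j, S) \<Rightarrow> map_pmf (Pair j) (FW (lv r) S)))"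
    unfolding BD_bind[OF lv2] map_bind_pmf by simp
  also have "\<dots> = bind_pmf (KP (N r)) (\<lambda>(j, S). map_pmf (\<lambda>\<alpha>. (j, S, \<alpha>)) (LL r S))"
  proof (rule bind_pmf_cong[OF refl])
    fix z assume z: "z \<in> set_pmf (KP (N r))"
    obtain j S where jS: "z = (j, S)" by fastforce
    have ok: "okS S" using set_KP[of j S "N r"] z jS by simp
    show "map_pmf (\<lambda>(j, F). (j, map length F, lb r F)) (case z of (j, S) \<Rightarrow> map_pmf (Pair j) (FW (lv r) S))
       = (case z of (j, S) \<Rightarrow> map_pmf (\<lambda>\<alpha>. (j, S, \<alpha>)) (LL r S))"
      unfolding jS LL_def by (auto simp: pmf.map_comp o_def set_FW[OF lv2 ok] intro!: map_pmf_cong)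
  qed
  finally show ?thesis .
qed

text \<open>There are two ways for the block at site 0 to fail. Either it is shorter than
  \<open>T r\<close>, and then it starts fewer than \<open>T r\<close> sites back, or the average of
  \<open>fI\<close> over it is off by at least \<open>dl\<close>.\<close>

lemma bd_untyp_subset:
  assumes "nice x" "fl r" "c r = g (lv (Suc r)) + dl" "bd k (N (Suc r)) (lv (Suc r)) x = (j, F)"
    and bad: "\<not> (typl r F \<and> (g (lv (Suc r)) - dl) * real (bsize F) \<le> infS (lv (Suc r)) F)"
  shows "atyp (lv (Suc r)) dl (T r) x \<or> (\<exists>j<T r. CC k (N (Suc r)) x (- int j))"
proof -
  let ?n = "lv (Suc r)"
  have b: "isblk k (N (Suc r)) ?n x j F" using nice_isblk[OF assms(1) lv2, of "N (Suc r)" "Suc r"] assms(4) by simp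
  have i: "infS ?n F = (\<Sum>i<bsize F. fI ?n (sh (- int j + int i) x))"
    by (rule infS_fI[OF lv2]) (use b in \<open>auto simp: isblk_def dest: CC_cut\<close>)
  show ?thesis
  proof (cases "T r \<le> bsize F")
    case False
    then show ?thesis using b by (auto simp: isblk_def)
  next
    case True
    then have "\<not> (infS ?n F \<le> (g ?n + dl) * real (bsize F) \<and> (g ?n - dl) * real (bsize F) \<le> infS ?n F)"
      using bad assms(2,3) by (auto simp: typl_def)
    then have "dl * real (bsize F) \<le> \<bar>infS ?n F - real (bsize F) * g ?n\<bar>"
      by (simp add: algebra_simps abs_real_def) linarith
    then show ?thesis unfolding atyp_def i using True b
      by (intro disjI1 exI[of _ "bsize F"] conjI exI[of _ j]) (auto simp: isblk_def)
  qed
qed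

lemma prob_untyp:
  assumes "fl r" "c r = g (lv (Suc r)) + dl"
  shows "P.prob {x. \<not> (typl r (snd (bd k (N (Suc r)) (lv (Suc r)) x)) \<and>
      (g (lv (Suc r)) - dl) * real (bsize (snd (bd k (N (Suc r)) (lv (Suc r)) x))) \<le> infS (lv (Suc r)) (snd (bd k (N (Suc r)) (lv (Suc r)) x)))}
    \<le> P.prob {x. atyp (lv (Suc r)) dl (T r) x} + real (T r) * kappa (N (Suc r))"
proof -
  let ?Q = "\<lambda>x. \<not> (typl r (snd (bd k (N (Suc r)) (lv (Suc r)) x)) \<and>
      (g (lv (Suc r)) - dl) * real (bsize (snd (bd k (N (Suc r)) (lv (Suc r)) x))) \<le> infS (lv (Suc r)) (snd (bd k (N (Suc r)) (lv (Suc r)) x)))"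
  have "P.prob {x. ?Q x} \<le> P.prob ({x. atyp (lv (Suc r)) dl (T r) x} \<union> (\<Union>j<T r. {x. CC k (N (Suc r)) x (- int j)}))"
  proof (rule P.finite_measure_mono_AE)
    show "AE x in P. x \<in> {x. ?Q x} \<longrightarrow> x \<in> {x. atyp (lv (Suc r)) dl (T r) x} \<union> (\<Union>j<T r. {x. CC k (N (Suc r)) x (- int j)})"
      using AE_nice
    proof eventually_elim
      case (elim x)
      show ?case using bd_untyp_subset[OF elim assms, of "fst (bd k (N (Suc r)) (lv (Suc r)) x)" "snd (bd k (N (Suc r)) (lv (Suc r)) x)"]
        by auto
    qed
  qed (auto intro!: sets_pred sets_CC)
  also have "\<dots> \<le> P.prob {x. atyp (lv (Suc r)) dl (T r) x} + P.prob (\<Union>j<T r. {x. CC k (N (Suc r)) x (- int j)})"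
    by (rule measure_Un_le) (auto intro!: sets_pred sets_CC)
  also have "P.prob (\<Union>j<T r. {x. CC k (N (Suc r)) x (- int j)}) \<le> (\<Sum>j<T r. P.prob {x. CC k (N (Suc r)) x (- int j)})"
    by (rule P.finite_measure_subadditive_finite) (auto intro!: sets_CC)
  also have "\<dots> = real (T r) * kappa (N (Suc r))" by (simp add: prob_CC)
  finally show ?thesis by simp
qed

lemma pmf_LL_Some:
  assumes "okS S" shows "pmf (LL (Suc r) S) (Nd (Some F) ps) \<le> pmf (map_pmf (rv (lv (Suc r))) (FW (lv (Suc r)) S)) F"
proof -
  have "pmf (LL (Suc r) S) (Nd (Some F) ps) = measure_pmf.prob (FW (lv (Suc r)) S) {F'. lb (Suc r) F' = Nd (Some F) ps}"
    by (simp add: LL_def pmf_map vimage_def del: lb.simps)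
  also have "\<dots> \<le> measure_pmf.prob (FW (lv (Suc r)) S) {F'. rv (lv (Suc r)) F' = F}"
    by (rule measure_pmf.finite_measure_mono) (auto split: if_splits)
  also have "\<dots> = pmf (map_pmf (rv (lv (Suc r))) (FW (lv (Suc r)) S)) F" by (simp add: pmf_map vimage_def)
  finally show ?thesis .
qed

text \<open>At most \<open>exp (d * length)\<close> labels are ambiguous, and typical labels have mass at most
  \<open>exp (- e * length)\<close> with \<open>e > d\<close>.\<close>

lemma prob_ambiguous:
  fixes d :: real and A :: "nat list \<Rightarrow> lab set"
  assumes fl: "fl r" and c: "c r = g (lv (Suc r)) + dl" and de: "d < g (lv (Suc r)) - dl"
    and A: "\<And>S. okS S \<Longrightarrow> A S \<subseteq> set_pmf (LL (Suc r) S)"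
    and card: "\<And>S. okS S \<Longrightarrow> real (card (A S)) \<le> exp (d * real (sum_list S))"
  shows "P.prob {x. snd (snd (dat (Suc r) x)) \<in> A (fst (snd (dat (Suc r) x)))}
    \<le> exp (- (g (lv (Suc r)) - dl - d) * real (T r)) + (P.prob {x. atyp (lv (Suc r)) dl (T r) x} + real (T r) * kappa (N (Suc r)))"
proof -
  let ?n = "lv (Suc r)" and ?e = "g (lv (Suc r)) - dl"
  \<comment> \<open>The lower bound on the information is not part of \<open>typl\<close>. It is the
    half of typicality that caps the mass of a single label.\<close>
  define nl where "nl S = {\<alpha>. T r \<le> sum_list S \<and> (\<exists>F ps. \<alpha> = Nd (Some F) ps \<and> ?e * real (sum_list S) \<le> infS ?n F)}" for S
  let ?U = "\<lambda>x. \<not> (typl r (snd (bd k (N (Suc r)) ?n x)) \<and>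
      ?e * real (bsize (snd (bd k (N (Suc r)) ?n x))) \<le> infS ?n (snd (bd k (N (Suc r)) ?n x)))"
  let ?V = "\<lambda>x. dat (Suc r) x \<in> {(j, S, \<alpha>). \<alpha> \<in> A S \<inter> nl S}"
  have "P.prob {x. snd (snd (dat (Suc r) x)) \<in> A (fst (snd (dat (Suc r) x)))} \<le> P.prob ({x. ?V x} \<union> {x. ?U x})"
  proof (rule P.finite_measure_mono)
    show "{x. snd (snd (dat (Suc r) x)) \<in> A (fst (snd (dat (Suc r) x)))} \<subseteq> {x. ?V x} \<union> {x. ?U x}"
    proof (intro subsetI UnCI)
      fix x assume x: "x \<in> {x. snd (snd (dat (Suc r) x)) \<in> A (fst (snd (dat (Suc r) x)))}" "x \<notin> {x. ?U x}"
      obtain j F where b: "bd k (N (Suc r)) ?n x = (j, F)" by fastforce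
      have t: "typl r F" "?e * real (bsize F) \<le> infS ?n F" using x(2) b by auto
      then have "T r \<le> sum_list (map length F)" "lb (Suc r) F = Nd (Some (rv ?n F)) (map (lb r) (lgrp (N r) F))"
        by (auto simp: typl_def length_concat_map)
      then have "lb (Suc r) F \<in> nl (map length F)" using t by (simp add: nl_def infS_rv length_concat_map)
      then show "x \<in> {x. ?V x}" using x(1) b by (simp add: dat_def)
    qed
    have "Measurable.pred P ?V" by measurable
    moreover have "Measurable.pred P ?U" by measurable
    ultimately show "{x. ?V x} \<union> {x. ?U x} \<in> sets P" by (intro sets.Un sets_pred)
  qed
  also have "\<dots> \<le> P.prob {x. ?V x} + P.prob {x. ?U x}"
    by (rule measure_Un_le) (rule sets_pred, measurable)+
  also have "P.prob {x. ?V x} \<le> exp (- (?e - d) * real (T r))"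
  proof -
    have "P.prob {x. ?V x} = measure_pmf.prob (DD (Suc r)) {(j, S, \<alpha>). \<alpha> \<in> A S \<inter> nl S}"
      by (simp only: prob_DD)
    also have "\<dots> \<le> exp (- (?e - d) * real (T r))"
      unfolding DD_bind
    proof (rule prob_bind_le)
      fix z assume z: "z \<in> set_pmf (KP (N (Suc r)))"
      obtain j S where jS: "z = (j, S)" by fastforce
      have ok: "okS S" using set_KP[of j S "N (Suc r)"] z jS by simp
      have "measure_pmf.prob (LL (Suc r) S) (A S \<inter> nl S) \<le> exp (- (?e - d) * real (T r))"
      proof (cases "T r \<le> sum_list S")
        case False
        then have "A S \<inter> nl S = {}" by (simp add: nl_def)
        then show ?thesis by simp
      next
        case True
        have finA: "finite (A S)" using A[OF ok] finite_LL[OF ok] finite_subset by blast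
        have le: "pmf (LL (Suc r) S) \<alpha> \<le> exp (- ?e * real (sum_list S))" if "\<alpha> \<in> A S \<inter> nl S" for \<alpha>
        proof -
          note h = that
          obtain F ps where F: "\<alpha> = Nd (Some F) ps" "?e * real (sum_list S) \<le> infS ?n F" using h by (auto simp: nl_def)
          have "\<alpha> \<in> set_pmf (LL (Suc r) S)" using h A[OF ok] by blast
          then obtain F' where F': "F' \<in> set_pmf (FW ?n S)" "\<alpha> = lb (Suc r) F'" unfolding set_LL by blast
          then have FF: "F = rv ?n F'" using F(1) by (auto split: if_splits)
          have "pmf (LL (Suc r) S) \<alpha> \<le> pmf (map_pmf (rv ?n) (FW ?n S)) F" unfolding F(1) by (rule pmf_LL_Some[OF ok])
          also have "\<dots> = exp (- infS ?n F')" unfolding FF by (rule infS_pmf[OF lv2 ok F'(1)])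
          also have "\<dots> \<le> exp (- ?e * real (sum_list S))" using F(2) FF by (simp add: infS_rv left_diff_distrib)
          finally show ?thesis .
        qed
        have "measure_pmf.prob (LL (Suc r) S) (A S \<inter> nl S) = (\<Sum>\<alpha>\<in>A S \<inter> nl S. pmf (LL (Suc r) S) \<alpha>)"
          using finA by (intro measure_measure_pmf_finite) auto
        also have "\<dots> \<le> real (card (A S \<inter> nl S)) * exp (- ?e * real (sum_list S))"
          using le by (rule sum_bounded_above)
        also have "\<dots> \<le> real (card (A S)) * exp (- ?e * real (sum_list S))"
          using card_mono[OF finA, of "A S \<inter> nl S"] by (intro mult_right_mono) auto
        also have "\<dots> \<le> exp (d * real (sum_list S)) * exp (- ?e * real (sum_list S))"
          using card[OF ok] by (intro mult_right_mono) auto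
        also have "\<dots> = exp (- ((?e - d) * real (sum_list S)))" by (simp add: exp_add[symmetric] algebra_simps)
        also have "\<dots> \<le> exp (- (?e - d) * real (T r))"
        proof -
          have "(?e - d) * real (T r) \<le> (?e - d) * real (sum_list S)" using de True by (intro mult_left_mono) auto
          then show ?thesis by (simp only: exp_le_cancel_iff minus_mult_left[symmetric] neg_le_iff_le)
        qed
        finally show ?thesis .
      qed
      then show "measure_pmf.prob (case z of (j, S) \<Rightarrow> map_pmf (\<lambda>\<alpha>. (j, S, \<alpha>)) (LL (Suc r) S)) {(j, S, \<alpha>). \<alpha> \<in> A S \<inter> nl S} \<le> exp (- (?e - d) * real (T r))"
        by (simp add: jS vimage_def Int_def)
    qed simp
    finally show ?thesis .
  qed
  also have "P.prob {x. ?U x} \<le> P.prob {x. atyp ?n dl (T r) x} + real (T r) * kappa (N (Suc r))"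
    by (rule prob_untyp[OF fl c])
  finally show ?thesis by simp
qed

end

subsection \<open>Coupled labels\<close>

definition amb :: "('a \<Rightarrow> 'b \<Rightarrow> bool) \<Rightarrow> 'b set \<Rightarrow> 'a \<Rightarrow> bool" where
  "amb R B a \<longleftrightarrow> (\<exists>b\<in>B. \<exists>b'\<in>B. b \<noteq> b' \<and> R a b \<and> R a b')"

lemma (in side) nice_dat:
  assumes "nice x" "dat r x = (j, S, \<alpha>)"
  shows "okS S" "\<alpha> \<in> set_pmf (LL r S)" "j < sum_list S" "bvs (N r) S"
    "\<exists>F. bd k (N r) (lv r) x = (j, F) \<and> isblk k (N r) (lv r) x j F \<and> S = map length F \<and> \<alpha> = lb r F \<and> F \<in> set_pmf (FW (lv r) S)"
proof -
  obtain j' F where b: "bd k (N r) (lv r) x = (j', F)" by fastforce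
  have blk: "isblk k (N r) (lv r) x j' F" using nice_isblk[OF assms(1) lv2, of "N r" r] b by simp
  have e: "j' = j" "S = map length F" "\<alpha> = lb r F" using assms(2) b by (auto simp: dat_def)
  show "okS S" using nice_blk_FW(1)[OF assms(1) blk lv2] e by simp
  show "\<alpha> \<in> set_pmf (LL r S)" using nice_blk_FW(2)[OF assms(1) blk lv2] e by (auto simp: set_LL)
  show "j < sum_list S" "bvs (N r) S" using blk e by (auto simp: isblk_def length_concat_map)
  show "\<exists>F. bd k (N r) (lv r) x = (j, F) \<and> isblk k (N r) (lv r) x j F \<and> S = map length F \<and> \<alpha> = lb r F \<and> F \<in> set_pmf (FW (lv r) S)"
    using nice_blk_FW(2)[OF assms(1) blk lv2] e b blk by auto
qed

locale two_sides = X: side \<mu> k lv N T c upd + Y: side \<nu> k lv N T c upd'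
  for \<mu> \<nu> k lv N T c upd upd' +
  assumes p_eq: "Y.p = X.p" and upd': "upd' r = (\<not> upd r)"
begin

lemma u_eq: "Y.u = X.u" using X.u_unique[OF Y.bern_axioms p_eq] by auto

lemma okS_eq: "Y.okS = X.okS" by (simp add: fun_eq_iff X.okS_def Y.okS_def u_eq)

lemma KP_eq: "Y.KP = X.KP" using X.KP_unique[OF Y.bernd_axioms p_eq] by auto

definition base :: "(nat list \<Rightarrow> lab \<Rightarrow> lab \<Rightarrow> bool) \<Rightarrow> nat \<Rightarrow> nat list \<Rightarrow> lab \<Rightarrow> lab \<Rightarrow> bool" where
  "base R r S \<alpha> \<beta> \<longleftrightarrow> (\<forall>i<length (sgrp (N r) S). R (sgrp (N r) S ! i) (pts \<alpha> ! i) (pts \<beta> ! i))"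

text \<open>Refining one side multiplies its labels, while the other side keeps one label per tuple
  of children. The sparse coupling is taken in the direction that bounds the ambiguous labels of the
  refined side by the number of labels opposite.\<close>

definition good :: "(nat list \<Rightarrow> lab \<Rightarrow> lab \<Rightarrow> bool) \<Rightarrow> nat \<Rightarrow> nat list \<Rightarrow> (lab \<Rightarrow> lab \<Rightarrow> bool) \<Rightarrow> bool" where
  "good R r S R' \<longleftrightarrow> (\<forall>\<alpha> \<beta>. R' \<alpha> \<beta> \<longrightarrow> base R r S \<alpha> \<beta>) \<and> rel_pmf R' (X.LL (Suc r) S) (Y.LL (Suc r) S) \<and>
     (if upd r then card {\<alpha>\<in>set_pmf (X.LL (Suc r) S). amb R' (set_pmf (Y.LL (Suc r) S)) \<alpha>} \<le> card (set_pmf (Y.LL (Suc r) S))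
      else card {\<beta>\<in>set_pmf (Y.LL (Suc r) S). amb (\<lambda>b a. R' a b) (set_pmf (X.LL (Suc r) S)) \<beta>} \<le> card (set_pmf (X.LL (Suc r) S)))"

text \<open>A sparse coupling is chosen for each shape. That the choice is legitimate at every stage
  is carried through the induction together with the coupling property, in \<open>rel_Rl\<close> and
  \<open>good_Rl\<close>.\<close>

primrec Rl :: "nat \<Rightarrow> nat list \<Rightarrow> lab \<Rightarrow> lab \<Rightarrow> bool" where
  "Rl 0 = (\<lambda>_ _ _. True)"
| "Rl (Suc r) = (\<lambda>S. SOME R'. good (Rl r) r S R')"

lemma good_exists:
  assumes R: "\<And>S. X.okS S \<Longrightarrow> rel_pmf (R S) (X.LL r S) (Y.LL r S)" and ok: "X.okS S"
  shows "\<exists>R'. good R r S R'"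
proof -
  let ?Ss = "sgrp (N r) S"
  have okY: "Y.okS S" using ok okS_eq by simp
  have "rel_pmf (\<lambda>xs ys. length xs = length ?Ss \<and> length ys = length ?Ss \<and> (\<forall>i<length ?Ss. R (?Ss ! i) (xs ! i) (ys ! i)))
     (lprod (map (X.LL r) ?Ss)) (lprod (map (Y.LL r) ?Ss))"
  proof (rule rel_lprod_nth)
    show "rel_pmf (R (?Ss ! i)) (map (X.LL r) ?Ss ! i) (map (Y.LL r) ?Ss ! i)" if "i < length ?Ss" for i
      using R[OF X.okS_sgrp[OF ok nth_mem[OF that]]] that by simp
  qed auto
  then have "rel_pmf (\<lambda>\<alpha> \<beta>. length (pts \<alpha>) = length ?Ss \<and> length (pts \<beta>) = length ?Ss \<and> (\<forall>i<length ?Ss. R (?Ss ! i) (pts \<alpha> ! i) (pts \<beta> ! i)))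
     (X.LL (Suc r) S) (Y.LL (Suc r) S)"
    unfolding X.pts_LL[OF ok, symmetric] Y.pts_LL[OF okY, symmetric] by (simp add: pmf.rel_map)
  then have base: "rel_pmf (base R r S) (X.LL (Suc r) S) (Y.LL (Suc r) S)"
    by (rule pmf.rel_mono_strong) (simp add: base_def)
  note fin = X.finite_LL[OF ok, of "Suc r"] Y.finite_LL[OF okY, of "Suc r"]
  show ?thesis
  proof (cases "upd r")
    case True
    from rel_pmf_sparse'[OF base fin] True show ?thesis by (simp add: good_def amb_def)
  next
    case False
    from rel_pmf_sparse[OF base fin] False show ?thesis by (simp add: good_def amb_def)
  qed
qed

lemma rel_Rl: "X.okS S \<Longrightarrow> rel_pmf (Rl r S) (X.LL r S) (Y.LL r S)"
  and good_Rl: "X.okS S \<Longrightarrow> good (Rl r) r S (Rl (Suc r) S)"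
proof -
  have step: "good (Rl r) r S (Rl (Suc r) S)" if "\<And>S. X.okS S \<Longrightarrow> rel_pmf (Rl r S) (X.LL r S) (Y.LL r S)" "X.okS S" for r S
    using someI_ex[OF good_exists[OF that]] by simp
  have rel: "X.okS S \<Longrightarrow> rel_pmf (Rl r S) (X.LL r S) (Y.LL r S)" for r S
  proof (induction r arbitrary: S)
    case 0
    have "Rl 0 S = top" by (simp add: fun_eq_iff)
    then show ?case by simp
  next
    case (Suc r)
    then show ?case using step[of r S] by (simp add: good_def del: Rl.simps)
  qed
  show "X.okS S \<Longrightarrow> rel_pmf (Rl r S) (X.LL r S) (Y.LL r S)" by (rule rel)
  show "X.okS S \<Longrightarrow> good (Rl r) r S (Rl (Suc r) S)" by (rule step[OF rel])
qed

end

text \<open>The relation is a parameter instead of \<open>Rl\<close>, and all estimates are stated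
  for both sides. Exchanging the sides and transposing the relation then gives an instance of the
  same locale (\<open>pair_swap\<close>), so each fact about one map holds for its inverse as
  well.\<close>

locale pair = two_sides +
  fixes Rel :: "nat \<Rightarrow> nat list \<Rightarrow> lab \<Rightarrow> lab \<Rightarrow> bool"
  assumes rel: "X.okS S \<Longrightarrow> rel_pmf (Rel r S) (X.LL r S) (Y.LL r S)"
    and relS: "X.okS S \<Longrightarrow> Rel (Suc r) S \<alpha> \<beta> \<Longrightarrow> i < length (sgrp (N r) S) \<Longrightarrow> Rel r (sgrp (N r) S ! i) (pts \<alpha> ! i) (pts \<beta> ! i)"
    and altern: "upd (Suc r) = (\<not> upd r)"
    and ambX: "upd r \<Longrightarrow> X.P.prob {x. amb (Rel (Suc r) (fst (snd (X.dat (Suc r) x)))) (set_pmf (Y.LL (Suc r) (fst (snd (X.dat (Suc r) x))))) (snd (snd (X.dat (Suc r) x)))} \<le> 3 * (1 / 2) ^ r"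
    and ambY: "\<not> upd r \<Longrightarrow> Y.P.prob {y. amb (\<lambda>b a. Rel (Suc r) (fst (snd (Y.dat (Suc r) y))) a b) (set_pmf (X.LL (Suc r) (fst (snd (Y.dat (Suc r) y))))) (snd (snd (Y.dat (Suc r) y)))} \<le> 3 * (1 / 2) ^ r"
    and typX: "upd r \<Longrightarrow> X.P.prob {x. \<not> X.typl r (snd (bd k (N (Suc r)) (lv (Suc r)) x))} \<le> 2 * (1 / 2) ^ r"
    and typY: "\<not> upd r \<Longrightarrow> Y.P.prob {y. \<not> Y.typl r (snd (bd k (N (Suc r)) (lv (Suc r)) y))} \<le> 2 * (1 / 2) ^ r"

lemma (in side) typl_bound:
  assumes "fl r" "c r = g (lv (Suc r)) + dl"
    "P.prob {x. atyp (lv (Suc r)) dl (T r) x} \<le> (1 / 2) ^ r" "real (T r) * kappa (N (Suc r)) \<le> (1 / 2) ^ r"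
  shows "P.prob {x. \<not> typl r (snd (bd k (N (Suc r)) (lv (Suc r)) x))} \<le> 2 * (1 / 2) ^ r"
proof -
  have "P.prob {x. \<not> typl r (snd (bd k (N (Suc r)) (lv (Suc r)) x))} \<le> P.prob {x. \<not> (typl r (snd (bd k (N (Suc r)) (lv (Suc r)) x)) \<and>
      (g (lv (Suc r)) - dl) * real (bsize (snd (bd k (N (Suc r)) (lv (Suc r)) x))) \<le> infS (lv (Suc r)) (snd (bd k (N (Suc r)) (lv (Suc r)) x)))}"
    by (rule P.finite_measure_mono) (auto intro!: sets_pred)
  also have "\<dots> \<le> 2 * (1 / 2) ^ r" using prob_untyp[OF assms(1,2)] assms(3,4) by linarith
  finally show ?thesis .
qed

lemma (in side) amb_bound:
  assumes fl: "fl r" and c: "c r = g (lv (Suc r)) + dl" and de: "d r < g (lv (Suc r)) - dl"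
    and at: "P.prob {x. atyp (lv (Suc r)) dl (T r) x} \<le> (1 / 2) ^ r" and kp: "real (T r) * kappa (N (Suc r)) \<le> (1 / 2) ^ r"
    and ex: "exp (- (g (lv (Suc r)) - dl - d r) * real (T r)) \<le> (1 / 2) ^ r"
    and card: "\<And>S. okS S \<Longrightarrow> real (card {\<alpha>\<in>set_pmf (LL (Suc r) S). Q S \<alpha>}) \<le> exp (d r * real (sum_list S))"
  shows "P.prob {x. Q (fst (snd (dat (Suc r) x))) (snd (snd (dat (Suc r) x)))} \<le> 3 * (1 / 2) ^ r"
proof -
  let ?A = "\<lambda>S. {\<alpha>\<in>set_pmf (LL (Suc r) S). Q S \<alpha>}"
  have "P.prob {x. Q (fst (snd (dat (Suc r) x))) (snd (snd (dat (Suc r) x)))}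
    \<le> P.prob {x. snd (snd (dat (Suc r) x)) \<in> ?A (fst (snd (dat (Suc r) x)))}"
  proof (rule P.finite_measure_mono_AE)
    show "AE x in P. x \<in> {x. Q (fst (snd (dat (Suc r) x))) (snd (snd (dat (Suc r) x)))} \<longrightarrow> x \<in> {x. snd (snd (dat (Suc r) x)) \<in> ?A (fst (snd (dat (Suc r) x)))}"
      using AE_nice
    proof eventually_elim
      case (elim x)
      show ?case using nice_dat(2)[OF elim, of "Suc r" "fst (dat (Suc r) x)" "fst (snd (dat (Suc r) x))" "snd (snd (dat (Suc r) x))"] by simp
    qed
    have "Measurable.pred P (\<lambda>x. snd (snd (dat (Suc r) x)) \<in> ?A (fst (snd (dat (Suc r) x))))"
      by (rule measurable_compose[OF dat_meas[of "Suc r"], of "\<lambda>z. snd (snd z) \<in> ?A (fst (snd z))"]) simp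
    then show "{x. snd (snd (dat (Suc r) x)) \<in> ?A (fst (snd (dat (Suc r) x)))} \<in> sets P" by (rule sets_pred)
  qed
  also have "\<dots> \<le> exp (- (g (lv (Suc r)) - dl - d r) * real (T r)) + (P.prob {x. atyp (lv (Suc r)) dl (T r) x} + real (T r) * kappa (N (Suc r)))"
    by (rule prob_ambiguous[OF fl c de _ card]) auto
  also have "\<dots> \<le> 3 * (1 / 2) ^ r" using at kp ex by linarith
  finally show ?thesis .
qed

text \<open>The label exponent \<open>d\<close> has to stay below rates that both sides can still
  reach, although they are refined in turn. This is possible because any rate of one side is
  exceeded by the other side at a suitable level (\<open>rate_compare\<close>).\<close>

theorem scheme_exists:
  assumes X: "bernd \<mu> k" and Y: "bernd \<nu> k" and p: "bern.p \<nu> k = bern.p \<mu> k"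
    and H1: "\<And>n \<epsilon>. 0 < \<epsilon> \<Longrightarrow> \<exists>m. bernd.Hf \<mu> n \<le> bernd.Hf \<nu> m + \<epsilon>"
    and H2: "\<And>n \<epsilon>. 0 < \<epsilon> \<Longrightarrow> \<exists>m. bernd.Hf \<nu> n \<le> bernd.Hf \<mu> m + \<epsilon>"
  shows "\<exists>lv N T c upd upd' Rel. pair \<mu> \<nu> k lv N T c upd upd' Rel"
proof -
  interpret X: bernd \<mu> k by fact
  interpret Y: bernd \<nu> k by fact
  have uu: "Y.u = X.u" using X.u_unique[OF Y.bern_axioms p] by auto
  have kk: "Y.kappa = X.kappa" by (simp add: fun_eq_iff X.kappa_formula Y.kappa_formula uu p)
  define gs where "gs b = (if b then X.g else Y.g)" for b
  define pa where "pa b n dl T = (if b then X.P.prob {x. X.atyp n dl T x} else Y.P.prob {x. Y.atyp n dl T x})" for b n dl T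
  have gmono: "gs b n \<le> gs b m" if "2 \<le> n" "n \<le> m" for b n m using X.g_mono Y.g_mono that by (simp add: gs_def)
  have gstrict: "\<exists>m\<ge>n. gs b n < gs b m" if "2 \<le> n" for b n using X.g_strict Y.g_strict that by (simp add: gs_def)
  have gcmp: "\<exists>m\<ge>2. gs b n < gs (\<not> b) m" if "2 \<le> n" for b n
  proof (cases b)
    case True
    show ?thesis using X.rate_compare[OF Y p H1 that, of 2] True by (simp add: gs_def)
  next
    case False
    show ?thesis using Y.rate_compare[OF X p[symmetric] H2 that, of 2] False by (simp add: gs_def)
  qed
  have patyp: "\<exists>T0. \<forall>T\<ge>T0. pa b n dl T < \<eta>" if "0 < dl" "2 \<le> n" "0 < \<eta>" for b n dl \<eta>
    using X.prob_atyp[OF that] Y.prob_atyp[OF that] by (cases b) (simp_all add: pa_def)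
  define upd :: "nat \<Rightarrow> bool" where "upd r = even r" for r
  \<comment> \<open>The state consists of digit level, block threshold and label exponent.\<close>
  define PP where "PP n s \<longleftrightarrow> (case s of (l, M, d) \<Rightarrow> 2 \<le> l \<and> (n = 0 \<longrightarrow> M = 0) \<and> 0 \<le> d \<and> (\<exists>m\<ge>2. d < gs True m) \<and> (\<exists>m\<ge>2. d < gs False m))"
    for n :: nat and s :: "nat \<times> nat \<times> real"
  define QQ where "QQ n s s' T c dl \<longleftrightarrow> (case s of (l, M, d) \<Rightarrow> case s' of (l', M', d') \<Rightarrow>
     l < l' \<and> M < M' \<and> c = gs (upd n) l' + dl \<and> d < gs (upd n) l' - dl \<and> 0 < dl \<and> c < d' \<and>
     exp (- (gs (upd n) l' - dl - d) * real T) \<le> (1 / 2) ^ n \<and> 2 \<le> exp ((d' - c) * real T) \<and>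
     real T * X.kappa M' \<le> (1 / 2) ^ n \<and> pa (upd n) l' dl T \<le> (1 / 2) ^ n)"
    for n :: nat and s s' :: "nat \<times> nat \<times> real" and T :: nat and c dl :: real
  have "\<exists>f. \<forall>n. PP n (f n) \<and> (\<exists>T c dl. QQ n (f n) (f (Suc n)) T c dl)"
  proof (rule dependent_nat_choice)
    have "0 \<le> X.g 2" unfolding X.g_def by (intro integral_nonneg_AE) (auto simp: X.fI_bounds)
    moreover have "0 \<le> Y.g 2" unfolding Y.g_def by (intro integral_nonneg_AE) (auto simp: Y.fI_bounds)
    ultimately have "0 \<le> gs b 2" for b by (simp add: gs_def)
    then have "\<exists>m\<ge>2. 0 < gs b m" for b using gstrict[of 2 b] by (metis le_less_trans order_refl)
    then show "\<exists>s. PP 0 s" by (intro exI[of _ "(2, 0, 0)"]) (simp add: PP_def)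
  next
    fix s n assume "PP n s"
    then obtain l M d where s: "s = (l, M, d)" and P: "2 \<le> l" "0 \<le> d" "\<exists>m\<ge>2. d < gs True m" "\<exists>m\<ge>2. d < gs False m"
      by (auto simp: PP_def split: prod.splits)
    define b where "b = upd n"
    obtain m where m: "2 \<le> m" "d < gs b m" using P by (cases b) auto
    define l' where "l' = max m (Suc l)"
    have l': "2 \<le> l'" "l < l'" "d < gs b l'" using m gmono[of m l' b] by (auto simp: l'_def intro: less_le_trans)
    obtain m' where m': "l' \<le> m'" "gs b l' < gs b m'" using gstrict[OF l'(1)] by blast
    \<comment> \<open>The half keeps \<open>d\<close> below \<open>gs b l' - dl\<close>, which makes
      typical labels too light to be ambiguous often; the third keeps the new exponent
      \<open>gs b l' + 2 * dl\<close> below a later rate of the same side.\<close>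
    define dl where "dl = min ((gs b l' - d) / 2) ((gs b m' - gs b l') / 3)"
    have dl: "0 < dl" "d < gs b l' - dl" "gs b l' + 2 * dl < gs b m'"
      using l' m' by (auto simp: dl_def min_def field_simps)
    define c where "c = gs b l' + dl"
    define d' where "d' = gs b l' + 2 * dl"
    have eps: "0 < (1 / 2 :: real) ^ n" by simp
    obtain T0 where T0: "\<And>T. T \<ge> T0 \<Longrightarrow> pa b l' dl T < (1 / 2) ^ n" using patyp[OF dl(1) l'(1) eps] by blast
    have expl: "\<exists>T1. \<forall>T\<ge>T1. exp (- a * real T) \<le> \<eta>" if "0 < a" "0 < \<eta>" for a \<eta> :: real
    proof -
      have "(\<lambda>T. exp (- a) ^ T) \<longlonglongrightarrow> 0" using that by (intro LIMSEQ_realpow_zero) auto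
      then have "eventually (\<lambda>T. exp (- a) ^ T < \<eta>) sequentially" using that by (intro order_tendstoD(2)) auto
      then show ?thesis by (auto simp: eventually_sequentially exp_of_nat_mult[symmetric] mult.commute intro: less_imp_le)
    qed
    obtain T1 where T1: "\<And>T. T \<ge> T1 \<Longrightarrow> exp (- (gs b l' - dl - d) * real T) \<le> (1 / 2) ^ n"
      using expl[of "gs b l' - dl - d" "(1 / 2) ^ n"] dl(2) by auto
    obtain T2 where T2: "\<And>T. T \<ge> T2 \<Longrightarrow> exp (- dl * real T) \<le> 1 / 2" using expl[of dl "1 / 2"] dl(1) by auto
    \<comment> \<open>\<open>T\<close> comes before the block threshold: it serves the three
      estimates on long blocks, and afterwards \<open>M'\<close> makes it rare that a block starts
      within \<open>T\<close> sites.\<close>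
    define T where "T = Max {T0, T1, T2}"
    have T: "T0 \<le> T" "T1 \<le> T" "T2 \<le> T" by (auto simp: T_def)
    have two: "2 \<le> exp ((d' - c) * real T)"
    proof -
      have e: "(d' - c) * real T = dl * real T" by (simp add: d'_def c_def)
      have "inverse (exp (dl * real T)) \<le> inverse 2" using T2[OF T(3)] by (simp add: exp_minus)
      then show ?thesis unfolding e by (rule inverse_le_imp_le) simp
    qed
    have "(\<lambda>M. real T * X.kappa M) \<longlonglongrightarrow> real T * 0" by (intro tendsto_intros X.kappa_lim)
    then have "eventually (\<lambda>M. real T * X.kappa M < (1 / 2) ^ n) sequentially" using eps by (intro order_tendstoD(2)) auto
    then obtain M0 where M0: "\<And>M. M \<ge> M0 \<Longrightarrow> real T * X.kappa M < (1 / 2) ^ n" by (auto simp: eventually_sequentially)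
    define M' where "M' = max M0 (Suc M)"
    have M': "M < M'" "real T * X.kappa M' \<le> (1 / 2) ^ n" using M0[of M'] by (auto simp: M'_def)
    have "QQ n s (l', M', d') T c dl"
      using l' M' dl T1[OF T(2)] T0[OF T(1)] two by (simp add: QQ_def s b_def[symmetric] c_def d'_def)
    moreover have "PP (Suc n) (l', M', d')"
    proof -
      have m2: "2 \<le> m'" using l' m' by simp
      have 1: "\<exists>m\<ge>2. d' < gs b m" using m' m2 dl(3) by (auto simp: d'_def)
      obtain m'' where "2 \<le> m''" "gs b m' < gs (\<not> b) m''" using gcmp[OF m2] by blast
      then have 2: "\<exists>m\<ge>2. d' < gs (\<not> b) m" using dl(3) by (auto simp: d'_def intro: less_trans)
      have "\<exists>m\<ge>2. d' < gs True m" "\<exists>m\<ge>2. d' < gs False m" using 1 2 by (cases b; simp)+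
      then show ?thesis using l' dl P by (simp add: PP_def d'_def)
    qed
    ultimately show "\<exists>s'. PP (Suc n) s' \<and> (\<exists>T c dl. QQ n s s' T c dl)" by blast
  qed
  then obtain f where f: "\<And>n. PP n (f n)" "\<And>n. \<exists>T c dl. QQ n (f n) (f (Suc n)) T c dl" by blast
  then obtain T c dl where Q: "\<And>n. QQ n (f n) (f (Suc n)) (T n) (c n) (dl n)" by metis
  define lv where "lv n = fst (f n)" for n
  define N where "N n = fst (snd (f n))" for n
  define d where "d n = snd (snd (f n))" for n
  have fn: "f n = (lv n, N n, d n)" for n by (simp add: lv_def N_def d_def)
  have q: "lv n < lv (Suc n)" "N n < N (Suc n)" "c n = gs (upd n) (lv (Suc n)) + dl n" "d n < gs (upd n) (lv (Suc n)) - dl n"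
    "0 < dl n" "c n < d (Suc n)" "exp (- (gs (upd n) (lv (Suc n)) - dl n - d n) * real (T n)) \<le> (1 / 2) ^ n"
    "2 \<le> exp ((d (Suc n) - c n) * real (T n))" "real (T n) * X.kappa (N (Suc n)) \<le> (1 / 2) ^ n"
    "pa (upd n) (lv (Suc n)) (dl n) (T n) \<le> (1 / 2) ^ n" for n
    using Q[of n] unfolding QQ_def fn by auto
  have pp: "2 \<le> lv n" "N 0 = 0" "0 \<le> d n" for n using f(1)[of n] f(1)[of 0] unfolding PP_def fn by auto
  have sX: "side \<mu> k lv N" by unfold_locales (use pp q in auto)
  have sY: "side \<nu> k lv N" by unfold_locales (use pp q in auto)
  define upd' where "upd' r = (\<not> upd r)" for r
  interpret two_sides \<mu> \<nu> k lv N T c upd upd'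
  proof -
    show "two_sides \<mu> \<nu> k lv N upd upd'"
      by (intro two_sides.intro two_sides_axioms.intro sX sY p) (simp add: upd'_def)
  qed
  have dc: "d n < c n" for n using q(3-5)[of n] by linarith
  have card1: "real (card (set_pmf (X.LL r S))) \<le> exp (d r * real (sum_list S))" if "X.okS S" for r S
    by (rule X.card_LL[OF pp(3) dc q(6) q(8) that])
  have card2: "real (card (set_pmf (Y.LL r S))) \<le> exp (d r * real (sum_list S))" if "X.okS S" for r S
    by (rule Y.card_LL[OF pp(3) dc q(6) q(8)]) (use that okS_eq in simp)
  have un1: "real (card (set_pmf (X.LL (Suc r) S))) \<le> exp (d r * real (sum_list S))" if "X.okS S" "\<not> upd r" for r S
    by (rule X.card_LL_unrefined[OF card1 that])
  have un2: "real (card (set_pmf (Y.LL (Suc r) S))) \<le> exp (d r * real (sum_list S))" if "X.okS S" "upd r" for r S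
    by (rule Y.card_LL_unrefined[OF card2]) (use that okS_eq in \<open>auto simp: upd'_def\<close>)
  have "pair \<mu> \<nu> k lv N T c upd upd' Rl"
  proof (intro pair.intro pair_axioms.intro two_sides_axioms)
    show "rel_pmf (Rl r S) (X.LL r S) (Y.LL r S)" if "X.okS S" for r S by (rule rel_Rl[OF that])
    show "Rl r (sgrp (N r) S ! i) (pts \<alpha> ! i) (pts \<beta> ! i)"
      if "X.okS S" "Rl (Suc r) S \<alpha> \<beta>" "i < length (sgrp (N r) S)" for r S \<alpha> \<beta> i
      using good_Rl[OF that(1), of r] that(2,3) unfolding good_def base_def by blast
    show "upd (Suc r) = (\<not> upd r)" for r by (simp add: upd_def)
    fix r
    {
      assume u: "upd r"
      have g: "c r = X.g (lv (Suc r)) + dl r" "d r < X.g (lv (Suc r)) - dl r" "X.P.prob {x. X.atyp (lv (Suc r)) (dl r) (T r) x} \<le> (1 / 2) ^ r"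
         "exp (- (X.g (lv (Suc r)) - dl r - d r) * real (T r)) \<le> (1 / 2) ^ r"
        using q(3,4,7,10)[of r] u by (simp_all add: gs_def pa_def)
      show "X.P.prob {x. \<not> X.typl r (snd (bd k (N (Suc r)) (lv (Suc r)) x))} \<le> 2 * (1 / 2) ^ r"
        by (rule X.typl_bound[OF u g(1,3) q(9)[of r]])
      show "X.P.prob {x. amb (Rl (Suc r) (fst (snd (X.dat (Suc r) x)))) (set_pmf (Y.LL (Suc r) (fst (snd (X.dat (Suc r) x))))) (snd (snd (X.dat (Suc r) x)))} \<le> 3 * (1 / 2) ^ r"
      proof (rule X.amb_bound[where d=d and Q="\<lambda>S. amb (Rl (Suc r) S) (set_pmf (Y.LL (Suc r) S))", OF u g(1,2,3) q(9)[of r] g(4)])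
        fix S assume ok: "X.okS S"
        have "card {\<alpha>\<in>set_pmf (X.LL (Suc r) S). amb (Rl (Suc r) S) (set_pmf (Y.LL (Suc r) S)) \<alpha>} \<le> card (set_pmf (Y.LL (Suc r) S))"
          using good_Rl[OF ok, of r] u unfolding good_def by simp
        then show "real (card {\<alpha>\<in>set_pmf (X.LL (Suc r) S). amb (Rl (Suc r) S) (set_pmf (Y.LL (Suc r) S)) \<alpha>}) \<le> exp (d r * real (sum_list S))"
          using un2[OF ok u] by linarith
      qed
    }
    {
      assume u: "\<not> upd r"
      then have u': "upd' r" by (simp add: upd'_def)
      have g: "c r = Y.g (lv (Suc r)) + dl r" "d r < Y.g (lv (Suc r)) - dl r" "Y.P.prob {x. Y.atyp (lv (Suc r)) (dl r) (T r) x} \<le> (1 / 2) ^ r"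
         "exp (- (Y.g (lv (Suc r)) - dl r - d r) * real (T r)) \<le> (1 / 2) ^ r" "real (T r) * Y.kappa (N (Suc r)) \<le> (1 / 2) ^ r"
        using q(3,4,7,9,10)[of r] u by (simp_all add: gs_def pa_def kk)
      show "Y.P.prob {x. \<not> Y.typl r (snd (bd k (N (Suc r)) (lv (Suc r)) x))} \<le> 2 * (1 / 2) ^ r"
        by (rule Y.typl_bound[OF u' g(1,3,5)])
      show "Y.P.prob {y. amb (\<lambda>b a. Rl (Suc r) (fst (snd (Y.dat (Suc r) y))) a b) (set_pmf (X.LL (Suc r) (fst (snd (Y.dat (Suc r) y))))) (snd (snd (Y.dat (Suc r) y)))} \<le> 3 * (1 / 2) ^ r"
      proof (rule Y.amb_bound[where d=d and Q="\<lambda>S. amb (\<lambda>b a. Rl (Suc r) S a b) (set_pmf (X.LL (Suc r) S))", OF u' g(1,2,3,5,4)])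
        fix S assume okY: "Y.okS S"
        then have ok: "X.okS S" by (simp add: okS_eq)
        have "card {\<beta>\<in>set_pmf (Y.LL (Suc r) S). amb (\<lambda>b a. Rl (Suc r) S a b) (set_pmf (X.LL (Suc r) S)) \<beta>} \<le> card (set_pmf (X.LL (Suc r) S))"
          using good_Rl[OF ok, of r] u unfolding good_def by simp
        then show "real (card {\<beta>\<in>set_pmf (Y.LL (Suc r) S). amb (\<lambda>b a. Rl (Suc r) S a b) (set_pmf (X.LL (Suc r) S)) \<beta>}) \<le> exp (d r * real (sum_list S))"
          using un1[OF ok u] by linarith
      qed
    }
  qed
  then show ?thesis by blast
qed

subsection \<open>Reading symbols off labels\<close>

lemma fill_cut:
  assumes "2 \<le> n" "1 \<le> k" "cut k x s" "wrd n x s (bsize F) = concat F" "\<forall>W\<in>set F. gapw k W"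
  shows "cut k x (s + int (bsize F))"
  using assms(3-)
proof (induction F arbitrary: s)
  case (Cons W F)
  have w: "wrd n x s (length W) = W" and wF: "wrd n x (s + int (length W)) (bsize F) = concat F"
    using Cons.prems(2) unfolding wrd_Cons_fill by auto
  have gW: "gapw k W" using Cons.prems by simp
  have W1: "1 \<le> length W" using gapw_length[OF gW] assms by simp
  have "cut k x (s + int (length W))"
    using cut_gapw[OF assms(1,2) Cons.prems(1) W1] gW w by auto
  from Cons.IH[OF this wF] Cons.prems(3) show ?case by (simp add: add.assoc)
qed simp

lemma wrd_append_fill:
  "wrd n x s (bsize (F @ F')) = concat (F @ F') \<longleftrightarrow>
   wrd n x s (bsize F) = concat F \<and> wrd n x (s + int (bsize F)) (bsize F') = concat F'"
  by (simp add: wrd_add)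

lemma fill_end_CC:
  assumes "2 \<le> n" "1 \<le> k" "cut k x s" "wrd n x s (bsize F) = concat F" "\<forall>W\<in>set F. gapw k W"
    "F \<noteq> []" "N < length (last F)"
  shows "CC k N x (s + int (bsize F))"
proof -
  obtain F0 W where F: "F = F0 @ [W]" using assms(6) by (cases F rule: rev_cases) auto
  have w0: "wrd n x s (bsize F0) = concat F0" and w: "wrd n x (s + int (bsize F0)) (length W) = W"
    using assms(4) unfolding F wrd_append_fill by auto
  have c0: "cut k x (s + int (bsize F0))"
    by (rule fill_cut[OF assms(1-3) w0]) (use assms(5) F in auto)
  have b: "bvs N (map length [W])" using assms(7) F by (simp add: bvs_def)
  from fill_ends[OF assms(1,2) c0 _ _ b] w assms(5) F show ?thesis by (simp add: add.assoc)
qed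

lemma sum_bsize: "sum_list (map bsize Fs) = bsize (concat Fs)"
  by (induction Fs) auto

context side
begin

text \<open>The groups of \<open>lgrp\<close> are the blocks of threshold \<open>N r\<close>: the
  first begins where the large block does, each later one just after a gap longer than
  \<open>N r\<close>.\<close>

lemma sub_block:
  assumes b: "isblk k (N (Suc r)) n x j F" and n: "2 \<le> n"
    and l: "loc (map sum_list (sgrp (N r) (map length F))) j = (i, j')"
  shows "i < length (lgrp (N r) F)" "isblk k (N r) n x j' (lgrp (N r) F ! i)"
    "j = bsize (concat (take i (lgrp (N r) F))) + j'"
proof -
  define Fs where "Fs = lgrp (N r) F"
  have F: "F = concat Fs" by (simp add: Fs_def)
  have sz: "map sum_list (sgrp (N r) (map length F)) = map bsize Fs"
    by (simp add: sgrp_map Fs_def o_def length_concat_map)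
  have "sum_list (map bsize Fs) = bsize F" unfolding F by (rule sum_bsize)
  then have "j < sum_list (map bsize Fs)" using b by (simp add: isblk_def)
  from loc_spec[OF this l[unfolded sz]] have i: "i < length Fs" "j' < bsize (Fs ! i)" "j = sum_list (take i (map bsize Fs)) + j'"
    by auto
  then show "i < length (lgrp (N r) F)" by (simp add: Fs_def)
  have st: "sum_list (take i (map bsize Fs)) = bsize (concat (take i Fs))"
  proof -
    have "sum_list (map bsize Gs) = bsize (concat Gs)" for Gs by (induction Gs) auto
    then show ?thesis by (simp add: take_map)
  qed
  then show "j = bsize (concat (take i (lgrp (N r) F))) + j'" using i(3) by (simp add: Fs_def)
  have FFs: "F = concat (take i Fs) @ (Fs ! i @ concat (drop (Suc i) Fs))"
    unfolding F using id_take_nth_drop[OF i(1)] by (metis concat.simps(2) concat_append)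
  have w: "wrd n x (- int j) (bsize F) = concat F" and cj: "CC k (N (Suc r)) x (- int j)" and gp: "\<forall>W\<in>set F. gapw k W"
    and bv: "bvs (N (Suc r)) (map length F)"
    using b by (auto simp: isblk_def)
  have wt: "wrd n x (- int j) (bsize (concat (take i Fs))) = concat (concat (take i Fs))"
    and wr: "wrd n x (- int j + int (bsize (concat (take i Fs)))) (bsize (Fs ! i @ concat (drop (Suc i) Fs))) = concat (Fs ! i @ concat (drop (Suc i) Fs))"
    using w unfolding FFs wrd_append_fill by blast+
  have wi: "wrd n x (- int j + int (bsize (concat (take i Fs)))) (bsize (Fs ! i)) = concat (Fs ! i)"
    using wr unfolding wrd_append_fill by blast
  have pos: "- int j + int (bsize (concat (take i Fs))) = - int j'" using i(3) st by simp
  have Pl: "N r < last (map length F)" "map length F \<noteq> []" using bv NS[of r] by (auto simp: bvs_def)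
  have blocks: "N r < last G \<and> (\<forall>L\<in>set (butlast G). \<not> N r < L)" if "G \<in> set (sgrp (N r) (map length F))" for G
    using grp_blocks[of "map length F" "\<lambda>L. N r < L" G] Pl that by (simp add: sgrp_def)
  have ne: "G \<noteq> []" if "G \<in> set Fs" for G using that grp_ne by (auto simp: Fs_def lgrp_def)
  have bvi: "bvs (N r) (map length G)" if "G \<in> set Fs" for G
  proof -
    have "map length G \<in> set (sgrp (N r) (map length F))" using that by (simp add: sgrp_map Fs_def)
    from blocks[OF this] ne[OF that] show ?thesis by (auto simp: bvs_def not_less)
  qed
  have CC: "CC k (N r) x (- int j')"
  proof (cases i)
    case 0
    then have "j' = j" using i(3) by simp
    then show ?thesis using CC_mono[of "N r" "N (Suc r)"] NS[of r] cj by (simp add: less_imp_le)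
  next
    case (Suc m)
    have tk: "take i Fs = take m Fs @ [Fs ! m]" using Suc i(1) by (simp add: take_Suc_conv_app_nth)
    have mem: "Fs ! m \<in> set Fs" using Suc i(1) by simp
    have la: "last (concat (take i Fs)) = last (Fs ! m)" using tk ne[OF mem] by simp
    have "N r < length (last (Fs ! m))" using bvi[OF mem] ne[OF mem] by (simp add: bvs_def last_map)
    moreover have "concat (take i Fs) \<noteq> []" using tk ne[OF mem] by simp
    moreover have "\<forall>W\<in>set (concat (take i Fs)). gapw k W" using gp FFs by (metis Un_iff set_append)
    ultimately have "CC k (N r) x (- int j + int (bsize (concat (take i Fs))))"
      using la by (intro fill_end_CC[OF n k1 CC_cut[OF cj] wt]) auto
    then show ?thesis unfolding pos .
  qed
  have "\<forall>W\<in>set (Fs ! i). gapw k W" using gp FFs by (metis Un_iff set_append)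
  then show "isblk k (N r) n x j' (lgrp (N r) F ! i)"
    unfolding Fs_def[symmetric] isblk_def using CC wi pos bvi[OF nth_mem[OF i(1)]] i(2) by simp
qed

lemma down:
  assumes "nice x" "dat (Suc r) x = (j, S, \<alpha>)" "loc (map sum_list (sgrp (N r) S)) j = (i, j')"
  shows "i < length (sgrp (N r) S)" "dat r x = (j', sgrp (N r) S ! i, pts \<alpha> ! i)"
proof -
  obtain F where F: "isblk k (N (Suc r)) (lv (Suc r)) x j F" "S = map length F" "\<alpha> = lb (Suc r) F"
    using nice_dat(5)[OF assms(1,2)] by blast
  note sb = sub_block[OF F(1) lv2 assms(3)[unfolded F(2)]]
  show i: "i < length (sgrp (N r) S)" using sb(1) F(2) by (simp add: sgrp_map)
  let ?Fi = "lgrp (N r) F ! i"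
  have b: "isblk k (N r) (lv r) x j' (map (map (take (lv r))) ?Fi)"
    by (rule isblk_coarse[OF sb(2) _ lv2 k1]) (use lvS[of r] in simp)
  then have "map (map (take (lv r))) ?Fi \<noteq> []" by (auto simp: isblk_def)
  with b have "bd k (N r) (lv r) x = (j', map (map (take (lv r))) ?Fi)"
    using bd_iff[OF lv2 k1] by blast
  then show "dat r x = (j', sgrp (N r) S ! i, pts \<alpha> ! i)"
    using sb(1) by (simp add: dat_def F(2,3) sgrp_map lb_coarse o_def)
qed

definition rd :: "nat \<Rightarrow> (int \<Rightarrow> sym) \<Rightarrow> bool list" where
  "rd r x = (case dat r x of (j, S, \<alpha>) \<Rightarrow> flat \<alpha> ! j)"

lemma nth_concat_sub:
  assumes "j < sum_list (map bsize Fs)" "loc (map bsize Fs) j = (i, j')" "\<And>G. G \<in> set Fs \<Longrightarrow> length (f G) = bsize G"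
  shows "concat (map f Fs) ! j = f (Fs ! i) ! j'"
proof -
  have e: "map length (map f Fs) = map bsize Fs" using assms(3) by simp
  have "concat (map f Fs) ! j = map f Fs ! i ! j'"
  proof (rule nth_concat_loc)
    have "length (concat (map f Fs)) = sum_list (map bsize Fs)"
      using length_concat[of "map f Fs"] arg_cong[OF e, of sum_list] by (rule trans)
    then show "j < length (concat (map f Fs))" using assms(1) by (simp only:)
    show "loc (map length (map f Fs)) j = (i, j')" unfolding e by (rule assms(2))
  qed
  then show ?thesis using loc_spec[OF assms(1,2)] by simp
qed

lemma bsize_rv [simp]: "bsize (rv n F) = bsize F" by (rule bsize_shape) simp

text \<open>A typical node replaces the readings of its children by extensions, an atypical one
  copies them. So what a site shows can only grow along the stages.\<close>

lemma flat_down: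
  assumes "j < bsize F" "loc (map sum_list (sgrp (N r) (map length F))) j = (i, j')"
  shows "prefix (flat (pts (lb (Suc r) F) ! i) ! j') (flat (lb (Suc r) F) ! j)"
    "\<not> typl r F \<Longrightarrow> flat (pts (lb (Suc r) F) ! i) ! j' = flat (lb (Suc r) F) ! j"
proof -
  let ?Fs = "lgrp (N r) F"
  have sz: "map sum_list (sgrp (N r) (map length F)) = map bsize ?Fs"
    by (simp add: sgrp_map o_def length_concat_map)
  have j: "j < sum_list (map bsize ?Fs)" using assms(1) by (simp add: sum_bsize)
  have l: "loc (map bsize ?Fs) j = (i, j')" using assms(2) sz by simp
  note i = loc_spec[OF j l]
  have p: "pts (lb (Suc r) F) ! i = lb r (?Fs ! i)" using i by simp
  have lo: "concat (map (\<lambda>G. flat (lb r G)) ?Fs) ! j = flat (lb r (?Fs ! i)) ! j'"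
    by (rule nth_concat_sub[OF j l]) (simp add: length_flat_lb)
  show e: "flat (pts (lb (Suc r) F) ! i) ! j' = flat (lb (Suc r) F) ! j" if "\<not> typl r F"
    unfolding p using lo that by (simp add: o_def)
  show "prefix (flat (pts (lb (Suc r) F) ! i) ! j') (flat (lb (Suc r) F) ! j)"
  proof (cases "typl r F")
    case False
    then show ?thesis using e by simp
  next
    case True
    let ?n = "lv (Suc r)"
    have "concat (map (\<lambda>G. concat (rv ?n G)) ?Fs) ! j = concat (rv ?n (?Fs ! i)) ! j'"
      by (rule nth_concat_sub[OF j l]) simp
    moreover have "concat (map (\<lambda>G. concat (rv ?n G)) ?Fs) = concat (rv ?n F)"
    proof -
      have "concat (map (\<lambda>G. concat (rv ?n G)) Gs) = concat (rv ?n (concat Gs))" for Gs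
        by (induction Gs) (auto simp: rv_def)
      from this[of ?Fs] show ?thesis by simp
    qed
    ultimately have hi: "flat (lb (Suc r) F) ! j = concat (rv ?n (?Fs ! i)) ! j'" using True by simp
    have j': "j' < bsize (?Fs ! i)"
    proof -
      have "map bsize ?Fs ! i = bsize (?Fs ! i)" by (rule nth_map) (use i in simp)
      then show ?thesis using i by (simp only:)
    qed
    have "prefix (flat (lb r (?Fs ! i)) ! j') (concat (rv (lv r) (?Fs ! i)) ! j')"
      using prefix_flat[of r "?Fs ! i"] j' by (simp add: list_all2_conv_all_nth length_flat_lb)
    moreover have "prefix (concat (rv (lv r) (?Fs ! i)) ! j') (concat (rv ?n (?Fs ! i)) ! j')"
      using prefix_rv[of "lv r" ?n "?Fs ! i"] lvS[of r] j' by (simp add: list_all2_conv_all_nth)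
    ultimately show ?thesis unfolding p hi by (rule prefix_order.trans)
  qed
qed

lemma nth_concat_rv:
  assumes "t < bsize F" "loc (map length F) t = (gi, t')"
  shows "concat (rv n F) ! t = take (if map length F ! gi \<le> n then n else 0) (concat F ! t)"
proof -
  have l: "gi < length F" "t' < length (F ! gi)" using loc_spec[of t "map length F" gi t'] assms by (auto simp: length_concat_map)
  have "concat (rv n F) ! t = rv n F ! gi ! t'"
    by (rule nth_concat_loc) (use assms in simp_all)
  also have "\<dots> = take (if length (F ! gi) \<le> n then n else 0) (F ! gi ! t')" using l by (simp add: rv_def rev1_def)
  also have "F ! gi ! t' = concat F ! t" using nth_concat_loc[OF assms] by simp
  finally show ?thesis using l by simp
qed

lemma prefix_rv_self: "t < bsize F \<Longrightarrow> prefix (concat (rv n F) ! t) (concat F ! t)"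
  using nth_concat_rv[of t F _ _ n] by (metis old.prod.exhaust take_is_prefix)

lemma blk_nth: "isblk k M n x j F \<Longrightarrow> t < bsize F \<Longrightarrow> concat F ! t = lev n (x (- int j + int t))"
  unfolding isblk_def by (metis nth_wrd)

lemma dat_sh:
  assumes "nice x" "dat r x = (j, S, \<alpha>)" "0 \<le> int j + i" "int j + i < int (sum_list S)"
  shows "dat r (sh i x) = (nat (int j + i), S, \<alpha>)"
proof -
  obtain F where F: "isblk k (N r) (lv r) x j F" "S = map length F" "\<alpha> = lb r F"
    using nice_dat(5)[OF assms(1,2)] by blast
  have b: "isblk k (N r) (lv r) (sh i x) (nat (int j + i)) F"
    by (rule isblk_sh[OF F(1)]) (use assms F in \<open>auto simp: length_concat_map\<close>)
  then have "F \<noteq> []" by (auto simp: isblk_def)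
  with b have "bd k (N r) (lv r) (sh i x) = (nat (int j + i), F)" using bd_iff[OF lv2 k1] by blast
  then show ?thesis by (simp add: dat_def F)
qed

lemma flat_prefix:
  assumes "nice x" "dat r x = (j, S, \<alpha>)" "t < sum_list S"
  shows "length (flat \<alpha>) = sum_list S" "prefix (flat \<alpha> ! t) (lev (lv r) (x (- int j + int t)))"
proof -
  obtain F where F: "isblk k (N r) (lv r) x j F" "S = map length F" "\<alpha> = lb r F"
    using nice_dat(5)[OF assms(1,2)] by blast
  have t: "t < bsize F" using assms F by (simp add: length_concat_map)
  show "length (flat \<alpha>) = sum_list S" using F by (simp add: length_flat_lb length_concat_map)
  have "prefix (flat (lb r F) ! t) (concat (rv (lv r) F) ! t)"
    using prefix_flat[of r F] t by (simp add: list_all2_conv_all_nth length_flat_lb)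
  also have "prefix \<dots> (concat F ! t)" by (rule prefix_rv_self[OF t])
  finally show "prefix (flat \<alpha> ! t) (lev (lv r) (x (- int j + int t)))" using blk_nth[OF F(1) t] F(3) by simp
qed

lemma gap_at:
  assumes b: "isblk k M n x j F" and n: "2 \<le> n" and l: "loc (map length F) j = (gi, t')"
  shows "gi < length F" "t' < length (F ! gi)" "j = sum_list (take gi (map length F)) + t'"
    "cut k x (- int t')" "wrd n x (- int t') (length (F ! gi)) = F ! gi" "gapw k (F ! gi)"
proof -
  have j: "j < bsize F" using b by (simp add: isblk_def)
  show ls: "gi < length F" "t' < length (F ! gi)" "j = sum_list (take gi (map length F)) + t'"
    using loc_spec[of j "map length F" gi t'] l j by (auto simp: length_concat_map)
  have FF: "F = take gi F @ ([F ! gi] @ drop (Suc gi) F)" using id_take_nth_drop[OF ls(1)] by simp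
  have w: "wrd n x (- int j) (bsize F) = concat F" using b by (simp add: isblk_def)
  have w1: "wrd n x (- int j) (bsize (take gi F)) = concat (take gi F)"
    and w2: "wrd n x (- int j + int (bsize (take gi F))) (bsize ([F ! gi] @ drop (Suc gi) F)) = concat ([F ! gi] @ drop (Suc gi) F)"
    using w FF wrd_append_fill[of n x "- int j" "take gi F" "[F ! gi] @ drop (Suc gi) F"] by metis+
  have gp: "\<forall>W\<in>set F. gapw k W" using b by (simp add: isblk_def)
  then show "gapw k (F ! gi)" using ls(1) by simp
  have pos: "- int j + int (bsize (take gi F)) = - int t'" using ls(3) by (simp add: length_concat_map take_map)
  show "wrd n x (- int t') (length (F ! gi)) = F ! gi"
    using w2 unfolding wrd_append_fill pos by simp
  have "cut k x (- int j + int (bsize (take gi F)))"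
    by (rule fill_cut[OF n k1 _ w1]) (use b gp in \<open>auto simp: isblk_def dest: CC_cut in_set_takeD\<close>)
  then show "cut k x (- int t')" unfolding pos .
qed

text \<open>In a typical block, gaps no longer than the level are disclosed in full, and
  \<open>GC\<close> places site 0 in such a gap.\<close>

lemma rd_long:
  assumes "nice x" "typl r (snd (bd k (N (Suc r)) (lv (Suc r)) x))" "GC (lv (Suc r)) x"
  shows "length (rd (Suc r) x) = lv (Suc r)"
proof -
  let ?n = "lv (Suc r)"
  obtain j S \<alpha> where d: "dat (Suc r) x = (j, S, \<alpha>)" by (metis prod_cases3)
  obtain F where F: "bd k (N (Suc r)) ?n x = (j, F)" "isblk k (N (Suc r)) ?n x j F" "S = map length F" "\<alpha> = lb (Suc r) F"
    using nice_dat(5)[OF assms(1) d] by blast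
  have j: "j < bsize F" using F(2) by (simp add: isblk_def)
  obtain gi t' where l: "loc (map length F) j = (gi, t')" by fastforce
  note ga = gap_at[OF F(2) lv2 l]
  have g1: "gc ?n (length (F ! gi)) t' x" using ga unfolding gc_def by simp
  obtain L j0 where g2: "L \<in> {1..?n}" "j0 < L" "gc ?n L j0 x" using assms(3) by (auto simp: GC_def)
  have "length (F ! gi) = L"
    using gc_unique[OF lv2, of "length (F ! gi)" L t' j0 "Suc r" x] g1 g2 ga(2) by simp
  then have le: "length (F ! gi) \<le> ?n" using g2 by simp
  have "rd (Suc r) x = concat (rv ?n F) ! j" using assms(2) F(1,4) d by (simp add: rd_def)
  also have "\<dots> = take ?n (lev ?n (x 0))" using nth_concat_rv[OF j l, of ?n] le ga(1) blk_nth[OF F(2) j] by simp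
  finally show ?thesis by simp
qed

text \<open>Cuts are the starts of gaps, hence functions of the skeleton; coupled data therefore
  have the same cuts.\<close>

lemma dat_cut:
  assumes "nice x" "dat r x = (j, S, \<alpha>)"
  shows "cut k x 0 \<longleftrightarrow> (\<exists>i\<le>length S. j = sum_list (take i S))"
proof
  obtain F where F: "isblk k (N r) (lv r) x j F" "S = map length F"
    using nice_dat(5)[OF assms(1,2)] by blast
  {
    assume c0: "cut k x 0"
    obtain gi t' where l: "loc (map length F) j = (gi, t')" by fastforce
    note ga = gap_at[OF F(1) lv2 l]
    have "t' = 0"
    proof (rule ccontr)
      assume t: "t' \<noteq> 0"
      have "\<forall>l\<in>{1..<length (F ! gi)}. \<not> cut k x (- int t' + int l)"
        using cut_gapw[OF lv2 k1 ga(4), of "length (F ! gi)" r] ga(2,5,6) by simp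
      moreover have "t' \<in> {1..<length (F ! gi)}" using ga(2) t by simp
      ultimately have "\<not> cut k x (- int t' + int t')" by blast
      then show False using c0 by simp
    qed
    then show "\<exists>i\<le>length S. j = sum_list (take i S)" using ga(1,3) F(2) by (auto intro!: exI[of _ gi])
  }
  {
    assume "\<exists>i\<le>length S. j = sum_list (take i S)"
    then obtain i where i: "j = sum_list (take i S)" by blast
    have FF: "F = take i F @ drop i F" by simp
    have w1: "wrd (lv r) x (- int j) (bsize (take i F)) = concat (take i F)"
      using F(1) FF wrd_append_fill[of "lv r" x "- int j" "take i F" "drop i F"] unfolding isblk_def by metis
    have "cut k x (- int j + int (bsize (take i F)))"
      by (rule fill_cut[OF lv2 k1 _ w1]) (use F(1) in \<open>auto simp: isblk_def dest: CC_cut in_set_takeD\<close>)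
    moreover have "bsize (take i F) = j" using i F(2) by (simp add: length_concat_map take_map)
    ultimately show "cut k x 0" by simp
  }
qed

lemma rd_keep:
  assumes "nice x" "\<not> fl r" shows "rd (Suc r) x = rd r x"
proof -
  obtain j S \<alpha> where d: "dat (Suc r) x = (j, S, \<alpha>)" by (metis prod_cases3)
  obtain F where F: "S = map length F" "\<alpha> = lb (Suc r) F" using nice_dat(5)[OF assms(1) d] by blast
  obtain i j' where l: "loc (map sum_list (sgrp (N r) S)) j = (i, j')" by fastforce
  have "j < bsize F" using nice_dat(3)[OF assms(1) d] F by (simp add: length_concat_map)
  from flat_down(2)[OF this l[unfolded F(1)]] assms(2)
  have "flat (pts \<alpha> ! i) ! j' = flat \<alpha> ! j" by (simp add: F(2) typl_def del: lb.simps)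
  then show ?thesis using down(2)[OF assms(1) d l] d by (simp add: rd_def)
qed

lemma rd_meas [measurable]: "rd r \<in> measurable P (count_space UNIV)"
  unfolding rd_def[abs_def] by (rule measurable_compose[OF dat_meas]) simp

lemma prob_rd_short_refined:
  assumes "fl r" and ty: "P.prob {x. \<not> typl r (snd (bd k (N (Suc r)) (lv (Suc r)) x))} \<le> e"
  shows "P.prob {x. length (rd (Suc r) x) < lv (Suc r)} \<le> e + (1 - P.prob {x. GC (lv (Suc r)) x})"
proof -
  let ?A = "{x. \<not> typl r (snd (bd k (N (Suc r)) (lv (Suc r)) x))}" and ?B = "{x. \<not> GC (lv (Suc r)) x}"
  have mA: "?A \<in> sets P" by (rule sets_pred) measurable
  have mB: "?B \<in> sets P" by (rule sets_pred) measurable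
  have "P.prob {x. length (rd (Suc r) x) < lv (Suc r)} \<le> P.prob (?A \<union> ?B)"
  proof (rule P.finite_measure_mono_AE)
    show "AE x in P. x \<in> {x. length (rd (Suc r) x) < lv (Suc r)} \<longrightarrow> x \<in> ?A \<union> ?B"
      using AE_nice by eventually_elim (use rd_long in force)
  qed (use mA mB in auto)
  also have "\<dots> \<le> P.prob ?A + P.prob ?B" by (rule measure_Un_le[OF mA mB])
  also have "P.prob ?B = 1 - P.prob {x. GC (lv (Suc r)) x}"
    using P.prob_compl[OF sets_pred[OF GC_meas[of "lv (Suc r)"]]] by (simp add: set_diff_eq)
  finally show ?thesis using ty by linarith
qed

lemma lv_ge: "n \<le> lv n"
proof (induction n)
  case (Suc n)
  then show ?case using lvS[of n] by simp
qed simp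

text \<open>After a refinement almost every site shows all digits of the level. A step without
  refinement keeps the readings by \<open>rd_keep\<close>, and as \<open>fl\<close> alternates, one
  of any two consecutive steps is a refinement.\<close>

lemma rd_short_lim:
  assumes alt: "\<And>r. fl (Suc r) = (\<not> fl r)"
    and ty: "\<And>r. fl r \<Longrightarrow> P.prob {x. \<not> typl r (snd (bd k (N (Suc r)) (lv (Suc r)) x))} \<le> 2 * (1 / 2) ^ r"
  shows "(\<lambda>r. P.prob {x. length (rd r x) \<le> n}) \<longlonglongrightarrow> 0"
proof -
  define b where "b r = 2 * (1 / 2) ^ r + (1 - P.prob {x. GC (lv (Suc r)) x})" for r
  have lvlim: "filterlim (\<lambda>r. lv (Suc r)) at_top sequentially"
    using lv_ge by (intro filterlim_at_top_mono[OF filterlim_Suc]) auto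
  have blim: "b \<longlonglongrightarrow> 0"
  proof -
    have "(\<lambda>r. P.prob {x. GC (lv (Suc r)) x}) \<longlonglongrightarrow> 1"
      by (rule filterlim_compose[OF prob_GC_lim lvlim])
    then have "b \<longlonglongrightarrow> 2 * 0 + (1 - 1)" unfolding b_def
      by (intro tendsto_intros LIMSEQ_realpow_zero) auto
    then show ?thesis by simp
  qed
  have ref: "P.prob {x. length (rd (Suc r) x) \<le> n} \<le> b r" if "fl r" "n < lv (Suc r)" for r
  proof -
    have "P.prob {x. length (rd (Suc r) x) \<le> n} \<le> P.prob {x. length (rd (Suc r) x) < lv (Suc r)}"
      by (rule P.finite_measure_mono) (use that in \<open>auto intro!: sets_pred\<close>)
    also have "\<dots> \<le> b r" unfolding b_def by (rule prob_rd_short_refined[OF that(1) ty[OF that(1)]])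
    finally show ?thesis .
  qed
  have bound: "P.prob {x. length (rd (Suc (Suc r)) x) \<le> n} \<le> b r + b (Suc r)" if "n < lv (Suc r)" for r
  proof -
    have bnn: "0 \<le> b q" for q by (simp add: b_def)
    have n2: "n < lv (Suc (Suc r))" using that lvS[of "Suc r"] by simp
    show ?thesis
    proof (cases "fl (Suc r)")
      case True
      then show ?thesis using ref[OF True n2] bnn[of r] by simp
    next
      case False
      then have f: "fl r" using alt by simp
      have "P.prob {x. length (rd (Suc (Suc r)) x) \<le> n} = P.prob {x. length (rd (Suc r) x) \<le> n}"
        by (rule P.finite_measure_eq_AE)
           (use AE_nice rd_keep[OF _ False] in \<open>auto intro!: sets_pred elim!: eventually_mono\<close>)
      then show ?thesis using ref[OF f that] bnn[of "Suc r"] by simp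
    qed
  qed
  have "(\<lambda>r. P.prob {x. length (rd (Suc (Suc r)) x) \<le> n}) \<longlonglongrightarrow> 0"
  proof (rule tendsto_sandwich[of "\<lambda>_. 0" _ _ "\<lambda>r. b r + b (Suc r)"])
    show "\<forall>\<^sub>F r in sequentially. P.prob {x. length (rd (Suc (Suc r)) x) \<le> n} \<le> b r + b (Suc r)"
      using eventually_ge_at_top[of n]
    proof eventually_elim
      case (elim r)
      show ?case by (rule bound) (use lv_ge[of "Suc r"] elim in simp)
    qed
    show "(\<lambda>r. b r + b (Suc r)) \<longlonglongrightarrow> 0" using tendsto_add[OF blim LIMSEQ_Suc[OF blim]] by simp
  qed auto
  then have "(\<lambda>r. P.prob {x. length (rd (Suc r) x) \<le> n}) \<longlonglongrightarrow> 0"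
    by (rule LIMSEQ_imp_Suc)
  then show ?thesis by (rule LIMSEQ_imp_Suc)
qed

end

subsection \<open>The coding map\<close>

lemma wrd_sub:
  assumes "n \<le> m" "w \<le> v"
  shows "wrd n x (- int w) (2 * w + 1) = map (take n) (take (2 * w + 1) (drop (v - w) (wrd m x (- int v) (2 * v + 1))))"
proof (rule nth_equalityI)
  fix i assume "i < length (wrd n x (- int w) (2 * w + 1))"
  then have i: "i < 2 * w + 1" by simp
  have "- int v + int (v - w + i) = - int w + int i" using assms by simp
  then show "wrd n x (- int w) (2 * w + 1) ! i = map (take n) (take (2 * w + 1) (drop (v - w) (wrd m x (- int v) (2 * v + 1)))) ! i"
    using i assms by (simp add: take_lev)
qed (use assms in simp)

text \<open>Events on centred windows form an intersection-stable generator: two windows can both be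
  read off a third one that is wider and finer.\<close>

lemma (in bern) measure_eqI_wrd:
  assumes M: "sets M = sets P" "finite_measure M"
    and eq: "\<And>n w V. measure M {x. wrd n x (- int w) (2 * w + 1) \<in> V} = P.prob {x. wrd n x (- int w) (2 * w + 1) \<in> V}"
  shows "M = P"
proof -
  define E where "E n w V = {x. wrd n x (- int w) (2 * w + 1) \<in> V}" for n w V
  define GG where "GG = {E n w V | n w V. True}"
  interpret M: finite_measure M by fact
  have GP: "E n w V \<in> sets P" for n w V unfolding E_def by (rule sets_wrd)
  have digit_GG: "{x. x i n = b} \<in> GG" for i n b
  proof -
    have "{x. x i n = b} = E (Suc n) (nat \<bar>i\<bar>) {V. V ! nat (i + \<bar>i\<bar>) ! n = b}"
    proof -
      have "wrd (Suc n) x (- int (nat \<bar>i\<bar>)) (2 * nat \<bar>i\<bar> + 1) ! nat (i + \<bar>i\<bar>) ! n = x i n" for x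
        by (subst nth_wrd) auto
      then show ?thesis unfolding E_def by (simp only: mem_Collect_eq)
    qed
    then show ?thesis by (auto simp: GG_def)
  qed
  have sub: "sets P \<subseteq> sigma_sets UNIV GG"
  proof -
    let ?S = "sigma UNIV GG"
    have sp: "space ?S = UNIV" and ss: "sets ?S = sigma_sets UNIV GG" by auto
    have d: "(\<lambda>x. x i n) \<in> measurable ?S (count_space UNIV)" for i n
    proof (subst measurable_count_space_eq2_countable)
      have "(\<lambda>x. x i n) -` {b} \<inter> space ?S \<in> sets ?S" for b
        unfolding ss sp using digit_GG[of i n b] by (auto simp: vimage_def)
      then show "(\<lambda>x. x i n) \<in> space ?S \<rightarrow> UNIV \<and> (\<forall>a\<in>UNIV. (\<lambda>x. x i n) -` {a} \<inter> space ?S \<in> sets ?S)" by simp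
    qed
    have c0: "(\<lambda>x. x i) \<in> measurable ?S symM" for i
      unfolding symM_def by (rule measurable_PiM_single') (use d in auto)
    have c: "(\<lambda>x. x i) \<in> measurable ?S \<mu>" for i
      unfolding measurable_cong_sets[OF refl sets_mu] by (rule c0)
    have "(\<lambda>x. x) \<in> measurable ?S P" by (rule measurable_P) (rule c)
    then have "A \<in> sets ?S" if "A \<in> sets P" for A using measurable_sets[OF _ that, of "\<lambda>x. x" ?S] by (simp add: sp)
    then show ?thesis unfolding ss by blast
  qed
  have gen: "sets P = sigma_sets UNIV GG"
  proof
    show "sigma_sets UNIV GG \<subseteq> sets P"
      using sets.sigma_sets_subset[of GG P] GP by (auto simp: GG_def)
  qed (rule sub)
  show ?thesis
  proof (rule measure_eqI_generator_eq[where E=GG and \<Omega>=UNIV and A="\<lambda>_. UNIV"])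
    show "Int_stable GG"
    proof (rule Int_stableI)
      fix A B assume "A \<in> GG" "B \<in> GG"
      then obtain n w V n' w' V' where AB: "A = E n w V" "B = E n' w' V'" by (auto simp: GG_def)
      define m v where "m = max n n'" and "v = max w w'"
      let ?f = "\<lambda>n w U. map (take n) (take (2 * w + 1) (drop (v - w) U))"
      have "A \<inter> B = E m v {U. ?f n w U \<in> V \<and> ?f n' w' U \<in> V'}"
        unfolding AB E_def using wrd_sub[of n m w v] wrd_sub[of n' m w' v] by (auto simp: m_def v_def)
      then show "A \<inter> B \<in> GG" by (auto simp: GG_def)
    qed
    show "emeasure M A = emeasure P A" if "A \<in> GG" for A
      using that eq by (auto simp: GG_def E_def M.emeasure_eq_measure P.emeasure_eq_measure)
    show "sets M = sigma_sets UNIV GG" "sets P = sigma_sets UNIV GG" using M gen by auto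
    have "UNIV = E 0 0 UNIV" by (simp add: E_def)
    then show "range (\<lambda>_::nat. UNIV) \<subseteq> GG" by (auto simp: GG_def)
    show "emeasure M UNIV \<noteq> \<infinity>" by simp
  qed auto
qed

context pair
begin

text \<open>Both skeletons have the law \<open>KP\<close>, so the identity couples them, and the
  labels are then coupled shape by shape.\<close>

lemma relDD:
  "rel_pmf (\<lambda>z z'. fst z = fst z' \<and> fst (snd z) = fst (snd z') \<and> X.okS (fst (snd z)) \<and> Rel r (fst (snd z)) (snd (snd z)) (snd (snd z'))) (X.DD r) (Y.DD r)"
  unfolding X.DD_bind Y.DD_bind KP_eq
proof (rule rel_pmf_bindI[where R="\<lambda>z z'. z = z' \<and> z \<in> set_pmf (X.KP (N r))"])
  show "rel_pmf (\<lambda>z z'. z = z' \<and> z \<in> set_pmf (X.KP (N r))) (X.KP (N r)) (X.KP (N r))" by (rule rel_pmf_reflI) simp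
  fix z z' assume zz: "z = z' \<and> z \<in> set_pmf (X.KP (N r))"
  obtain j S where z: "z = (j, S)" by fastforce
  have "(j, S) \<in> set_pmf (X.KP (N r))" using zz z by auto
  from X.set_KP(3)[OF this] have ok: "X.okS S" .
  show "rel_pmf (\<lambda>z z'. fst z = fst z' \<and> fst (snd z) = fst (snd z') \<and> X.okS (fst (snd z)) \<and> Rel r (fst (snd z)) (snd (snd z)) (snd (snd z')))
    (case z of (j, S) \<Rightarrow> map_pmf (\<lambda>\<alpha>. (j, S, \<alpha>)) (X.LL r S)) (case z' of (j, S) \<Rightarrow> map_pmf (\<lambda>\<alpha>. (j, S, \<alpha>)) (Y.LL r S))"
    using zz z rel[OF ok, of r] ok by (auto simp: pmf.rel_map)
qed

definition PA :: "nat \<Rightarrow> nat list \<Rightarrow> lab \<Rightarrow> lab set" where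
  "PA r S \<beta> = {\<alpha>\<in>set_pmf (X.LL r S). Rel r S \<alpha> \<beta>}"

text \<open>There is output only if the label has exactly one partner; the empty word means that the
  stage decides nothing.\<close>

definition outd :: "nat \<Rightarrow> nat \<times> nat list \<times> lab \<Rightarrow> bool list" where
  "outd r z = (if \<exists>\<alpha>. PA r (fst (snd z)) (snd (snd z)) = {\<alpha>} then flat (the_elem (PA r (fst (snd z)) (snd (snd z)))) ! fst z else [])"

definition out :: "nat \<Rightarrow> (int \<Rightarrow> sym) \<Rightarrow> bool list" where "out r y = outd r (Y.dat r y)"

text \<open>A digit is true if some stage outputs it as true, and digits that are never decided
  become false. In this form \<open>Psi\<close> is total, measurable and equivariant on the whole
  space; on \<open>nice\<close> points \<open>out_consistent\<close> makes the stages agree.\<close>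

definition Psi :: "(int \<Rightarrow> sym) \<Rightarrow> int \<Rightarrow> sym" where
  "Psi y i n \<longleftrightarrow> (\<exists>r. n < length (out r (sh i y)) \<and> out r (sh i y) ! n)"

definition ambs :: "nat \<Rightarrow> (int \<Rightarrow> sym) \<Rightarrow> bool" where
  "ambs r y \<longleftrightarrow> amb (\<lambda>b a. Rel r (fst (snd (Y.dat r y))) a b) (set_pmf (X.LL r (fst (snd (Y.dat r y))))) (snd (snd (Y.dat r y)))"

lemma Psi_sh: "Psi (sh a y) = sh a (Psi y)"
  by (intro ext) (simp add: Psi_def)

lemma out_meas [measurable]: "out r \<in> measurable Y.P (count_space UNIV)"
  unfolding out_def[abs_def] by (rule measurable_compose[OF Y.dat_meas]) simp

lemma out_sh_meas [measurable]: "(\<lambda>y. out r (sh i y)) \<in> measurable Y.P (count_space UNIV)"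
  by (rule measurable_compose[OF Y.sh_measurable out_meas])

lemma ambs_meas [measurable]: "Measurable.pred Y.P (ambs r)"
  unfolding ambs_def[abs_def]
  by (rule measurable_compose[OF Y.dat_meas, of "\<lambda>z. amb (\<lambda>b a. Rel r (fst (snd z)) a b) (set_pmf (X.LL r (fst (snd z)))) (snd (snd z))"]) simp

lemma Psi_digit_meas [measurable]: "Measurable.pred Y.P (\<lambda>y. Psi y i n)"
  unfolding Psi_def by measurable

lemma Psi_meas: "Psi \<in> measurable Y.P X.P"
proof (rule X.measurable_P)
  fix i
  have "(\<lambda>y. Psi y i) \<in> measurable Y.P symM"
    unfolding symM_def by (rule measurable_PiM_single') auto
  then show "(\<lambda>y. Psi y i) \<in> measurable Y.P \<mu>" using X.sets_mu by (simp cong: measurable_cong_sets)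
qed

lemma PA_single:
  assumes "Y.nice y" "Y.dat r y = (j, S, \<beta>)" "\<not> ambs r y" "\<alpha> \<in> PA r S \<beta>"
  shows "PA r S \<beta> = {\<alpha>}"
  using assms(2-) unfolding ambs_def amb_def PA_def by auto

text \<open>Related labels have related children, so a partner at one stage restricts to a partner
  at the stage before, whose reading is a prefix. If X is not refined in between, the two readings
  coincide.\<close>

lemma PA_step:
  assumes y: "Y.nice y" and d: "Y.dat (Suc r) y = (j, S, \<beta>)" and a: "\<alpha> \<in> PA (Suc r) S \<beta>"
    and l: "loc (map sum_list (sgrp (N r) S)) j = (i, j')"
  shows "pts \<alpha> ! i \<in> PA r (sgrp (N r) S ! i) (pts \<beta> ! i)"
    "prefix (flat (pts \<alpha> ! i) ! j') (flat \<alpha> ! j)"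
    "\<not> upd r \<Longrightarrow> flat (pts \<alpha> ! i) ! j' = flat \<alpha> ! j"
proof -
  have ok: "X.okS S" using Y.nice_dat(1)[OF y d] okS_eq by simp
  have i: "i < length (sgrp (N r) S)" using Y.down(1)[OF y d l] .
  have aLL: "\<alpha> \<in> set_pmf (X.LL (Suc r) S)" and aR: "Rel (Suc r) S \<alpha> \<beta>" using a by (auto simp: PA_def)
  have "pts \<alpha> \<in> set_pmf (lprod (map (X.LL r) (sgrp (N r) S)))"
    unfolding X.pts_LL[OF ok, symmetric] using aLL by simp
  then have "list_all2 (\<lambda>x S. x \<in> set_pmf (X.LL r S)) (pts \<alpha>) (sgrp (N r) S)" by (simp add: set_lprod list_all2_map2)
  then have "pts \<alpha> ! i \<in> set_pmf (X.LL r (sgrp (N r) S ! i))" using i by (simp add: list_all2_conv_all_nth)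
  then show "pts \<alpha> ! i \<in> PA r (sgrp (N r) S ! i) (pts \<beta> ! i)"
    using relS[OF ok aR i] by (simp add: PA_def)
  obtain F where F: "F \<in> set_pmf (X.FW (lv (Suc r)) S)" "\<alpha> = X.lb (Suc r) F" using aLL unfolding X.set_LL by blast
  have S: "map length F = S" using X.set_FW[OF X.lv2 ok] F(1) by blast
  have j: "j < bsize F" using Y.nice_dat(3)[OF y d] S by (simp add: length_concat_map)
  note fd = X.flat_down[OF j l[folded S]]
  show "prefix (flat (pts \<alpha> ! i) ! j') (flat \<alpha> ! j)" unfolding F(2) by (rule fd(1))
  show "flat (pts \<alpha> ! i) ! j' = flat \<alpha> ! j" if "\<not> upd r" unfolding F(2) by (rule fd(2)) (use that in \<open>simp add: X.typl_def\<close>)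
qed

lemma PA_consistent:
  assumes y: "Y.nice y"
  shows "Y.dat (r + m) y = (j, S, \<beta>) \<Longrightarrow> \<alpha> \<in> PA (r + m) S \<beta> \<Longrightarrow> Y.dat r y = (j0, S0, \<beta>0) \<Longrightarrow>
     \<exists>\<alpha>0\<in>PA r S0 \<beta>0. prefix (flat \<alpha>0 ! j0) (flat \<alpha> ! j)"
proof (induction m arbitrary: j S \<beta> \<alpha>)
  case 0
  then show ?case by auto
next
  case (Suc m)
  have d: "Y.dat (Suc (r + m)) y = (j, S, \<beta>)" and a: "\<alpha> \<in> PA (Suc (r + m)) S \<beta>" using Suc.prems by auto
  obtain i j' where l: "loc (map sum_list (sgrp (N (r + m)) S)) j = (i, j')" by fastforce
  note st = PA_step[OF y d a l]
  from Suc.IH[OF Y.down(2)[OF y d l] st(1) Suc.prems(3)] st(2)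
  show ?case by (blast intro: prefix_order.trans)
qed

lemma out_consistent:
  assumes y: "Y.nice y" and rr: "r \<le> r'" and ne: "out r y \<noteq> []" "out r' y \<noteq> []"
  shows "prefix (out r y) (out r' y)"
proof -
  obtain j S \<beta> where d: "Y.dat r' y = (j, S, \<beta>)" by (metis prod_cases3)
  obtain j0 S0 \<beta>0 where d0: "Y.dat r y = (j0, S0, \<beta>0)" by (metis prod_cases3)
  obtain \<alpha> where a: "PA r' S \<beta> = {\<alpha>}" "out r' y = flat \<alpha> ! j"
    using ne(2) d by (auto simp: out_def outd_def split: if_splits)
  obtain \<alpha>0 where a0: "PA r S0 \<beta>0 = {\<alpha>0}" "out r y = flat \<alpha>0 ! j0"
    using ne(1) d0 by (auto simp: out_def outd_def split: if_splits)
  have "Y.dat (r + (r' - r)) y = (j, S, \<beta>)" "\<alpha> \<in> PA (r + (r' - r)) S \<beta>" using d a rr by auto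
  from PA_consistent[OF y this d0] a a0 show ?thesis by auto
qed

lemma Psi_out:
  assumes y: "Y.nice y" and n: "n < length (out r (sh i y))"
  shows "Psi y i n = out r (sh i y) ! n"
proof
  have y': "Y.nice (sh i y)" using y by simp
  assume "Psi y i n"
  then obtain r' where r': "n < length (out r' (sh i y))" "out r' (sh i y) ! n" by (auto simp: Psi_def)
  have ne: "out r (sh i y) \<noteq> []" "out r' (sh i y) \<noteq> []" using n r' by auto
  have "prefix (out r (sh i y)) (out r' (sh i y)) \<or> prefix (out r' (sh i y)) (out r (sh i y))"
    using out_consistent[OF y' _ ne] out_consistent[OF y' _ ne(2,1)] by (meson nat_le_linear)
  then show "out r (sh i y) ! n" using n r' by (auto simp: prefix_def nth_append)
qed (use n in \<open>auto simp: Psi_def\<close>)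

definition okw :: "nat \<Rightarrow> nat \<Rightarrow> nat \<times> nat list \<times> lab \<Rightarrow> bool" where
  "okw w n z \<longleftrightarrow> w \<le> fst z \<and> fst z + w < sum_list (fst (snd z)) \<and> (\<forall>i<2 * w + 1. n \<le> length (flat (snd (snd z)) ! (fst z - w + i)))"

definition win :: "nat \<Rightarrow> nat \<Rightarrow> nat \<times> nat list \<times> lab \<Rightarrow> bool list list" where
  "win w n z = map (\<lambda>i. take n (flat (snd (snd z)) ! (fst z - w + i))) [0..<2 * w + 1]"

definition cutf :: "nat \<times> nat list \<times> lab \<Rightarrow> bool" where
  "cutf z \<longleftrightarrow> (\<exists>i\<le>length (fst (snd z)). fst z = sum_list (take i (fst (snd z))))"

lemma win_X:
  assumes x: "X.nice x" and ok: "okw w n (X.dat r x)"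
  shows "win w n (X.dat r x) = wrd n x (- int w) (2 * w + 1)"
proof (rule nth_equalityI)
  fix i assume "i < length (win w n (X.dat r x))"
  then have i: "i < 2 * w + 1" by (simp add: win_def)
  obtain j S \<alpha> where d: "X.dat r x = (j, S, \<alpha>)" by (metis prod_cases3)
  have jw: "w \<le> j" "j + w < sum_list S" "n \<le> length (flat \<alpha> ! (j - w + i))" using ok i unfolding okw_def d by auto
  have t: "j - w + i < sum_list S" using jw i by linarith
  have "prefix (flat \<alpha> ! (j - w + i)) (lev (lv r) (x (- int j + int (j - w + i))))" by (rule X.flat_prefix(2)[OF x d t])
  moreover have "- int j + int (j - w + i) = - int w + int i" using jw by simp
  ultimately have pf: "prefix (flat \<alpha> ! (j - w + i)) (lev (lv r) (x (- int w + int i)))" by simp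
  have nl: "n \<le> lv r" using prefix_length_le[OF pf] jw(3) by simp
  have "take n (flat \<alpha> ! (j - w + i)) = take n (lev (lv r) (x (- int w + int i)))"
    using pf jw(3) by (auto simp: prefix_def)
  then show "win w n (X.dat r x) ! i = wrd n x (- int w) (2 * w + 1) ! i"
    using i nl by (simp add: win_def d take_lev del: upt_Suc)
qed (simp add: win_def)

text \<open>Along a block only the offset changes (\<open>dat_sh\<close>), so a unique partner of
  \<open>\<beta>\<close> yields the output at every site of the window at once.\<close>

lemma win_Y:
  assumes y: "Y.nice y" and d: "Y.dat r y = (j, S, \<beta>)" and a: "PA r S \<beta> = {\<alpha>}" and ok: "okw w n (j, S, \<alpha>)"
  shows "win w n (j, S, \<alpha>) = wrd n (Psi y) (- int w) (2 * w + 1)"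
proof (rule nth_equalityI)
  fix i assume "i < length (win w n (j, S, \<alpha>))"
  then have i: "i < 2 * w + 1" by (simp add: win_def)
  have jw: "w \<le> j" "j + w < sum_list S" "n \<le> length (flat \<alpha> ! (j - w + i))" using ok i by (auto simp: okw_def)
  define i' where "i' = - int w + int i"
  have "Y.dat r (sh i' y) = (nat (int j + i'), S, \<beta>)"
    by (rule Y.dat_sh[OF y d]) (use jw i in \<open>auto simp: i'_def\<close>)
  moreover have "nat (int j + i') = j - w + i" using jw by (simp add: i'_def)
  ultimately have "out r (sh i' y) = flat \<alpha> ! (j - w + i)" using a by (simp add: out_def outd_def)
  then have "Psi y i' m = flat \<alpha> ! (j - w + i) ! m" if "m < n" for m using Psi_out[OF y, of m r i'] that jw(3) by simp
  then have "lev n (Psi y i') = take n (flat \<alpha> ! (j - w + i))" using jw(3) by (intro nth_equalityI) auto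
  then show "win w n (j, S, \<alpha>) ! i = wrd n (Psi y) (- int w) (2 * w + 1) ! i" using i by (simp add: win_def i'_def del: upt_Suc)
qed (simp add: win_def)

lemma sets_XD: "{x. A (X.dat r x)} \<in> sets X.P"
  using measurable_sets[OF X.dat_meas, of "{z. A z}" r] by (simp add: vimage_def)

text \<open>If the label of \<open>y\<close> has a single partner, \<open>Psi y\<close> shows the
  digits of that partner around site 0. The coupling carries an event on labels of \<open>x\<close>
  to the labels of \<open>y\<close> that are ambiguous or have their only partner in the event.
  Where the window is readable, an event on labels is one on the window. The cut is a second
  argument of \<open>\<Theta>\<close> because coupled data share the skeleton.\<close>

lemma law_ineq:
  "X.P.prob {x. \<Theta> (cut k x 0) (wrd n x (- int w) (2 * w + 1))}
    \<le> Y.P.prob {y. \<Theta> (cut k y 0) (wrd n (Psi y) (- int w) (2 * w + 1))} + Y.P.prob {y. ambs r y} + X.P.prob {x. \<not> okw w n (X.dat r x)}"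
proof -
  define A where "A z \<longleftrightarrow> okw w n z \<and> \<Theta> (cutf z) (win w n z)" for z
  define B where "B z \<longleftrightarrow> amb (\<lambda>b a. Rel r (fst (snd z)) a b) (set_pmf (X.LL r (fst (snd z)))) (snd (snd z)) \<or>
     (\<exists>\<alpha>. PA r (fst (snd z)) (snd (snd z)) = {\<alpha>} \<and> A (fst z, fst (snd z), \<alpha>))" for z
  have "X.P.prob {x. \<Theta> (cut k x 0) (wrd n x (- int w) (2 * w + 1))} \<le> X.P.prob ({x. A (X.dat r x)} \<union> {x. \<not> okw w n (X.dat r x)})"
  proof (rule X.P.finite_measure_mono_AE)
    show "AE x in X.P. x \<in> {x. \<Theta> (cut k x 0) (wrd n x (- int w) (2 * w + 1))} \<longrightarrow> x \<in> {x. A (X.dat r x)} \<union> {x. \<not> okw w n (X.dat r x)}"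
      using X.AE_nice
    proof eventually_elim
      case (elim x)
      have "cut k x 0 \<longleftrightarrow> cutf (X.dat r x)" using X.dat_cut[OF elim, of r] by (metis cutf_def fst_conv prod_cases3 snd_conv)
      then show ?case using win_X[OF elim, of w n r] by (auto simp: A_def)
    qed
  qed (intro sets.Un sets_XD)
  also have "\<dots> \<le> X.P.prob {x. A (X.dat r x)} + X.P.prob {x. \<not> okw w n (X.dat r x)}"
    by (rule measure_Un_le) (rule sets_XD)+
  also have "X.P.prob {x. A (X.dat r x)} = measure_pmf.prob (X.DD r) {z. A z}" by (simp add: X.prob_DD)
  also have "\<dots> \<le> measure_pmf.prob (Y.DD r) {z. B z}"
  proof (rule rel_pmf_prob_le[OF relDD])
    fix z z' assume z: "z \<in> set_pmf (X.DD r)" and z': "z' \<in> set_pmf (Y.DD r)"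
      and R: "fst z = fst z' \<and> fst (snd z) = fst (snd z') \<and> X.okS (fst (snd z)) \<and> Rel r (fst (snd z)) (snd (snd z)) (snd (snd z'))"
      and A: "z \<in> {z. A z}"
    obtain j S \<alpha> \<beta> where zz: "z = (j, S, \<alpha>)" "z' = (j, S, \<beta>)" using R by (metis prod.collapse)
    have "\<alpha> \<in> set_pmf (X.LL r S)" using z unfolding X.DD_bind zz by auto
    then have "\<alpha> \<in> PA r S \<beta>" using R zz by (simp add: PA_def)
    then have "amb (\<lambda>b a. Rel r S a b) (set_pmf (X.LL r S)) \<beta> \<or> PA r S \<beta> = {\<alpha>}"
      unfolding amb_def PA_def by auto
    then show "z' \<in> {z. B z}" using A zz by (auto simp: B_def)
  qed
  also have "\<dots> = Y.P.prob {y. B (Y.dat r y)}" by (simp add: Y.prob_DD)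
  also have "\<dots> \<le> Y.P.prob ({y. \<Theta> (cut k y 0) (wrd n (Psi y) (- int w) (2 * w + 1))} \<union> {y. ambs r y})"
  proof (rule Y.P.finite_measure_mono_AE)
    show "AE y in Y.P. y \<in> {y. B (Y.dat r y)} \<longrightarrow> y \<in> {y. \<Theta> (cut k y 0) (wrd n (Psi y) (- int w) (2 * w + 1))} \<union> {y. ambs r y}"
      using Y.AE_nice
    proof eventually_elim
      case (elim y)
      obtain j S \<beta> where d: "Y.dat r y = (j, S, \<beta>)" by (metis prod_cases3)
      show ?case
      proof (intro impI UnCI)
        assume "y \<in> {y. B (Y.dat r y)}" "y \<notin> {y. ambs r y}"
        then obtain \<alpha> where a: "PA r S \<beta> = {\<alpha>}" "A (j, S, \<alpha>)" using d by (auto simp: B_def ambs_def)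
        have "cut k y 0 \<longleftrightarrow> cutf (j, S, \<alpha>)" using Y.dat_cut[OF elim d] by (simp add: cutf_def)
        then show "y \<in> {y. \<Theta> (cut k y 0) (wrd n (Psi y) (- int w) (2 * w + 1))}"
          using a win_Y[OF elim d a(1), of w n] by (simp add: A_def)
      qed
    qed
    have "(\<lambda>y. wrd n (Psi y) (- int w) (2 * w + 1)) \<in> measurable Y.P (count_space UNIV)"
      by (rule measurable_compose[OF Psi_meas X.wrd_meas])
    then have "Measurable.pred Y.P (\<lambda>y. \<Theta> (cut k y 0) (wrd n (Psi y) (- int w) (2 * w + 1)))"
      by (rule measurable_compose_countable[where f="\<lambda>V y. \<Theta> (cut k y 0) V", rotated]) measurable
    then show "{y. \<Theta> (cut k y 0) (wrd n (Psi y) (- int w) (2 * w + 1))} \<union> {y. ambs r y} \<in> sets Y.P"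
      by (intro sets.Un Y.sets_pred ambs_meas)
  qed
  also have "\<dots> \<le> Y.P.prob {y. \<Theta> (cut k y 0) (wrd n (Psi y) (- int w) (2 * w + 1))} + Y.P.prob {y. ambs r y}"
  proof (rule measure_Un_le)
    have "(\<lambda>y. wrd n (Psi y) (- int w) (2 * w + 1)) \<in> measurable Y.P (count_space UNIV)"
      by (rule measurable_compose[OF Psi_meas X.wrd_meas])
    then have "Measurable.pred Y.P (\<lambda>y. \<Theta> (cut k y 0) (wrd n (Psi y) (- int w) (2 * w + 1)))"
      by (rule measurable_compose_countable[where f="\<lambda>V y. \<Theta> (cut k y 0) V", rotated]) measurable
    then show "{y. \<Theta> (cut k y 0) (wrd n (Psi y) (- int w) (2 * w + 1))} \<in> sets Y.P" by (rule Y.sets_pred)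
  qed (rule Y.sets_pred[OF ambs_meas])
  finally show ?thesis by simp
qed

lemma N_ge: "n \<le> N n"
proof (induction n)
  case (Suc n)
  then show ?case using X.NS[of n] by simp
qed simp

lemma rdX_lim: "(\<lambda>r. X.P.prob {x. length (X.rd r x) \<le> n}) \<longlonglongrightarrow> 0"
  by (rule X.rd_short_lim[OF altern typX])

text \<open>The window is unreadable only if a block boundary lies in it or one of its sites shows
  too few digits; both are rare, and there are \<open>2 * w + 1\<close> sites.\<close>

lemma okw_lim: "(\<lambda>r. X.P.prob {x. \<not> okw w n (X.dat r x)}) \<longlonglongrightarrow> 0"
proof -
  let ?W = "{- int w..int w}"
  define bb where "bb r = (\<Sum>i\<in>?W. X.kappa (N r) + X.P.prob {x. length (X.rd r x) \<le> n})" for r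
  have kl: "(\<lambda>r. X.kappa (N r)) \<longlonglongrightarrow> 0"
    by (rule filterlim_compose[OF X.kappa_lim]) (rule filterlim_at_top_mono[OF filterlim_ident], use N_ge in auto)
  have "bb \<longlonglongrightarrow> (\<Sum>i\<in>?W. 0 + 0)" unfolding bb_def by (intro tendsto_intros kl rdX_lim)
  then have bb0: "bb \<longlonglongrightarrow> 0" by simp
  have le: "X.P.prob {x. \<not> okw w n (X.dat r x)} \<le> bb r" for r
  proof -
    let ?E = "\<lambda>i. {x. CC k (N r) x i} \<union> {x. length (X.rd r (sh i x)) \<le> n}"
    have m1: "{x. length (X.rd r (sh i x)) \<le> n} \<in> sets X.P" for i by (rule X.sets_pred) measurable
    have mE: "?E i \<in> sets X.P" for i by (intro sets.Un X.sets_CC m1)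
    have "X.P.prob {x. \<not> okw w n (X.dat r x)} \<le> X.P.prob (\<Union>i\<in>?W. ?E i)"
    proof (rule X.P.finite_measure_mono_AE)
      show "AE x in X.P. x \<in> {x. \<not> okw w n (X.dat r x)} \<longrightarrow> x \<in> (\<Union>i\<in>?W. ?E i)"
        using X.AE_nice
      proof eventually_elim
        case (elim x)
        obtain j S \<alpha> where d: "X.dat r x = (j, S, \<alpha>)" by (metis prod_cases3)
        obtain F where F: "isblk k (N r) (lv r) x j F" "S = map length F" using X.nice_dat(5)[OF elim d] by blast
        have ends: "CC k (N r) x (- int j)" "CC k (N r) x (- int j + int (bsize F))" "j < bsize F"
          using F(1) fill_ends[OF X.lv2 X.k1, of x "- int j" r F "N r"] by (auto simp: isblk_def dest: CC_cut)
        show ?case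
        proof (intro impI, rule ccontr)
          assume no: "x \<in> {x. \<not> okw w n (X.dat r x)}" "x \<notin> (\<Union>i\<in>?W. ?E i)"
          then have nC: "\<not> CC k (N r) x i" and nl: "n < length (X.rd r (sh i x))" if "i \<in> ?W" for i
            using that by (auto simp: not_le)
          have w1: "w \<le> j"
          proof (rule ccontr)
            assume "\<not> w \<le> j"
            then have "- int j \<in> ?W" by auto
            then show False using nC ends(1) by blast
          qed
          have w2: "j + w < bsize F"
          proof (rule ccontr)
            assume "\<not> j + w < bsize F"
            then have "- int j + int (bsize F) \<in> ?W" using ends(3) by auto
            then show False using nC ends(2) by blast
          qed
          have "n \<le> length (flat \<alpha> ! (j - w + i))" if i: "i < 2 * w + 1" for i
          proof -
            let ?i = "- int w + int i"
            have "X.dat r (sh ?i x) = (nat (int j + ?i), S, \<alpha>)"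
              by (rule X.dat_sh[OF elim d]) (use w1 w2 i F(2) in \<open>auto simp: length_concat_map\<close>)
            moreover have "nat (int j + ?i) = j - w + i" using w1 by simp
            ultimately have "X.rd r (sh ?i x) = flat \<alpha> ! (j - w + i)" by (simp add: X.rd_def)
            moreover have "?i \<in> ?W" using i by auto
            ultimately show ?thesis using nl[of ?i] by simp
          qed
          then have "okw w n (X.dat r x)" using w1 w2 d F(2) by (simp add: okw_def length_concat_map)
          then show False using no by simp
        qed
      qed
    qed (use mE in auto)
    also have "\<dots> \<le> (\<Sum>i\<in>?W. X.P.prob (?E i))" by (rule X.P.finite_measure_subadditive_finite) (use mE in auto)
    also have "\<dots> \<le> bb r" unfolding bb_def
    proof (rule sum_mono)
      fix i
      have "X.P.prob (?E i) \<le> X.P.prob {x. CC k (N r) x i} + X.P.prob {x. length (X.rd r (sh i x)) \<le> n}"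
        by (rule measure_Un_le) (intro X.sets_CC m1)+
      also have "X.P.prob {x. length (X.rd r (sh i x)) \<le> n} = X.P.prob {x. length (X.rd r x) \<le> n}"
        by (rule X.prob_sh) (rule X.sets_pred, measurable)
      finally show "X.P.prob (?E i) \<le> X.kappa (N r) + X.P.prob {x. length (X.rd r x) \<le> n}"
        by (simp add: X.prob_CC del: sh_apply)
    qed
    finally show ?thesis .
  qed
  show ?thesis by (rule tendsto_sandwich[OF _ _ tendsto_const bb0]) (use le in auto)
qed

text \<open>The next step in which Y is refined: ambiguity of Y labels is controlled after such
  steps.\<close>

definition rY :: "nat \<Rightarrow> nat" where "rY m = (if upd m then Suc m else m)"

lemma rY: "\<not> upd (rY m)" "m \<le> rY m" using altern by (auto simp: rY_def)

lemma rY_lim: "filterlim rY at_top sequentially"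
  by (rule filterlim_at_top_mono[OF filterlim_ident]) (use rY in auto)

lemma ambs_lim: "(\<lambda>m. Y.P.prob {y. ambs (Suc (rY m)) y}) \<longlonglongrightarrow> 0"
proof -
  have "(\<lambda>r. 3 * (1 / 2) ^ r :: real) \<longlonglongrightarrow> 3 * 0" by (intro tendsto_intros LIMSEQ_realpow_zero) auto
  from filterlim_compose[OF this rY_lim] have l: "(\<lambda>m. 3 * (1 / 2) ^ rY m :: real) \<longlonglongrightarrow> 0" by simp
  show ?thesis
    by (rule tendsto_sandwich[OF _ _ tendsto_const l]) (use ambY[OF rY(1)] in \<open>auto simp: ambs_def\<close>)
qed

lemma Suc_rY_lim: "filterlim (\<lambda>m. Suc (rY m)) at_top sequentially"
  by (rule filterlim_at_top_mono[OF rY_lim]) auto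

text \<open>Both errors of \<open>law_ineq\<close> vanish along the stages
  \<open>Suc (rY m)\<close>. As \<open>\<Theta>\<close> is arbitrary, complements later turn the
  inequality into equality of laws.\<close>

lemma law_le:
  "X.P.prob {x. \<Theta> (cut k x 0) (wrd n x (- int w) (2 * w + 1))} \<le> Y.P.prob {y. \<Theta> (cut k y 0) (wrd n (Psi y) (- int w) (2 * w + 1))}"
proof (rule LIMSEQ_le_const)
  let ?p = "Y.P.prob {y. \<Theta> (cut k y 0) (wrd n (Psi y) (- int w) (2 * w + 1))}"
  have "(\<lambda>m. ?p + Y.P.prob {y. ambs (Suc (rY m)) y} + X.P.prob {x. \<not> okw w n (X.dat (Suc (rY m)) x)}) \<longlonglongrightarrow> ?p + 0 + 0"
    by (intro tendsto_add tendsto_const ambs_lim filterlim_compose[OF okw_lim Suc_rY_lim])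
  then show "(\<lambda>m. ?p + Y.P.prob {y. ambs (Suc (rY m)) y} + X.P.prob {x. \<not> okw w n (X.dat (Suc (rY m)) x)}) \<longlonglongrightarrow> ?p" by simp
  show "\<exists>M. \<forall>m\<ge>M. X.P.prob {x. \<Theta> (cut k x 0) (wrd n x (- int w) (2 * w + 1))}
      \<le> ?p + Y.P.prob {y. ambs (Suc (rY m)) y} + X.P.prob {x. \<not> okw w n (X.dat (Suc (rY m)) x)}"
    using law_ineq by blast
qed

lemma distr_Psi: "distr Y.P X.P Psi = X.P"
proof (rule X.measure_eqI_wrd)
  interpret D: prob_space "distr Y.P X.P Psi" by (rule Y.P.prob_space_distr[OF Psi_meas])
  show "finite_measure (distr Y.P X.P Psi)" by unfold_locales
  fix n w V
  have eq: "measure (distr Y.P X.P Psi) {x. wrd n x (- int w) (2 * w + 1) \<in> V} = Y.P.prob {y. wrd n (Psi y) (- int w) (2 * w + 1) \<in> V}" for V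
    using measure_distr[OF Psi_meas X.sets_wrd[of "\<lambda>v. v \<in> V" n "- int w" "2 * w + 1"]] by (simp add: vimage_def)
  have le: "X.P.prob {x. wrd n x (- int w) (2 * w + 1) \<in> V} \<le> measure (distr Y.P X.P Psi) {x. wrd n x (- int w) (2 * w + 1) \<in> V}" for V
    unfolding eq using law_le[of "\<lambda>_ v. v \<in> V" n w] by simp
  have c1: "X.P.prob {x. wrd n x (- int w) (2 * w + 1) \<in> - V} = 1 - X.P.prob {x. wrd n x (- int w) (2 * w + 1) \<in> V}"
    using X.P.prob_compl[OF X.sets_wrd[of "\<lambda>v. v \<in> V" n "- int w" "2 * w + 1"]] by (simp add: set_diff_eq)
  have c2: "measure (distr Y.P X.P Psi) {x. wrd n x (- int w) (2 * w + 1) \<in> - V} = 1 - measure (distr Y.P X.P Psi) {x. wrd n x (- int w) (2 * w + 1) \<in> V}"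
    using D.prob_compl[of "{x. wrd n x (- int w) (2 * w + 1) \<in> V}"] X.sets_wrd[of "\<lambda>v. v \<in> V" n "- int w" "2 * w + 1"] by (simp add: set_diff_eq)
  show "measure (distr Y.P X.P Psi) {x. wrd n x (- int w) (2 * w + 1) \<in> V} = X.P.prob {x. wrd n x (- int w) (2 * w + 1) \<in> V}"
    using le[of V] le[of "- V"] c1 c2 by linarith
qed simp

lemma AE_Psi: "AE x in X.P. Q x \<Longrightarrow> AE y in Y.P. Q (Psi y)"
  using AE_distrD[OF Psi_meas, of Q] unfolding distr_Psi by blast

lemma AE_sh: "AE y in Y.P. Q y \<Longrightarrow> AE y in Y.P. Q (sh i y)"
  using AE_distrD[OF Y.sh_measurable[of i], of Q] unfolding Y.distr_sh by blast

text \<open>For \<open>x\<close> the cut is a function of the window. By \<open>law_le\<close> the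
  same dependence has probability 1 when the cut is taken from \<open>y\<close> and the window from
  \<open>Psi y\<close>, which says that the two have the same cuts.\<close>

lemma AE_Psi_cut: "AE y in Y.P. \<forall>i. cut k (Psi y) i = cut k y i"
proof -
  have "AE y in Y.P. cut k (Psi y) 0 = cut k y 0"
  proof -
    let ?\<Theta> = "\<lambda>b V. b \<longleftrightarrow> patend k (take k V)"
    have c: "cut k x 0 \<longleftrightarrow> patend k (take k (wrd 2 x (- int k) (2 * k + 1)))" for x
      using cut_patend[of 2 k k x "- int k"] X.k1 by (simp add: take_wrd)
    have "{x. ?\<Theta> (cut k x 0) (wrd 2 x (- int k) (2 * k + 1))} = space X.P" using c by auto
    then have f1: "X.P.prob {x. ?\<Theta> (cut k x 0) (wrd 2 x (- int k) (2 * k + 1))} = 1"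
      by (simp only: X.P.prob_space)
    have "1 \<le> Y.P.prob {y. ?\<Theta> (cut k y 0) (wrd 2 (Psi y) (- int k) (2 * k + 1))}"
      using law_le[of ?\<Theta> 2 k] unfolding f1 .
    then have "Y.P.prob {y. ?\<Theta> (cut k y 0) (wrd 2 (Psi y) (- int k) (2 * k + 1))} = 1"
      by (rule antisym[OF Y.P.prob_le_1])
    moreover have "{y. ?\<Theta> (cut k y 0) (wrd 2 (Psi y) (- int k) (2 * k + 1))} = {y. cut k (Psi y) 0 = cut k y 0}"
      using c by blast
    ultimately have one: "Y.P.prob {y. cut k (Psi y) 0 = cut k y 0} = 1" by (simp only:)
    have [measurable]: "Measurable.pred Y.P (\<lambda>y. cut k (Psi y) 0)"
      by (rule measurable_compose[OF Psi_meas X.pred_cut])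
    have m: "{y. cut k (Psi y) 0 = cut k y 0} \<in> sets Y.P" by (rule Y.sets_pred) measurable
    show ?thesis using one Y.P.prob_eq_1[OF m] by simp
  qed
  from AE_sh[OF this] show ?thesis
    unfolding AE_all_countable Psi_sh cut_sh by simp
qed

text \<open>An X label shows more than \<open>n\<close> digits at site 0 with probability close to
  1. Through the coupling, so does the unique partner of the label of \<open>y\<close>, up to the
  probability of ambiguity.\<close>

lemma AE_determined: "AE y in Y.P. \<forall>i n. \<exists>r. n < length (out r (sh i y))"
proof -
  have "AE y in Y.P. \<exists>r. n < length (out r y)" for n
  proof -
    let ?p = "Y.P.prob {y. \<exists>r. n < length (out r y)}"
    have m: "{y. \<exists>r. n < length (out r y)} \<in> sets Y.P" by (rule Y.sets_pred) measurable
    have one: "1 \<le> ?p + Y.P.prob {y. ambs r y} + X.P.prob {x. length (X.rd r x) \<le> n}" for r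
    proof -
      define B where "B z \<longleftrightarrow> amb (\<lambda>b a. Rel r (fst (snd z)) a b) (set_pmf (X.LL r (fst (snd z)))) (snd (snd z)) \<or> n < length (outd r z)" for z
      have "1 - X.P.prob {x. length (X.rd r x) \<le> n} = X.P.prob {x. n < length (X.rd r x)}"
        using X.P.prob_compl[of "{x. length (X.rd r x) \<le> n}"] X.sets_pred[of "\<lambda>x. length (X.rd r x) \<le> n"] by (simp add: set_diff_eq not_le)
      also have "\<dots> = measure_pmf.prob (X.DD r) {z. n < length (flat (snd (snd z)) ! fst z)}"
        by (simp add: X.prob_DD X.rd_def case_prod_beta)
      also have "\<dots> \<le> measure_pmf.prob (Y.DD r) {z. B z}"
      proof (rule rel_pmf_prob_le[OF relDD])
        fix z z' assume z: "z \<in> set_pmf (X.DD r)" and z': "z' \<in> set_pmf (Y.DD r)"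
          and R: "fst z = fst z' \<and> fst (snd z) = fst (snd z') \<and> X.okS (fst (snd z)) \<and> Rel r (fst (snd z)) (snd (snd z)) (snd (snd z'))"
          and A: "z \<in> {z. n < length (flat (snd (snd z)) ! fst z)}"
        obtain j S \<alpha> \<beta> where zz: "z = (j, S, \<alpha>)" "z' = (j, S, \<beta>)" using R by (metis prod.collapse)
        have "\<alpha> \<in> set_pmf (X.LL r S)" using z unfolding X.DD_bind zz by auto
        then have "\<alpha> \<in> PA r S \<beta>" using R zz by (simp add: PA_def)
        then have "amb (\<lambda>b a. Rel r S a b) (set_pmf (X.LL r S)) \<beta> \<or> PA r S \<beta> = {\<alpha>}"
          unfolding amb_def PA_def by auto
        then show "z' \<in> {z. B z}" using A zz by (auto simp: B_def outd_def)
      qed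
      also have "\<dots> = Y.P.prob {y. B (Y.dat r y)}" by (simp add: Y.prob_DD)
      also have "\<dots> \<le> Y.P.prob ({y. \<exists>r. n < length (out r y)} \<union> {y. ambs r y})"
      proof (rule Y.P.finite_measure_mono)
        show "{y. B (Y.dat r y)} \<subseteq> {y. \<exists>r. n < length (out r y)} \<union> {y. ambs r y}"
          unfolding B_def out_def ambs_def by blast
      qed (intro sets.Un m Y.sets_pred[OF ambs_meas])
      also have "\<dots> \<le> ?p + Y.P.prob {y. ambs r y}"
        by (rule measure_Un_le[OF m Y.sets_pred[OF ambs_meas]])
      finally show ?thesis by simp
    qed
    have "(\<lambda>m. ?p + Y.P.prob {y. ambs (Suc (rY m)) y} + X.P.prob {x. length (X.rd (Suc (rY m)) x) \<le> n}) \<longlonglongrightarrow> ?p + 0 + 0"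
      by (intro tendsto_add tendsto_const ambs_lim filterlim_compose[OF rdX_lim Suc_rY_lim])
    then have "1 \<le> ?p + 0 + 0" by (rule LIMSEQ_le_const) (use one in blast)
    then have "1 \<le> ?p" by simp
    then have p1: "?p = 1" by (rule antisym[OF Y.P.prob_le_1])
    show ?thesis using p1 Y.P.prob_eq_1[OF m] by simp
  qed
  from AE_sh[OF this] show ?thesis by (simp add: AE_all_countable)
qed

end

subsection \<open>Inverting the coding map\<close>

lemma loc_unique:
  "i < length as \<Longrightarrow> t < as ! i \<Longrightarrow> loc as (sum_list (take i as) + t) = (i, t)"
  by (induction as arbitrary: i) (auto simp: nth_Cons split: nat.splits)

lemma loc_unique_bound: "i < length as \<Longrightarrow> t < as ! i \<Longrightarrow> sum_list (take i as) + t < sum_list as" for as :: "nat list"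
  by (induction as arbitrary: i) (auto simp: nth_Cons split: nat.splits)

lemma sum_list_concat_map_eq: "sum_list (map sum_list Ss) = sum_list (concat Ss)" for Ss :: "nat list list"
  by (induction Ss) auto

lemma concat_shape_inj:
  assumes "map length F = map length F'" "concat F = concat F'" shows "F = F'"
proof -
  have "length F = length F'" using assms(1) by (metis length_map)
  moreover have "length x = length y" if "(x, y) \<in> set (zip F F')" for x y
    using that assms(1) by (auto simp: in_set_zip) (metis nth_map)
  ultimately show ?thesis using concat_eq_concat_iff[of F F'] assms(2) by auto
qed

text \<open>Gap lengths are determined by the cuts, so sequences with equal cuts are parsed at the
  same places; only the letters of the gaps may differ.\<close>

lemma fill_transfer:
  assumes "2 \<le> n" "1 \<le> k" "\<And>i. cut k x i = cut k y i" "cut k y s" "wrd n y s (bsize G) = concat G" "\<forall>W\<in>set G. gapw k W"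
  shows "\<exists>F. map length F = map length G \<and> (\<forall>W\<in>set F. gapw k W) \<and> wrd n x s (bsize F) = concat F"
  using assms(4-)
proof (induction G arbitrary: s)
  case (Cons W G)
  have w: "wrd n y s (length W) = W" and wG: "wrd n y (s + int (length W)) (bsize G) = concat G"
    using Cons.prems(2) unfolding wrd_Cons_fill by auto
  have gW: "gapw k W" using Cons.prems by simp
  have W1: "1 \<le> length W" using gapw_length[OF gW] assms by simp
  have cy: "cut k y (s + int (length W))" "\<forall>l\<in>{1..<length W}. \<not> cut k y (s + int l)"
    using cut_gapw[OF assms(1,2) Cons.prems(1) W1] gW w by auto
  have cx: "cut k x s" using Cons.prems(1) assms(3) by simp
  have gx: "gapw k (wrd n x s (length W))" using cut_gapw[OF assms(1,2) cx W1] cy assms(3) by simp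
  from Cons.IH[OF cy(1) wG] Cons.prems(3) obtain F where
    F: "map length F = map length G" "\<forall>W\<in>set F. gapw k W" "wrd n x (s + int (length W)) (bsize F) = concat F" by auto
  have "wrd n x s (bsize (wrd n x s (length W) # F)) = concat (wrd n x s (length W) # F)"
    unfolding wrd_Cons_fill using F(3) by simp
  then show ?case using F gx by (intro exI[of _ "wrd n x s (length W) # F"]) simp
qed simp

lemma blk_transfer:
  assumes "2 \<le> n" "1 \<le> k" "\<And>i. cut k x i = cut k y i" "isblk k M n y j G"
  shows "\<exists>F. isblk k M n x j F \<and> map length F = map length G"
proof -
  have cc: "CC k M x i = CC k M y i" for i using assms(3) by (simp add: CC_def)
  obtain F where F: "map length F = map length G" "\<forall>W\<in>set F. gapw k W" "wrd n x (- int j) (bsize F) = concat F"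
    using fill_transfer[OF assms(1-3), of "- int j" G] assms(4) by (auto simp: isblk_def dest: CC_cut)
  have "bsize F = bsize G" using F(1) by (rule bsize_shape)
  then have "isblk k M n x j F" using F assms(4) cc by (simp add: isblk_def)
  then show ?thesis using F(1) by blast
qed

lemma (in bern) sets_iff:
  "Measurable.pred P Q \<Longrightarrow> Measurable.pred P Q' \<Longrightarrow> {x. Q x = Q' x} \<in> sets P"
proof -
  assume a: "Measurable.pred P Q" "Measurable.pred P Q'"
  have "{x. Q x = Q' x} = ({x. Q x} \<inter> {x. Q' x}) \<union> ((space P - {x. Q x}) \<inter> (space P - {x. Q' x}))" by auto
  also have "\<dots> \<in> sets P" by (intro sets.Un sets.Int sets.compl_sets sets_pred a)
  finally show ?thesis .
qed

lemma (in side) sets_untyped: "{x. \<not> typl r (snd (bd k (N (Suc r)) (lv (Suc r)) x))} \<in> sets P"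
  by (rule sets_pred) measurable

lemma (in side) sets_rd_short: "{x. length (rd r x) \<le> n} \<in> sets P"
  by (rule sets_pred) measurable

context pair
begin

lemma pair_swap: "pair \<nu> \<mu> k lv N T c upd' upd (\<lambda>r S a b. Rel r S b a)"
proof (intro pair.intro pair_axioms.intro)
  show "two_sides \<nu> \<mu> k lv N upd' upd"
    by (intro two_sides.intro two_sides_axioms.intro X.side_axioms Y.side_axioms) (auto simp: p_eq upd')
  show "rel_pmf (\<lambda>a b. Rel r S b a) (Y.LL r S) (X.LL r S)" if "Y.okS S" for r S
  proof -
    have "rel_pmf (Rel r S)\<inverse>\<inverse> (Y.LL r S) (X.LL r S)" using rel[of S r] that okS_eq by (simp add: pmf.rel_flip)
    moreover have "(Rel r S)\<inverse>\<inverse> = (\<lambda>a b. Rel r S b a)" by (simp add: fun_eq_iff)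
    ultimately show ?thesis by simp
  qed
  show "Rel r (sgrp (N r) S ! i) (pts \<beta> ! i) (pts \<alpha> ! i)"
    if "Y.okS S" "Rel (Suc r) S \<beta> \<alpha>" "i < length (sgrp (N r) S)" for S r \<alpha> \<beta> i
    using relS that okS_eq by simp
  show "upd' (Suc r) = (\<not> upd' r)" for r using upd' altern by simp
qed (use ambX ambY typX typY upd' in auto)

text \<open>The label that \<open>y\<close> predicts for its image is the one the image has.
  \<open>Psi y\<close> shows the digits of \<open>\<alpha>\<close> on the whole \<open>i\<close>-th
  part. If that part carries a disclosed filler, these digits are the complete \<open>rv\<close> of
  a block, and by \<open>lb_rv\<close> a label is a function of it. Without a filler the displayed
  digits might fit several labels.\<close>

lemma dat_Psi:
  assumes y: "Y.nice y" and x: "X.nice (Psi y)" and cuts: "\<And>i. cut k (Psi y) i = cut k y i"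
    and R: "R = Suc r0" and nu: "\<not> upd R"
    and d: "Y.dat (Suc R) y = (j, S, \<beta>)" and a: "PA (Suc R) S \<beta> = {\<alpha>}"
    and l: "loc (map sum_list (sgrp (N R) S)) j = (i, j')" and Some: "pts \<alpha> ! i = Nd (Some Fa) ps"
  shows "X.dat R (Psi y) = (j', sgrp (N R) S ! i, pts \<alpha> ! i)"
proof -
  let ?n = "lv R" and ?Si = "sgrp (N R) S ! i"
  have iS: "i < length (sgrp (N R) S)" and dR: "Y.dat R y = (j', ?Si, pts \<beta> ! i)" using Y.down[OF y d l] by auto
  have aPA: "\<alpha> \<in> PA (Suc R) S \<beta>" using a by simp
  obtain G where G: "isblk k (N R) ?n y j' G" "?Si = map length G" using Y.nice_dat(5)[OF y dR] by blast
  obtain Fx where Fx: "isblk k (N R) ?n (Psi y) j' Fx" "map length Fx = map length G"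
    using blk_transfer[OF X.lv2 X.k1 cuts G(1)] by blast
  have "Fx \<noteq> []" using Fx(1) by (auto simp: isblk_def)
  then have bdx: "bd k (N R) ?n (Psi y) = (j', Fx)" using Fx(1) bd_iff[OF X.lv2 X.k1] by blast
  have ok: "X.okS ?Si" using Y.nice_dat(1)[OF y dR] okS_eq by simp
  have "pts \<alpha> ! i \<in> set_pmf (X.LL R ?Si)" using PA_step(1)[OF y d aPA l] by (simp add: PA_def)
  then obtain Gx where Gx: "Gx \<in> set_pmf (X.FW ?n ?Si)" "pts \<alpha> ! i = X.lb R Gx" unfolding X.set_LL by blast
  have Gs: "map length Gx = ?Si" using X.set_FW[OF X.lv2 ok] Gx(1) by blast
  have Gd: "length e = ?n" if "e \<in> set (concat Gx)" for e
  proof -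
    have "e \<in> set_pmf (X.sp ?n)" using X.set_FW[OF X.lv2 ok] Gx(1) that by fastforce
    then show ?thesis using X.set_sp by blast
  qed
  have Fa: "flat (pts \<alpha> ! i) = concat (rv ?n Gx)"
    using Some Gx(2) unfolding R X.lb.simps by (auto split: if_splits)
  have bs: "bsize Fx = sum_list ?Si" "bsize Gx = sum_list ?Si" using Fx(2) G(2) Gs by (simp_all add: length_concat_map)
  have eqt: "concat (rv ?n Fx) ! t = concat (rv ?n Gx) ! t" if t: "t < sum_list ?Si" for t
  proof -
    obtain gi t' where lt: "loc ?Si t = (gi, t')" by fastforce
    have 1: "concat (rv ?n Fx) ! t = take (if ?Si ! gi \<le> ?n then ?n else 0) (concat Fx ! t)"
      using X.nth_concat_rv[of t Fx gi t' ?n] t lt bs Fx(2) G(2) by simp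
    have 2: "concat (rv ?n Gx) ! t = take (if ?Si ! gi \<le> ?n then ?n else 0) (concat Gx ! t)"
      using X.nth_concat_rv[of t Gx gi t' ?n] t lt bs Gs by simp
    show ?thesis
    proof (cases "?Si ! gi \<le> ?n")
      case True
      \<comment> \<open>Site \<open>i'\<close> sits at position \<open>t\<close> of the part, and
        the output of \<open>y\<close> there is read from \<open>\<alpha>\<close>. As X is not
        refined between \<open>R\<close> and \<open>Suc R\<close>, the part and
        \<open>\<alpha>\<close> display the same digits.\<close>
      define i' where "i' = - int j' + int t"
      have j: "j = sum_list (take i (map sum_list (sgrp (N R) S))) + j'" "j' < map sum_list (sgrp (N R) S) ! i"
        "i < length (map sum_list (sgrp (N R) S))"
        using loc_spec[OF _ l] Y.nice_dat(3)[OF y d]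
        by (metis concat_sgrp sum_list_concat_map_eq)+
      define j2 where "j2 = sum_list (take i (map sum_list (sgrp (N R) S))) + t"
      have t2: "t < map sum_list (sgrp (N R) S) ! i" using t iS by simp
      have l2: "loc (map sum_list (sgrp (N R) S)) j2 = (i, t)" unfolding j2_def by (rule loc_unique[OF j(3) t2])
      have j2S: "j2 < sum_list S"
        using loc_unique_bound[OF j(3) t2] unfolding j2_def by (metis concat_sgrp sum_list_concat_map_eq)
      have ji: "int j + i' = int j2" using j(1) by (simp add: j2_def i'_def)
      have d2: "Y.dat (Suc R) (sh i' y) = (j2, S, \<beta>)"
        using Y.dat_sh[OF y d, of i'] ji j2S by simp
      have y2: "Y.nice (sh i' y)" using y by simp
      have "flat (pts \<alpha> ! i) ! t = flat \<alpha> ! j2" using PA_step(3)[OF y2 d2 aPA l2 nu] .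
      moreover have "out (Suc R) (sh i' y) = flat \<alpha> ! j2" using a by (simp add: out_def outd_def d2)
      ultimately have o: "out (Suc R) (sh i' y) = concat (rv ?n Gx) ! t" using Fa by simp
      have len: "length (concat (rv ?n Gx) ! t) = ?n" using 2 True Gd[OF nth_mem] t bs by simp
      have "Psi y i' m = concat (rv ?n Gx) ! t ! m" if "m < ?n" for m
        using Psi_out[OF y, of m "Suc R" i'] that o len by simp
      then have "lev ?n (Psi y i') = concat (rv ?n Gx) ! t" using len by (intro nth_equalityI) auto
      moreover have "concat Fx ! t = lev ?n (Psi y i')" using X.blk_nth[OF Fx(1)] t bs by (simp add: i'_def)
      ultimately show ?thesis using 1 True len by simp
    qed (use 1 2 in simp)
  qed
  have "concat (rv ?n Fx) = concat (rv ?n Gx)"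
    by (rule nth_equalityI) (use eqt bs in auto)
  then have "rv ?n Fx = rv ?n Gx" by (intro concat_shape_inj) (use Fx(2) G(2) Gs in auto)
  then have "X.lb R Fx = X.lb R Gx" by (rule X.lb_rv)
  then show ?thesis using bdx Gx(2) Fx(2) G(2) by (simp add: X.dat_def)
qed

text \<open>X is refined in the step to stage \<open>R = Suc r0\<close>, Y in the step to
  \<open>Suc R\<close>. By the second refinement the label of \<open>y\<close> at stage
  \<open>Suc R\<close> determines \<open>\<alpha>\<close>, hence by \<open>dat_Psi\<close> the label
  of \<open>Psi y\<close> at stage \<open>R\<close>. By the first, that label determines its
  partner. The label of \<open>y\<close> at stage \<open>R\<close> is a partner, so the inverse map
  outputs its digits, which are digits of \<open>y\<close>.\<close>

lemma AE_inverse: "AE y in Y.P. pair.Psi \<nu> \<mu> k lv N T c upd' upd (\<lambda>r S a b. Rel r S b a) (Psi y) = y"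
proof -
  interpret S: pair \<nu> \<mu> k lv N T c upd' upd "\<lambda>r S a b. Rel r S b a" by (rule pair_swap)
  have SPsi: "Measurable.pred Y.P (\<lambda>y. S.Psi (Psi y) i n)" for i n
    by (rule measurable_compose[OF Psi_meas S.Psi_digit_meas])
  have digit0: "AE y in Y.P. S.Psi (Psi y) 0 n = y 0 n" for n
  proof -
    let ?E = "{y. S.Psi (Psi y) 0 n = y 0 n}"
    have mE: "?E \<in> sets Y.P" by (rule Y.sets_iff[OF SPsi Y.digit])
    have main: "1 \<le> Y.P.prob ?E + 5 * (1 / 2) ^ r0 + Y.P.prob {y. ambs (Suc (Suc r0)) y} + Y.P.prob {y. length (Y.rd (Suc r0) y) \<le> n}"
      if nu: "\<not> upd (Suc r0)" for r0
    proof -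
      let ?R = "Suc r0"
      have u0: "upd r0" using nu altern by simp
      define ix where "ix z = loc (map sum_list (sgrp (N ?R) (fst (snd z)))) (fst z)" for z :: "nat \<times> nat list \<times> lab"
      \<comment> \<open>The two demands on the child of an X label that contains site 0: it
        discloses a filler, and it has no second partner.\<close>
      define A where "A z \<longleftrightarrow> (\<exists>Fa ps. pts (snd (snd z)) ! fst (ix z) = Nd (Some Fa) ps) \<and>
         \<not> amb (Rel ?R (sgrp (N ?R) (fst (snd z)) ! fst (ix z))) (set_pmf (Y.LL ?R (sgrp (N ?R) (fst (snd z)) ! fst (ix z)))) (pts (snd (snd z)) ! fst (ix z))" for z
      define B where "B z \<longleftrightarrow> amb (\<lambda>b a. Rel (Suc ?R) (fst (snd z)) a b) (set_pmf (X.LL (Suc ?R) (fst (snd z)))) (snd (snd z)) \<or>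
         (\<exists>\<alpha>. PA (Suc ?R) (fst (snd z)) (snd (snd z)) = {\<alpha>} \<and> A (fst z, fst (snd z), \<alpha>))" for z
      let ?U = "{x. \<not> X.typl r0 (snd (bd k (N ?R) (lv ?R) x))}" and ?V = "{x. S.ambs ?R x}"
      have mU: "?U \<in> sets X.P" by (rule X.sets_untyped)
      have mV: "?V \<in> sets X.P" by (rule X.sets_pred[OF S.ambs_meas])
      have "X.P.prob {x. \<not> A (X.dat (Suc ?R) x)} \<le> X.P.prob (?U \<union> ?V)"
      proof (rule X.P.finite_measure_mono_AE)
        show "AE x in X.P. x \<in> {x. \<not> A (X.dat (Suc ?R) x)} \<longrightarrow> x \<in> ?U \<union> ?V"
          using X.AE_nice
        proof eventually_elim
          case (elim x)
          obtain j S \<alpha> where d: "X.dat (Suc ?R) x = (j, S, \<alpha>)" by (metis prod_cases3)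
          obtain i j' where l: "loc (map sum_list (sgrp (N ?R) S)) j = (i, j')" by fastforce
          have dR: "X.dat ?R x = (j', sgrp (N ?R) S ! i, pts \<alpha> ! i)" by (rule X.down(2)[OF elim d l])
          show ?case
          proof (intro impI, rule ccontr)
            assume nA: "x \<in> {x. \<not> A (X.dat (Suc ?R) x)}" and no: "x \<notin> ?U \<union> ?V"
            have "pts \<alpha> ! i = X.lb ?R (snd (bd k (N ?R) (lv ?R) x))"
              using dR by (auto simp: X.dat_def case_prod_beta simp del: X.lb.simps)
            then have "\<exists>Fa ps. pts \<alpha> ! i = Nd (Some Fa) ps" using no by simp
            moreover have "\<not> amb (Rel ?R (sgrp (N ?R) S ! i)) (set_pmf (Y.LL ?R (sgrp (N ?R) S ! i))) (pts \<alpha> ! i)"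
              using no by (simp add: S.ambs_def dR)
            ultimately have "A (X.dat (Suc ?R) x)" by (simp add: A_def ix_def d l)
            then show False using nA by simp
          qed
        qed
      qed (use mU mV in auto)
      also have "\<dots> \<le> X.P.prob ?U + X.P.prob ?V" by (rule measure_Un_le[OF mU mV])
      \<comment> \<open>Twice \<open>(1 / 2) ^ r0\<close> for an atypical block and three times for
        an ambiguous label.\<close>
      also have "\<dots> \<le> 5 * (1 / 2) ^ r0"
        using typX[OF u0] ambX[OF u0] by (simp add: S.ambs_def)
      finally have nA: "X.P.prob {x. \<not> A (X.dat (Suc ?R) x)} \<le> 5 * (1 / 2) ^ r0" .
      have "1 - X.P.prob {x. \<not> A (X.dat (Suc ?R) x)} = X.P.prob {x. A (X.dat (Suc ?R) x)}"
        using X.P.prob_compl[OF sets_XD[of "\<lambda>z. \<not> A z" "Suc ?R"]] by (simp add: set_diff_eq)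
      also have "\<dots> = measure_pmf.prob (X.DD (Suc ?R)) {z. A z}" by (simp add: X.prob_DD)
      also have "\<dots> \<le> measure_pmf.prob (Y.DD (Suc ?R)) {z. B z}"
      proof (rule rel_pmf_prob_le[OF relDD])
        fix z z' assume z: "z \<in> set_pmf (X.DD (Suc ?R))" and z': "z' \<in> set_pmf (Y.DD (Suc ?R))"
          and R: "fst z = fst z' \<and> fst (snd z) = fst (snd z') \<and> X.okS (fst (snd z)) \<and> Rel (Suc ?R) (fst (snd z)) (snd (snd z)) (snd (snd z'))"
          and A: "z \<in> {z. A z}"
        obtain j S \<alpha> \<beta> where zz: "z = (j, S, \<alpha>)" "z' = (j, S, \<beta>)" using R by (metis prod.collapse)
        have "\<alpha> \<in> set_pmf (X.LL (Suc ?R) S)" using z unfolding X.DD_bind zz by auto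
        then have "\<alpha> \<in> PA (Suc ?R) S \<beta>" using R zz by (simp add: PA_def)
        then have "amb (\<lambda>b a. Rel (Suc ?R) S a b) (set_pmf (X.LL (Suc ?R) S)) \<beta> \<or> PA (Suc ?R) S \<beta> = {\<alpha>}"
          unfolding amb_def PA_def by auto
        then show "z' \<in> {z. B z}" using A zz by (auto simp: B_def)
      qed
      also have "\<dots> = Y.P.prob {y. B (Y.dat (Suc ?R) y)}" by (simp add: Y.prob_DD)
      also have "\<dots> \<le> Y.P.prob (?E \<union> ({y. ambs (Suc ?R) y} \<union> {y. length (Y.rd ?R y) \<le> n}))"
      proof (rule Y.P.finite_measure_mono_AE)
        show "AE y in Y.P. y \<in> {y. B (Y.dat (Suc ?R) y)} \<longrightarrow> y \<in> ?E \<union> ({y. ambs (Suc ?R) y} \<union> {y. length (Y.rd ?R y) \<le> n})"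
          using Y.AE_nice AE_Psi[OF X.AE_nice] AE_Psi_cut
        proof eventually_elim
          case (elim y)
          note y = elim(1) and x = elim(2) and cuts = elim(3)
          show ?case
          proof (intro impI, rule ccontr)
            assume Bd: "y \<in> {y. B (Y.dat (Suc ?R) y)}" and no: "y \<notin> ?E \<union> ({y. ambs (Suc ?R) y} \<union> {y. length (Y.rd ?R y) \<le> n})"
            obtain j S \<beta> where d: "Y.dat (Suc ?R) y = (j, S, \<beta>)" by (metis prod_cases3)
            obtain i j' where l: "loc (map sum_list (sgrp (N ?R) S)) j = (i, j')" by fastforce
            obtain \<alpha> where a: "PA (Suc ?R) S \<beta> = {\<alpha>}" and A: "A (j, S, \<alpha>)"
              using Bd no d by (auto simp: B_def ambs_def)
            obtain Fa ps where Some: "pts \<alpha> ! i = Nd (Some Fa) ps" using A by (auto simp: A_def ix_def l)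
            have dx: "X.dat ?R (Psi y) = (j', sgrp (N ?R) S ! i, pts \<alpha> ! i)"
              by (rule dat_Psi[OF y x _ refl nu d a l Some]) (use cuts in blast)
            have dR: "Y.dat ?R y = (j', sgrp (N ?R) S ! i, pts \<beta> ! i)" by (rule Y.down(2)[OF y d l])
            have "pts \<alpha> ! i \<in> PA ?R (sgrp (N ?R) S ! i) (pts \<beta> ! i)" using PA_step(1)[OF y d _ l, of \<alpha>] a by simp
            then have b: "pts \<beta> ! i \<in> S.PA ?R (sgrp (N ?R) S ! i) (pts \<alpha> ! i)"
              using Y.nice_dat(2)[OF y dR] by (simp add: PA_def S.PA_def)
            have "\<not> S.ambs ?R (Psi y)" using A by (simp add: A_def ix_def l S.ambs_def dx)
            from S.PA_single[OF x dx this b]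
            have "S.out ?R (Psi y) = flat (pts \<beta> ! i) ! j'" by (simp add: S.out_def S.outd_def dx)
            then have o: "S.out ?R (Psi y) = Y.rd ?R y" by (simp add: Y.rd_def dR)
            have n: "n < length (Y.rd ?R y)" using no by (simp add: not_le)
            have "S.Psi (Psi y) 0 n = Y.rd ?R y ! n" using S.Psi_out[OF x, of n ?R 0] o n by simp
            also have "\<dots> = y 0 n"
            proof -
              have pf: "prefix (Y.rd ?R y) (lev (lv ?R) (y 0))"
                using Y.flat_prefix(2)[OF y dR Y.nice_dat(3)[OF y dR]] by (simp add: Y.rd_def dR)
              then have "Y.rd ?R y ! n = lev (lv ?R) (y 0) ! n" using n by (auto simp: prefix_def nth_append)
              moreover have "n < lv ?R" using prefix_length_le[OF pf] n by simp
              ultimately show ?thesis by simp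
            qed
            finally show False using no by simp
          qed
        qed
      qed (intro sets.Un mE Y.sets_pred[OF ambs_meas] Y.sets_rd_short)
      also have "\<dots> \<le> Y.P.prob ?E + (Y.P.prob {y. ambs (Suc ?R) y} + Y.P.prob {y. length (Y.rd ?R y) \<le> n})"
      proof -
        have m3: "{y. length (Y.rd ?R y) \<le> n} \<in> sets Y.P" by (rule Y.sets_rd_short)
        note mm = Y.sets_pred[OF ambs_meas[of "Suc ?R"]]
        show ?thesis
          by (rule order_trans[OF measure_Un_le[OF mE sets.Un[OF mm m3]]])
             (use measure_Un_le[OF mm m3] in simp)
      qed
      finally show ?thesis using nA by simp
    qed
    \<comment> \<open>\<open>rY (Suc m)\<close> is at least 1, so it has the form
      \<open>Suc r0\<close> that \<open>main\<close> needs.\<close>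
    define f where "f m = Y.P.prob ?E + 5 * (1 / 2) ^ (rY (Suc m) - 1) + Y.P.prob {y. ambs (Suc (rY (Suc m))) y} + Y.P.prob {y. length (Y.rd (rY (Suc m)) y) \<le> n}" for m
    have "1 \<le> f m" for m
    proof -
      have e: "rY (Suc m) = Suc (rY (Suc m) - 1)" using rY(2)[of "Suc m"] by simp
      show ?thesis using main[of "rY (Suc m) - 1"] rY(1)[of "Suc m"] unfolding f_def e[symmetric] by simp
    qed
    moreover have "f \<longlonglongrightarrow> Y.P.prob ?E + 5 * 0 + 0 + 0"
      unfolding f_def
    proof (intro tendsto_intros)
      have rl: "filterlim (\<lambda>m. rY (Suc m)) at_top sequentially" by (rule filterlim_compose[OF rY_lim filterlim_Suc])
      have "filterlim (\<lambda>m. rY (Suc m) - 1) at_top sequentially"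
      proof (rule filterlim_at_top_mono[OF filterlim_ident], rule always_eventually, rule allI)
        fix m show "m \<le> rY (Suc m) - 1" using rY(2)[of "Suc m"] by simp
      qed
      moreover have "(\<lambda>r. (1 / 2 :: real) ^ r) \<longlonglongrightarrow> 0" by (intro LIMSEQ_realpow_zero) auto
      ultimately show "(\<lambda>m. (1 / 2 :: real) ^ (rY (Suc m) - 1)) \<longlonglongrightarrow> 0" by (rule filterlim_compose[rotated])
      show "(\<lambda>m. Y.P.prob {y. ambs (Suc (rY (Suc m))) y}) \<longlonglongrightarrow> 0" using LIMSEQ_Suc[OF ambs_lim] .
      show "(\<lambda>m. Y.P.prob {y. length (Y.rd (rY (Suc m)) y) \<le> n}) \<longlonglongrightarrow> 0"
        by (rule filterlim_compose[OF S.rdX_lim rl])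
    qed
    ultimately have "1 \<le> Y.P.prob ?E + 5 * 0 + 0 + 0" by (intro LIMSEQ_le_const[of f]) blast+
    then have "1 \<le> Y.P.prob ?E" by simp
    then have "Y.P.prob ?E = 1" by (rule antisym[OF Y.P.prob_le_1])
    then show ?thesis using Y.P.prob_eq_1[OF mE] by simp
  qed
  have "AE y in Y.P. \<forall>i n. S.Psi (Psi (sh i y)) 0 n = sh i y 0 n"
    unfolding AE_all_countable using AE_sh[OF digit0] by blast
  then show ?thesis
  proof eventually_elim
    case (elim y)
    then have "S.Psi (Psi y) i n = y i n" for i n by (simp add: Psi_sh S.Psi_sh)
    then show ?case by (intro ext)
  qed
qed

end

subsection \<open>Topo-finitary isomorphism\<close>

text \<open>The reverse map, its equivariance and its law are included. The relation is then
  symmetric by its form, and isomorphisms through auxiliary processes can be chained.\<close>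

definition tiso :: "'a::topological_space measure \<Rightarrow> 'b::topological_space measure \<Rightarrow> bool" where
  "tiso M N \<longleftrightarrow> (\<exists>\<phi> \<psi> A B. \<phi> \<in> measurable (iproc M) (iproc N) \<and> \<psi> \<in> measurable (iproc N) (iproc M) \<and>
     (\<forall>a x. \<phi> (sh a x) = sh a (\<phi> x)) \<and> (\<forall>a y. \<psi> (sh a y) = sh a (\<psi> y)) \<and>
     A \<in> sets (iproc M) \<and> (AE x in iproc M. x \<in> A) \<and> B \<in> sets (iproc N) \<and> (AE y in iproc N. y \<in> B) \<and>
     homeomorphism A B \<phi> \<psi> \<and>
     distr (iproc M) (iproc N) \<phi> = iproc N \<and> distr (iproc N) (iproc M) \<psi> = iproc M)"

lemma tiso_sym: "tiso M N \<Longrightarrow> tiso N M"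
  unfolding tiso_def using homeomorphism_symD by blast

text \<open>The middle sets \<open>B\<close> and \<open>A'\<close> both have full measure but need
  not agree, so the outer sets shrink to the points whose image lies in both.\<close>

lemma tiso_trans:
  assumes "tiso M N" "tiso N K" shows "tiso M K"
proof -
  obtain \<phi> \<psi> A B where 1: "\<phi> \<in> measurable (iproc M) (iproc N)" "\<psi> \<in> measurable (iproc N) (iproc M)"
     "\<forall>a x. \<phi> (sh a x) = sh a (\<phi> x)" "\<forall>a y. \<psi> (sh a y) = sh a (\<psi> y)"
     "A \<in> sets (iproc M)" "AE x in iproc M. x \<in> A" "B \<in> sets (iproc N)" "AE y in iproc N. y \<in> B"
     "homeomorphism A B \<phi> \<psi>"
     "distr (iproc M) (iproc N) \<phi> = iproc N" "distr (iproc N) (iproc M) \<psi> = iproc M"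
    using assms(1) unfolding tiso_def by blast
  obtain \<phi>' \<psi>' A' B' where 2: "\<phi>' \<in> measurable (iproc N) (iproc K)" "\<psi>' \<in> measurable (iproc K) (iproc N)"
     "\<forall>a x. \<phi>' (sh a x) = sh a (\<phi>' x)" "\<forall>a y. \<psi>' (sh a y) = sh a (\<psi>' y)"
     "A' \<in> sets (iproc N)" "AE x in iproc N. x \<in> A'" "B' \<in> sets (iproc K)" "AE y in iproc K. y \<in> B'"
     "homeomorphism A' B' \<phi>' \<psi>'"
     "distr (iproc N) (iproc K) \<phi>' = iproc K" "distr (iproc K) (iproc N) \<psi>' = iproc N"
    using assms(2) unfolding tiso_def by blast
  define A2 where "A2 = A \<inter> (\<phi> -` A' \<inter> space (iproc M))"
  define B2 where "B2 = B' \<inter> (\<psi>' -` B \<inter> space (iproc K))"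
  have spM: "A \<subseteq> space (iproc M)" using 1(5) by (rule sets.sets_into_space)
  have spK: "B' \<subseteq> space (iproc K)" using 2(7) by (rule sets.sets_into_space)
  have h1: "\<And>x. x \<in> A \<Longrightarrow> \<phi> x \<in> B \<and> \<psi> (\<phi> x) = x" "\<And>y. y \<in> B \<Longrightarrow> \<psi> y \<in> A \<and> \<phi> (\<psi> y) = y"
    "continuous_on A \<phi>" "continuous_on B \<psi>"
    using 1(9) by (auto simp: homeomorphism_def)
  have h2: "\<And>x. x \<in> A' \<Longrightarrow> \<phi>' x \<in> B' \<and> \<psi>' (\<phi>' x) = x" "\<And>y. y \<in> B' \<Longrightarrow> \<psi>' y \<in> A' \<and> \<phi>' (\<psi>' y) = y"
    "continuous_on A' \<phi>'" "continuous_on B' \<psi>'"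
    using 2(9) by (auto simp: homeomorphism_def)
  have A2: "\<And>x. x \<in> A2 \<longleftrightarrow> x \<in> A \<and> \<phi> x \<in> A'" using spM by (auto simp: A2_def)
  have B2: "\<And>z. z \<in> B2 \<longleftrightarrow> z \<in> B' \<and> \<psi>' z \<in> B" using spK by (auto simp: B2_def)
  show ?thesis
    unfolding tiso_def
  proof (intro exI[of _ "\<phi>' \<circ> \<phi>"] exI[of _ "\<psi> \<circ> \<psi>'"] exI[of _ A2] exI[of _ B2] conjI)
    show "\<phi>' \<circ> \<phi> \<in> measurable (iproc M) (iproc K)" using 1(1) 2(1) by (rule measurable_comp)
    show "\<psi> \<circ> \<psi>' \<in> measurable (iproc K) (iproc M)" using 2(2) 1(2) by (rule measurable_comp)
    show "A2 \<in> sets (iproc M)" unfolding A2_def using 1(1,5) 2(5) by (intro sets.Int measurable_sets)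
    show "B2 \<in> sets (iproc K)" unfolding B2_def using 2(2,7) 1(7) by (intro sets.Int measurable_sets)
    have "AE x in distr (iproc M) (iproc N) \<phi>. x \<in> A'" by (subst 1(10)) (rule 2(6))
    then have "AE x in iproc M. \<phi> x \<in> A'" by (rule AE_distrD[OF 1(1)])
    then show "AE x in iproc M. x \<in> A2" using 1(6) by eventually_elim (simp add: A2)
    have "AE z in distr (iproc K) (iproc N) \<psi>'. z \<in> B" by (subst 2(11)) (rule 1(8))
    then have "AE z in iproc K. \<psi>' z \<in> B" by (rule AE_distrD[OF 2(2)])
    then show "AE z in iproc K. z \<in> B2" using 2(8) by eventually_elim (simp add: B2)
    show "homeomorphism A2 B2 (\<phi>' \<circ> \<phi>) (\<psi> \<circ> \<psi>')"
    proof (rule homeomorphismI)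
      have s1: "A2 \<subseteq> A" "\<phi> ` A2 \<subseteq> A'" using A2 by auto
      show "continuous_on A2 (\<phi>' \<circ> \<phi>)"
        using continuous_on_subset[OF h1(3) s1(1)] continuous_on_subset[OF h2(3) s1(2)] by (rule continuous_on_compose)
      have s2: "B2 \<subseteq> B'" "\<psi>' ` B2 \<subseteq> B" using B2 by auto
      show "continuous_on B2 (\<psi> \<circ> \<psi>')"
        using continuous_on_subset[OF h2(4) s2(1)] continuous_on_subset[OF h1(4) s2(2)] by (rule continuous_on_compose)
    qed (use h1 h2 A2 B2 in auto)
    show "distr (iproc M) (iproc K) (\<phi>' \<circ> \<phi>) = iproc K" using distr_distr[OF 2(1) 1(1)] 1(10) 2(10) by simp
    show "distr (iproc K) (iproc M) (\<psi> \<circ> \<psi>') = iproc M" using distr_distr[OF 1(2) 2(2)] 1(11) 2(11) by simp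
  qed (use 1(3,4) 2(3,4) in auto)
qed

lemma clopen_digit: "open {x :: int \<Rightarrow> sym. x i n = b}"
proof -
  have t: "{True} = {False<..}" "{False} = {..<True}" by auto
  have c: "continuous_on UNIV (\<lambda>x :: int \<Rightarrow> sym. x i n)"
    by (intro continuous_on_product_coordinates[THEN continuous_on_compose2[rotated]] continuous_on_product_coordinates) auto
  have "open ((\<lambda>x :: int \<Rightarrow> sym. x i n) -` {b})"
    by (rule open_vimage[OF _ c]) (cases b; simp add: t)
  then show ?thesis by (simp add: vimage_def)
qed

text \<open>Conditions on finitely many digits are closed and open. Functions of the block at a site
  are thus locally constant where the block exists.\<close>

definition clop :: "('a::topological_space \<Rightarrow> bool) \<Rightarrow> bool" where
  "clop Q \<longleftrightarrow> open {x. Q x} \<and> open {x. \<not> Q x}"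

lemma clop_digit: "clop (\<lambda>x :: int \<Rightarrow> sym. x i n)"
  unfolding clop_def using clopen_digit[of i n True] clopen_digit[of i n False] by simp

lemma clop_not: "clop Q \<Longrightarrow> clop (\<lambda>x. \<not> Q x)" by (simp add: clop_def)

lemma clop_const: "clop (\<lambda>_. b)" by (simp add: clop_def)

lemma clop_conj: "clop Q \<Longrightarrow> clop Q' \<Longrightarrow> clop (\<lambda>x. Q x \<and> Q' x)"
  unfolding clop_def de_Morgan_conj Collect_conj_eq Collect_disj_eq by (blast intro: open_Int open_Un)

lemma clop_ball: "finite J \<Longrightarrow> (\<And>j. j \<in> J \<Longrightarrow> clop (Q j)) \<Longrightarrow> clop (\<lambda>x. \<forall>j\<in>J. Q j x)"
proof (induction J rule: finite_induct)
  case (insert j J)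
  then show ?case using clop_conj[of "Q j" "\<lambda>x. \<forall>j\<in>J. Q j x"] by auto
qed (simp add: clop_const)

lemma clop_iff: "clop Q \<Longrightarrow> clop (\<lambda>x. Q x = b)" using clop_not[of Q] by (cases b) auto

lemma clop_cut: "clop (\<lambda>x. cut k x i)"
  unfolding cut_def by (intro clop_conj clop_ball clop_digit clop_not) auto

lemma clop_CC: "clop (\<lambda>x. CC k N x i)"
  unfolding CC_def by (intro clop_conj clop_ball clop_cut clop_not) auto

lemma clop_wrd: "clop (\<lambda>x. wrd n x s L = v)"
proof -
  have "wrd n x s L = v \<longleftrightarrow> length v = L \<and> (\<forall>j\<in>{..<L}. length (v ! j) = n \<and> (\<forall>m\<in>{..<n}. x (s + int j) m = v ! j ! m))" for x
    by (auto simp: list_eq_iff_nth_eq)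
  then show ?thesis by (simp only:) (intro clop_conj clop_ball clop_iff clop_digit clop_const finite_lessThan)
qed

lemma clop_isblk: "clop (\<lambda>x. isblk k N n (sh i x) j F)"
  unfolding isblk_def CC_sh wrd_sh by (intro clop_conj clop_CC clop_wrd clop_const)

context pair
begin

definition DY :: "(int \<Rightarrow> sym) set" where
  "DY = {y. Y.nice y \<and> (\<forall>i n. \<exists>r. n < length (out r (sh i y)))}"

lemma DY_sets: "DY \<in> sets Y.P"
  unfolding DY_def by (rule Y.sets_pred) measurable

lemma AE_DY: "AE y in Y.P. y \<in> DY"
  using Y.AE_nice AE_determined by eventually_elim (simp add: DY_def)

text \<open>A stage that outputs digit \<open>n\<close> does so on account of the block at that site
  alone, and nearby points have the same block.\<close>

lemma continuous_Psi: "continuous_on DY Psi"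
proof (intro continuous_on_coordinatewise_then_product)
  fix i n
  show "continuous_on DY (\<lambda>y. Psi y i n)"
    unfolding continuous_on_topological
  proof (intro ballI allI impI)
    fix y B assume y: "y \<in> DY" and B: "open B" "Psi y i n \<in> B"
    have ny: "Y.nice y" "Y.nice (sh i y)" using y by (simp_all add: DY_def)
    obtain r where r: "n < length (out r (sh i y))" using y by (auto simp: DY_def)
    obtain j F where b: "bd k (N r) (lv r) (sh i y) = (j, F)" by fastforce
    then have blk: "isblk k (N r) (lv r) (sh i y) j F" using Y.nice_isblk[OF ny(2) Y.lv2, of "N r" r] by simp
    then have ne: "F \<noteq> []" by (auto simp: isblk_def)
    let ?U = "{y'. isblk k (N r) (lv r) (sh i y') j F}"
    have "Psi y' i n = Psi y i n" if "y' \<in> DY" "y' \<in> ?U" for y'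
    proof -
      have "bd k (N r) (lv r) (sh i y') = (j, F)" using that(2) bd_iff[OF Y.lv2 Y.k1 ne] by simp
      then have "out r (sh i y') = out r (sh i y)" using b by (simp add: out_def Y.dat_def)
      moreover have "Y.nice y'" using that(1) by (simp add: DY_def)
      ultimately show ?thesis using Psi_out[OF ny(1) r] Psi_out[of y' n r i] r by simp
    qed
    moreover have "open ?U" using clop_isblk by (simp add: clop_def)
    ultimately show "\<exists>A. open A \<and> y \<in> A \<and> (\<forall>y'\<in>DY. y' \<in> A \<longrightarrow> Psi y' i n \<in> B)"
      using B blk by (intro exI[of _ ?U]) auto
  qed
qed

theorem tiso_pair: "tiso \<mu> \<nu>"
proof -
  interpret S: pair \<nu> \<mu> k lv N T c upd' upd "\<lambda>r S a b. Rel r S b a" by (rule pair_swap)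
  have inv: "AE y in Y.P. S.Psi (Psi y) = y" by (rule AE_inverse)
  have inv': "AE x in X.P. Psi (S.Psi x) = x" using S.AE_inverse by simp
  \<comment> \<open>Points at which both maps are decided in succession and lead back to the start;
    \<open>A\<close> and \<open>B\<close> are carried onto each other.\<close>
  define A where "A = {x. x \<in> S.DY \<and> S.Psi x \<in> DY \<and> Psi (S.Psi x) = x}"
  define B where "B = {y. y \<in> DY \<and> Psi y \<in> S.DY \<and> S.Psi (Psi y) = y}"
  have eqs: "{x. Psi (S.Psi x) = x} \<in> sets X.P"
  proof -
    have e: "{x. Psi (S.Psi x) i n = x i n} \<in> sets X.P" for i n
      by (rule X.sets_iff[OF measurable_compose[OF S.Psi_meas Psi_digit_meas] X.digit])
    have "{x. Psi (S.Psi x) = x} = (\<Inter>i. \<Inter>n. {x. Psi (S.Psi x) i n = x i n})" by (auto simp: fun_eq_iff)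
    also have "\<dots> \<in> sets X.P"
      by (intro sets.countable_INT' image_subsetI) (use e in auto)
    finally show ?thesis .
  qed
  have eqs': "{y. S.Psi (Psi y) = y} \<in> sets Y.P"
  proof -
    have e: "{y. S.Psi (Psi y) i n = y i n} \<in> sets Y.P" for i n
      by (rule Y.sets_iff[OF measurable_compose[OF Psi_meas S.Psi_digit_meas] Y.digit])
    have "{y. S.Psi (Psi y) = y} = (\<Inter>i. \<Inter>n. {y. S.Psi (Psi y) i n = y i n})" by (auto simp: fun_eq_iff)
    also have "\<dots> \<in> sets Y.P"
      by (intro sets.countable_INT' image_subsetI) (use e in auto)
    finally show ?thesis .
  qed
  show ?thesis
    unfolding tiso_def
  proof (rule exI[of _ S.Psi], rule exI[of _ Psi], rule exI[of _ A], rule exI[of _ B], intro conjI)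
    show "S.Psi \<in> measurable X.P Y.P" by (rule S.Psi_meas)
    show "Psi \<in> measurable Y.P X.P" by (rule Psi_meas)
    have "A = S.DY \<inter> (S.Psi -` DY \<inter> space X.P) \<inter> {x. Psi (S.Psi x) = x}" by (auto simp: A_def)
    then show "A \<in> sets X.P" using S.DY_sets measurable_sets[OF S.Psi_meas DY_sets] eqs by auto
    have "B = DY \<inter> (Psi -` S.DY \<inter> space Y.P) \<inter> {y. S.Psi (Psi y) = y}" by (auto simp: B_def)
    then show "B \<in> sets Y.P" using DY_sets measurable_sets[OF Psi_meas S.DY_sets] eqs' by auto
    show "AE x in X.P. x \<in> A" using S.AE_DY S.AE_Psi[OF AE_DY] inv' by eventually_elim (simp add: A_def)
    show "AE y in Y.P. y \<in> B" using AE_DY AE_Psi[OF S.AE_DY] inv by eventually_elim (simp add: B_def)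
    show "homeomorphism A B S.Psi Psi"
    proof (rule homeomorphismI)
      show "continuous_on A S.Psi" by (rule continuous_on_subset[OF S.continuous_Psi]) (auto simp: A_def)
      show "continuous_on B Psi" by (rule continuous_on_subset[OF continuous_Psi]) (auto simp: B_def)
    qed (auto simp: A_def B_def)
    show "distr X.P Y.P S.Psi = Y.P" by (rule S.distr_Psi)
    show "distr Y.P X.P Psi = X.P" by (rule distr_Psi)
  qed (simp_all add: Psi_sh S.Psi_sh)
qed

end

theorem tiso_marked:
  assumes X: "bernd \<mu> k" and Y: "bernd \<nu> k" and p: "bern.p \<nu> k = bern.p \<mu> k"
    and H1: "\<And>n \<epsilon>. 0 < \<epsilon> \<Longrightarrow> \<exists>m. bernd.Hf \<mu> n \<le> bernd.Hf \<nu> m + \<epsilon>"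
    and H2: "\<And>n \<epsilon>. 0 < \<epsilon> \<Longrightarrow> \<exists>m. bernd.Hf \<nu> n \<le> bernd.Hf \<mu> m + \<epsilon>"
  shows "tiso \<mu> \<nu>"
proof -
  obtain lv N T c upd upd' Rel where "pair \<mu> \<nu> k lv N T c upd upd' Rel"
    using scheme_exists[OF X Y p H1 H2] by blast
  then show ?thesis by (rule pair.tiso_pair)
qed

subsection \<open>Coding Polish alphabets by digit sequences\<close>

lemma (in iid) distr_site:
  assumes N: "iid N" and f: "f \<in> measurable M N" and d: "distr M N f = N"
  shows "distr P (iproc N) (\<lambda>x. f \<circ> x) = iproc N"
proof -
  interpret N: iid N by (rule N)
  have m: "(\<lambda>x. f (x i)) \<in> measurable P N" for i by (rule measurable_compose[OF coord f])
  have "P.indep_vars (\<lambda>_. N) (\<lambda>i x. f (x i)) UNIV"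
    by (rule P.indep_vars_compose2[OF indep_coord]) (rule f)
  then have "distr P (PiM UNIV (\<lambda>_. N)) (\<lambda>x. \<lambda>i\<in>UNIV. f (x i)) = PiM UNIV (\<lambda>i. distr P N (\<lambda>x. f (x i)))"
    by (subst (asm) P.indep_vars_iff_distr_eq_PiM') (auto simp: m)
  moreover have "distr P N (\<lambda>x. f (x i)) = N" for i
  proof -
    have "distr P N (\<lambda>x. f (x i)) = distr (distr P M (\<lambda>x. x i)) N f"
      by (subst distr_distr[OF f coord]) (simp add: comp_def)
    then show ?thesis by (simp add: iproc_def PP.PiM_component d)
  qed
  ultimately have "distr P (iproc N) (\<lambda>x. \<lambda>i\<in>UNIV. f (x i)) = iproc N" by (simp only: iproc_def)
  moreover have "(\<lambda>x. \<lambda>i\<in>UNIV. f (x i)) = (\<lambda>x :: int \<Rightarrow> 'a. f \<circ> x)" by (simp add: fun_eq_iff)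
  ultimately show ?thesis by (simp only:)
qed

lemma (in iid) AE_coords:
  assumes "AE x in M. Q x" shows "AE x in P. \<forall>i. Q (x i)"
proof -
  have "AE x in P. Q (x i)" for i
  proof (rule AE_distrD[OF coord])
    have "distr P M (\<lambda>x. x i) = M" by (simp add: iproc_def PP.PiM_component)
    with assms show "AE x in distr P M (\<lambda>x. x i). Q x" by (simp only:)
  qed
  then show ?thesis by (simp add: AE_all_countable)
qed

lemma (in iid) sets_coords: assumes "A \<in> sets M" shows "{x. \<forall>i. x i \<in> A} \<in> sets P"
proof -
  have "{x. \<forall>i. x i \<in> A} = (\<Inter>i. (\<lambda>x. x i) -` A \<inter> space P)" by auto
  also have "\<dots> \<in> sets P" by (intro sets.countable_INT' image_subsetI measurable_sets[OF coord] assms) auto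
  finally show ?thesis .
qed

lemma continuous_on_site:
  assumes "continuous_on A f" shows "continuous_on {x. \<forall>i::int. x i \<in> A} (\<lambda>x. f \<circ> x)"
proof (rule continuous_on_coordinatewise_then_product)
  fix i :: int
  show "continuous_on {x. \<forall>i::int. x i \<in> A} (\<lambda>x. (f \<circ> x) i)"
    unfolding comp_def
    by (rule continuous_on_compose2[OF assms]) (auto intro: continuous_on_subset[OF continuous_on_product_coordinates])
qed

text \<open>An isomorphism of alphabets acts letter by letter. Full measure and continuity survive
  the passage to the product because there are countably many sites and the topology is
  coordinatewise.\<close>

lemma tiso_site:
  fixes M :: "'a::topological_space measure" and N :: "'b::topological_space measure"
  assumes M: "iid M" and N: "iid N" and f: "f \<in> measurable M N" and g: "g \<in> measurable N M"
    and A: "A \<in> sets M" "AE x in M. x \<in> A" and B: "B \<in> sets N"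
    and h: "homeomorphism A B f g" and d: "distr M N f = N"
  shows "tiso M N"
proof -
  interpret M: iid M by (rule M)
  interpret N: iid N by (rule N)
  have h': "\<And>x. x \<in> A \<Longrightarrow> f x \<in> B \<and> g (f x) = x" "\<And>y. y \<in> B \<Longrightarrow> g y \<in> A \<and> f (g y) = y"
    "continuous_on A f" "continuous_on B g"
    using h by (auto simp: homeomorphism_def)
  have Bs: "{y \<in> space N. y \<in> B} \<in> sets N" using B by (simp add: N.space_UNIV)
  have "AE x in M. f x \<in> B" using A(2) by eventually_elim (simp add: h')
  then have "AE y in distr M N f. y \<in> B" by (rule AE_distr_iff[OF f Bs, THEN iffD2])
  then have AEB: "AE y in N. y \<in> B" by (simp only: d)
  have "distr N M g = distr (distr M N f) M g" by (simp add: d)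
  also have "\<dots> = distr M M (g \<circ> f)" by (rule distr_distr[OF g f])
  also have "\<dots> = distr M M (\<lambda>x. x)"
    using A(2) measurable_comp[OF f g] by (intro distr_cong_AE) (auto elim!: eventually_mono simp: h')
  finally have d': "distr N M g = M" by simp
  show ?thesis
    unfolding tiso_def
  proof (rule exI[of _ "\<lambda>x. f \<circ> x"], rule exI[of _ "\<lambda>y. g \<circ> y"], rule exI[of _ "{x. \<forall>i. x i \<in> A}"],
      rule exI[of _ "{y. \<forall>i. y i \<in> B}"], intro conjI)
    show "(\<lambda>x. f \<circ> x) \<in> measurable (iproc M) (iproc N)"
      by (rule N.measurable_P) (simp add: measurable_compose[OF M.coord f])
    show "(\<lambda>x. g \<circ> x) \<in> measurable (iproc N) (iproc M)"
      by (rule M.measurable_P) (simp add: measurable_compose[OF N.coord g])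
    show "\<forall>a x. f \<circ> sh a x = sh a (f \<circ> x)" "\<forall>a y. g \<circ> sh a y = sh a (g \<circ> y)" by (auto simp: sh_def)
    show "{x. \<forall>i. x i \<in> A} \<in> sets (iproc M)" using A(1) by (rule M.sets_coords)
    show "{x. \<forall>i. x i \<in> B} \<in> sets (iproc N)" using B by (rule N.sets_coords)
    show "AE x in iproc M. x \<in> {x. \<forall>i. x i \<in> A}" using M.AE_coords[OF A(2)] by simp
    show "AE x in iproc N. x \<in> {x. \<forall>i. x i \<in> B}" using N.AE_coords[OF AEB] by simp
    show "homeomorphism {x. \<forall>i::int. x i \<in> A} {y. \<forall>i::int. y i \<in> B} (\<lambda>x. f \<circ> x) (\<lambda>y. g \<circ> y)"
    proof (rule homeomorphismI)
      show "continuous_on {x. \<forall>i::int. x i \<in> A} (\<lambda>x. f \<circ> x)" by (rule continuous_on_site[OF h'(3)])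
      show "continuous_on {x. \<forall>i::int. x i \<in> B} (\<lambda>x. g \<circ> x)" by (rule continuous_on_site[OF h'(4)])
    qed (auto simp: h'(1,2) fun_eq_iff)
    show "distr (iproc M) (iproc N) (\<lambda>x. f \<circ> x) = iproc N" by (rule M.distr_site[OF N f d])
    show "distr (iproc N) (iproc M) (\<lambda>y. g \<circ> y) = iproc M" by (rule N.distr_site[OF M g d'])
  qed
qed

lemma lev_eq_iff: "lev n c = lev n c' \<longleftrightarrow> (\<forall>i<n. c i = c' i)"
  by (auto simp: list_eq_iff_nth_eq)

lemma sets_symM_lev: "{c. Q (lev n c)} \<in> sets symM"
proof -
  have "{c \<in> space symM. lev n c = d} \<in> sets symM" for d
  proof -
    have "{c \<in> space symM. lev n c = d} = {c \<in> space symM. length d = n \<and> (\<forall>i<n. c i = d ! i)}"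
      by (auto simp: list_eq_iff_nth_eq)
    also have "\<dots> \<in> sets symM" unfolding symM_def by measurable
    finally show ?thesis .
  qed
  then have "(\<Union>d\<in>{d. Q d}. {c \<in> space symM. lev n c = d}) \<in> sets symM"
    by (intro sets.countable_UN') auto
  moreover have "(\<Union>d\<in>{d. Q d}. {c \<in> space symM. lev n c = d}) = {c. Q (lev n c)}" by auto
  ultimately show ?thesis by simp
qed

text \<open>A compact set is the intersection of its cylinder neighbourhoods: a point outside
  differs from every point of the set in some digit, and by compactness finitely many digits
  suffice.\<close>

lemma compact_sets_symM:
  assumes "compact C" shows "C \<in> sets symM"
proof -
  have "c \<in> C" if c: "\<And>n. lev n c \<in> lev n ` C" for c
  proof (rule ccontr)
    assume "c \<notin> C"
    have cov: "C \<subseteq> (\<Union>i. {c'. c' i = (\<not> c i)})"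
    proof
      fix c' assume "c' \<in> C"
      then have "c' \<noteq> c" using \<open>c \<notin> C\<close> by blast
      then obtain i where "c' i \<noteq> c i" by blast
      then show "c' \<in> (\<Union>i. {c'. c' i = (\<not> c i)})" by auto
    qed
    have o: "open {c' :: sym. c' i = b}" for i b
    proof -
      have t: "{True} = {False<..}" "{False} = {..<True}" by auto
      have "open ((\<lambda>c' :: sym. c' i) -` {b})"
        by (rule open_vimage[OF _ continuous_on_product_coordinates]) (cases b; simp add: t)
      then show ?thesis by (simp add: vimage_def)
    qed
    obtain J where "J \<subseteq> UNIV" and J: "finite J" "C \<subseteq> (\<Union>i\<in>J. {c'. c' i = (\<not> c i)})"
      by (rule compactE_image[OF assms, of UNIV "\<lambda>i. {c'. c' i = (\<not> c i)}", OF o cov])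
    obtain c' where c': "c' \<in> C" "lev (Suc (Max (insert 0 J))) c = lev (Suc (Max (insert 0 J))) c'" using c by blast
    obtain i where i: "i \<in> J" "c' i = (\<not> c i)" using J(2) c'(1) by blast
    have "i \<le> Max (insert 0 J)" by (rule Max_ge) (use J(1) i(1) in auto)
    then have "c i = c' i" using c'(2) unfolding lev_eq_iff less_Suc_eq_le by blast
    then show False using i(2) by simp
  qed
  then have "C = (\<Inter>n. {c. lev n c \<in> lev n ` C})" by blast
  also have "\<dots> \<in> sets symM" by (intro sets.countable_INT' image_subsetI sets_symM_lev) auto
  finally show ?thesis .
qed

text \<open>Null boundaries make each digit continuous off a null set. \<open>B_small\<close> makes
  the digits separate points and the inverse coding continuous.\<close>

locale coded = prob_space \<mu> for \<mu> :: "'a::polish_space measure" +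
  fixes B :: "nat \<Rightarrow> 'a set"
  assumes sets_borel: "sets \<mu> = sets borel"
    and B_borel: "B i \<in> sets borel" and B_null: "measure \<mu> (frontier (B i)) = 0"
    and B_small: "0 < e \<Longrightarrow> \<exists>i. x \<in> B i \<and> B i \<subseteq> ball x e"
begin

definition code :: "'a \<Rightarrow> sym" where "code x = (\<lambda>i. x \<in> B i)"
definition inner :: "'a set" where "inner = {x. \<forall>i. x \<notin> frontier (B i)}"
definition law :: "sym measure" where "law = distr \<mu> symM code"

lemma code_apply: "code x i = (x \<in> B i)" by (simp add: code_def)

lemma space_mu: "space \<mu> = UNIV" using sets_eq_imp_space_eq[OF sets_borel] by simp

lemma iid_mu: "iid \<mu>" by unfold_locales (rule space_mu)

lemma inner_borel: "inner \<in> sets \<mu>"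
proof -
  have "inner = (\<Inter>i. - frontier (B i))" by (auto simp: inner_def)
  then show ?thesis by (auto simp: sets_borel)
qed

lemma AE_inner: "AE x in \<mu>. x \<in> inner"
proof -
  have "AE x in \<mu>. x \<notin> frontier (B i)" for i
    using B_null[of i] prob_eq_0[of "frontier (B i)"] by (simp add: sets_borel)
  then show ?thesis unfolding inner_def by (simp add: AE_all_countable)
qed

lemma code_measurable [measurable]: "code \<in> measurable \<mu> symM"
  unfolding symM_def code_def
proof (rule measurable_PiM_single')
  fix i show "(\<lambda>x. x \<in> B i) \<in> measurable \<mu> (count_space UNIV)"
    using B_borel[of i] sets_borel by (simp add: pred_def space_mu)
qed auto

lemma iid_law: "iid law"
proof -
  interpret L: prob_space law unfolding law_def by (rule prob_space_distr) (rule code_measurable)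
  show ?thesis by unfold_locales (simp add: law_def)
qed

lemma continuous_code: "continuous_on inner code"
proof (rule continuous_on_coordinatewise_then_product)
  fix i
  show "continuous_on inner (\<lambda>x. code x i)"
    unfolding continuous_on_topological
  proof (intro ballI allI impI)
    fix x W assume x: "x \<in> inner" and W: "open W" "code x i \<in> W"
    have key: "\<exists>U. open U \<and> x \<in> U \<and> (\<forall>y\<in>inner. y \<in> U \<longrightarrow> code y i \<in> W)"
      if U: "open U" "x \<in> U" and e: "\<And>y. y \<in> U \<Longrightarrow> (y \<in> B i) = (x \<in> B i)" for U
    proof (intro exI[of _ U] conjI ballI impI U)
      fix y assume "y \<in> U"
      then have "code y i = code x i" unfolding code_apply by (rule e)
      with W(2) show "code y i \<in> W" by (simp only:)
    qed
    show "\<exists>U. open U \<and> x \<in> U \<and> (\<forall>y\<in>inner. y \<in> U \<longrightarrow> code y i \<in> W)"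
    proof (cases "x \<in> B i")
      case True
      then have "x \<in> interior (B i)" using x closure_subset[of "B i"] unfolding inner_def frontier_def by blast
      then show ?thesis using True interior_subset[of "B i"] by (intro key[of "interior (B i)"]) auto
    next
      case False
      then have "x \<notin> closure (B i)" using x interior_subset[of "B i"] unfolding inner_def frontier_def by blast
      then show ?thesis using False closure_subset[of "B i"] by (intro key[of "- closure (B i)"]) auto
    qed
  qed
qed

lemma code_inj: assumes "code x = code y" shows "x = y"
proof (rule ccontr)
  assume "x \<noteq> y"
  then obtain i where "x \<in> B i" "B i \<subseteq> ball x (dist x y)" using B_small[of "dist x y" x] by auto
  moreover have "y \<in> B i" using fun_cong[OF assms, of i] \<open>x \<in> B i\<close> by (simp add: code_apply)
  ultimately show False by auto
qed

text \<open>The domain is the image of a subset \<open>A\<close>. For a sigma-compact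
  \<open>A\<close> inside \<open>inner\<close> this image is measurable, which is what the inverse
  coding requires.\<close>

definition decode :: "'a set \<Rightarrow> sym \<Rightarrow> 'a" where
  "decode A c = (if c \<in> code ` A then THE x. code x = c else undefined)"

lemma decode_code: "x \<in> A \<Longrightarrow> decode A (code x) = x"
  unfolding decode_def using code_inj by auto

lemma continuous_decode: "continuous_on (code ` A) (decode A)"
  unfolding continuous_on_topological
proof (intro ballI allI impI)
  fix c W assume c: "c \<in> code ` A" and W: "open W" "decode A c \<in> W"
  obtain x where x: "x \<in> A" "c = code x" using c by auto
  then have "x \<in> W" using W by (simp add: decode_code)
  then obtain e where e: "0 < e" "ball x e \<subseteq> W" using W(1) open_contains_ball by blast
  obtain i where i: "x \<in> B i" "B i \<subseteq> ball x e" using B_small[OF e(1)] by blast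
  have t: "{True} = {False<..}" by auto
  have "open ((\<lambda>c::sym. c i) -` {True})"
    by (rule open_vimage[OF _ continuous_on_product_coordinates]) (simp add: t)
  moreover have "decode A c' \<in> W" if "c' \<in> code ` A" "c' \<in> (\<lambda>c. c i) -` {True}" for c'
  proof -
    note h = that
    obtain y where y: "y \<in> A" "c' = code y" using h(1) by blast
    then have "y \<in> B i" using h(2) by (simp add: code_apply)
    then show ?thesis using i(2) e(2) y by (auto simp: decode_code)
  qed
  ultimately show "\<exists>U. open U \<and> c \<in> U \<and> (\<forall>c'\<in>code ` A. c' \<in> U \<longrightarrow> decode A c' \<in> W)"
    using i(1) x(2) by (intro exI[of _ "(\<lambda>c. c i) -` {True}"]) (auto simp: code_apply)
qed

text \<open>Inner regularity of Borel probabilities on Polish spaces. Compact pieces are wanted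
  because their continuous images are compact, hence measurable.\<close>

lemma inner_sigma_compact:
  "\<exists>K. (\<forall>n::nat. compact (K n)) \<and> (\<Union>n. K n) \<subseteq> inner \<and> (AE x in \<mu>. x \<in> (\<Union>n. K n))"
proof -
  have 1: "emeasure \<mu> inner = 1" using AE_inner prob_eq_1[OF inner_borel] by (simp add: emeasure_eq_measure)
  have "\<exists>K. compact K \<and> K \<subseteq> inner \<and> 1 - 1 / real (Suc n) < measure \<mu> K" for n
  proof -
    have "ennreal (1 - 1 / real (Suc n)) < (SUP K \<in> {K. K \<subseteq> inner \<and> compact K}. emeasure \<mu> K)"
      using inner_regular[OF sets_borel, of inner] 1 inner_borel sets_borel by (simp add: ennreal_less_one_iff)
    then obtain K where K: "K \<subseteq> inner" "compact K" "ennreal (1 - 1 / real (Suc n)) < emeasure \<mu> K"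
      by (auto simp: less_SUP_iff)
    then show ?thesis by (intro exI[of _ K]) (simp add: emeasure_eq_measure ennreal_less_iff)
  qed
  then obtain K where K: "\<And>n. compact (K n)" "\<And>n. K n \<subseteq> inner" "\<And>n. 1 - 1 / real (Suc n) < measure \<mu> (K n)"
    by metis
  have Ks: "K n \<in> sets \<mu>" for n using K(1)[of n] by (simp add: sets_borel compact_imp_closed)
  have Us: "(\<Union>n. K n) \<in> sets \<mu>" using Ks by auto
  have "1 \<le> measure \<mu> (\<Union>n. K n)"
  proof (rule field_le_epsilon)
    fix e :: real assume "0 < e"
    then obtain n where n: "1 / real (Suc n) < e" using nat_approx_posE by metis
    have "measure \<mu> (K n) \<le> measure \<mu> (\<Union>n. K n)" using Us by (intro finite_measure_mono) auto
    then show "1 \<le> measure \<mu> (\<Union>n. K n) + e" using K(3)[of n] n by linarith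
  qed
  then have "measure \<mu> (\<Union>n. K n) = 1" using prob_le_1[of "\<Union>n. K n"] by linarith
  then have "AE x in \<mu>. x \<in> (\<Union>n. K n)" using prob_eq_1[OF Us] by simp
  then show ?thesis using K(1,2) by (intro exI[of _ K]) auto
qed

lemma tiso_law: "tiso \<mu> law"
proof -
  obtain K where K: "\<And>n::nat. compact (K n)" "(\<Union>n. K n) \<subseteq> inner" "AE x in \<mu>. x \<in> (\<Union>n. K n)"
    using inner_sigma_compact by blast
  define A where "A = (\<Union>n. K n)"
  have cont: "continuous_on A code" using continuous_on_subset[OF continuous_code K(2)] by (simp add: A_def)
  have im: "code ` (A \<inter> F) \<in> sets symM" if "closed F" for F
  proof -
    have "compact (code ` (K n \<inter> F))" for n
      by (rule compact_continuous_image[OF continuous_on_subset[OF cont]])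
         (use K(1) that in \<open>auto simp: A_def compact_Int_closed\<close>)
    then have "(\<Union>n. code ` (K n \<inter> F)) \<in> sets symM" by (intro sets.countable_UN' image_subsetI compact_sets_symM) auto
    also have "(\<Union>n. code ` (K n \<inter> F)) = code ` (A \<inter> F)" by (auto simp: A_def)
    finally show ?thesis .
  qed
  have dec: "decode A \<in> measurable symM borel"
  proof (rule borel_measurableI)
    fix S :: "'a set" assume S: "open S"
    \<comment> \<open>Off the image the value is \<open>undefined\<close>, and it may or may not
      belong to \<open>S\<close>.\<close>
    have "decode A -` S \<inter> space symM = (if undefined \<in> S then - code ` (A \<inter> - S) else code ` A - code ` (A \<inter> - S))"
    proof (rule set_eqI)
      fix c
      show "c \<in> decode A -` S \<inter> space symM \<longleftrightarrow>
        c \<in> (if undefined \<in> S then - code ` (A \<inter> - S) else code ` A - code ` (A \<inter> - S))"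
      proof (cases "c \<in> code ` A")
        case True
        then obtain x where x: "x \<in> A" "c = code x" by blast
        moreover have "c \<in> code ` (A \<inter> - S) \<longleftrightarrow> x \<notin> S" using x code_inj by blast
        ultimately show ?thesis using True by (simp add: decode_code)
      next
        case False
        moreover then have "c \<notin> code ` (A \<inter> - S)" by blast
        ultimately show ?thesis by (simp add: decode_def)
      qed
    qed
    also have "\<dots> \<in> sets symM"
      using im[of "- S"] im[of UNIV] S sets.compl_sets[of "code ` (A \<inter> - S)" symM]
      by (auto simp: Compl_eq_Diff_UNIV)
    finally show "decode A -` S \<inter> space symM \<in> sets symM" .
  qed
  show ?thesis
  proof (rule tiso_site[OF iid_mu iid_law])
    show "code \<in> measurable \<mu> law" by (simp add: law_def)
    show "decode A \<in> measurable law \<mu>"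
      using dec by (simp add: law_def measurable_cong_sets[OF refl sets_borel])
    show "A \<in> sets \<mu>" unfolding A_def sets_borel 
      by (intro sets.countable_UN' image_subsetI borel_closed compact_imp_closed K(1)) auto
    show "AE x in \<mu>. x \<in> A" using K(3) by (simp add: A_def)
    show "code ` A \<in> sets law" using im[of UNIV] by (simp add: law_def)
    show "homeomorphism A (code ` A) code (decode A)"
      by (rule homeomorphismI) (auto simp: cont continuous_decode decode_code)
    show "distr \<mu> law code = law" unfolding law_def by (rule distr_cong) auto
  qed
qed

end

subsection \<open>Entropy of coded measures\<close>

context coded
begin

lemma sets_law: "sets law = sets symM" by (simp add: law_def)

lemma bern_law: "1 \<le> k \<Longrightarrow> bern law k"
  using iid_law sets_law by (simp add: bern_def bern_axioms_def)

lemma lev_code_sets: "{y. Q (lev n (code y))} \<in> sets \<mu>"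
  using measurable_sets[OF code_measurable sets_symM_lev[of Q n]] by (simp add: vimage_def space_mu)

lemma prob_law: "{c. Q c} \<in> sets symM \<Longrightarrow> measure law {c. Q c} = measure \<mu> {y. Q (code y)}"
  unfolding law_def by (subst measure_distr[OF code_measurable]) (auto simp: vimage_def space_mu)

lemma pmf_law: "pmf (bern.sp law n) d = measure \<mu> {y. lev n (code y) = d}"
  using bern.pmf_sp[OF bern_law[OF order_refl], of n d] prob_law[OF sets_symM_lev[of "\<lambda>w. w = d" n]] by simp

lemma cyl_Inter: "(\<Inter>n. {y. lev n (code y) = lev n (code x)}) = {x}"
proof -
  have "y = x" if "\<And>n. lev n (code y) = lev n (code x)" for y
  proof (rule code_inj, rule ext)
    fix i show "code y i = code x i" using that[of "Suc i"] unfolding lev_eq_iff by blast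
  qed
  then show ?thesis by blast
qed

lemma cyl_tendsto: "(\<lambda>n. measure \<mu> {y. lev n (code y) = lev n (code x)}) \<longlonglongrightarrow> measure \<mu> {x}"
proof -
  have "decseq (\<lambda>n. {y. lev n (code y) = lev n (code x)})"
    by (rule decseq_SucI) (auto simp: lev_eq_iff)
  moreover have "range (\<lambda>n. {y. lev n (code y) = lev n (code x)}) \<subseteq> sets \<mu>"
    by (intro image_subsetI lev_code_sets)
  ultimately show ?thesis using finite_Lim_measure_decseq unfolding cyl_Inter[of x, symmetric] by blast
qed

lemma AE_cyl_pos: "AE x in \<mu>. \<forall>n. 0 < measure \<mu> {y. lev n (code y) = lev n (code x)}"
proof -
  have "AE x in \<mu>. 0 < measure \<mu> {y. lev n (code y) = lev n (code x)}" for n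
  proof -
    interpret L: bern law 1 by (rule bern_law[OF order_refl])
    have pl: "pmf (L.sp n) d = measure \<mu> {y. lev n (code y) = d}" for d by (rule pmf_law)
    have "measure law {c. lev n c \<in> - set_pmf (L.sp n)} = 0"
      unfolding L.prob_sp[symmetric] measure_pmf_zero_iff by blast
    then have "measure \<mu> {y. lev n (code y) \<in> - set_pmf (L.sp n)} = 0"
      using prob_law[OF sets_symM_lev[of "\<lambda>d. d \<in> - set_pmf (L.sp n)" n]] by simp
    then have "AE y in \<mu>. y \<notin> {y. lev n (code y) \<in> - set_pmf (L.sp n)}"
      using prob_eq_0[OF lev_code_sets[of "\<lambda>d. d \<in> - set_pmf (L.sp n)" n]] by simp
    then show ?thesis by eventually_elim (simp add: pl[symmetric] pmf_positive_iff)
  qed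
  then show ?thesis by (simp add: AE_all_countable)
qed

definition info :: "nat \<Rightarrow> 'a \<Rightarrow> real" where
  "info n x = - ln (measure \<mu> {y. lev n (code y) = lev n (code x)})"

lemma info_mono:
  assumes "\<And>n. 0 < measure \<mu> {y. lev n (code y) = lev n (code x)}" shows "info n x \<le> info (Suc n) x"
proof -
  have "{y. lev (Suc n) (code y) = lev (Suc n) (code x)} \<subseteq> {y. lev n (code y) = lev n (code x)}"
    by (auto simp: lev_eq_iff)
  then have "measure \<mu> {y. lev (Suc n) (code y) = lev (Suc n) (code x)} \<le> measure \<mu> {y. lev n (code y) = lev n (code x)}"
    by (intro finite_measure_mono lev_code_sets)
  then show ?thesis unfolding info_def using assms[of "Suc n"] assms[of n] by simp
qed

lemma info_measurable [measurable]: "info n \<in> borel_measurable \<mu>"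
proof -
  have "(\<lambda>x. lev n (code x)) \<in> measurable \<mu> (count_space UNIV)"
    using lev_code_sets[of "\<lambda>w. w = _" n]
    by (intro measurable_count_space_eq2_countable[THEN iffD2]) (auto simp: vimage_def space_mu)
  then have "(\<lambda>x. (\<lambda>d. - ln (measure \<mu> {y. lev n (code y) = d})) (lev n (code x))) \<in> borel_measurable \<mu>"
    by (rule measurable_compose) simp
  then show ?thesis by (simp add: info_def[abs_def])
qed

lemma SUP_info_atom:
  assumes "0 < measure \<mu> {x}" shows "(SUP n. ennreal (info n x)) = ennreal (- ln (measure \<mu> {x}))"
proof -
  have pos: "0 < measure \<mu> {y. lev n (code y) = lev n (code x)}" for n
  proof -
    have "measure \<mu> {x} \<le> measure \<mu> {y. lev n (code y) = lev n (code x)}"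
      by (intro finite_measure_mono lev_code_sets) auto
    with assms show ?thesis by linarith
  qed
  have "incseq (\<lambda>n. ennreal (info n x))" by (intro incseq_SucI ennreal_leI info_mono pos)
  then have 1: "(\<lambda>n. ennreal (info n x)) \<longlonglongrightarrow> (SUP n. ennreal (info n x))" by (rule LIMSEQ_SUP)
  have "(\<lambda>n. - ln (measure \<mu> {y. lev n (code y) = lev n (code x)})) \<longlonglongrightarrow> - ln (measure \<mu> {x})"
    using assms by (intro tendsto_minus tendsto_ln cyl_tendsto) auto
  then have "(\<lambda>n. ennreal (info n x)) \<longlonglongrightarrow> ennreal (- ln (measure \<mu> {x}))"
    unfolding info_def by (rule tendsto_ennrealI)
  with 1 show ?thesis by (rule LIMSEQ_unique)
qed

lemma SUP_info_nonatom:
  assumes "measure \<mu> {x} = 0" and pos: "\<And>n. 0 < measure \<mu> {y. lev n (code y) = lev n (code x)}"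
  shows "(SUP n. ennreal (info n x)) = \<infinity>"
proof -
  have "\<exists>n. of_nat j \<le> ennreal (info n x)" for j
  proof -
    have "eventually (\<lambda>n. measure \<mu> {y. lev n (code y) = lev n (code x)} < exp (- real j)) sequentially"
      using cyl_tendsto[of x] assms(1) by (auto intro!: order_tendstoD(2))
    then obtain n where "measure \<mu> {y. lev n (code y) = lev n (code x)} < exp (- real j)"
      by (auto simp: eventually_sequentially)
    then have "ln (measure \<mu> {y. lev n (code y) = lev n (code x)}) < - real j"
      using pos[of n] by (metis exp_ln exp_less_cancel_iff)
    then have "real j \<le> info n x" by (simp add: info_def)
    then have "ennreal (real j) \<le> ennreal (info n x)" by (rule ennreal_leI)
    then show ?thesis by (auto simp: ennreal_of_nat_eq_real_of_nat)
  qed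
  then have "(SUP n. ennreal (info n x)) = top" by (intro ennreal_SUP_eq_top) auto
  then show ?thesis by simp
qed

lemma atom_sets: "{x} \<in> sets \<mu>" by (simp add: sets_borel)

text \<open>Along the cylinders around \<open>x\<close> the mass decreases to that of
  \<open>{x}\<close>, so the information tends to \<open>- ln\<close> of it, which is infinite
  almost everywhere off the atoms. If the atoms carry all the mass, integration gives the sum in
  \<open>shannon_entropy\<close>; otherwise both sides are infinite.\<close>

theorem entropy_info: "shannon_entropy \<mu> = (\<integral>\<^sup>+x. (SUP n. ennreal (info n x)) \<partial>\<mu>)"
proof -
  define D where "D = {x. measure \<mu> {x} \<noteq> 0}"
  define F where "F x = (SUP n. ennreal (info n x))" for x
  have D: "countable D" unfolding D_def by (rule countable_support)
  have Fm: "F \<in> borel_measurable \<mu>" unfolding F_def by measurable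
  have Dsets: "V \<in> sets \<mu>" if "V \<subseteq> D" for V
  proof -
    have "countable V" using that D by (rule countable_subset)
    then have "(\<Union>x\<in>V. {x}) \<in> sets \<mu>" by (intro sets.countable_UN' image_subsetI atom_sets)
    then show ?thesis by simp
  qed
  have zero: "measure \<mu> {x} = 0" if "x \<notin> D" for x using that by (simp add: D_def)
  have ci: "(\<integral>\<^sup>+x. f x \<partial>count_space D) = (\<integral>\<^sup>+x. f x * indicator D x \<partial>count_space UNIV)" for f :: "'a \<Rightarrow> ennreal"
    by (rule nn_integral_count_space_indicator) (simp add: NO_MATCH_def)
  have sumD: "(\<integral>\<^sup>+ x. emeasure \<mu> {x} \<partial>count_space UNIV) = emeasure \<mu> D"
    unfolding emeasure_countable_singleton[OF atom_sets D] ci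
    by (intro nn_integral_cong) (auto simp: indicator_def emeasure_eq_measure zero)
  show ?thesis
  proof (cases "emeasure \<mu> D = 1")
    case True
    have AE: "AE x in \<mu>. x \<in> D"
      using True prob_eq_1[OF Dsets[OF order_refl]] by (simp add: emeasure_eq_measure)
    have eq: "restrict_space \<mu> D = density (count_space D) (\<lambda>x. emeasure \<mu> {x})"
    proof (rule measure_eqI_countable[OF _ _ D])
      show "sets (restrict_space \<mu> D) = Pow D"
        using Dsets by (subst sets_restrict_space) (auto simp: image_iff)
      fix a assume "a \<in> D"
      then show "emeasure (restrict_space \<mu> D) {a} = emeasure (density (count_space D) (\<lambda>x. emeasure \<mu> {x})) {a}"
        using Dsets[OF order_refl]
        by (subst emeasure_restrict_space) (auto simp: emeasure_density space_mu nn_integral_count_space_indicator one_ennreal_def[symmetric])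
    qed simp
    have "(\<integral>\<^sup>+x. F x \<partial>\<mu>) = (\<integral>\<^sup>+x. F x * indicator D x \<partial>\<mu>)"
      by (intro nn_integral_cong_AE eventually_mono[OF AE]) simp
    also have "\<dots> = (\<integral>\<^sup>+x. F x \<partial>restrict_space \<mu> D)"
      using Dsets[OF order_refl] by (subst nn_integral_restrict_space) (auto simp: space_mu)
    also have "\<dots> = (\<integral>\<^sup>+x. emeasure \<mu> {x} * F x \<partial>count_space D)"
      unfolding eq by (rule nn_integral_density) auto
    also have "\<dots> = (\<integral>\<^sup>+x. ennreal (- measure \<mu> {x} * ln (measure \<mu> {x})) \<partial>count_space D)"
    proof (rule nn_integral_cong)
      fix x assume "x \<in> space (count_space D)"
      then have pos: "0 < measure \<mu> {x}" by (simp add: D_def zero_less_measure_iff)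
      have "F x = ennreal (- ln (measure \<mu> {x}))" unfolding F_def by (rule SUP_info_atom[OF pos])
      then show "emeasure \<mu> {x} * F x = ennreal (- measure \<mu> {x} * ln (measure \<mu> {x}))"
        using pos prob_le_1[of "{x}"] by (simp add: emeasure_eq_measure ennreal_mult[symmetric])
    qed
    also have "\<dots> = (\<integral>\<^sup>+x. ennreal (- measure \<mu> {x} * ln (measure \<mu> {x})) \<partial>count_space UNIV)"
      unfolding ci
      by (intro nn_integral_cong) (auto simp: indicator_def zero)
    finally show ?thesis unfolding shannon_entropy_def sumD F_def using True by simp
  next
    case False
    have cD: "- D \<in> sets \<mu>" using Dsets[OF order_refl] sets.compl_sets[of D \<mu>] by (simp add: space_mu Compl_eq_Diff_UNIV)
    have "emeasure \<mu> (- D) \<noteq> 0"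
    proof
      assume "emeasure \<mu> (- D) = 0"
      then have "measure \<mu> D = 1"
        using prob_compl[OF Dsets[OF order_refl]] by (simp add: emeasure_eq_measure space_mu Compl_eq_Diff_UNIV)
      with False show False by (simp add: emeasure_eq_measure)
    qed
    then have "\<infinity> = (\<integral>\<^sup>+x. \<infinity> * indicator (- D) x \<partial>\<mu>)"
      using cD by (subst nn_integral_cmult_indicator) (auto simp: ennreal_top_mult)
    also have "\<dots> \<le> (\<integral>\<^sup>+x. F x \<partial>\<mu>)"
      using AE_cyl_pos
      by (intro nn_integral_mono_AE) (auto elim!: eventually_mono simp: F_def SUP_info_nonatom zero indicator_def)
    finally show ?thesis unfolding shannon_entropy_def sumD F_def using False by (simp add: top_unique)
  qed
qed

text \<open>Monotone convergence in \<open>entropy_info\<close>. It connects the entropy of the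
  alphabet with the entropies of finitely many digits on which the rate comparison rests.\<close>

theorem entropy_sup:
  assumes "bernd law k" shows "shannon_entropy \<mu> = (SUP n. ennreal (bernd.Hf law n))"
proof -
  interpret D: bernd law k by (rule assms)
  have sl: "D.sl n (lev n (code x)) = info n x" for n x
    unfolding D.sl_def info_def pmf_law ..
  have i0: "0 \<le> info n x" for n x using D.sl_nonneg[of n "lev n (code x)"] by (simp add: sl)
  have "ennreal (D.Hf n) = (\<integral>\<^sup>+x. ennreal (info n x) \<partial>\<mu>)" for n
  proof -
    have "(\<lambda>c. D.sl n (lev n c)) \<in> borel_measurable law" by (rule measurable_compose[OF D.lev_mu]) simp
    then have m: "(\<lambda>c. D.sl n (lev n c)) \<in> borel_measurable symM"
      by (simp add: measurable_cong_sets[OF sets_law refl])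
    have "D.Hf n = (LINT c|distr \<mu> symM code. D.sl n (lev n c))" unfolding D.Hf_def by (simp only: law_def)
    also have "\<dots> = (LINT x|\<mu>. info n x)"
      by (subst integral_distr[OF code_measurable m]) (simp only: sl)
    finally have e: "D.Hf n = (LINT x|\<mu>. info n x)" .
    have "integrable \<mu> (info n)"
      by (rule integrable_const_bound[of _ "D.BS n"])
         (use D.sl_bound[of n "code _"] i0 in \<open>auto simp: sl[symmetric] D.sl_nonneg\<close>)
    then show ?thesis unfolding e by (intro nn_integral_eq_integral[symmetric]) (auto simp: i0)
  qed
  moreover have "(\<integral>\<^sup>+x. (SUP n. ennreal (info n x)) \<partial>\<mu>) = (SUP n. \<integral>\<^sup>+x. ennreal (info n x) \<partial>\<mu>)"
  proof (rule nn_integral_monotone_convergence_SUP_AE)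
    fix n show "AE x in \<mu>. ennreal (info n x) \<le> ennreal (info (Suc n) x)"
      using AE_cyl_pos by eventually_elim (intro ennreal_leI info_mono, blast)
  qed measurable
  ultimately show ?thesis unfolding entropy_info by simp
qed

lemma p_law:
  assumes "1 \<le> k" shows "bern.p law k = measure \<mu> (B 0) * measure \<mu> (B 1 - B 0) ^ (k - 1)"
proof -
  interpret L: bern law k by (rule bern_law[OF assms])
  have s: "{c. c 0} \<in> sets symM" "{c. \<not> c 0 \<and> c 1} \<in> sets symM"
    using sets_symM_lev[of "\<lambda>d. d ! 0" 2] sets_symM_lev[of "\<lambda>d. \<not> d ! 0 \<and> d ! 1" 2] by simp_all
  have "{y. y \<notin> B 0 \<and> y \<in> B 1} = B 1 - B 0" by auto
  then show ?thesis
    using prob_law[OF s(1)] prob_law[OF s(2)] by (simp add: L.p_formula code_apply)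
qed

lemma pmf_law2: "pmf (bern.sp law 2) [a, b] = measure \<mu> {y. (y \<in> B 0) = a \<and> (y \<in> B 1) = b}"
  by (simp add: pmf_law lev_def upt_rec numeral_2_eq_2 code_apply)

end

text \<open>Equal suprema, possibly infinite, are turned into the one-sided approximations that
  \<open>tiso_marked\<close> asks for.\<close>

lemma SUP_ennreal_approx:
  assumes "(SUP n. ennreal (a n)) = (SUP n. ennreal (b n))" "\<And>n. 0 \<le> b n" "(0::real) < e"
  shows "\<exists>m::nat. a (n::nat) \<le> b m + e"
proof (rule ccontr)
  assume "\<not> ?thesis"
  then have lt: "b m < a n - e" for m by (auto simp: not_le algebra_simps)
  have "ennreal (a n) \<le> (SUP n. ennreal (b n))" unfolding assms(1)[symmetric] by (rule SUP_upper) simp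
  also have "\<dots> \<le> ennreal (a n - e)" by (intro SUP_least ennreal_leI) (simp add: lt less_imp_le)
  finally have "a n \<le> a n - e" using lt[of 0] assms(2)[of 0] by (subst (asm) ennreal_le_iff) auto
  with assms(3) show False by simp
qed

lemma tiso_coded:
  assumes M: "coded \<mu> B" and N: "coded \<nu> B'" and X: "bernd (coded.law \<mu> B) k" and Y: "bernd (coded.law \<nu> B') k"
    and p: "measure \<mu> (B 0) * measure \<mu> (B 1 - B 0) ^ (k - 1) = measure \<nu> (B' 0) * measure \<nu> (B' 1 - B' 0) ^ (k - 1)"
    and h: "shannon_entropy \<mu> = shannon_entropy \<nu>"
  shows "tiso \<mu> \<nu>"
proof -
  interpret M: coded \<mu> B by (rule M)
  interpret N: coded \<nu> B' by (rule N)
  interpret X: bernd M.law k by (rule X)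
  interpret Y: bernd N.law k by (rule Y)
  have hh: "(SUP n. ennreal (X.Hf n)) = (SUP n. ennreal (Y.Hf n))"
    using h M.entropy_sup[OF X] N.entropy_sup[OF Y] by simp
  have X0: "0 \<le> X.Hf n" for n unfolding X.Hf_def by (intro Bochner_Integration.integral_nonneg) (simp add: X.sl_nonneg)
  have Y0: "0 \<le> Y.Hf n" for n unfolding Y.Hf_def by (intro Bochner_Integration.integral_nonneg) (simp add: Y.sl_nonneg)
  have "tiso M.law N.law"
    by (rule tiso_marked[OF X Y _ SUP_ennreal_approx[OF hh Y0] SUP_ennreal_approx[OF hh[symmetric] X0]])
       (simp_all only: M.p_law[OF X.k1] N.p_law[OF X.k1] p)
  then show ?thesis by (intro tiso_trans[OF M.tiso_law tiso_trans[OF _ tiso_sym[OF N.tiso_law]]])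
qed

subsection \<open>Marker sets\<close>

text \<open>With a one-letter marker, a gap is any run of other letters closed by the marker. Two
  different other letters give two words of each length.\<close>

lemma (in bern) nd_single:
  assumes k: "k = 1" and d: "d0 \<in> set_pmf (sp 2)" "d1 \<in> set_pmf (sp 2)" "d2 \<in> set_pmf (sp 2)"
    "d1 \<noteq> d2" "d0 ! 0" "\<not> d1 ! 0" "\<not> d2 ! 0"
  shows "bernd \<mu> k"
proof unfold_locales
  fix N :: nat
  define v where "v d = map (\<lambda>j. if j = N + 1 then d0 else d) [0..<N + 2]" for d
  have g: "gapw k (v d)" if "\<not> d ! 0" for d
  proof -
    have "v d ! j = (if j = N + 1 then d0 else d)" if "j < N + 2" for j using that by (simp add: v_def del: upt_Suc)
    moreover have "length (v d) = N + 2" by (simp add: v_def)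
    ultimately show ?thesis using that d(5) unfolding gapw_def patend_def k by auto
  qed
  have "v d1 ! 0 \<noteq> v d2 ! 0" using d(4) by (simp add: v_def del: upt_Suc)
  then have "v d1 \<noteq> v d2" by auto
  moreover have "v d \<in> set_pmf (wp 2 (N + 2))" if "d \<in> set_pmf (sp 2)" for d
    unfolding set_wp v_def using that d(1) by auto
  ultimately show "\<exists>L>N. \<exists>n\<ge>2. \<exists>v v'. v \<noteq> v' \<and> v \<in> set_pmf (wp n L) \<and> v' \<in> set_pmf (wp n L) \<and> gapw k v \<and> gapw k v'"
    using d g by (intro exI[of _ "N + 2"] conjI exI[of _ 2] exI[of _ "v d1"] exI[of _ "v d2"]) auto
qed

text \<open>Here two letters are enough: the word b...baab and its variant with an isolated a at
  position 1 contain aab only at the end. With a one-letter marker, a two-letter alphabet would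
  leave a single gap word per length.\<close>

lemma (in bern) nd_triple:
  assumes k: "k = 3" and d: "d0 \<in> set_pmf (sp 2)" "d1 \<in> set_pmf (sp 2)" "d0 ! 0" "isa d1"
  shows "bernd \<mu> k"
proof unfold_locales
  fix N :: nat
  define v where "v S = map (\<lambda>j. if j \<in> S then d1 else d0) [0..<N + 6]" for S :: "nat set"
  have d': "\<not> isa d0" "\<not> d1 ! 0" using d by (auto simp: isa_def)
  have 23: "{2..3::nat} = {2, 3}" by auto
  have nth: "v S ! j = (if j \<in> S then d1 else d0)" if "j < N + 6" for j S using that by (simp add: v_def del: upt_Suc)
  have len: "length (v S) = N + 6" for S by (simp add: v_def)
  have pt: "patend 3 (take l (v S)) \<longleftrightarrow> 3 \<le> l \<and> l - 1 \<notin> S \<and> l - 2 \<in> S \<and> l - 3 \<in> S" if "l \<le> N + 6" for l S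
  proof (cases "3 \<le> l")
    case True
    then have "take l (v S) ! (l - 1) = v S ! (l - 1)" "take l (v S) ! (l - 2) = v S ! (l - 2)"
      "take l (v S) ! (l - 3) = v S ! (l - 3)" by auto
    then show ?thesis using True that d' d nth unfolding patend_def 23 by (auto simp: len)
  qed (simp add: patend_def len)
  have g: "gapw k (v S)" if S: "N + 3 \<in> S" "N + 4 \<in> S" "S \<subseteq> {1, N + 3, N + 4}" for S
  proof -
    have "N + 5 \<notin> S" using S(3) by auto
    moreover have "N + 6 - 1 = N + 5" "N + 6 - 2 = N + 4" "N + 6 - 3 = N + 3" "take (N + 6) (v S) = v S"
      "3 \<le> N + 6" by (auto simp: len)
    ultimately have "patend 3 (v S)" using pt[OF order_refl, of S] S(1,2) by (simp only: simp_thms)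
    moreover have "\<not> patend 3 (take l (v S))" if "l < N + 6" for l
    proof
      assume "patend 3 (take l (v S))"
      then have "3 \<le> l" "l - 1 \<notin> S" "l - 2 \<in> S" "l - 3 \<in> S" using pt[of l S] that by auto
      then have "l - 3 = 1 \<or> l - 3 = N + 3 \<or> l - 3 = N + 4" "l - 2 = 1 \<or> l - 2 = N + 3 \<or> l - 2 = N + 4"
        "l - 1 \<noteq> N + 3" "l - 1 \<noteq> N + 4" using S by auto
      then show False using that \<open>3 \<le> l\<close> by arith
    qed
    ultimately show ?thesis unfolding gapw_def k len by blast
  qed
  have ne: "v {N + 3, N + 4} \<noteq> v {1, N + 3, N + 4}"
  proof
    assume "v {N + 3, N + 4} = v {1, N + 3, N + 4}"
    then have "v {N + 3, N + 4} ! 1 = v {1, N + 3, N + 4} ! 1" by simp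
    then show False using d d' nth[of 1] by (auto split: if_splits)
  qed
  have "v S \<in> set_pmf (wp 2 (N + 6))" for S unfolding set_wp v_def using d by auto
  then show "\<exists>L>N. \<exists>n\<ge>2. \<exists>v v'. v \<noteq> v' \<and> v \<in> set_pmf (wp n L) \<and> v' \<in> set_pmf (wp n L) \<and> gapw k v \<and> gapw k v'"
    using g ne
    by (intro exI[of _ "N + 6"] conjI exI[of _ 2] exI[of _ "v {N + 3, N + 4}"] exI[of _ "v {1, N + 3, N + 4}"]) auto
qed

text \<open>Spheres around \<open>d\<close> of different radii are disjoint, so only countably many
  have positive mass, while the radii in an interval are uncountable.\<close>

lemma null_radius:
  fixes \<mu> :: "'a::metric_space measure"
  assumes "prob_space \<mu>" "sets \<mu> = sets borel" "a < b"
  shows "\<exists>r. a < r \<and> r < b \<and> measure \<mu> (frontier (ball d r)) = 0"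
proof -
  interpret prob_space \<mu> by fact
  have m: "dist d \<in> measurable \<mu> borel" unfolding measurable_cong_sets[OF assms(2) refl]
    by (intro borel_measurable_continuous_onI continuous_intros)
  interpret R: prob_space "distr \<mu> borel (dist d)" by (rule prob_space_distr[OF m])
  define w where "w r = measure (distr \<mu> borel (dist d)) {r}" for r
  have cw: "countable {r. w r \<noteq> 0}" unfolding w_def by (rule R.countable_support)
  have "\<exists>r\<in>{a<..<b}. w r = 0"
  proof (rule ccontr)
    assume "\<not> ?thesis"
    then have "{a<..<b} \<subseteq> {r. w r \<noteq> 0}" by blast
    then have "countable {a<..<b}" using cw by (rule countable_subset)
    moreover have "uncountable {a<..<b}" using assms(3) by (rule uncountable_open_interval[THEN iffD2])
    ultimately show False by (rule notE[rotated])
  qed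
  then obtain r where r: "r \<in> {a<..<b}" "w r = 0" by (rule bexE)
  have "measure \<mu> (frontier (ball d r)) \<le> measure \<mu> (dist d -` {r} \<inter> space \<mu>)"
  proof (rule finite_measure_mono)
    show "frontier (ball d r) \<subseteq> dist d -` {r} \<inter> space \<mu>"
    proof
      fix x assume x: "x \<in> frontier (ball d r)"
      have "x \<in> cball d r"
        by (rule subsetD[OF closure_minimal[OF ball_subset_cball closed_cball]]) (use x in \<open>simp add: frontier_def\<close>)
      moreover have "x \<notin> ball d r" using x by (simp add: frontier_def interior_open)
      moreover have "space \<mu> = UNIV" using sets_eq_imp_space_eq[OF assms(2)] by simp
      ultimately show "x \<in> dist d -` {r} \<inter> space \<mu>" by simp
    qed
    show "dist d -` {r} \<inter> space \<mu> \<in> sets \<mu>" by (rule measurable_sets[OF m]) simp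
  qed
  also have "\<dots> = 0" using r(2) unfolding w_def measure_distr[OF m borel_singleton[OF sets.empty_sets]] .
  finally have "measure \<mu> (frontier (ball d r)) = 0" using measure_nonneg[of \<mu> "frontier (ball d r)"] by linarith
  then show ?thesis using r(1) by (intro exI[of _ r]) simp
qed

text \<open>Digits 0 and 1 define the marker, hence the first two sets are prescribed. Balls around
  a dense sequence provide the small sets.\<close>

lemma coded_exists:
  fixes \<mu> :: "'a::polish_space measure"
  assumes mu: "prob_space \<mu>" "sets \<mu> = sets borel"
    and E: "E \<in> sets borel" "measure \<mu> (frontier E) = 0" "E' \<in> sets borel" "measure \<mu> (frontier E') = 0"
  shows "\<exists>B. coded \<mu> B \<and> B 0 = E \<and> B 1 = E'"
proof -
  obtain D :: "'a set" where D: "countable D" "\<And>X. open X \<Longrightarrow> X \<noteq> {} \<Longrightarrow> \<exists>d\<in>D. d \<in> X"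
    using countable_dense_exists by blast
  \<comment> \<open>The lower bound on the radius lets balls around dense points reach every point,
    the upper bound makes them small.\<close>
  have "\<forall>d m. \<exists>r. 1 / real (m + 2) < r \<and> r < 1 / real (m + 1) \<and> measure \<mu> (frontier (ball d r)) = 0"
    by (intro allI null_radius[OF mu]) (simp add: field_simps)
  then obtain R where R: "\<And>d m. 1 / real (m + 2) < R d m" "\<And>d m. R d m < 1 / real (m + 1)"
    "\<And>d m. measure \<mu> (frontier (ball d (R d m))) = 0" by metis
  define B where "B i = (if i = 0 then E else if i = 1 then E' else
     (case prod_decode (i - 2) of (j, m) \<Rightarrow> ball (from_nat_into D j) (R (from_nat_into D j) m)))" for i
  have "coded \<mu> B"
  proof (rule coded.intro[OF mu(1)], unfold_locales)
    fix i
    show "B i \<in> sets borel" using E by (auto simp: B_def split: prod.splits)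
    show "measure \<mu> (frontier (B i)) = 0" using E R(3) by (auto simp: B_def split: prod.splits)
  next
    fix e :: real and x :: 'a assume "0 < e"
    then obtain m where m: "1 / real (Suc m) < e / 2" using nat_approx_posE[of "e / 2"] by auto
    obtain d where d: "d \<in> D" "d \<in> ball x (1 / real (m + 2))" using D(2)[of "ball x (1 / real (m + 2))"] by auto
    obtain j where j: "from_nat_into D j = d" using d(1) D(1) by (metis from_nat_into_surj)
    have "B (prod_encode (j, m) + 2) = ball d (R d m)" by (simp add: B_def j)
    moreover have "x \<in> ball d (R d m)" using d(2) R(1)[of m d] by (simp add: dist_commute)
    moreover have "ball d (R d m) \<subseteq> ball x e"
    proof
      fix y assume "y \<in> ball d (R d m)"
      then have "dist x y < R d m + R d m"
        using dist_triangle[of x y d] d(2) R(1)[of m d] by simp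
      then show "y \<in> ball x e" using R(2)[of d m] m by simp
    qed
    ultimately show "\<exists>i. x \<in> B i \<and> B i \<subseteq> ball x e" by metis
  qed (use mu in auto)
  then show ?thesis by (intro exI[of _ B]) (simp add: B_def)
qed

text \<open>\<open>E\<close> serves as the marker letter, and the other two cells supply the two
  letters needed to fill gaps in different ways.\<close>

definition split3 :: "'a::topological_space measure \<Rightarrow> 'a set \<Rightarrow> 'a set \<Rightarrow> bool" where
  "split3 \<mu> E E' \<longleftrightarrow> E \<in> sets borel \<and> measure \<mu> (frontier E) = 0 \<and> E' \<in> sets borel \<and> measure \<mu> (frontier E') = 0
     \<and> 0 < measure \<mu> E \<and> 0 < measure \<mu> (E' - E) \<and> 0 < measure \<mu> (- E - E')"

context coded
begin

lemma cells:
  "{y. (y \<in> B 0) = True \<and> (y \<in> B 1) = True} = B 0 \<inter> B 1"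
  "{y. (y \<in> B 0) = True \<and> (y \<in> B 1) = False} = B 0 - B 1"
  "{y. (y \<in> B 0) = False \<and> (y \<in> B 1) = True} = B 1 - B 0"
  "{y. (y \<in> B 0) = False \<and> (y \<in> B 1) = False} = - B 0 - B 1"
  by auto

lemma B0_split: "measure \<mu> (B 0) = measure \<mu> (B 0 \<inter> B 1) + measure \<mu> (B 0 - B 1)"
proof -
  have "measure \<mu> (B 0 \<inter> B 1 \<union> (B 0 - B 1)) = measure \<mu> (B 0 \<inter> B 1) + measure \<mu> (B 0 - B 1)"
    by (intro finite_measure_Union) (use B_borel[of 0] B_borel[of 1] in \<open>auto simp: sets_borel\<close>)
  moreover have "B 0 \<inter> B 1 \<union> (B 0 - B 1) = B 0" by auto
  ultimately show ?thesis by simp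
qed

lemma mark_pos: assumes "0 < measure \<mu> (B 0)" shows "\<exists>d0 \<in> set_pmf (bern.sp law 2). d0 ! 0"
proof -
  have "0 < measure \<mu> (B 0 \<inter> B 1) \<or> 0 < measure \<mu> (B 0 - B 1)"
    using assms B0_split measure_nonneg[of \<mu> "B 0 \<inter> B 1"] by linarith
  then have "[True, True] \<in> set_pmf (bern.sp law 2) \<or> [True, False] \<in> set_pmf (bern.sp law 2)"
    unfolding pmf_positive_iff[symmetric] pmf_law2 cells .
  then show ?thesis by (metis nth_Cons_0)
qed

lemma bernd_single:
  assumes "split3 \<mu> (B 0) (B 1)" shows "bernd law 1"
proof -
  interpret L: bern law 1 by (rule bern_law[OF order_refl])
  obtain d0 where d0: "d0 \<in> set_pmf (L.sp 2)" "d0 ! 0" using mark_pos assms by (auto simp: split3_def)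
  show ?thesis
  proof (rule L.nd_single[OF refl d0(1) _ _ _ d0(2)])
    show "[False, True] \<in> set_pmf (L.sp 2)" "[False, False] \<in> set_pmf (L.sp 2)"
      unfolding pmf_positive_iff[symmetric] pmf_law2 cells using assms by (auto simp: split3_def)
  qed simp_all
qed

lemma bernd_triple:
  assumes "0 < measure \<mu> (B 0)" "0 < measure \<mu> (B 1 - B 0)" shows "bernd law 3"
proof -
  interpret L: bern law 3 by (rule bern_law) simp
  obtain d0 where d0: "d0 \<in> set_pmf (L.sp 2)" "d0 ! 0" using mark_pos assms by auto
  show ?thesis
  proof (rule L.nd_triple[OF refl d0(1) _ d0(2)])
    show "[False, True] \<in> set_pmf (L.sp 2)"
      unfolding pmf_positive_iff[symmetric] pmf_law2 cells using assms by auto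
  qed (simp add: isa_def)
qed

end

lemma tiso_single:
  fixes \<mu> :: "'a::polish_space measure" and \<nu> :: "'b::polish_space measure"
  assumes "prob_space \<mu>" "sets \<mu> = sets borel" "prob_space \<nu>" "sets \<nu> = sets borel"
    "split3 \<mu> E E'" "split3 \<nu> F F'" "measure \<mu> E = measure \<nu> F" "shannon_entropy \<mu> = shannon_entropy \<nu>"
  shows "tiso \<mu> \<nu>"
proof -
  obtain B where B: "coded \<mu> B" "B 0 = E" "B 1 = E'"
    using coded_exists[OF assms(1,2), of E E'] assms(5) by (auto simp: split3_def)
  obtain B' where B': "coded \<nu> B'" "B' 0 = F" "B' 1 = F'"
    using coded_exists[OF assms(3,4), of F F'] assms(6) by (auto simp: split3_def)
  show ?thesis
  proof (rule tiso_coded[OF B(1) B'(1)])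
    show "bernd (coded.law \<mu> B) 1" by (rule coded.bernd_single[OF B(1)]) (simp add: B assms(5) del: One_nat_def)
    show "bernd (coded.law \<nu> B') 1" by (rule coded.bernd_single[OF B'(1)]) (simp add: B' assms(6) del: One_nat_def)
  qed (use assms(7,8) B B' in auto)
qed

lemma tiso_triple:
  fixes \<mu> :: "'a::polish_space measure" and \<nu> :: "'b::polish_space measure"
  assumes "prob_space \<mu>" "sets \<mu> = sets borel" "prob_space \<nu>" "sets \<nu> = sets borel"
    "E \<in> sets borel" "measure \<mu> (frontier E) = 0" "E' \<in> sets borel" "measure \<mu> (frontier E') = 0"
    "F \<in> sets borel" "measure \<nu> (frontier F) = 0" "F' \<in> sets borel" "measure \<nu> (frontier F') = 0"
    "0 < measure \<mu> E" "0 < measure \<mu> (E' - E)" "0 < measure \<nu> F" "0 < measure \<nu> (F' - F)"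
    "measure \<mu> E * measure \<mu> (E' - E) ^ 2 = measure \<nu> F * measure \<nu> (F' - F) ^ 2"
    "shannon_entropy \<mu> = shannon_entropy \<nu>"
  shows "tiso \<mu> \<nu>"
proof -
  obtain B where B: "coded \<mu> B" "B 0 = E" "B 1 = E'"
    using coded_exists[OF assms(1,2), of E E'] assms(5-8) by auto
  obtain B' where B': "coded \<nu> B'" "B' 0 = F" "B' 1 = F'"
    using coded_exists[OF assms(3,4), of F F'] assms(9-12) by auto
  show ?thesis
  proof (rule tiso_coded[OF B(1) B'(1)])
    show "bernd (coded.law \<mu> B) 3" by (rule coded.bernd_triple[OF B(1)]) (simp_all only: B assms)
    show "bernd (coded.law \<nu> B') 3" by (rule coded.bernd_triple[OF B'(1)]) (simp_all only: B' assms)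
  qed (use assms(17,18) B B' in auto)
qed

definition eta :: "real \<Rightarrow> real" where "eta x = - x * ln x"

lemma eta_superadd:
  assumes "0 < a" "0 < b" shows "eta (a + b) < eta a + eta b"
proof -
  have "a * ln a < a * ln (a + b)" "b * ln b < b * ln (a + b)" using assms by auto
  then show ?thesis by (simp add: eta_def algebra_simps)
qed

lemma eta_nonneg: "0 \<le> x \<Longrightarrow> x \<le> 1 \<Longrightarrow> 0 \<le> eta x"
  by (cases "x = 0") (auto simp: eta_def mult_nonneg_nonpos)

lemma eta_0 [simp]: "eta 0 = 0" by (simp add: eta_def)

lemma eta_subadd: "0 \<le> a \<Longrightarrow> 0 \<le> b \<Longrightarrow> eta (a + b) \<le> eta a + eta b"
  using eta_superadd[of a b] by (cases "a = 0 \<or> b = 0") auto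

text \<open>The complement of \<open>E\<close> is divided into two cells of positive mass, so the
  entropy strictly exceeds that of the partition into \<open>E\<close> and its complement. The
  excess is the room for an additional atom.\<close>

lemma split3_entropy:
  fixes \<mu> :: "'a::polish_space measure"
  assumes mu: "prob_space \<mu>" "sets \<mu> = sets borel" and s: "split3 \<mu> E E'"
  shows "ennreal (eta (measure \<mu> E) + eta (1 - measure \<mu> E)) < shannon_entropy \<mu>" "measure \<mu> E < 1"
proof -
  obtain B where B: "coded \<mu> B" "B 0 = E" "B 1 = E'"
    using coded_exists[OF mu, of E E'] s by (auto simp: split3_def)
  interpret M: coded \<mu> B by (rule B(1))
  interpret X: bernd M.law 1 by (rule M.bernd_single) (simp add: B s del: One_nat_def)
  have sm: "E \<in> sets \<mu>" "E' \<in> sets \<mu>" using s M.sets_borel by (auto simp: split3_def)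
  have "measure \<mu> (- E) = measure \<mu> (E' - E) + measure \<mu> (- E - E')"
  proof -
    have "measure \<mu> ((E' - E) \<union> (- E - E')) = measure \<mu> (E' - E) + measure \<mu> (- E - E')"
    proof (rule M.finite_measure_Union)
      show "E' - E \<in> sets \<mu>" using sm by auto
      have "- E - E' = space \<mu> - E - E'" by (auto simp: M.space_mu)
      then show "- E - E' \<in> sets \<mu>" using sm by auto
    qed auto
    moreover have "(E' - E) \<union> (- E - E') = - E" by auto
    ultimately show ?thesis by simp
  qed
  moreover have "measure \<mu> (- E) = 1 - measure \<mu> E"
    using M.prob_compl[OF sm(1)] by (simp add: M.space_mu Compl_eq_Diff_UNIV)
  ultimately have c: "1 - measure \<mu> E = measure \<mu> (E' - E) + measure \<mu> (- E - E')" by simp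
  have pos: "0 < measure \<mu> (E' - E)" "0 < measure \<mu> (- E - E')" using s by (auto simp: split3_def)
  show lt1: "measure \<mu> E < 1" using c pos by linarith
  have fin: "{d :: bool list. length d = 2} = {[True, True], [True, False], [False, True], [False, False]}"
    by (auto simp: length_Suc_conv numeral_2_eq_2)
  have pm: "pmf (X.sp 2) [True, True] = measure \<mu> (E \<inter> E')" "pmf (X.sp 2) [True, False] = measure \<mu> (E - E')"
    "pmf (X.sp 2) [False, True] = measure \<mu> (E' - E)" "pmf (X.sp 2) [False, False] = measure \<mu> (- E - E')"
    unfolding M.pmf_law2 B by (auto intro!: arg_cong[of _ _ "measure \<mu>"])
  have "X.Hf 2 = (LINT d|distr M.law (count_space UNIV) (lev 2). X.sl 2 d)"
    unfolding X.Hf_def by (subst integral_distr[OF X.lev_mu]) auto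
  also have "distr M.law (count_space UNIV) (lev 2) = measure_pmf (X.sp 2)"
    unfolding X.sp_def by (rule measure_pmf_rvpmf[symmetric]) (use X.lev_mu X.prob_space_axioms in auto)
  also have "(LINT d|measure_pmf (X.sp 2). X.sl 2 d) = (\<Sum>d\<in>{d. length d = 2}. X.sl 2 d * pmf (X.sp 2) d)"
    by (rule integral_measure_pmf_real) (use X.set_sp[of 2] fin in auto)
  also have "\<dots> = eta (measure \<mu> (E \<inter> E')) + eta (measure \<mu> (E - E')) + eta (measure \<mu> (E' - E)) + eta (measure \<mu> (- E - E'))"
    unfolding fin by (simp add: X.sl_def eta_def pm)
  finally have "X.Hf 2 = eta (measure \<mu> (E \<inter> E')) + eta (measure \<mu> (E - E')) + eta (measure \<mu> (E' - E)) + eta (measure \<mu> (- E - E'))" .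
  moreover have "eta (measure \<mu> E) \<le> eta (measure \<mu> (E \<inter> E')) + eta (measure \<mu> (E - E'))"
    using eta_subadd[of "measure \<mu> (E \<inter> E')" "measure \<mu> (E - E')"] unfolding M.B0_split[unfolded B] by simp
  moreover have "eta (1 - measure \<mu> E) < eta (measure \<mu> (E' - E)) + eta (measure \<mu> (- E - E'))"
    unfolding c by (rule eta_superadd[OF pos])
  ultimately have "eta (measure \<mu> E) + eta (1 - measure \<mu> E) < X.Hf 2" by linarith
  moreover have "0 \<le> eta (measure \<mu> E) + eta (1 - measure \<mu> E)"
    using lt1 measure_nonneg[of \<mu> E] by (intro add_nonneg_nonneg eta_nonneg) auto
  ultimately have "ennreal (eta (measure \<mu> E) + eta (1 - measure \<mu> E)) < ennreal (X.Hf 2)" by (simp add: ennreal_less_iff)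
  also have "\<dots> \<le> (SUP n. ennreal (X.Hf n))" by (rule SUP_upper) simp
  also have "\<dots> = shannon_entropy \<mu>" using M.entropy_sup[OF X.bernd_axioms] by simp
  finally show "ennreal (eta (measure \<mu> E) + eta (1 - measure \<mu> E)) < shannon_entropy \<mu>" .
qed

subsection \<open>Discrete measures with prescribed atoms and entropy\<close>

lemma eta_le_sqrt: assumes "0 < x" shows "eta x \<le> 2 * sqrt x"
proof -
  have "ln (1 / sqrt x) \<le> 1 / sqrt x - 1" using assms by (intro ln_le_minus_one) auto
  then have "- ln x \<le> 2 / sqrt x" using assms by (simp add: ln_div ln_sqrt)
  then have "x * (- ln x) \<le> x * (2 / sqrt x)" using assms by (intro mult_left_mono) auto
  also have "x * (2 / sqrt x) = 2 * (x / sqrt x)" by simp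
  also have "x / sqrt x = sqrt x" using assms by (intro real_div_sqrt) simp
  finally show ?thesis by (simp add: eta_def)
qed

lemma continuous_on_eta: "continuous_on {0..1} eta"
  unfolding continuous_on_def
proof
  fix x :: real assume x: "x \<in> {0..1}"
  show "(eta \<longlongrightarrow> eta x) (at x within {0..1})"
  proof (cases "x = 0")
    case True
    have "(eta \<longlongrightarrow> 0) (at 0 within {0..1})"
    proof (rule tendsto_sandwich)
      show "eventually (\<lambda>y. 0 \<le> eta y) (at 0 within {0..1})"
        unfolding eventually_at_filter by (rule always_eventually) (auto intro: eta_nonneg)
      show "eventually (\<lambda>y. eta y \<le> 2 * sqrt y) (at 0 within {0..1})"
        unfolding eventually_at_filter by (rule always_eventually) (auto intro: eta_le_sqrt)
      have "((\<lambda>y. 2 * sqrt y) \<longlongrightarrow> 2 * sqrt 0) (at 0 within {0..1})" by (intro tendsto_intros)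
      then show "((\<lambda>y. 2 * sqrt y) \<longlongrightarrow> 0) (at 0 within {0..1})" by simp
    qed auto
    then show ?thesis using True by simp
  next
    case False
    then have "isCont eta x" using x unfolding eta_def[abs_def] by (intro continuous_intros) auto
    then show ?thesis unfolding isCont_def by (rule tendsto_within_subset) simp
  qed
qed

text \<open>The mass beside the two atoms is moved continuously from a single point,
  \<open>\<theta> = 0\<close>, to \<open>n\<close> equal points, \<open>\<theta> = 1\<close>. The
  entropy rises from below \<open>h\<close> to at least \<open>h\<close>, and the intermediate value
  theorem applies.\<close>

lemma pmf_entropy:
  fixes a b h :: real
  assumes a: "0 \<le> a" "0 \<le> b" "a + b < 1" and h: "eta a + eta b + eta (1 - a - b) < h"
  shows "\<exists>\<rho> :: nat pmf. pmf \<rho> 0 = a \<and> pmf \<rho> 1 = b \<and> (\<integral>\<^sup>+ i. ennreal (eta (pmf \<rho> i)) \<partial>count_space UNIV) = ennreal h"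
proof -
  define c where "c = 1 - a - b"
  have c: "0 < c" "c \<le> 1" using a by (auto simp: c_def)
  \<comment> \<open>Spreading mass \<open>c\<close> evenly over \<open>n\<close> points adds
    \<open>c * ln (real n)\<close>, which reaches \<open>h\<close> once \<open>n\<close> is at least
    \<open>exp (h / c)\<close>.\<close>
  define n where "n = nat \<lceil>exp (h / c)\<rceil>"
  have n: "exp (h / c) \<le> real n" unfolding n_def by (metis ceiling_correct exp_gt_zero less_le_not_le nat_0_le of_int_of_nat_eq order.strict_trans2 real_nat_ceiling_ge)
  then have n0: "0 < real n" using exp_gt_zero[of "h / c"] by linarith
  have "h / c \<le> ln (real n)" using n n0 by (metis exp_gt_zero ln_exp ln_le_cancel_iff)
  then have hn: "h \<le> c * ln (real n)" using c by (simp add: field_simps)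
  define G where "G \<theta> = eta a + eta b + eta (c * (1 - \<theta>)) + real n * eta (c * \<theta> / real n)" for \<theta>
  have "continuous_on {0..1} G"
    unfolding G_def
  proof (intro continuous_intros continuous_on_compose2[OF continuous_on_eta])
    show "(\<lambda>x. c * (1 - x)) ` {0..1} \<subseteq> {0..1}" 
    proof (rule image_subsetI)
      fix x :: real assume "x \<in> {0..1}"
      then show "c * (1 - x) \<in> {0..1}" using c mult_le_one[of c "1 - x"] by auto
    qed
    have "c * x / real n \<le> 1" if "x \<in> {0..1}" for x
    proof -
      have "c * x \<le> 1" using c that by (intro mult_le_one) auto
      moreover have "1 \<le> real n" using n0 by simp
      ultimately show ?thesis using n0 by (simp add: divide_le_eq)
    qed
    then show "(\<lambda>x. c * x / real n) ` {0..1} \<subseteq> {0..1}" using c n0 by auto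
  qed (use n0 in auto)
  moreover have "G 0 \<le> h" using h by (simp add: G_def c_def)
  moreover have "h \<le> G 1"
  proof -
    have "real n * eta (c / real n) = eta c + c * ln (real n)"
      using c n0 by (simp add: eta_def ln_div algebra_simps)
    moreover have "0 \<le> eta a" "0 \<le> eta b" "0 \<le> eta c" using a c by (auto intro!: eta_nonneg)
    ultimately show ?thesis using hn by (simp add: G_def)
  qed
  ultimately obtain \<theta> where \<theta>: "0 \<le> \<theta>" "\<theta> \<le> 1" "G \<theta> = h" using IVT'[of G 0 h 1] by auto
  define f where "f i = (if i = 0 then a else if i = 1 then b else if i = 2 then c * (1 - \<theta>)
     else if i < n + 3 then c * \<theta> / real n else 0)" for i :: nat
  have sum: "(\<Sum>i<n+3. g (f i)) = g a + g b + g (c * (1 - \<theta>)) + real n * g (c * \<theta> / real n)" for g :: "real \<Rightarrow> real"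
  proof -
    have "{..<n+3} = {0, 1, 2} \<union> {3..<n+3}" by auto
    then have "(\<Sum>i<n+3. g (f i)) = (\<Sum>i\<in>{0, 1, 2}. g (f i)) + (\<Sum>i\<in>{3..<n+3}. g (f i))"
      by (simp only:) (rule sum.union_disjoint, auto)
    also have "(\<Sum>i\<in>{3..<n+3}. g (f i)) = (\<Sum>i\<in>{3..<n+3}. g (c * \<theta> / real n))"
      by (rule sum.cong) (auto simp: f_def)
    finally show ?thesis by (simp add: f_def)
  qed
  have f0: "0 \<le> f i" for i using a c \<theta> by (simp add: f_def)
  have "real n * (c * \<theta> / real n) = c * \<theta>" using n0 by simp
  then have "(\<Sum>i<n+3. f i) = a + b + c * (1 - \<theta>) + c * \<theta>" using sum[of "\<lambda>x. x"] by (simp only:)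
  then have s1: "(\<Sum>i<n+3. f i) = 1" by (simp add: c_def algebra_simps)
  have f1: "f i \<le> 1" for i
  proof (cases "i < n + 3")
    case True
    then have "f i \<le> (\<Sum>i<n+3. f i)" by (intro member_le_sum) (auto simp: f0)
    then show ?thesis by (simp only: s1)
  qed (simp add: f_def)
  have "(\<integral>\<^sup>+i. ennreal (f i) \<partial>count_space UNIV) = (\<Sum>i<n+3. ennreal (f i))"
    by (rule nn_integral_count_space') (auto simp: f_def)
  also have "\<dots> = 1" by (subst sum_ennreal) (simp_all only: f0 s1 ennreal_1)
  finally have p: "pmf (embed_pmf f) i = f i" for i by (intro pmf_embed_pmf f0)
  have "(\<integral>\<^sup>+i. ennreal (eta (f i)) \<partial>count_space UNIV) = (\<Sum>i<n+3. ennreal (eta (f i)))"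
    by (rule nn_integral_count_space') (auto simp: f_def)
  also have "\<dots> = ennreal (\<Sum>i<n+3. eta (f i))" by (rule sum_ennreal) (intro eta_nonneg f0 f1)
  also have "\<dots> = ennreal h" unfolding sum \<theta>(3)[symmetric] G_def ..
  finally show ?thesis by (intro exI[of _ "embed_pmf f"]) (simp add: p, simp add: f_def)
qed

lemma frontier_discrete: "frontier (S :: 'a discrete set) = {}"
  by (simp add: frontier_def closure_closed interior_open closed_def open_discrete)

lemma discrete_measure_exists:
  fixes a b h :: real
  assumes "0 < a" "0 < b" "a + b < 1" "eta a + eta b + eta (1 - a - b) < h"
  shows "\<exists>\<rho> :: nat discrete measure. prob_space \<rho> \<and> sets \<rho> = sets borel \<and> shannon_entropy \<rho> = ennreal h
     \<and> measure \<rho> {discrete 0} = a \<and> measure \<rho> {discrete 1} = b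
     \<and> split3 \<rho> {discrete 0} {discrete 1} \<and> split3 \<rho> {discrete 1} {discrete 0}"
proof -
  obtain \<tau> :: "nat pmf" where \<tau>: "pmf \<tau> 0 = a" "pmf \<tau> 1 = b"
    "(\<integral>\<^sup>+ i. ennreal (eta (pmf \<tau> i)) \<partial>count_space UNIV) = ennreal h"
    using pmf_entropy[of a b h] assms by auto
  define \<rho> where "\<rho> = map_pmf discrete \<tau>"
  have inj: "inj (discrete :: nat \<Rightarrow> nat discrete)" by (simp add: inj_def discrete_inject)
  have bij: "bij_betw discrete (UNIV :: nat set) (UNIV :: nat discrete set)"
    using inj by (auto simp: bij_betw_def) (metis of_discrete_inverse rangeI)
  have pm: "pmf \<rho> (discrete i) = pmf \<tau> i" for i unfolding \<rho>_def by (rule pmf_map_inj'[OF inj])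
  have ms: "measure \<rho> {discrete 0} = a" "measure \<rho> {discrete 1} = b" by (simp_all only: measure_pmf_single pm \<tau>)
  have ne: "discrete (0::nat) \<noteq> discrete 1" by (simp add: discrete_inject)
  have "measure \<rho> ({discrete 0} \<union> {discrete 1}) = a + b"
    using ne measure_pmf.finite_measure_Union[of "{discrete 0}" \<rho> "{discrete 1}"] ms by simp
  then have "measure \<rho> (- ({discrete 0} \<union> {discrete 1})) = 1 - (a + b)"
    using measure_pmf.prob_compl[of "{discrete 0} \<union> {discrete 1}" \<rho>] by (simp add: Compl_eq_Diff_UNIV)
  moreover have "- {discrete (0::nat)} - {discrete 1} = - ({discrete 0} \<union> {discrete 1})"
    "- {discrete (1::nat)} - {discrete 0} = - ({discrete 0} \<union> {discrete 1})" by auto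
  moreover have "{discrete (0::nat)} - {discrete 1} = {discrete 0}" "{discrete (1::nat)} - {discrete 0} = {discrete 1}"
    using ne by auto
  ultimately have s3: "split3 \<rho> {discrete 0} {discrete 1}" "split3 \<rho> {discrete 1} {discrete 0}"
    unfolding split3_def frontier_discrete using assms(1-3) ms by (auto simp: open_discrete)
  have "(\<integral>\<^sup>+ x. emeasure \<rho> {x} \<partial>count_space UNIV) = 1"
    by (simp add: emeasure_pmf_single nn_integral_pmf measure_pmf.emeasure_space_1[simplified])
  moreover have "(\<integral>\<^sup>+ x. ennreal (- measure \<rho> {x} * ln (measure \<rho> {x})) \<partial>count_space UNIV) = ennreal h"
    using nn_integral_bij_count_space[OF bij, of "\<lambda>x. ennreal (eta (pmf \<rho> x))"] \<tau>(3)
    by (simp add: measure_pmf_single pm eta_def)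
  ultimately have "shannon_entropy \<rho> = ennreal h" by (simp add: shannon_entropy_def)
  moreover have "sets borel = (UNIV :: nat discrete set set)" using borel_open[OF open_discrete] by blast
  ultimately show ?thesis using ms s3
    by (intro exI[of _ "measure_pmf \<rho>"]) (simp add: measure_pmf.prob_space_axioms)
qed

text \<open>Continuity of \<open>eta\<close> at 0: a very light atom costs very little entropy, and
  the inequality in \<open>h\<close> is strict.\<close>

lemma small_atom:
  assumes q: "0 < q" "q < 1" and h: "eta q + eta (1 - q) < h"
  shows "eventually (\<lambda>\<delta>. 0 < \<delta> \<and> q + \<delta> < 1 \<and> eta q + eta \<delta> + eta (1 - q - \<delta>) < h) (at_right 0)"
proof -
  have "continuous_on {0..1 - q} (\<lambda>\<delta>. eta q + eta \<delta> + eta (1 - q - \<delta>))"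
  proof (intro continuous_on_add continuous_on_const)
    show "continuous_on {0..1 - q} eta" by (rule continuous_on_subset[OF continuous_on_eta]) (use q in auto)
    show "continuous_on {0..1 - q} (\<lambda>\<delta>. eta (1 - q - \<delta>))"
      by (rule continuous_on_compose2[OF continuous_on_eta]) (use q in \<open>auto intro!: continuous_intros\<close>)
  qed
  then have "((\<lambda>\<delta>. eta q + eta \<delta> + eta (1 - q - \<delta>)) \<longlongrightarrow> eta q + eta 0 + eta (1 - q - 0)) (at 0 within {0..1 - q})"
    unfolding continuous_on_def by (rule bspec) (use q in simp)
  moreover have "at 0 within {0..1 - q} = at_right (0::real)" using q by (intro at_within_Icc_at_right) simp
  ultimately have "eventually (\<lambda>\<delta>. eta q + eta \<delta> + eta (1 - q - \<delta>) < h) (at_right 0)"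
    using h by (intro order_tendstoD(2)) auto
  moreover have "eventually (\<lambda>\<delta>. \<delta> \<in> {0<..<1 - q}) (at_right 0)" using q by (intro eventually_at_right_real) simp
  ultimately show ?thesis by eventually_elim auto
qed

lemma uniform_split3:
  assumes q: "0 < q" "q < 1"
  defines "U \<equiv> uniform_measure lborel {0..1::real}"
  shows "split3 U {..q} {..(1 + q) / 2}" "measure U {..q} = q" "shannon_entropy U = \<infinity>"
    "prob_space U" "sets U = sets borel"
proof -
  have m: "measure U S = measure lborel ({0..1} \<inter> S)" if "S \<in> sets borel" for S
    unfolding U_def using that by (subst measure_uniform_measure) auto
  have fr: "frontier {..t} = {t}" for t :: real by (auto simp: frontier_def)
  have i: "{0..1} \<inter> {..t} = {0..t}" if "t \<le> 1" for t :: real using that by auto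
  show mq: "measure U {..q} = q" using q by (simp add: m i)
  have "{0..1} \<inter> ({..(1 + q) / 2} - {..q}) = {q<..(1 + q) / 2}" using q by auto
  then have 1: "measure U ({..(1 + q) / 2} - {..q}) = (1 - q) / 2" using q by (simp add: m field_simps)
  have "{0..1} \<inter> (- {..q} - {..(1 + q) / 2}) = {(1 + q) / 2<..1}" using q by auto
  then have 2: "measure U (- {..q} - {..(1 + q) / 2}) = (1 - q) / 2" using q by (simp add: m field_simps)
  have z: "measure U {t} = 0" for t
  proof -
    have "measure lborel ({0..1} \<inter> {t}) \<le> measure lborel {t}" by (intro measure_mono_fmeasurable) (auto simp: fmeasurable_def)
    then show ?thesis by (simp add: m measure_le_0_iff)
  qed
  show "split3 U {..q} {..(1 + q) / 2}" unfolding split3_def fr 1 2 mq z using q by simp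
  show pU: "prob_space U" unfolding U_def by (rule prob_space_uniform_measure) auto
  show "sets U = sets borel" by (simp add: U_def)
  interpret U: prob_space U by (rule pU)
  show "shannon_entropy U = \<infinity>" by (simp add: shannon_entropy_def U.emeasure_eq_measure z)
qed

lemma tiso_split3:
  fixes \<mu> :: "'a::polish_space measure" and \<nu> :: "'b::polish_space measure"
  assumes mu: "prob_space \<mu>" "sets \<mu> = sets borel" and nu: "prob_space \<nu>" "sets \<nu> = sets borel"
    and s: "split3 \<mu> E E'" "split3 \<nu> F F'" and h: "shannon_entropy \<mu> = shannon_entropy \<nu>"
  shows "tiso \<mu> \<nu>"
proof -
  define q r where "q = measure \<mu> E" and "r = measure \<nu> F"
  have q: "0 < q" "q < 1" "ennreal (eta q + eta (1 - q)) < shannon_entropy \<mu>"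
    using split3_entropy[OF mu s(1)] s(1) by (auto simp: q_def split3_def)
  have r: "0 < r" "r < 1" "ennreal (eta r + eta (1 - r)) < shannon_entropy \<mu>"
    using split3_entropy[OF nu s(2)] s(2) h by (auto simp: r_def split3_def)
  show ?thesis
  proof (cases "shannon_entropy \<mu> = \<infinity>")
    case True
    let ?U = "uniform_measure lborel {0..1::real}"
    have 1: "tiso \<mu> ?U"
      using tiso_single[OF mu uniform_split3(4,5)[OF q(1,2)] s(1) uniform_split3(1)[OF q(1,2)]]
        uniform_split3(2,3)[OF q(1,2)] True by (simp add: q_def)
    have 2: "tiso \<nu> ?U"
      using tiso_single[OF nu uniform_split3(4,5)[OF r(1,2)] s(2) uniform_split3(1)[OF r(1,2)]]
        uniform_split3(2,3)[OF r(1,2)] True h by (simp add: r_def)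
    show ?thesis by (rule tiso_trans[OF 1 tiso_sym[OF 2]])
  next
    case False
    then obtain t where t: "0 \<le> t" "shannon_entropy \<mu> = ennreal t" by (cases "shannon_entropy \<mu>") auto
    have "eta q + eta (1 - q) < t" "eta r + eta (1 - r) < t"
      using q(3) r(3) ennreal_leI[of t] unfolding t(2) by (meson not_le)+
    \<comment> \<open>One value \<open>\<delta>\<close> must suit both sides, as it becomes the mass
      of an atom shared by \<open>\<rho>\<close> and \<open>\<sigma>\<close>; hence the conjunction
      of two eventual statements.\<close>
    then have "eventually (\<lambda>\<delta>. (0 < \<delta> \<and> q + \<delta> < 1 \<and> eta q + eta \<delta> + eta (1 - q - \<delta>) < t)
       \<and> (0 < \<delta> \<and> r + \<delta> < 1 \<and> eta r + eta \<delta> + eta (1 - r - \<delta>) < t)) (at_right 0)"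
      using q r by (intro eventually_conj small_atom)
    then obtain \<delta> where \<delta>: "0 < \<delta>" "q + \<delta> < 1" "eta q + eta \<delta> + eta (1 - q - \<delta>) < t"
       "r + \<delta> < 1" "eta r + eta \<delta> + eta (1 - r - \<delta>) < t"
      using eventually_happens'[OF trivial_limit_at_right_real] by blast
    obtain \<rho> :: "nat discrete measure" where \<rho>: "prob_space \<rho>" "sets \<rho> = sets borel" "shannon_entropy \<rho> = ennreal t"
      "measure \<rho> {discrete 0} = q" "measure \<rho> {discrete 1} = \<delta>" "split3 \<rho> {discrete 0} {discrete 1}" "split3 \<rho> {discrete 1} {discrete 0}"
      using discrete_measure_exists[OF q(1) \<delta>(1-3)] by blast
    obtain \<sigma> :: "nat discrete measure" where \<sigma>: "prob_space \<sigma>" "sets \<sigma> = sets borel" "shannon_entropy \<sigma> = ennreal t"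
      "measure \<sigma> {discrete 0} = r" "measure \<sigma> {discrete 1} = \<delta>" "split3 \<sigma> {discrete 0} {discrete 1}" "split3 \<sigma> {discrete 1} {discrete 0}"
      using discrete_measure_exists[OF r(1) \<delta>(1,4,5)] by blast
    have 1: "tiso \<mu> \<rho>" by (rule tiso_single[OF mu \<rho>(1,2) s(1) \<rho>(6)]) (simp_all add: \<rho> t q_def[symmetric])
    \<comment> \<open>The two atoms exchange roles: now the one of mass \<open>\<delta>\<close> is
      the marker.\<close>
    have 2: "tiso \<rho> \<sigma>" by (rule tiso_single[OF \<rho>(1,2) \<sigma>(1,2) \<rho>(7) \<sigma>(7)]) (simp_all add: \<rho>(3,5) \<sigma>(3,5) del: One_nat_def)
    have 3: "tiso \<nu> \<sigma>" by (rule tiso_single[OF nu \<sigma>(1,2) s(2) \<sigma>(6)]) (simp_all add: \<sigma> t h[symmetric] r_def[symmetric])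
    show ?thesis by (rule tiso_trans[OF 1 tiso_trans[OF 2 tiso_sym[OF 3]]])
  qed
qed

subsection \<open>Two-point measures\<close>

text \<open>On the positive half-line \<open>(1 - x) * x\<^sup>2\<close> has its maximum at 2 / 3
  and decreases afterwards.\<close>

lemma cubic_decreasing:
  fixes x s :: real assumes "2 / 3 < x" "x < s" shows "(1 - s) * s\<^sup>2 < (1 - x) * x\<^sup>2"
proof -
  have s: "2 / 3 < s" using assms by simp
  have "(2 / 3) * x < x * x" "(2 / 3) * s < s * s" "(2 / 3) * x < s * x" "(2 / 3) * s < x * s"
    using assms s by (auto intro!: mult_strict_right_mono)
  then have "x + s < x * x + x * s + s * s" by (simp add: mult.commute)
  then have "0 < (s - x) * ((x * x + x * s + s * s) - (x + s))" using assms by simp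
  also have "\<dots> = (1 - x) * x\<^sup>2 - (1 - s) * s\<^sup>2" by (simp add: power2_eq_square algebra_simps)
  finally show ?thesis by simp
qed

lemma binary_entropy_decreasing:
  assumes "1 / 2 \<le> a" "a < s" "s < 1" shows "eta s + eta (1 - s) < eta a + eta (1 - a)"
proof (rule DERIV_neg_imp_decreasing_open[OF assms(2)])
  show "continuous_on {a..s} (\<lambda>x. eta x + eta (1 - x))"
  proof (intro continuous_on_add)
    show "continuous_on {a..s} eta" by (rule continuous_on_subset[OF continuous_on_eta]) (use assms in auto)
    show "continuous_on {a..s} (\<lambda>x. eta (1 - x))"
      by (rule continuous_on_compose2[OF continuous_on_eta]) (use assms in \<open>auto intro!: continuous_intros\<close>)
  qed
  fix x assume x: "a < x" "x < s"
  have "((\<lambda>x. eta x + eta (1 - x)) has_real_derivative (ln (1 - x) - ln x)) (at x)"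
    unfolding eta_def using x assms by (auto intro!: derivative_eq_intros simp: divide_simps) (simp add: algebra_simps)
  moreover have "ln (1 - x) < ln x" using x assms by simp
  ultimately show "\<exists>y. ((\<lambda>x. eta x + eta (1 - x)) has_real_derivative y) (at x) \<and> y < 0" by force
qed

text \<open>The word aab has the same probability under (t, 1 - t) as under (s, 1 - s) for a second root
  s > 1 - t of the cubic, and the latter pair has smaller entropy; moving slightly
  to the left of s leaves room for a third symbol.\<close>

lemma three_symbols:
  fixes t :: real assumes t: "0 < t" "t \<le> 1 / 2"
  shows "\<exists>x b. 0 < x \<and> 0 < b \<and> x + b < 1 \<and> b * x\<^sup>2 = (1 - t) * t\<^sup>2 \<and> eta x + eta b + eta (1 - x - b) < eta t + eta (1 - t)"
proof -
  define f where "f x = (1 - x) * x\<^sup>2" for x :: real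
  have ft: "0 < f t" using t by (simp add: f_def)
  \<comment> \<open>The maximum of the cubic is 4 / 27, and the double root at 2 / 3 shows that
    \<open>t\<close> stays below it.\<close>
  have "4 / 27 - f t = (t - 2 / 3)\<^sup>2 * (t + 1 / 3)"
    unfolding f_def by (simp add: power2_eq_square field_simps)
  moreover have "0 < (t - 2 / 3)\<^sup>2 * (t + 1 / 3)" using t by (intro mult_pos_pos) auto
  moreover have "f (2 / 3) = 4 / 27" by (simp add: f_def power2_eq_square)
  ultimately have f23: "f t < f (2 / 3)" by linarith
  have "continuous_on {2 / 3..1} f" unfolding f_def by (intro continuous_intros)
  moreover have "f 1 \<le> f t" using ft by (simp add: f_def)
  ultimately obtain s where s: "2 / 3 \<le> s" "s \<le> 1" "f s = f t" using IVT2'[of f 1 "f t" "2 / 3"] f23 by auto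
  have "s \<noteq> 2 / 3"
  proof
    assume "s = 2 / 3"
    then have "f s = f (2 / 3)" by (rule arg_cong)
    then show False using f23 s(3) by simp
  qed
  then have s1: "2 / 3 < s" using s(1) by simp
  have "f 1 = 0" by (simp add: f_def)
  then have "s \<noteq> 1" using ft s(3) by auto
  then have s2: "s < 1" using s(2) by simp
  have dec: "f s < f x" if "2 / 3 < x" "x < s" for x using cubic_decreasing[OF that] by (simp add: f_def)
  \<comment> \<open>For \<open>t < 1 / 2\<close> the cubic is larger at \<open>1 - t\<close> than at
    \<open>t\<close>, so its decreasing branch takes the value \<open>f t\<close> only beyond
    \<open>1 - t\<close>.\<close>
  have st: "1 - t < s"
  proof (rule ccontr)
    assume "\<not> 1 - t < s"
    then have le: "s \<le> 1 - t" by simp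
    have "f (1 - t) \<le> f s" using cubic_decreasing[OF s1, of "1 - t"] le by (cases "s = 1 - t") (auto simp: f_def)
    moreover have "f (1 - t) - f t = t * (1 - t) * (1 - 2 * t)" by (simp add: f_def power2_eq_square algebra_simps)
    moreover have "0 < t * (1 - t) * (1 - 2 * t)" using t le s1 by (intro mult_pos_pos) auto
    ultimately show False using s(3) by linarith
  qed
  \<comment> \<open>The mass \<open>f t / x\<^sup>2\<close> keeps the probability of the marker
    fixed, and the third symbol receives the rest; at \<open>x = s\<close> nothing is left for
    it.\<close>
  define w where "w x = eta x + eta (f t / x\<^sup>2) + eta (1 - x - f t / x\<^sup>2)" for x
  have bx: "f t / x\<^sup>2 \<le> 1 - x" if "x \<in> {(2 / 3 + s) / 2..s}" for x
  proof -
    have "f t \<le> f x" using dec[of x] s1 s(3) that by (cases "x = s") auto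
    moreover have "0 < x" using that s1 by auto
    ultimately show ?thesis by (simp add: f_def divide_le_eq)
  qed
  have x01: "0 < x" "x < 1" if "x \<in> {(2 / 3 + s) / 2..s}" for x using that s1 s2 by auto
  have "continuous_on {(2 / 3 + s) / 2..s} w"
    unfolding w_def
  proof (intro continuous_on_add)
    show "continuous_on {(2 / 3 + s) / 2..s} eta"
      by (rule continuous_on_subset[OF continuous_on_eta]) (use s1 s2 in auto)
    show "continuous_on {(2 / 3 + s) / 2..s} (\<lambda>x. eta (f t / x\<^sup>2))"
    proof (rule continuous_on_compose2[OF continuous_on_eta])
      show "continuous_on {(2 / 3 + s) / 2..s} (\<lambda>x. f t / x\<^sup>2)" using s1 by (intro continuous_intros) auto
      show "(\<lambda>x. f t / x\<^sup>2) ` {(2 / 3 + s) / 2..s} \<subseteq> {0..1}"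
      proof (rule image_subsetI)
        fix x assume x: "x \<in> {(2 / 3 + s) / 2..s}"
        have "0 \<le> f t / x\<^sup>2" using ft by simp
        moreover have "f t / x\<^sup>2 \<le> 1" using bx[OF x] x01[OF x] by linarith
        ultimately show "f t / x\<^sup>2 \<in> {0..1}" by (simp only: atLeastAtMost_iff)
      qed
    qed
    show "continuous_on {(2 / 3 + s) / 2..s} (\<lambda>x. eta (1 - x - f t / x\<^sup>2))"
    proof (rule continuous_on_compose2[OF continuous_on_eta])
      show "continuous_on {(2 / 3 + s) / 2..s} (\<lambda>x. 1 - x - f t / x\<^sup>2)" using s1 by (intro continuous_intros) auto
      show "(\<lambda>x. 1 - x - f t / x\<^sup>2) ` {(2 / 3 + s) / 2..s} \<subseteq> {0..1}"
      proof (rule image_subsetI)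
        fix x assume x: "x \<in> {(2 / 3 + s) / 2..s}"
        have "0 \<le> f t / x\<^sup>2" using ft by simp
        then show "1 - x - f t / x\<^sup>2 \<in> {0..1}" using bx[OF x] x01[OF x] by auto
      qed
    qed
  qed
  then have "(w \<longlongrightarrow> w s) (at s within {(2 / 3 + s) / 2..s})" using s1 by (simp add: continuous_on_def)
  moreover have "w s < eta t + eta (1 - t)"
  proof -
    have "f t / s\<^sup>2 = 1 - s" using s(3)[symmetric] s1 by (simp add: f_def)
    then have "w s = eta s + eta (1 - s)" by (simp add: w_def)
    also have "\<dots> < eta (1 - t) + eta (1 - (1 - t))" by (rule binary_entropy_decreasing) (use t st s2 in auto)
    finally show ?thesis by simp
  qed
  ultimately have "eventually (\<lambda>x. w x < eta t + eta (1 - t)) (at s within {(2 / 3 + s) / 2..s})"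
    by (rule order_tendstoD(2))
  moreover have "at s within {(2 / 3 + s) / 2..s} = at_left s" using s1 by (intro at_within_Icc_at_left) simp
  ultimately have "eventually (\<lambda>x. w x < eta t + eta (1 - t)) (at_left s)" by simp
  moreover have "eventually (\<lambda>x. x \<in> {(2 / 3 + s) / 2<..<s}) (at_left s)" using s1 by (intro eventually_at_left_real) simp
  ultimately have "eventually (\<lambda>x. w x < eta t + eta (1 - t) \<and> x \<in> {(2 / 3 + s) / 2<..<s}) (at_left s)"
    by (rule eventually_conj)
  then obtain x where x: "w x < eta t + eta (1 - t)" "(2 / 3 + s) / 2 < x" "x < s"
    using eventually_happens'[OF trivial_limit_at_left_real] by fastforce
  have x0: "0 < x" "2 / 3 < x" using x(2) s1 by auto
  have "f t < f x" using dec[OF x0(2) x(3)] s(3) by simp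
  then have "f t / x\<^sup>2 < 1 - x" using x0 by (simp add: f_def divide_less_eq)
  then show ?thesis using x0 x(1) ft
    by (intro exI[of _ x] exI[of _ "f t / x\<^sup>2"]) (auto simp: w_def f_def)
qed


lemma two_atoms_measure:
  fixes \<mu> :: "'a::polish_space measure"
  assumes mu: "prob_space \<mu>" "sets \<mu> = sets borel" and xy: "x \<noteq> y" "measure \<mu> {x} + measure \<mu> {y} = 1"
    and S: "S \<in> sets borel"
  shows "measure \<mu> S = (if x \<in> S then measure \<mu> {x} else 0) + (if y \<in> S then measure \<mu> {y} else 0)"
proof -
  interpret prob_space \<mu> by (rule mu(1))
  have sing: "{z} \<in> sets \<mu>" for z by (simp add: mu(2))
  have u: "measure \<mu> ({x} \<union> {y}) = measure \<mu> {x} + measure \<mu> {y}"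
    using xy(1) sing by (intro finite_measure_Union) auto
  have su: "{x} \<union> {y} \<in> sets \<mu>" by (intro sets.Un sing)
  have "measure \<mu> ({x} \<union> {y}) = 1" using u xy(2) by simp
  then have ae: "AE z in \<mu>. z \<in> {x} \<union> {y}" by (rule prob_eq_1[OF su, THEN iffD1])
  have "measure \<mu> S = measure \<mu> (S \<inter> ({x} \<union> {y}))"
  proof (rule measure_eq_AE)
    show "AE z in \<mu>. (z \<in> S) = (z \<in> S \<inter> ({x} \<union> {y}))" using ae by eventually_elim blast
    show "S \<in> sets \<mu>" using S by (simp only: mu(2))
    then show "S \<inter> ({x} \<union> {y}) \<in> sets \<mu>" using su by (rule sets.Int)
  qed
  also have "S \<inter> ({x} \<union> {y}) = (if x \<in> S then {x} else {}) \<union> (if y \<in> S then {y} else {})" by auto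
  also have "measure \<mu> \<dots> = (if x \<in> S then measure \<mu> {x} else 0) + (if y \<in> S then measure \<mu> {y} else 0)"
    using u by (cases "x \<in> S"; cases "y \<in> S") simp_all
  finally show ?thesis .
qed

lemma two_atoms_entropy:
  fixes \<mu> :: "'a::polish_space measure"
  assumes mu: "prob_space \<mu>" "sets \<mu> = sets borel" and xy: "x \<noteq> y" "measure \<mu> {x} + measure \<mu> {y} = 1"
  shows "shannon_entropy \<mu> = ennreal (eta (measure \<mu> {x}) + eta (measure \<mu> {y}))"
proof -
  interpret prob_space \<mu> by (rule mu(1))
  have z: "measure \<mu> {z} = 0" if "z \<notin> {x, y}" for z
  proof -
    have n: "x \<notin> {z}" "y \<notin> {z}" and b: "{z} \<in> sets borel" using that by auto
    show ?thesis using two_atoms_measure[OF mu xy b] unfolding if_not_P[OF n(1)] if_not_P[OF n(2)] by simp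
  qed
  have "(\<integral>\<^sup>+ z. emeasure \<mu> {z} \<partial>count_space UNIV) = (\<Sum>z\<in>{x, y}. emeasure \<mu> {z})"
    by (rule nn_integral_count_space') (auto simp: emeasure_eq_measure z)
  also have "\<dots> = ennreal (measure \<mu> {x}) + ennreal (measure \<mu> {y})" using xy(1) by (simp add: emeasure_eq_measure)
  also have "\<dots> = 1" by (simp add: ennreal_plus[symmetric] xy(2) del: ennreal_plus)
  finally have 1: "(\<integral>\<^sup>+ z. emeasure \<mu> {z} \<partial>count_space UNIV) = 1" .
  have "(\<integral>\<^sup>+ z. ennreal (- measure \<mu> {z} * ln (measure \<mu> {z})) \<partial>count_space UNIV)
      = (\<Sum>z\<in>{x, y}. ennreal (eta (measure \<mu> {z})))"
    unfolding eta_def by (rule nn_integral_count_space') (auto simp: z)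
  also have "\<dots> = ennreal (eta (measure \<mu> {x})) + ennreal (eta (measure \<mu> {y}))" using xy(1) by simp
  also have "\<dots> = ennreal (eta (measure \<mu> {x}) + eta (measure \<mu> {y}))"
    by (rule ennreal_plus[symmetric]) (intro eta_nonneg measure_nonneg prob_le_1)+
  finally show ?thesis using 1 by (simp add: shannon_entropy_def)
qed

text \<open>Two atoms do not allow three cells. The marker aab, with a the atom of mass at most 1 /
  2, leads to a discrete measure of the same entropy that has them.\<close>

lemma two_point:
  fixes \<mu> :: "'a::polish_space measure"
  assumes mu: "prob_space \<mu>" "sets \<mu> = sets borel" and xy: "x \<noteq> y" "measure \<mu> {x} + measure \<mu> {y} = 1"
    and t: "0 < measure \<mu> {x}" "measure \<mu> {x} \<le> 1 / 2"
  shows "\<exists>\<rho> :: nat discrete measure. prob_space \<rho> \<and> sets \<rho> = sets borel \<and> shannon_entropy \<mu> = shannon_entropy \<rho>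
     \<and> split3 \<rho> {discrete 0} {discrete 1} \<and> tiso \<mu> \<rho>"
proof -
  define t where "t = measure \<mu> {x}"
  have y: "measure \<mu> {y} = 1 - t" using xy(2) by (simp add: t_def)
  obtain a b where ab: "0 < a" "0 < b" "a + b < 1" "b * a\<^sup>2 = (1 - t) * t\<^sup>2"
    "eta a + eta b + eta (1 - a - b) < eta t + eta (1 - t)"
    using three_symbols[of t] t by (auto simp: t_def)
  obtain \<rho> :: "nat discrete measure" where \<rho>: "prob_space \<rho>" "sets \<rho> = sets borel"
    "shannon_entropy \<rho> = ennreal (eta t + eta (1 - t))" "measure \<rho> {discrete 0} = a" "measure \<rho> {discrete 1} = b"
    "split3 \<rho> {discrete 0} {discrete 1}" "split3 \<rho> {discrete 1} {discrete 0}"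
    using discrete_measure_exists[OF ab(1-3,5)] by blast
  have h: "shannon_entropy \<mu> = shannon_entropy \<rho>"
    using two_atoms_entropy[OF mu xy] \<rho>(3) by (simp add: y t_def[symmetric])
  have d: "0 < dist x y" using xy(1) by simp
  obtain r where r: "0 < r" "r < dist x y" "measure \<mu> (frontier (ball x r)) = 0" using null_radius[OF mu d] by blast
  obtain r' where r': "0 < r'" "r' < dist x y" "measure \<mu> (frontier (ball y r')) = 0" using null_radius[OF mu d] by blast
  have mb: "measure \<mu> (ball y r') = 1 - t"
    using two_atoms_measure[OF mu xy, of "ball y r'"] r' by (simp add: y dist_commute)
  have ma: "measure \<mu> (ball x r - ball y r') = t"
    using two_atoms_measure[OF mu xy, of "ball x r - ball y r'"] r r' by (simp add: t_def dist_commute)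
  have ne: "discrete (0::nat) \<noteq> discrete 1" by (simp add: discrete_inject)
  then have md: "{discrete (0::nat)} - {discrete 1} = {discrete 0}" by auto
  have "tiso \<mu> \<rho>"
  proof (rule tiso_triple[OF mu \<rho>(1,2)])
    show "measure \<mu> (frontier (ball y r')) = 0" "measure \<mu> (frontier (ball x r)) = 0" by fact+
    show "measure \<rho> (frontier {discrete 1}) = 0" "measure \<rho> (frontier {discrete 0}) = 0" by (simp_all add: frontier_discrete)
    show "measure \<mu> (ball y r') * (measure \<mu> (ball x r - ball y r'))\<^sup>2 = measure \<rho> {discrete 1} * (measure \<rho> ({discrete 0} - {discrete 1}))\<^sup>2"
      unfolding mb ma md \<rho>(4,5) ab(4) ..
    show "0 < measure \<mu> (ball y r')" "0 < measure \<mu> (ball x r - ball y r')" unfolding mb ma using t by (auto simp: t_def)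
    show "0 < measure \<rho> {discrete 1}" "0 < measure \<rho> ({discrete 0} - {discrete 1})" unfolding md \<rho>(4,5) by (rule ab)+
    show "shannon_entropy \<mu> = shannon_entropy \<rho>" by (rule h)
  qed (auto simp: borel_open open_discrete)
  then show ?thesis using \<rho> h by blast
qed

subsection \<open>The isomorphism theorem\<close>

lemma AE_support:
  fixes \<mu> :: "'a::polish_space measure"
  assumes mu: "prob_space \<mu>" "sets \<mu> = sets borel"
  shows "AE x in \<mu>. \<forall>e>0. 0 < measure \<mu> (ball x e)"
proof -
  obtain B where "coded \<mu> B" using coded_exists[OF mu, of "{}" "{}"] by auto
  then interpret coded \<mu> B .
  show ?thesis
    using AE_cyl_pos
  proof eventually_elim
    case (elim x)
    show ?case
    proof (intro allI impI)
      fix e :: real assume "0 < e"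
      then obtain i where i: "x \<in> B i" "B i \<subseteq> ball x e" using B_small by blast
      have "{y. lev (Suc i) (code y) = lev (Suc i) (code x)} \<subseteq> ball x e"
      proof
        fix y assume "y \<in> {y. lev (Suc i) (code y) = lev (Suc i) (code x)}"
        then have "code y i = code x i" by (simp add: lev_eq_iff)
        then show "y \<in> ball x e" using i unfolding code_apply by blast
      qed
      then have "measure \<mu> {y. lev (Suc i) (code y) = lev (Suc i) (code x)} \<le> measure \<mu> (ball x e)"
        by (intro finite_measure_mono) (auto simp: sets_borel)
      then show "0 < measure \<mu> (ball x e)" using elim[rule_format, of "Suc i"] by linarith
    qed
  qed
qed

text \<open>The cases are one, two, or at least three points in the topological support. Around
  three support points there are disjoint balls of positive mass, and for two of these the radii can
  be taken with null boundary.\<close>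

lemma trichotomy:
  fixes \<mu> :: "'a::polish_space measure"
  assumes mu: "prob_space \<mu>" "sets \<mu> = sets borel"
  shows "(\<exists>x. measure \<mu> {x} = 1) \<or> (\<exists>x y. x \<noteq> y \<and> measure \<mu> {x} + measure \<mu> {y} = 1 \<and> 0 < measure \<mu> {x} \<and> measure \<mu> {x} \<le> 1 / 2)
     \<or> (\<exists>E E'. split3 \<mu> E E')"
proof -
  interpret prob_space \<mu> by (rule mu(1))
  have bs: "ball z e \<in> sets \<mu>" "{z} \<in> sets \<mu>" for z :: 'a and e by (auto simp: mu(2))
  define S where "S = {x. \<forall>e>0. 0 < measure \<mu> (ball x e)}"
  have ae: "AE x in \<mu>. x \<in> S" unfolding S_def using AE_support[OF mu] by simp
  have "S \<noteq> {}"
  proof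
    assume "S = {}"
    then have "AE x in \<mu>. False" using ae by simp
    then show False by simp
  qed
  then obtain x where x: "x \<in> S" by blast
  consider "S \<subseteq> {x}" | y where "y \<in> S" "y \<noteq> x" "S \<subseteq> {x, y}"
    | y z where "y \<in> S" "z \<in> S" "y \<noteq> x" "z \<noteq> x" "z \<noteq> y" using x by blast
  then show ?thesis
  proof cases
    case 1
    then have "AE z in \<mu>. z \<in> {x}" using ae by (auto elim!: eventually_mono)
    then have "measure \<mu> {x} = 1" by (rule prob_eq_1[OF bs(2), THEN iffD2])
    then show ?thesis by blast
  next
    case 2
    have ae2: "AE w in \<mu>. w \<in> {x} \<union> {y}" using ae 2(3) by (auto elim!: eventually_mono)
    have sxy: "{x} \<union> {y} \<in> sets \<mu>" by (intro sets.Un bs)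
    have "measure \<mu> ({x} \<union> {y}) = 1" using ae2 by (rule prob_eq_1[OF sxy, THEN iffD2])
    moreover have "measure \<mu> ({x} \<union> {y}) = measure \<mu> {x} + measure \<mu> {y}"
      using 2(2) bs by (intro finite_measure_Union) auto
    ultimately have s1: "measure \<mu> {x} + measure \<mu> {y} = 1" by simp
    have "measure \<mu> (ball x (dist x y)) = measure \<mu> {x}" "measure \<mu> (ball y (dist x y)) = measure \<mu> {y}"
      using two_atoms_measure[OF mu 2(2)[symmetric] s1, of "ball x (dist x y)"]
        two_atoms_measure[OF mu 2(2)[symmetric] s1, of "ball y (dist x y)"] 2(2) by (auto simp: dist_commute)
    moreover have d0: "0 < dist x y" using 2(2) by auto
    have "0 < measure \<mu> (ball x (dist x y))" "0 < measure \<mu> (ball y (dist x y))"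
      using x 2(1) d0 unfolding S_def by blast+
    ultimately have "0 < measure \<mu> {x}" "0 < measure \<mu> {y}" by simp_all
    moreover have "measure \<mu> {x} \<le> 1 / 2 \<or> measure \<mu> {y} \<le> 1 / 2" using s1 by linarith
    ultimately show ?thesis using s1 2(2) by (metis add.commute)
  next
    case 3
    \<comment> \<open>Half of the smallest distance, so that balls of radius at most
      \<open>m\<close> around the three points are disjoint.\<close>
    define m where "m = min (dist x y) (min (dist x z) (dist y z)) / 2"
    have m: "0 < m" "2 * m \<le> dist x y" "2 * m \<le> dist x z" "2 * m \<le> dist y z" using 3 by (auto simp: m_def)
    obtain r where r: "0 < r" "r < m" "measure \<mu> (frontier (ball x r)) = 0" using null_radius[OF mu m(1)] by blast
    obtain r' where r': "0 < r'" "r' < m" "measure \<mu> (frontier (ball y r')) = 0" using null_radius[OF mu m(1)] by blast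
    have far: "w \<notin> ball b e'" if "w \<in> ball a e" "e \<le> m" "e' \<le> m" "2 * m \<le> dist a b" for a b w :: 'a and e e'
      using that dist_triangle[of a b w] dist_commute[of w b] by auto
    have "ball y r' \<subseteq> ball y r' - ball x r" using far[of _ y r' r x] r r' m by (auto simp: dist_commute)
    then have "measure \<mu> (ball y r') \<le> measure \<mu> (ball y r' - ball x r)" using bs by (intro finite_measure_mono) auto
    moreover have "ball z m \<subseteq> - ball x r - ball y r'"
      using far[of _ z m r x] far[of _ z m r' y] r r' m by (auto simp: dist_commute)
    then have "measure \<mu> (ball z m) \<le> measure \<mu> (- ball x r - ball y r')" by (intro finite_measure_mono) (auto simp: mu(2))
    moreover have "0 < measure \<mu> (ball x r)" "0 < measure \<mu> (ball y r')" "0 < measure \<mu> (ball z m)"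
      using x 3 r(1) r'(1) m(1) by (auto simp: S_def)
    ultimately have "split3 \<mu> (ball x r) (ball y r')" unfolding split3_def using r(3) r'(3) by auto
    then show ?thesis by blast
  qed
qed

lemma dirac_entropy:
  fixes \<mu> :: "'a::polish_space measure"
  assumes mu: "prob_space \<mu>" "sets \<mu> = sets borel" and x: "measure \<mu> {x} = 1"
  shows "shannon_entropy \<mu> = 0"
proof -
  interpret prob_space \<mu> by (rule mu(1))
  have z: "measure \<mu> {z} = 0" if "z \<noteq> x" for z
  proof -
    have "measure \<mu> ({x} \<union> {z}) = measure \<mu> {x} + measure \<mu> {z}"
      using that by (intro finite_measure_Union) (auto simp: mu(2))
    then show ?thesis using x prob_le_1[of "{x} \<union> {z}"] measure_nonneg[of \<mu> "{z}"] by linarith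
  qed
  have "(\<integral>\<^sup>+ z. emeasure \<mu> {z} \<partial>count_space UNIV) = (\<Sum>z\<in>{x}. emeasure \<mu> {z})"
    by (rule nn_integral_count_space') (auto simp: emeasure_eq_measure z)
  moreover have "ennreal (- measure \<mu> {z} * ln (measure \<mu> {z})) = 0" for z by (cases "z = x") (simp_all add: x z)
  ultimately show ?thesis unfolding shannon_entropy_def by (simp add: emeasure_eq_measure x)
qed

lemma tiso_dirac:
  fixes \<mu> :: "'a::polish_space measure" and \<nu> :: "'b::polish_space measure"
  assumes mu: "prob_space \<mu>" "sets \<mu> = sets borel" "measure \<mu> {x} = 1"
    and nu: "prob_space \<nu>" "sets \<nu> = sets borel" "measure \<nu> {y} = 1"
  shows "tiso \<mu> \<nu>"
proof -
  interpret M: prob_space \<mu> by (rule mu(1))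
  interpret N: prob_space \<nu> by (rule nu(1))
  have sp: "space \<mu> = UNIV" "space \<nu> = UNIV"
    using sets_eq_imp_space_eq[OF mu(2)] sets_eq_imp_space_eq[OF nu(2)] by simp_all
  have sx: "{x} \<in> sets \<mu>" and sy: "{y} \<in> sets \<nu>" by (simp_all add: mu(2) nu(2))
  have aeN: "AE w in \<nu>. w \<in> {y}" using nu(3) by (rule N.prob_eq_1[OF sy, THEN iffD1])
  show ?thesis
  proof (rule tiso_site[where f="\<lambda>_. y" and g="\<lambda>_. x" and A="{x}" and B="{y}"])
    show "iid \<mu>" by unfold_locales (rule sp)
    show "iid \<nu>" by unfold_locales (rule sp)
    show "AE z in \<mu>. z \<in> {x}" using mu(3) by (rule M.prob_eq_1[OF sx, THEN iffD1])
    show "homeomorphism {x} {y} (\<lambda>_. y) (\<lambda>_. x)" by (rule homeomorphismI) auto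
    show "distr \<mu> \<nu> (\<lambda>_. y) = \<nu>"
    proof (rule measure_eqI)
      fix A assume "A \<in> sets (distr \<mu> \<nu> (\<lambda>_. y))"
      then have A: "A \<in> sets \<nu>" by simp
      have "emeasure \<nu> A = emeasure \<nu> (if y \<in> A then space \<nu> else {})"
        by (rule emeasure_eq_AE) (use aeN A sets.top[of \<nu>] in \<open>auto elim!: eventually_mono simp: sp\<close>)
      then show "emeasure (distr \<mu> \<nu> (\<lambda>_. y)) A = emeasure \<nu> A"
        using A by (subst emeasure_distr) (auto simp: sp M.emeasure_space_1[unfolded sp] N.emeasure_space_1[unfolded sp])
    qed simp
  qed (auto simp: sx sy sp)
qed

lemma entropy_nonzero:
  fixes M :: "'a::polish_space measure"
  assumes M: "prob_space M" "sets M = sets borel" and nd: "\<nexists>x. measure M {x} = 1"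
  shows "shannon_entropy M \<noteq> 0"
proof -
  consider x y where "x \<noteq> y" "measure M {x} + measure M {y} = 1" "0 < measure M {x}" "measure M {x} \<le> 1 / 2"
    | E E' where "split3 M E E'" using trichotomy[OF M] nd by blast
  then show ?thesis
  proof cases
    case 1
    then have "0 < eta (measure M {x})" by (simp add: eta_def mult_pos_neg)
    moreover have "0 \<le> eta (measure M {y})" using 1 by (intro eta_nonneg) auto
    ultimately show ?thesis using two_atoms_entropy[OF M 1(1,2)] by simp
  next
    case 2
    then show ?thesis using split3_entropy(1)[OF M 2] by auto
  qed
qed

lemma tiso_nondirac:
  fixes M :: "'a::polish_space measure" and N :: "'b::polish_space measure"
  assumes M: "prob_space M" "sets M = sets borel" and nd: "\<nexists>x. measure M {x} = 1"
    and N: "prob_space N" "sets N = sets borel" "split3 N F F'" and e: "shannon_entropy M = shannon_entropy N"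
  shows "tiso M N"
proof -
  consider x y where "x \<noteq> y" "measure M {x} + measure M {y} = 1" "0 < measure M {x}" "measure M {x} \<le> 1 / 2"
    | E E' where "split3 M E E'" using trichotomy[OF M] nd by blast
  then show ?thesis
  proof cases
    case 1
    obtain \<rho> :: "nat discrete measure" where \<rho>: "prob_space \<rho>" "sets \<rho> = sets borel" "shannon_entropy M = shannon_entropy \<rho>"
      "split3 \<rho> {discrete 0} {discrete 1}" "tiso M \<rho>" using two_point[OF M 1] by blast
    have "tiso \<rho> N" by (rule tiso_split3[OF \<rho>(1,2) N(1,2) \<rho>(4) N(3)]) (simp only: \<rho>(3)[symmetric] e)
    with \<rho>(5) show ?thesis by (rule tiso_trans)
  next
    case 2
    then show ?thesis by (rule tiso_split3[OF M N(1,2) _ N(3) e])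
  qed
qed

text \<open>Among these measures entropy zero characterises the point masses, which are matched with
  each other. Otherwise a two-point \<open>\<nu>\<close> is first exchanged for a measure with three
  cells, and \<open>tiso_nondirac\<close> does the same for \<open>\<mu>\<close>.\<close>

theorem tiso_entropy:
  fixes \<mu> :: "'a::polish_space measure" and \<nu> :: "'b::polish_space measure"
  assumes mu: "prob_space \<mu>" "sets \<mu> = sets borel" and nu: "prob_space \<nu>" "sets \<nu> = sets borel"
    and h: "shannon_entropy \<mu> = shannon_entropy \<nu>"
  shows "tiso \<mu> \<nu>"
proof -
  show ?thesis
  proof (cases "(\<exists>x. measure \<mu> {x} = 1) \<or> (\<exists>y. measure \<nu> {y} = 1)")
    case True
    have "\<exists>x. measure \<mu> {x} = 1" using True entropy_nonzero[OF mu] dirac_entropy[OF nu] h by auto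
    moreover have "\<exists>y. measure \<nu> {y} = 1" using True entropy_nonzero[OF nu] dirac_entropy[OF mu] h by auto
    ultimately show ?thesis using tiso_dirac[OF mu _ nu] by blast
  next
    case False
    then consider x y where "x \<noteq> y" "measure \<nu> {x} + measure \<nu> {y} = 1" "0 < measure \<nu> {x}" "measure \<nu> {x} \<le> 1 / 2"
      | E E' where "split3 \<nu> E E'" using trichotomy[OF nu] by blast
    then show ?thesis
    proof cases
      case 1
      obtain \<rho> :: "nat discrete measure" where \<rho>: "prob_space \<rho>" "sets \<rho> = sets borel" "shannon_entropy \<nu> = shannon_entropy \<rho>"
        "split3 \<rho> {discrete 0} {discrete 1}" "tiso \<nu> \<rho>" using two_point[OF nu 1] by blast
      have "tiso \<mu> \<rho>" by (rule tiso_nondirac[OF mu _ \<rho>(1,2,4)]) (use False h \<rho>(3) in auto)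
      then show ?thesis using tiso_sym[OF \<rho>(5)] by (rule tiso_trans)
    next
      case 2
      show ?thesis by (rule tiso_nondirac[OF mu _ nu 2 h]) (use False in auto)
    qed
  qed
qed

theorem theorem3p17:
  fixes \<mu> :: "'a::polish_space measure" and \<nu> :: "'b::polish_space measure"
  assumes "prob_space \<mu>" and "sets \<mu> = sets borel"
    and "prob_space \<nu>" and "sets \<nu> = sets borel"
    and "shannon_entropy \<mu> = shannon_entropy \<nu>"
  shows "\<exists>\<phi> :: (int \<Rightarrow> 'a) \<Rightarrow> (int \<Rightarrow> 'b).
           \<phi> \<in> measurable (PiM UNIV (\<lambda>_. \<mu>)) (PiM UNIV (\<lambda>_. \<nu>)) \<and>
           (\<forall>x. \<phi> (shift x) = shift (\<phi> x)) \<and>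
           (\<exists>A B \<psi>. A \<in> sets (PiM UNIV (\<lambda>_. \<mu>)) \<and> emeasure (PiM UNIV (\<lambda>_. \<mu>)) A = 1 \<and>
                     B \<in> sets (PiM UNIV (\<lambda>_. \<nu>)) \<and> emeasure (PiM UNIV (\<lambda>_. \<nu>)) B = 1 \<and>
                     homeomorphism A B \<phi> \<psi>) \<and>
           distr (PiM UNIV (\<lambda>_. \<mu>)) (PiM UNIV (\<lambda>_. \<nu>)) \<phi> = PiM UNIV (\<lambda>_. \<nu>)"
proof -
  interpret M: prob_space "iproc \<mu>" unfolding iproc_def by (intro prob_space_PiM assms)
  interpret N: prob_space "iproc \<nu>" unfolding iproc_def by (intro prob_space_PiM assms)
  obtain \<phi> \<psi> A B where 1: "\<phi> \<in> measurable (iproc \<mu>) (iproc \<nu>)" "\<psi> \<in> measurable (iproc \<nu>) (iproc \<mu>)"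
     "\<forall>a x. \<phi> (sh a x) = sh a (\<phi> x)" "\<forall>a y. \<psi> (sh a y) = sh a (\<psi> y)"
     "A \<in> sets (iproc \<mu>)" "AE x in iproc \<mu>. x \<in> A" "B \<in> sets (iproc \<nu>)" "AE y in iproc \<nu>. y \<in> B"
     "homeomorphism A B \<phi> \<psi>"
     "distr (iproc \<mu>) (iproc \<nu>) \<phi> = iproc \<nu>" "distr (iproc \<nu>) (iproc \<mu>) \<psi> = iproc \<mu>"
    using tiso_entropy[OF assms] unfolding tiso_def by blast
  have "emeasure (iproc \<mu>) A = 1" "emeasure (iproc \<nu>) B = 1"
    using M.prob_eq_1[OF 1(5)] N.prob_eq_1[OF 1(7)] 1(6,8) by (simp_all add: M.emeasure_eq_measure N.emeasure_eq_measure)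
  \<comment> \<open>\<open>shift\<close> is the shift \<open>sh\<close> by 1.\<close>
  moreover have "\<phi> (shift x) = shift (\<phi> x)" for x using 1(3) unfolding shift_def sh_def by blast
  ultimately show ?thesis
    unfolding iproc_def[symmetric] using 1 by blast
qed

end
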